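(* Let $z\in k[\Delta]$ with $\deg z<p-1$. Then $H_z$ is a finitely generated module over its center $\mathfrak{Z}(H_z)$, and $\operatorname{gr}(\mathfrak{Z}(H_z))=\mathfrak{Z}(\operatorname{gr}(H_z))=\mathfrak{Z}(H)$.
   Context: $k$ is an algebraically closed field of characteristic $p>2$. $\mathfrak{g}=\mathfrak{sl}_2$ over $k$ with standard basis $e,f,h$; $V$ is its natural 2-dimensional representation with basis $x,y$ such that $ex=0$, $fx=y$, $ey=x$, $fy=0$, $hx=x$, $hy=-y$. $\mathfrak{U}\mathfrak{g}$ is the enveloping algebra and $\Delta=h^2+4ef-2h\in\mathfrak{U}\mathfrak{g}$; $\deg z$ is the degree of $z$ as a polynomial in $\Delta$. For $z\in k[\Delta]$, $H_z$ is the quotient of the smash product $\mathfrak{U}\mathfrak{g}\ltimes TV$ ($TV$ the tensor algebra, with $[g,v]=g\cdot v$ for $g\in\mathfrak{g}$, $v\in V$) by the two-sided ideal generated by $[x,y]-z$; $H=H_0=\mathfrak{U}(\mathfrak{g}\ltimes V)$. $\mathfrak{Z}(\cdot)$ denotes the center. $H_z$ carries the algebra filtration in which elements of $\mathfrak{U}\mathfrak{g}$ have degree $0$ and $x,y$ have degree $1$; $\operatorname{gr}$ denotes the associated graded with respect to this filtration (for $\mathfrak{Z}(H_z)$, the induced filtration). By the PBW property the natural surjection $H\to\operatorname{gr}(H_z)$ is an isomorphism, used to identify $\operatorname{gr}(H_z)$ with $H$; $\operatorname{gr}(\mathfrak{Z}(H_z))$ is naturally a subalgebra of $\mathfrak{Z}(\operatorname{gr}(H_z))$.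 *)

theory Defs
  imports
    "HOL-Library.Poly_Mapping"
    "HOL-Computational_Algebra.Computational_Algebra"
    "HOL-Algebra.Embedded_Algebras"
    "HOL-Algebra.QuotRing"
    "HOL-Algebra.Algebraic_Closure_Type"
begin

section \<open>Free associative algebras\<close>

text \<open>
  The free monoid on \<open>'g\<close>, written additively so that \<open>'g word \<Rightarrow>\<^sub>0 'k\<close> with the convolution
  product of \<^theory>\<open>HOL-Library.Poly_Mapping\<close> is the free associative unital algebra
  \<open>k\<langle>g\<rangle>\<close>, that is, the tensor algebra of the vector space with basis \<open>'g\<close>.
\<close>

datatype 'g word = Word (letters: "'g list")

instantiation word :: (type) monoid_add
begin
definition zero_word :: "'a word" where "0 = Word []"
definition plus_word :: "'a word \<Rightarrow> 'a word \<Rightarrow> 'a word"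
  where "u + v = Word (letters u @ letters v)"
instance by standard (simp_all add: zero_word_def plus_word_def)
end

type_synonym ('g, 'k) free_alg = "'g word \<Rightarrow>\<^sub>0 'k"

definition scalar :: "'k::comm_ring_1 \<Rightarrow> ('g, 'k) free_alg"
  where "scalar c = Poly_Mapping.single 0 c"

definition var :: "'g \<Rightarrow> ('g, 'k::comm_ring_1) free_alg"
  where "var g = Poly_Mapping.single (Word [g]) 1"

definition commutator :: "'a::ring \<Rightarrow> 'a \<Rightarrow> 'a"
  where "commutator a b = a * b - b * a"


section \<open>The algebras \<open>H\<^sub>z\<close>\<close>

datatype sl2_basis = E | F | H
datatype V_basis = Vx | Vy

type_synonym gen = "sl2_basis + V_basis"
type_synonym 'k falg = "(gen, 'k) free_alg"

abbreviation sl2_var :: "sl2_basis \<Rightarrow> 'k::comm_ring_1 falg" where "sl2_var g \<equiv> var (Inl g)"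
abbreviation V_var :: "V_basis \<Rightarrow> 'k::comm_ring_1 falg" where "V_var v \<equiv> var (Inr v)"

text \<open>The Lie bracket of \<open>sl\<^sub>2\<close> and its action on \<open>V\<close>, as linear elements of the free algebra.\<close>

fun sl2_bracket :: "sl2_basis \<Rightarrow> sl2_basis \<Rightarrow> 'k::comm_ring_1 falg" where
  "sl2_bracket E F = sl2_var H"
| "sl2_bracket F E = - sl2_var H"
| "sl2_bracket H E = scalar 2 * sl2_var E"
| "sl2_bracket E H = - (scalar 2 * sl2_var E)"
| "sl2_bracket H F = - (scalar 2 * sl2_var F)"
| "sl2_bracket F H = scalar 2 * sl2_var F"
| "sl2_bracket E E = 0"
| "sl2_bracket F F = 0"
| "sl2_bracket H H = 0"

fun sl2_act :: "sl2_basis \<Rightarrow> V_basis \<Rightarrow> 'k::comm_ring_1 falg" where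
  "sl2_act E Vx = 0"
| "sl2_act F Vx = V_var Vy"
| "sl2_act E Vy = V_var Vx"
| "sl2_act F Vy = 0"
| "sl2_act H Vx = V_var Vx"
| "sl2_act H Vy = - V_var Vy"

abbreviation free_ring :: "'k::comm_ring_1 falg ring"
  where "free_ring \<equiv> ring_of_type_algebra"

lemma ring_free_ring: "ring (free_ring :: 'k::comm_ring_1 falg ring)"
proof -
  have "\<exists>y. x + y = 0" "\<exists>y. y + x = 0" for x :: "'k falg"
    using add.right_inverse[of x] left_minus[of x] by blast+
  then show ?thesis
    unfolding ring_of_type_algebra_def
    by unfold_locales (auto simp: algebra_simps Units_def)
qed

definition smash_ideal :: "'k::comm_ring_1 falg set" where
  "smash_ideal = Idl\<^bsub>free_ring\<^esub>
     ({commutator (sl2_var g) (sl2_var g') - sl2_bracket g g' | g g'. True}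
      \<union> {commutator (sl2_var g) (V_var v) - sl2_act g v | g v. True})"

text \<open>The smash product of \<open>U(sl\<^sub>2)\<close> and \<open>TV\<close>.\<close>

definition smash :: "'k::comm_ring_1 falg set ring"
  where "smash = free_ring Quot smash_ideal"

definition smash_class :: "'k::comm_ring_1 falg \<Rightarrow> 'k falg set"
  where "smash_class a = smash_ideal +>\<^bsub>free_ring\<^esub> a"

definition Delta :: "'k::comm_ring_1 falg" where
  "Delta = sl2_var H ^ 2 + scalar 4 * sl2_var E * sl2_var F - scalar 2 * sl2_var H"

definition eval_Delta :: "'k::comm_ring_1 poly \<Rightarrow> 'k falg"
  where "eval_Delta z = (\<Sum>i\<le>degree z. scalar (coeff z i) * Delta ^ i)"

definition H_ideal :: "'k::comm_ring_1 poly \<Rightarrow> 'k falg set set" where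
  "H_ideal z =
     Idl\<^bsub>smash\<^esub> {smash_class (commutator (V_var Vx) (V_var Vy) - eval_Delta z)}"

definition H_alg :: "'k::comm_ring_1 poly \<Rightarrow> 'k falg set set ring"
  where "H_alg z = smash Quot H_ideal z"

lemma ideal_smash_ideal: "ideal smash_ideal free_ring"
  unfolding smash_ideal_def
  by (rule ring.genideal_ideal[OF ring_free_ring]) (simp add: ring_of_type_algebra_def)

lemma ring_smash: "ring smash"
  unfolding smash_def by (rule ideal.quotient_is_ring[OF ideal_smash_ideal])

lemma ideal_H_ideal: "ideal (H_ideal z) smash"
  unfolding H_ideal_def
  by (rule ring.genideal_ideal[OF ring_smash])
    (auto simp: smash_def smash_class_def FactRing_def A_RCOSETS_def RCOSETS_def a_r_coset_def
      ring_of_type_algebra_def)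

lemma ring_H_alg: "ring (H_alg z)"
  unfolding H_alg_def by (rule ideal.quotient_is_ring[OF ideal_H_ideal])

definition H_class :: "'k::comm_ring_1 poly \<Rightarrow> 'k falg \<Rightarrow> 'k falg set set"
  where "H_class z a = H_ideal z +>\<^bsub>smash\<^esub> smash_class a"


section \<open>Centers and finite generation\<close>

definition center :: "('a, 'm) ring_scheme \<Rightarrow> 'a set" where
  "center R = {a \<in> carrier R. \<forall>b\<in>carrier R. a \<otimes>\<^bsub>R\<^esub> b = b \<otimes>\<^bsub>R\<^esub> a}"

definition center_ring :: "'a ring \<Rightarrow> 'a ring"
  where "center_ring R = R\<lparr>carrier := center R\<rparr>"

definition fin_gen_over :: "('a, 'm) ring_scheme \<Rightarrow> 'a set \<Rightarrow> bool" where
  "fin_gen_over R K \<longleftrightarrow> (\<exists>Us. set Us \<subseteq> carrier R \<and> ring.Span R K Us = carrier R)"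


section \<open>Associated graded rings\<close>

text \<open>
  \<open>fil\<close> is an increasing multiplicative filtration indexed by the natural numbers, and
  \<open>prev R fil n\<close> is its step \<open>n - 1\<close>, the step \<open>- 1\<close> being zero.
  An element of the associated graded ring is the finitely supported family of its homogeneous
  components, the \<open>n\<close>-th one being a coset of \<open>prev R fil n\<close> in \<open>fil n\<close>.
\<close>

definition prev :: "('a, 'm) ring_scheme \<Rightarrow> (nat \<Rightarrow> 'a set) \<Rightarrow> nat \<Rightarrow> 'a set"
  where "prev R fil n = (case n of 0 \<Rightarrow> {\<zero>\<^bsub>R\<^esub>} | Suc m \<Rightarrow> fil m)"

definition gr :: "('a, 'm) ring_scheme \<Rightarrow> (nat \<Rightarrow> 'a set) \<Rightarrow> (nat \<Rightarrow> 'a set) ring" where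
  "gr R fil =
    \<lparr>carrier = {u. (\<forall>n. \<exists>a\<in>fil n. u n = prev R fil n +>\<^bsub>R\<^esub> a)
                  \<and> finite {n. u n \<noteq> prev R fil n}},
     monoid.mult = (\<lambda>u v n. \<Otimes>\<^bsub>R A_Mod prev R fil n\<^esub>i\<in>{..n}.
                       [mod prev R fil n:] u i \<Otimes>\<^bsub>R\<^esub> v (n - i)),
     one = (\<lambda>n. prev R fil n +>\<^bsub>R\<^esub> (if n = 0 then \<one>\<^bsub>R\<^esub> else \<zero>\<^bsub>R\<^esub>)),
     ring.zero = prev R fil,
     add = (\<lambda>u v n. u n <+>\<^bsub>R\<^esub> v n)\<rparr>"

text \<open>
  For a subring \<open>S\<close> of \<open>R\<close> with the induced filtration, the canonical embedding of \<open>gr S\<close>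
  into \<open>gr R\<close> enlarges a coset of \<open>S \<inter> prev R fil n\<close> to the coset of \<open>prev R fil n\<close>.
\<close>

definition gr_embed ::
    "('a, 'm) ring_scheme \<Rightarrow> (nat \<Rightarrow> 'a set) \<Rightarrow> (nat \<Rightarrow> 'a set) \<Rightarrow> (nat \<Rightarrow> 'a set)"
  where "gr_embed R fil u = (\<lambda>n. prev R fil n <+>\<^bsub>R\<^esub> u n)"

definition gr_center :: "'a ring \<Rightarrow> (nat \<Rightarrow> 'a set) \<Rightarrow> (nat \<Rightarrow> 'a set) set" where
  "gr_center R fil =
     gr_embed R fil ` carrier (gr (center_ring R) (\<lambda>n. fil n \<inter> center R))"


section \<open>The filtration of \<open>H\<^sub>z\<close> and the natural map \<open>H \<rightarrow> gr(H\<^sub>z)\<close>\<close>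

definition V_degree :: "gen word \<Rightarrow> nat"
  where "V_degree w = length (filter (\<lambda>g. \<not> isl g) (letters w))"

definition H_fil :: "'k::comm_ring_1 poly \<Rightarrow> nat \<Rightarrow> 'k falg set set set" where
  "H_fil z n = H_class z ` {a. \<forall>w\<in>Poly_Mapping.keys a. V_degree w \<le> n}"

definition gr_H :: "'k::comm_ring_1 poly \<Rightarrow> (nat \<Rightarrow> 'k falg set set set) ring"
  where "gr_H z = gr (H_alg z) (H_fil z)"

definition V_component :: "nat \<Rightarrow> 'k::comm_ring_1 falg \<Rightarrow> 'k falg" where
  "V_component n a =
     (\<Sum>w \<in> {w \<in> Poly_Mapping.keys a. V_degree w = n}. Poly_Mapping.single w (Poly_Mapping.lookup a w))"

text \<open>
  The graded map from the free algebra onto \<open>gr(H\<^sub>z)\<close> sends \<open>e, f, h\<close> to their classes in degree 0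
  and \<open>x, y\<close> to their classes in degree 1. It vanishes on the defining relations of \<open>H = H\<^sub>0\<close>,
  so \<open>natural_map\<close> does not depend on the representative \<open>a\<close>.
\<close>

definition graded_class :: "'k::comm_ring_1 poly \<Rightarrow> 'k falg \<Rightarrow> nat \<Rightarrow> 'k falg set set set" where
  "graded_class z a =
     (\<lambda>n. prev (H_alg z) (H_fil z) n +>\<^bsub>H_alg z\<^esub> H_class z (V_component n a))"

definition natural_map ::
    "'k::comm_ring_1 poly \<Rightarrow> 'k falg set set \<Rightarrow> (nat \<Rightarrow> 'k falg set set set)" where
  "natural_map z A = the_elem (graded_class z ` {a. H_class 0 a = A})"

end

theory Submission
  imports Defs
begin

text \<open>
  Letting \<open>H\<^sub>z\<close> act on the span of the monomials \<open>x\<^sup>i y\<^sup>j f\<^sup>a p(h) e\<^sup>c\<close> gives the PBW theorem and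
  realises \<open>H\<^sub>z\<close> as an algebra of operators.

  For \<open>z = 0\<close> the map \<open>n \<mapsto> (n - n(h + 1)) / x y\<close> is a derivation of the center, nilpotent of order \<open>p\<close>,
  that sends the quadratic central element to a nonzero scalar. So the center is spanned by the first \<open>p\<close> powers of
  this element over the kernel, which consists of polynomials in \<open>x\<^sup>p, y\<^sup>p, f\<^sup>p, h\<^sup>p - h, e\<^sup>p\<close>. It remains to lift these
  elements to the center of \<open>H\<^sub>z\<close>.

  For the quadratic element one solves a difference equation, which is possible as \<open>deg z < p - 1\<close>.
  To lift \<open>x\<^sup>p\<close>, put \<open>D = \<Delta> + 1\<close> and think of right multiplication by \<open>D\<close> as \<open>c\<^sup>2\<close>. The left multiplication by \<open>x\<close> then
  splits into ladder operators changing \<open>c\<close> by \<open>\<plusminus>1\<close>, and \<open>p\<close> steps of the ladder give an element commuting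
  with \<open>D\<close>, namely a cyclic continuant of size \<open>p\<close>. This continuant is odd in \<open>c\<close> and invariant under
  \<open>c \<mapsto> c + 1\<close>, hence equal to \<open>s P(s\<^sup>2)\<close> with \<open>s = c\<^sup>p - c\<close>, and \<open>P\<close> evaluates to a central element with leading term
  a multiple of \<open>x\<^sup>p\<close>. An automorphism exchanging \<open>x\<close> and \<open>y\<close> up to sign takes care of \<open>y\<^sup>p\<close>.

  Finite generation follows by reducing exponents modulo the lifts of the \<open>p\<close>-th powers.
\<close>

text \<open>The choice D = \<Delta> + 1 comes from x: left and right multiplication L, R by D
  satisfy (L - R)^2 = 2 (L + R) - 1 on x, a curve parametrized by R = c^2, L = (c + 1)^2. The root c
  of D is adjoined as a 2x2 matrix acting from the right. It commutes with the left multiplications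
  by 8e, -8eT and 4x, which also commute with each other, so the ladder becomes a computation in the
  commutative ring k[A, B, \<lambda>][c].

  One step up followed by one step down is A \<zeta>(c) + B. The difference equation for the
  correction in T says exactly that \<zeta>(-1 - c) = \<zeta>(c), and this symmetry makes the
  continuant odd. It is solved degree by degree with denominators 2 (d + 1), d at most deg z, hence
  invertible when deg z < p - 1.

  The leading term is found by comparison with \<zeta> = 0, where the continuant is exactly (c^p -
  c) \<lambda>^p. The ladder yields the lift only multiplied by c^p - c, so centrality needs right
  cancellation of D^((p-1)/2) - 1, and of e for the commutator with f; the PBW basis provides
  both.\<close>

section \<open>Linear operators on the space of PBW monomials\<close>

text \<open>
  The key \<open>(i, j, a, c)\<close> with coefficient \<open>p\<close> stands for the element
  \<open>x\<^sup>i y\<^sup>j f\<^sup>a p(h) e\<^sup>c\<close> of \<open>H\<^sub>z\<close>.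
\<close>

type_synonym key = "nat \<times> nat \<times> nat \<times> nat"
type_synonym 'k pbw = "key \<Rightarrow>\<^sub>0 'k poly"

abbreviation "lookup \<equiv> Poly_Mapping.lookup"
abbreviation "single \<equiv> Poly_Mapping.single"
abbreviation "keys \<equiv> Poly_Mapping.keys"

definition smul :: "'k::field \<Rightarrow> 'k pbw \<Rightarrow> 'k pbw"
  where "smul c m = Poly_Mapping.map (smult c) m"

lemma lookup_smul [simp]: "lookup (smul c m) k = smult c (lookup m k)"
  by (simp add: smul_def map.rep_eq when_def)

lemma smul_single [simp]: "smul c (single k p) = single k (smult c p)"
  by (rule poly_mapping_eqI) (simp add: lookup_single when_def)

lemma smul_add: "smul c (u + v) = smul c u + smul c v"
  by (rule poly_mapping_eqI) (simp add: lookup_add smult_add_right)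

lemma smul_zero [simp]: "smul c 0 = 0"
  by (rule poly_mapping_eqI) simp

lemma smul_sum: "smul c (sum f A) = (\<Sum>a\<in>A. smul c (f a))"
  by (induction A rule: infinite_finite_induct) (auto simp: smul_add)

lemma smul_one [simp]: "smul 1 m = m"
  by (rule poly_mapping_eqI) simp

lemma smul_smul: "smul a (smul b m) = smul (a * b) m"
  by (rule poly_mapping_eqI) simp

lemma smul_add_left: "smul (a + b) m = smul a m + smul b m"
  by (rule poly_mapping_eqI) (simp add: lookup_add smult_add_left)

lemma keys_smul: "keys (smul c m) \<subseteq> keys m"
  by (auto simp: in_keys_iff)

text \<open>Linearity is over k only: moving e past p(h) substitutes h - 2 for h, so the operators
  are not linear over k[h].\<close>

definition klinear :: "('k::field pbw \<Rightarrow> 'k pbw) \<Rightarrow> bool"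
  where "klinear f \<longleftrightarrow> (\<forall>u v. f (u + v) = f u + f v) \<and> (\<forall>c u. f (smul c u) = smul c (f u))"

text \<open>A type of its own makes the operators an instance of \<open>ring_1\<close>, so that
  noncommutative identities can be handled by the ring simplification rules.\<close>

typedef (overloaded) 'k endo = "{f :: 'k::field pbw \<Rightarrow> 'k pbw. klinear f}"
  morphisms app Endo
  by (rule exI[of _ "\<lambda>_. 0"]) (simp add: klinear_def)

lemma klinear_app: "klinear (app f)"
  using app by blast

lemma app_Endo: "klinear f \<Longrightarrow> app (Endo f) = f"
  by (simp add: Endo_inverse)

lemma endo_eqI: "(\<And>m. app f m = app g m) \<Longrightarrow> f = g"
  by (metis app_inject ext)

lemma app_add_right: "app f (u + v) = app f u + app f v"
  and app_smul: "app f (smul c u) = smul c (app f u)"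
  using klinear_app[of f] by (auto simp: klinear_def)

lemma app_zero_right [simp]: "app f 0 = 0"
  using app_add_right[of f 0 0] by simp

lemma app_minus_right: "app f (- u) = - app f u"
  using app_add_right[of f u "- u"] by (simp add: eq_neg_iff_add_eq_0 add.commute)

lemma app_diff_right: "app f (u - v) = app f u - app f v"
  using app_add_right[of f u "- v"] by (simp add: app_minus_right)

lemma app_sum: "app f (sum g A) = (\<Sum>a\<in>A. app f (g a))"
  by (induction A rule: infinite_finite_induct) (auto simp: app_add_right)

instantiation endo :: (field) ring_1
begin
definition zero_endo :: "'a endo" where "0 = Endo (\<lambda>_. 0)"
definition one_endo :: "'a endo" where "1 = Endo (\<lambda>m. m)"
definition plus_endo :: "'a endo \<Rightarrow> 'a endo \<Rightarrow> 'a endo" where "f + g = Endo (\<lambda>m. app f m + app g m)"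
definition minus_endo :: "'a endo \<Rightarrow> 'a endo \<Rightarrow> 'a endo" where "f - g = Endo (\<lambda>m. app f m - app g m)"
definition uminus_endo :: "'a endo \<Rightarrow> 'a endo" where "- f = Endo (\<lambda>m. - app f m)"
definition times_endo :: "'a endo \<Rightarrow> 'a endo \<Rightarrow> 'a endo" where "f * g = Endo (\<lambda>m. app f (app g m))"

lemma smul_minus: "smul c (- m) = - smul c m"
  by (rule poly_mapping_eqI) simp

lemma smul_diff: "smul c (u - v) = smul c u - smul c v"
  by (rule poly_mapping_eqI) (simp add: lookup_minus smult_diff_right)

lemma app_0 [simp]: "app (0 :: 'a endo) m = 0"
  and app_1 [simp]: "app (1 :: 'a endo) m = m"
  and app_plus: "app (f + g :: 'a endo) m = app f m + app g m"
  and app_minus: "app (f - g :: 'a endo) m = app f m - app g m"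
  and app_uminus: "app (- f :: 'a endo) m = - app f m"
  and app_times: "app (f * g :: 'a endo) m = app f (app g m)"
  unfolding zero_endo_def one_endo_def plus_endo_def minus_endo_def uminus_endo_def times_endo_def
  by (subst app_Endo; simp add: klinear_def app_add_right app_smul smul_add smul_minus smul_diff)+

instance
proof
  have "app (1 :: 'a endo) (single (0,0,0,0) 1) \<noteq> app 0 (single (0,0,0,0) 1)"
    by (metis app_0 app_1 keys_zero keys_single one_neq_zero insert_not_empty)
  then show "(0 :: 'a endo) \<noteq> 1" by metis
qed (auto intro!: endo_eqI simp: app_plus app_minus app_uminus app_times app_add_right)
end

lemma app_sum_left: "app (sum g A) m = (\<Sum>a\<in>A. app (g a) m)"
  by (induction A rule: infinite_finite_induct) (auto simp: app_plus)

definition scal :: "'k::field \<Rightarrow> 'k endo" where "scal c = Endo (smul c)"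

lemma app_scal [simp]: "app (scal c) m = smul c m"
  unfolding scal_def by (subst app_Endo) (auto simp: klinear_def smul_add smul_smul mult.commute)

lemma scal_commute: "scal c * f = f * scal c"
  by (rule endo_eqI) (simp add: app_times app_smul)

lemma scal_add: "scal (a + b) = scal a + scal b"
  and scal_mult: "scal (a * b) = scal a * scal b"
  and scal_1: "scal 1 = 1"
  by (auto intro!: endo_eqI simp: app_plus app_times smul_add_left smul_smul)

lemma pbw_sum: "(m :: 'k::field pbw) = (\<Sum>k\<in>keys m. single k (lookup m k))"
proof (rule poly_mapping_eqI)
  fix k
  show "lookup m k = lookup (\<Sum>k\<in>keys m. single k (lookup m k)) k"
    by (cases "k \<in> keys m")
      (auto simp: lookup_sum lookup_single when_def in_keys_iff if_distrib sum.delta cong: if_cong)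
qed

lemma pbw_induct [case_names single add zero]:
  fixes m :: "'k::field pbw"
  assumes "\<And>k p. k \<in> keys m \<Longrightarrow> P (single k p)" and "\<And>u v. P u \<Longrightarrow> P v \<Longrightarrow> P (u + v)" and "P 0"
  shows "P m"
proof -
  have "P (\<Sum>k\<in>A. single k (lookup m k))" if "finite A" "A \<subseteq> keys m" for A
    using that by (induction A) (auto intro: assms)
  from this[of "keys m"] show ?thesis using pbw_sum[of m] by simp
qed

definition lin :: "(key \<Rightarrow> 'k poly \<Rightarrow> 'k pbw) \<Rightarrow> 'k::field pbw \<Rightarrow> 'k pbw"
  where "lin \<phi> m = (\<Sum>k\<in>keys m. \<phi> k (lookup m k))"

definition coeff_linear :: "(key \<Rightarrow> 'k poly \<Rightarrow> 'k::field pbw) \<Rightarrow> bool"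
  where "coeff_linear \<phi> \<longleftrightarrow> (\<forall>k p q. \<phi> k (p + q) = \<phi> k p + \<phi> k q) \<and> (\<forall>k c p. \<phi> k (smult c p) = smul c (\<phi> k p))"

lemma coeff_linearI:
  assumes "\<And>k p q. \<phi> k (p + q) = \<phi> k p + \<phi> k q" "\<And>k c p. \<phi> k (smult c p) = smul c (\<phi> k p)"
  shows "coeff_linear \<phi>"
  using assms unfolding coeff_linear_def by blast

lemma coeff_linear_plus: "coeff_linear \<phi> \<Longrightarrow> \<phi> k (p + q) = \<phi> k p + \<phi> k q"
  and coeff_linear_smult: "coeff_linear \<phi> \<Longrightarrow> \<phi> k (smult c p) = smul c (\<phi> k p)"
  unfolding coeff_linear_def by blast+

lemma coeff_linear_zero: "coeff_linear \<phi> \<Longrightarrow> \<phi> k 0 = 0"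
  unfolding coeff_linear_def by (metis add_cancel_right_right)

text \<open>Cancellation can shrink the support of a sum, so additivity of \<open>lin\<close> is
  proved by summing over a common finite superset of the supports.\<close>

lemma lin_superset:
  assumes "coeff_linear \<phi>" "finite A" "keys m \<subseteq> A"
  shows "lin \<phi> m = (\<Sum>k\<in>A. \<phi> k (lookup m k))"
  unfolding lin_def using assms
  by (intro sum.mono_neutral_left) (auto simp: in_keys_iff coeff_linear_zero)

lemma klinear_lin:
  assumes "coeff_linear \<phi>" shows "klinear (lin \<phi>)"
  unfolding klinear_def
proof (intro conjI allI)
  fix u v :: "'a pbw" and c
  show "lin \<phi> (u + v) = lin \<phi> u + lin \<phi> v"
    using assms keys_add[of u v]
    by (simp add: lin_superset[where A = "keys u \<union> keys v"] lookup_add coeff_linear_plus sum.distrib)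
  show "lin \<phi> (smul c u) = smul c (lin \<phi> u)"
    using assms by (simp add: lin_superset[where A = "keys u"] keys_smul smul_sum coeff_linear_smult)
qed

definition lend :: "(key \<Rightarrow> 'k poly \<Rightarrow> 'k pbw) \<Rightarrow> 'k::field endo" where "lend \<phi> = Endo (lin \<phi>)"

lemma app_lend: "coeff_linear \<phi> \<Longrightarrow> app (lend \<phi>) m = lin \<phi> m"
  unfolding lend_def by (simp add: app_Endo klinear_lin)

lemma app_lend_single: "coeff_linear \<phi> \<Longrightarrow> app (lend \<phi>) (single k p) = \<phi> k p"
  by (auto simp: app_lend lin_def coeff_linear_zero)

lemma endo_eq_single:
  assumes "\<And>k p. app f (single k p) = app g (single k p)" shows "f = g"
proof (rule endo_eqI)
  show "app f m = app g m" for m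
    by (induction m rule: pbw_induct) (auto simp: assms app_add_right)
qed

section \<open>Modules over polynomial rings\<close>

text \<open>
  An additive map commuting with the scalars turns a module over \<open>R\<close> into one over \<open>R[X]\<close>.
\<close>

definition poly_scale :: "('r::comm_ring_1 \<Rightarrow> 'm \<Rightarrow> 'm) \<Rightarrow> ('m \<Rightarrow> 'm) \<Rightarrow> 'r poly \<Rightarrow> 'm \<Rightarrow> 'm::ab_group_add"
  where "poly_scale s \<phi> q m = fold_coeffs (\<lambda>a u. s a m + \<phi> u) q 0"

locale module_operator = Modules.module s for s :: "'r::comm_ring_1 \<Rightarrow> 'm::ab_group_add \<Rightarrow> 'm" +
  fixes \<phi> :: "'m \<Rightarrow> 'm"
  assumes \<phi>_add: "\<phi> (u + v) = \<phi> u + \<phi> v" and \<phi>_scale: "\<phi> (s a u) = s a (\<phi> u)"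
begin

lemma \<phi>_0 [simp]: "\<phi> 0 = 0"
  using \<phi>_add[of 0 0] by simp

abbreviation "ps \<equiv> poly_scale s \<phi>"

lemma ps_0 [simp]: "ps 0 m = 0"
  by (simp add: poly_scale_def)

lemma ps_pCons: "ps (pCons a q) m = s a m + \<phi> (ps q m)"
  by (cases "a = 0 \<and> q = 0") (auto simp: poly_scale_def)

lemma ps_const [simp]: "ps [:a:] m = s a m"
  by (simp add: ps_pCons)

lemma ps_X: "ps [:0, 1:] m = \<phi> m"
  by (simp add: ps_pCons)

lemma ps_zero_right [simp]: "ps q 0 = 0"
  by (induction q) (auto simp: ps_pCons)

lemma ps_add: "ps (q + r) m = ps q m + ps r m"
proof (induction q arbitrary: r)
  case (pCons a q)
  then show ?case
    by (cases r) (simp add: ps_pCons \<phi>_add scale_left_distrib add_ac)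
qed simp

lemma ps_smult: "ps (smult a r) m = s a (ps r m)"
  by (induction r) (simp_all add: ps_pCons scale_right_distrib \<phi>_scale)

lemma ps_add_right: "ps q (u + v) = ps q u + ps q v"
  by (induction q) (simp_all add: ps_pCons scale_right_distrib \<phi>_add add_ac)

lemma ps_comm:
  assumes "\<And>u v. g (u + v) = g u + g v" "\<And>a u. g (s a u) = s a (g u)" "\<And>u. g (\<phi> u) = \<phi> (g u)"
  shows "g (ps q m) = ps q (g m)"
proof -
  have "g 0 = 0" using assms(1)[of 0 0] by simp
  then show ?thesis by (induction q) (auto simp: ps_pCons assms)
qed

lemma ps_mult: "ps (q * r) m = ps q (ps r m)"
  by (induction q) (auto simp: ps_pCons ps_add ps_smult)

lemma module_ps: "Modules.module ps"
  by unfold_locales (auto simp: ps_add ps_add_right ps_mult pCons_one[symmetric] simp del: pCons_one)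

end

subsection \<open>Evaluation of polynomials in noncommutative algebras\<close>

text \<open>A k-algebra given by its central scalars. The same evaluation \<open>peval\<close> then
  serves the free algebra, the operators, the 2x2 matrices and the polynomial rings.\<close>

locale scalars =
  fixes \<iota> :: "'k::comm_ring_1 \<Rightarrow> 'a::ring_1"
  assumes \<iota>_add: "\<iota> (a + b) = \<iota> a + \<iota> b" and \<iota>_mult: "\<iota> (a * b) = \<iota> a * \<iota> b" and \<iota>_1: "\<iota> 1 = 1"
    and \<iota>_comm: "\<iota> c * u = u * \<iota> c"
begin

lemma \<iota>_0: "\<iota> 0 = 0"
  using \<iota>_add[of 0 0] by simp

lemma \<iota>_minus: "\<iota> (- a) = - \<iota> a"
  using \<iota>_add[of a "- a"] by (simp add: \<iota>_0 eq_neg_iff_add_eq_0 add.commute)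

lemma \<iota>_diff: "\<iota> (a - b) = \<iota> a - \<iota> b"
  using \<iota>_add[of a "- b"] by (simp add: \<iota>_minus)

lemma \<iota>_of_nat: "\<iota> (of_nat n) = of_nat n"
  by (induction n) (auto simp: \<iota>_0 \<iota>_1 \<iota>_add)

lemma \<iota>_numeral: "\<iota> (numeral n) = numeral n"
  using \<iota>_of_nat[of "numeral n"] by simp

lemma \<iota>_left_comm: "u * (\<iota> c * v) = \<iota> c * (u * v)"
  by (metis \<iota>_comm mult.assoc)

sublocale left: module_operator "\<lambda>a u. \<iota> a * u" "\<lambda>u. d * u" for d
proof unfold_locales
  show "d * (\<iota> a * u) = \<iota> a * (d * u)" for a u by (rule \<iota>_left_comm)
qed (auto simp: distrib_left distrib_right \<iota>_add \<iota>_mult \<iota>_1 mult.assoc)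

definition peval :: "'a \<Rightarrow> 'k poly \<Rightarrow> 'a"
  where "peval d q = poly_scale (\<lambda>a u. \<iota> a * u) (\<lambda>u. d * u) q 1"

lemma peval_pCons: "peval d (pCons a q) = \<iota> a + d * peval d q"
  and peval_0 [simp]: "peval d 0 = 0"
  by (simp_all add: peval_def left.ps_pCons)

lemma peval_1 [simp]: "peval d 1 = 1"
  by (simp add: peval_pCons \<iota>_1 one_pCons)

lemma peval_X [simp]: "peval d [:0, 1:] = d"
  by (simp add: peval_pCons \<iota>_1 \<iota>_0)

lemma peval_const [simp]: "peval d [:a:] = \<iota> a"
  by (simp add: peval_pCons)

lemma peval_add: "peval d (q + r) = peval d q + peval d r"
  by (simp add: peval_def left.ps_add)

lemma peval_smult: "peval d (smult a r) = \<iota> a * peval d r"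
  by (simp add: peval_def left.ps_smult)

lemma peval_left: "poly_scale (\<lambda>a u. \<iota> a * u) (\<lambda>u. d * u) q v = peval d q * v"
  by (induction q) (simp_all add: peval_pCons left.ps_pCons distrib_right mult.assoc)

lemma peval_mult: "peval d (q * r) = peval d q * peval d r"
  using left.ps_mult[of d q r 1] by (simp add: peval_left)

lemma peval_comm: "u * d = d * u \<Longrightarrow> u * peval d q = peval d q * u"
proof (induction q)
  case (pCons a q)
  then have "u * (d * peval d q) = (d * peval d q) * u"
    by (metis mult.assoc)
  then show ?case by (simp add: peval_pCons distrib_left distrib_right \<iota>_comm)
qed simp

lemma peval_minus: "peval d (- q) = - peval d q"
  using peval_add[of d q "- q"] by (simp add: eq_neg_iff_add_eq_0 add.commute)

lemma peval_diff: "peval d (q - r) = peval d q - peval d r"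
  using peval_add[of d q "- r"] by (simp add: peval_minus)

lemma peval_pcompose: "peval d (pcompose q r) = peval (peval d r) q"
  by (induction q) (auto simp: pcompose_pCons peval_add peval_mult peval_pCons)

lemma peval_power: "peval d (q ^ n) = peval d q ^ n"
  by (induction n) (auto simp: peval_mult)

end

interpretation sc: scalars "scal :: 'k::field \<Rightarrow> 'k endo"
  by unfold_locales (rule scal_add scal_mult scal_1 scal_commute)+


section \<open>The action on PBW monomials\<close>

definition vdeg :: "key \<Rightarrow> nat" where "vdeg = (\<lambda>(i,j,a,c). i + j)"

lemma vdeg_simp [simp]: "vdeg (i,j,a,c) = i + j"
  by (simp add: vdeg_def)

definition Xop :: "'k::field endo"
  where "Xop = lend (\<lambda>(i,j,a,c) p. single (Suc i,j,a,c) p)"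

definition Hop :: "'k::field endo"
  where "Hop = lend (\<lambda>(i,j,a,c) p. single (i,j,a,c) ([:of_nat i - of_nat j - 2 * of_nat a, 1:] * p))"

text \<open>Left multiplication by \<open>e\<close> in \<open>U(sl\<^sub>2)\<close>: \<open>e f\<^sup>a = f\<^sup>a e + a f\<^sup>a\<^sup>-\<^sup>1 (h - a + 1)\<close>.\<close>

definition U_e :: "key \<Rightarrow> 'k::field poly \<Rightarrow> 'k pbw"
  where "U_e = (\<lambda>(i,j,a,c) p. single (i,j,a,Suc c) (pcompose p [:-2, 1:])
      + single (i,j,a-1,c) (of_nat a * [:1 - of_nat a, 1:] * p))"

text \<open>The letter is moved past a leading x, else past a leading y, else it acts inside U(sl2).
  Moving past y applies the operator y to a vector that is no longer a monomial, so the recursion is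
  not structural; hence approximate operators are passed as parameters.\<close>

definition step_e :: "'k::field endo \<Rightarrow> 'k endo \<Rightarrow> key \<Rightarrow> 'k poly \<Rightarrow> 'k pbw"
  where "step_e e y = (\<lambda>(i,j,a,c) p. case i of
      Suc i' \<Rightarrow> app Xop (app e (single (i',j,a,c) p))
    | 0 \<Rightarrow> (case j of
        Suc j' \<Rightarrow> app y (app e (single (0,j',a,c) p)) + single (1,j',a,c) p
      | 0 \<Rightarrow> U_e (0,0,a,c) p))"

definition step_f :: "'k::field endo \<Rightarrow> 'k endo \<Rightarrow> key \<Rightarrow> 'k poly \<Rightarrow> 'k pbw"
  where "step_f f y = (\<lambda>(i,j,a,c) p. case i of
      Suc i' \<Rightarrow> app Xop (app f (single (i',j,a,c) p)) + app y (single (i',j,a,c) p)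
    | 0 \<Rightarrow> (case j of
        Suc j' \<Rightarrow> app y (app f (single (0,j',a,c) p))
      | 0 \<Rightarrow> single (0,0,Suc a,c) p))"

definition zop :: "'k::field poly \<Rightarrow> 'k endo \<Rightarrow> 'k endo \<Rightarrow> 'k endo"
  where "zop z e f = sc.peval (Hop * Hop + 4 * e * f - 2 * Hop) z"

definition step_y :: "'k::field poly \<Rightarrow> 'k endo \<Rightarrow> 'k endo \<Rightarrow> 'k endo \<Rightarrow> key \<Rightarrow> 'k poly \<Rightarrow> 'k pbw"
  where "step_y z e f y = (\<lambda>(i,j,a,c) p. case i of
      Suc i' \<Rightarrow> app (Xop * y - zop z e f) (single (i',j,a,c) p)
    | 0 \<Rightarrow> single (0,Suc j,a,c) p)"

text \<open>\<open>ops z n\<close> gives the operators \<open>e, f, y\<close> correctly on monomials of degree \<open>< n\<close> in \<open>x, y\<close>.\<close>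

primrec ops :: "'k::field poly \<Rightarrow> nat \<Rightarrow> 'k endo \<times> 'k endo \<times> 'k endo" where
  "ops z 0 = (0, 0, 0)"
| "ops z (Suc n) = (case ops z n of (e, f, y) \<Rightarrow>
     (lend (step_e e y), lend (step_f f y), lend (step_y z e f y)))"

abbreviation "e_op z n \<equiv> fst (ops z n)"
abbreviation "f_op z n \<equiv> fst (snd (ops z n))"
abbreviation "y_op z n \<equiv> snd (snd (ops z n))"

lemma ops_Suc:
  "e_op z (Suc n) = lend (step_e (e_op z n) (y_op z n))"
  "f_op z (Suc n) = lend (step_f (f_op z n) (y_op z n))"
  "y_op z (Suc n) = lend (step_y z (e_op z n) (f_op z n) (y_op z n))"
  by (auto split: prod.splits)

lemma coeff_linear_U_e: "coeff_linear U_e"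
proof (rule coeff_linearI)
  fix k :: key and p q :: "'a poly" and c
  obtain i j a b where k: "k = (i,j,a,b)" by (cases k)
  show "U_e k (p + q) = U_e k p + U_e k q"
    unfolding k by (simp only: U_e_def prod.case pcompose_add distrib_left single_add add_ac)
  show "U_e k (smult c p) = smul c (U_e k p)"
    unfolding k by (simp only: U_e_def prod.case pcompose_smult mult_smult_right smul_add smul_single)
qed

lemma coeff_linear_step:
  "coeff_linear (step_e e y)" "coeff_linear (step_f f y)" "coeff_linear (step_y z e f y)"
  by (rule coeff_linearI; auto simp: step_e_def step_f_def step_y_def single_add app_add_right smul_add
      smul_single[symmetric] app_smul coeff_linear_plus[OF coeff_linear_U_e] coeff_linear_smult[OF coeff_linear_U_e]
      simp del: smul_single split: nat.split)+

lemma coeff_linear_XH: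
  "coeff_linear (\<lambda>(i,j,a,c) p. single (Suc i,j,a,c) p :: 'k::field pbw)"
  "coeff_linear (\<lambda>(i,j,a,c) p. single (i,j,a,c) ([:of_nat i - of_nat j - 2 * of_nat a, 1:] * p) :: 'k::field pbw)"
   apply (rule coeff_linearI; auto simp: single_add)
  by (rule coeff_linearI; simp only: split_paired_all prod.case distrib_left single_add mult_smult_right smul_single)

lemma Xop_single [simp]: "app Xop (single (i,j,a,c) p) = single (Suc i,j,a,c) p"
  unfolding Xop_def by (subst app_lend_single) (auto simp: coeff_linear_XH)

lemma Hop_single: "app Hop (single (i,j,a,c) p) = single (i,j,a,c) ([:of_nat i - of_nat j - 2 * of_nat a, 1:] * p)"
  unfolding Hop_def by (subst app_lend_single[OF coeff_linear_XH(2)]) auto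

text \<open>The inequality is strict so that \<open>below 0\<close> is the zero space. This gives
  trivial induction bases and matches the step -1 of a filtration.\<close>

definition below :: "nat \<Rightarrow> 'k::field pbw set" where "below n = {m. \<forall>k\<in>keys m. vdeg k < n}"

lemma below_add: "u \<in> below n \<Longrightarrow> v \<in> below n \<Longrightarrow> u + v \<in> below n"
  using keys_add[of u v] by (auto simp: below_def)

lemma below_0 [simp]: "0 \<in> below n"
  by (simp add: below_def)

lemma below_minus: "u \<in> below n \<Longrightarrow> - u \<in> below n"
  by (auto simp: below_def in_keys_iff)

lemma below_diff: "u \<in> below n \<Longrightarrow> v \<in> below n \<Longrightarrow> u - v \<in> below n"
  using below_add[OF _ below_minus, of u n v] by simp

lemma below_smul: "u \<in> below n \<Longrightarrow> smul c u \<in> below n"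
  using keys_smul[of c u] by (auto simp: below_def)

lemma below_single [simp]: "vdeg k < n \<Longrightarrow> single k p \<in> below n"
  by (simp add: below_def)

lemma below_mono: "m \<in> below n \<Longrightarrow> n \<le> n' \<Longrightarrow> m \<in> below n'"
  by (auto simp: below_def)

lemma below_zero_eq: "m \<in> below 0 \<Longrightarrow> m = 0"
  unfolding below_def using keys_eq_empty[of m] by blast

lemma below_induct [consumes 1, case_names single add zero]:
  fixes m :: "'k::field pbw"
  assumes "m \<in> below n" "\<And>i j a c p. i + j < n \<Longrightarrow> P (single (i,j,a,c) p)"
    "\<And>u v. P u \<Longrightarrow> P v \<Longrightarrow> P (u + v)" "P 0"
  shows "P m"
  by (rule pbw_induct[of m P]) (use assms in \<open>auto simp: below_def\<close>)

lemma app_below: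
  assumes "m \<in> below n" "\<And>i j a c p. i + j < n \<Longrightarrow> app g (single (i,j,a,c) p) \<in> below n'"
  shows "app g m \<in> below n'"
  using assms(1) by (induction rule: below_induct) (auto simp: assms(2) app_add_right below_add)

lemma Xop_below: "m \<in> below n \<Longrightarrow> app Xop m \<in> below (Suc n)"
  by (erule app_below) simp

lemma Hop_below: "m \<in> below n \<Longrightarrow> app Hop m \<in> below n"
  by (erule app_below) (simp add: Hop_single)

lemma app_numeral: "app (numeral n) m = smul (numeral n) m"
  using sc.\<iota>_numeral[of n] by (metis app_scal)

text \<open>This lets the approximate Casimir operator be replaced by a better one inside
  z(\<Delta>), on a subspace where both are known to agree.\<close>

lemma app_peval_cong:
  assumes "m \<in> V" "0 \<in> V" "\<And>u v. u \<in> V \<Longrightarrow> v \<in> V \<Longrightarrow> u + v \<in> V" "\<And>c u. u \<in> V \<Longrightarrow> smul c u \<in> V"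
    and "\<And>u. u \<in> V \<Longrightarrow> app d u = app d' u" "\<And>u. u \<in> V \<Longrightarrow> app d u \<in> V"
  shows "app (sc.peval d q) m \<in> V \<and> app (sc.peval d q) m = app (sc.peval d' q) m"
proof -
  have V: "app (sc.peval d q) m \<in> V" for q
    by (induction q) (simp_all add: assms(1-4,6) sc.peval_pCons app_plus app_times)
  have "app (sc.peval d q) m = app (sc.peval d' q) m"
  proof (induction q)
    case (pCons a q)
    then show ?case using V[of q] by (simp add: assms(5)[symmetric] sc.peval_pCons app_plus app_times)
  qed simp
  with V show ?thesis by blast
qed

lemma Casimir_below:
  assumes "m \<in> below n" "\<And>m. m \<in> below n \<Longrightarrow> app e m \<in> below n" "\<And>m. m \<in> below n \<Longrightarrow> app f m \<in> below n"
  shows "app (Hop * Hop + 4 * e * f - 2 * Hop) m \<in> below n"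
  using assms by (auto simp: app_minus app_plus app_numeral app_times mult.assoc
     intro!: below_diff below_add below_smul Hop_below)

lemma zop_below_cong:
  assumes "m \<in> below n" "\<And>m. m \<in> below n \<Longrightarrow> app e m = app e' m \<and> app e m \<in> below n"
    "\<And>m. m \<in> below n \<Longrightarrow> app f m = app f' m \<and> app f m \<in> below n"
  shows "app (zop z e f) m \<in> below n \<and> app (zop z e f) m = app (zop z e' f') m"
  unfolding zop_def
proof (rule app_peval_cong[where V = "below n", OF assms(1)])
  show "app (Hop * Hop + 4 * e * f - 2 * Hop) u = app (Hop * Hop + 4 * e' * f' - 2 * Hop) u" if "u \<in> below n" for u
  proof -
    from assms(3)[OF that] have f: "app f' u = app f u" "app f u \<in> below n" by auto
    with assms(2)[of "app f u"] show ?thesis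
      by (simp add: app_minus app_plus app_numeral app_times mult.assoc)
  qed
qed (use assms(2,3) in \<open>auto intro!: Casimir_below below_add below_smul\<close>)

section \<open>Stabilization of the approximate operators\<close>

declare ops.simps(2) [simp del]

lemma ops_single:
  "app (e_op z (Suc n)) (single (Suc i,j,a,c) p) = app Xop (app (e_op z n) (single (i,j,a,c) p))"
  "app (f_op z (Suc n)) (single (Suc i,j,a,c) p) = app Xop (app (f_op z n) (single (i,j,a,c) p)) + app (y_op z n) (single (i,j,a,c) p)"
  "app (y_op z (Suc n)) (single (Suc i,j,a,c) p) = app Xop (app (y_op z n) (single (i,j,a,c) p))
     - app (zop z (e_op z n) (f_op z n)) (single (i,j,a,c) p)"
  "app (e_op z (Suc n)) (single (0,Suc j,a,c) p) = app (y_op z n) (app (e_op z n) (single (0,j,a,c) p)) + single (1,j,a,c) p"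
  "app (f_op z (Suc n)) (single (0,Suc j,a,c) p) = app (y_op z n) (app (f_op z n) (single (0,j,a,c) p))"
  "app (y_op z (Suc n)) (single (0,j,a,c) p) = single (0,Suc j,a,c) p"
  "app (e_op z (Suc n)) (single (0,0,a,c) p) = U_e (0,0,a,c) p"
  "app (f_op z (Suc n)) (single (0,0,a,c) p) = single (0,0,Suc a,c) p"
  unfolding ops_Suc app_lend_single[OF coeff_linear_step(1)] app_lend_single[OF coeff_linear_step(2)]
    app_lend_single[OF coeff_linear_step(3)]
  by (simp_all add: step_e_def step_f_def step_y_def app_minus app_times)

text \<open>Degree bounds and stability are proved together: to see that y (e m) is stable one must
  know that e m again lies in the range where y is already correct.\<close>

lemma ops_stable:
  assumes "m \<in> below n"
  shows "app (e_op z n) m \<in> below n \<and> app (e_op z (Suc n)) m = app (e_op z n) m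
    \<and> app (f_op z n) m \<in> below n \<and> app (f_op z (Suc n)) m = app (f_op z n) m
    \<and> app (y_op z n) m \<in> below (Suc n) \<and> app (y_op z (Suc n)) m = app (y_op z n) m"
  using assms
proof (induction n arbitrary: m)
  case 0
  then show ?case by (auto dest: below_zero_eq)
next
  case (Suc n)
  have z: "app (zop z (e_op z n) (f_op z n)) m \<in> below n
     \<and> app (zop z (e_op z (Suc n)) (f_op z (Suc n))) m = app (zop z (e_op z n) (f_op z n)) m"
    if "m \<in> below n" for m
  proof -
    have "app (zop z (e_op z n) (f_op z n)) m \<in> below n
     \<and> app (zop z (e_op z n) (f_op z n)) m = app (zop z (e_op z (Suc n)) (f_op z (Suc n))) m"
      by (rule zop_below_cong[OF that]) (use Suc.IH in auto)
    then show ?thesis by metis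
  qed
  from Suc.prems show ?case
  proof (induction rule: below_induct)
    case (single i j a c p)
    consider (x) i' where "i = Suc i'" | (y) j' where "i = 0" "j = Suc j'" | (u) "i = 0" "j = 0"
      by (cases i; cases j) auto
    then show ?case
    proof cases
      case x
      then have m: "single (i',j,a,c) p \<in> below n" using single by simp
      show ?thesis
        using Suc.IH[OF m] z[OF m] below_mono[of _ n "Suc (Suc n)"]
        by (simp add: x ops_single Xop_below below_add) (blast intro: Xop_below below_diff)
    next
      case y
      then have m: "single (0,j',a,c) p \<in> below n" using single by simp
      from Suc.IH[OF m] have ef: "app (e_op z n) (single (0,j',a,c) p) \<in> below n"
         "app (f_op z n) (single (0,j',a,c) p) \<in> below n"
         "app (e_op z (Suc n)) (single (0,j',a,c) p) = app (e_op z n) (single (0,j',a,c) p)"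
         "app (f_op z (Suc n)) (single (0,j',a,c) p) = app (f_op z n) (single (0,j',a,c) p)" by auto
      show ?thesis
        using Suc.IH[OF ef(1)] Suc.IH[OF ef(2)] y single
        by (simp add: y ef ops_single below_add)
    next
      case u
      then show ?thesis
        by (simp add: ops_single U_e_def below_add)
    qed
  qed (simp_all add: app_add_right below_add)
qed

lemma ops_stable_ge:
  assumes "m \<in> below n" "n \<le> n'"
  shows "app (e_op z n') m = app (e_op z n) m \<and> app (f_op z n') m = app (f_op z n) m
    \<and> app (y_op z n') m = app (y_op z n) m"
  using assms(2)
proof (induction rule: dec_induct)
  case (step k)
  with ops_stable[of m k z] below_mono[OF assms(1)] show ?case by simp
qed simp

text \<open>\<open>Suc (vdeg k)\<close> is the first level at which the monomial k lies in the range
  of correctness, since \<open>below\<close> is strict.\<close>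

definition Eop :: "'k::field poly \<Rightarrow> 'k endo" where "Eop z = lend (\<lambda>k p. app (e_op z (Suc (vdeg k))) (single k p))"
definition Fop :: "'k::field poly \<Rightarrow> 'k endo" where "Fop z = lend (\<lambda>k p. app (f_op z (Suc (vdeg k))) (single k p))"
definition Yop :: "'k::field poly \<Rightarrow> 'k endo" where "Yop z = lend (\<lambda>k p. app (y_op z (Suc (vdeg k))) (single k p))"

lemma coeff_linear_app_single: "coeff_linear (\<lambda>k p. app (g k) (single k p))"
  by (rule coeff_linearI) (auto simp: single_add app_add_right app_smul simp flip: smul_single)

lemma EFY_ops:
  assumes "m \<in> below n"
  shows "app (Eop z) m = app (e_op z n) m" "app (Fop z) m = app (f_op z n) m" "app (Yop z) m = app (y_op z n) m"
proof -
  have "app (Eop z) m = app (e_op z n) m \<and> app (Fop z) m = app (f_op z n) m \<and> app (Yop z) m = app (y_op z n) m"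
    using assms
  proof (induction rule: below_induct)
    case (single i j a c p)
    then show ?case
      using ops_stable_ge[of "single (i,j,a,c) p" "Suc (i+j)" n z]
      by (simp add: Eop_def Fop_def Yop_def app_lend_single[OF coeff_linear_app_single] del: ops.simps)
  qed (auto simp: app_add_right)
  then show "app (Eop z) m = app (e_op z n) m" "app (Fop z) m = app (f_op z n) m" "app (Yop z) m = app (y_op z n) m"
    by auto
qed

lemma E_below: "m \<in> below n \<Longrightarrow> app (Eop z) m \<in> below n"
  and F_below: "m \<in> below n \<Longrightarrow> app (Fop z) m \<in> below n"
  and Y_below: "m \<in> below n \<Longrightarrow> app (Yop z) m \<in> below (Suc n)"
  using ops_stable[of m n z] EFY_ops[of m n z] by auto

abbreviation Zop :: "'k::field poly \<Rightarrow> 'k endo" where "Zop z \<equiv> zop z (Eop z) (Fop z)"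

lemma Zop_below: "m \<in> below n \<Longrightarrow> app (Zop z) m \<in> below n"
  using zop_below_cong[of m n "Eop z" "Eop z" "Fop z" "Fop z"] by (auto simp: E_below F_below)

text \<open>The recursion now holds for the limiting operators themselves, so that the
  approximations need not be unfolded in what follows.\<close>

lemma EFY_single:
  defines "s \<equiv> \<lambda>i j a c p. single (i,j,a,c) (p :: 'k::field poly)"
  shows "app (Eop z) (s (Suc i) j a c p) = app Xop (app (Eop z) (s i j a c p))"
    "app (Fop z) (s (Suc i) j a c p) = app Xop (app (Fop z) (s i j a c p)) + app (Yop z) (s i j a c p)"
    "app (Yop z) (s (Suc i) j a c p) = app Xop (app (Yop z) (s i j a c p)) - app (Zop z) (s i j a c p)"
    "app (Eop z) (s 0 (Suc j) a c p) = app (Yop z) (app (Eop z) (s 0 j a c p)) + s 1 j a c p"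
    "app (Fop z) (s 0 (Suc j) a c p) = app (Yop z) (app (Fop z) (s 0 j a c p))"
    "app (Yop z) (s 0 j a c p) = s 0 (Suc j) a c p"
    "app (Eop z) (s 0 0 a c p) = U_e (0,0,a,c) p"
    "app (Fop z) (s 0 0 a c p) = s 0 0 (Suc a) c p"
proof -
  define n where "n = Suc (i + j)"
  have m: "s i j a c p \<in> below n" and m0: "s 0 j a c p \<in> below n"
     and m1: "s (Suc i) j a c p \<in> below (Suc n)" "s 0 (Suc j) a c p \<in> below (Suc n)" "s 0 j a c p \<in> below (Suc n)"
    and m2: "s 0 0 a c p \<in> below (Suc 0)"
    by (auto simp: s_def n_def)
  have z: "app (Zop z) (s i j a c p) = app (zop z (e_op z n) (f_op z n)) (s i j a c p)"
    by (rule zop_below_cong[OF m, THEN conjunct2]) (simp_all add: E_below F_below EFY_ops(1,2)[symmetric])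
  show "app (Eop z) (s (Suc i) j a c p) = app Xop (app (Eop z) (s i j a c p))"
    "app (Fop z) (s (Suc i) j a c p) = app Xop (app (Fop z) (s i j a c p)) + app (Yop z) (s i j a c p)"
    "app (Yop z) (s (Suc i) j a c p) = app Xop (app (Yop z) (s i j a c p)) - app (Zop z) (s i j a c p)"
    unfolding z EFY_ops[OF m] EFY_ops[OF m1(1)] by (simp_all add: s_def ops_single)
  have "app (e_op z n) (s 0 j a c p) \<in> below n" "app (f_op z n) (s 0 j a c p) \<in> below n"
    using ops_stable[OF m0] by auto
  note u = EFY_ops[OF this(1)] EFY_ops[OF this(2)]
  show "app (Eop z) (s 0 (Suc j) a c p) = app (Yop z) (app (Eop z) (s 0 j a c p)) + s 1 j a c p"
    "app (Fop z) (s 0 (Suc j) a c p) = app (Yop z) (app (Fop z) (s 0 j a c p))"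
    unfolding EFY_ops[OF m0] EFY_ops[OF m1(2)] u by (simp_all add: s_def ops_single)
  show "app (Yop z) (s 0 j a c p) = s 0 (Suc j) a c p"
    unfolding EFY_ops[OF m1(3)] by (simp add: s_def ops_single)
  show "app (Eop z) (s 0 0 a c p) = U_e (0,0,a,c) p" "app (Fop z) (s 0 0 a c p) = s 0 0 (Suc a) c p"
    unfolding EFY_ops[OF m2] by (simp_all add: s_def ops_single)
qed

lemma EX: "Eop z * Xop = Xop * Eop z"
  and FX: "Fop z * Xop = Xop * Fop z + Yop z"
  and YX: "Yop z * Xop = Xop * Yop z - Zop z"
  by (rule endo_eq_single; simp only: split_paired_all app_times app_plus app_minus EFY_single Xop_single)+

lemma HX: "Hop * Xop = Xop * Hop + Xop"
  by (rule endo_eq_single)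
    (simp only: split_paired_all app_times app_plus Hop_single Xop_single single_add[symmetric], simp add: smult_add_left smult_diff_left algebra_simps)

text \<open>The relations involving \<open>x\<close> on the left hold by construction; the others need induction on the degree.\<close>

lemma app_eq_below_Suc:
  assumes x: "\<And>m. m \<in> below n \<Longrightarrow> app g (app Xop m) = app g' (app Xop m)"
    and y: "\<And>j a c p. j < n \<Longrightarrow> app g (single (0,Suc j,a,c) p) = app g' (single (0,Suc j,a,c) p)"
    and u: "\<And>a c p. app g (single (0,0,a,c) p) = app g' (single (0,0,a,c) p)"
    and "m \<in> below (Suc n)"
  shows "app g m = app g' m"
  using assms(4)
proof (induction rule: below_induct)
  case (single i j a c p)
  consider (x) i' where "i = Suc i'" | (y) j' where "i = 0" "j = Suc j'" | (u) "i = 0" "j = 0"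
    by (cases i; cases j) auto
  then show ?case
  proof cases
    case (x i')
    have "single (i',j,a,c) p \<in> below n" using single x by simp
    from assms(1)[OF this] x show ?thesis by simp
  qed (use single in \<open>auto simp: y u\<close>)
qed (auto simp: app_add_right)

lemma sl2_base:
  defines "s \<equiv> \<lambda>a c p. single (0,0,a,c) (p :: 'k::field poly)"
  shows "app (Eop z * Fop z) (s a c p) = app (Fop z * Eop z + Hop) (s a c p)"
    "app (Hop * Eop z) (s a c p) = app (Eop z * Hop + 2 * Eop z) (s a c p)"
    "app (Hop * Fop z) (s a c p) = app (Fop z * Hop - 2 * Fop z) (s a c p)"
proof -
  \<comment> \<open>The coefficient in [e, f^(a+1)] exceeds the one in [e, f^a] by the weight h -
    2a, which is the term h in e f = f e + h.\<close>
  have 1: "of_nat (Suc a) * [:1 - of_nat (Suc a), 1:] = of_nat a * [:1 - of_nat a, 1:] + [:- (2 * of_nat a), 1 :: 'k:]"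
    for a by (simp add: of_nat_poly algebra_simps)
  have H: "app Hop (single (0,0,a,c) p) = single (0,0,a,c) ([:- (2 * of_nat a), 1:] * p)"
    for a c and p :: "'k poly" using Hop_single[of 0 0 a c p] by simp
  have F: "app (Fop z) (single (0,0,a,c) p) = single (0,0,Suc a,c) p" for a c and p :: "'k poly"
    by (rule EFY_single)
  have E: "app (Eop z) (single (0,0,a,c) p) = single (0,0,a,Suc c) (pcompose p [:-2, 1:])
      + single (0,0,a-1,c) (of_nat a * [:1 - of_nat a, 1:] * p)" for a c and p :: "'k poly"
    by (simp only: EFY_single U_e_def prod.case)
  have FE: "single (0,0,Suc (a-1),c) (of_nat a * [:1 - of_nat a, 1:] * p)
      = single (0,0,a,c) (of_nat a * [:1 - of_nat a, 1:] * p)" for c and p :: "'k poly"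
    by (cases a) simp_all
  show "app (Eop z * Fop z) (s a c p) = app (Fop z * Eop z + Hop) (s a c p)"
    by (simp only: s_def app_times app_plus app_add_right H E F FE diff_Suc_1 1 distrib_right single_add add.assoc)
  have 2: "[:- (2 * of_nat (a - 1)), 1:] * (of_nat a * (r * q)) = of_nat a * (r * ([:- (2 * of_nat a), 1:] * q)) + 2 * (of_nat a * (r * q))"
    for q r :: "'k poly"
  proof (cases a)
    case (Suc b)
    have "[:- (2 * of_nat b), 1:] = [:- (2 * of_nat (Suc b)), 1:] + (2 :: 'k poly)"
      by (simp add: numeral_poly)
    then show ?thesis unfolding Suc diff_Suc_1 by (simp only: distrib_right distrib_left mult.left_commute mult.assoc)
  qed simp
  have 3: "[:- (2 * of_nat a), 1:] * pcompose p [:-2, 1:] = pcompose ([:- (2 * of_nat a), 1:] * p) [:-2, 1:] + 2 * pcompose p [:-2,1:]"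
    for p :: "'k poly"
  proof -
    have "[:- (2 * of_nat a), 1:] = pcompose [:- (2 * of_nat a), 1:] [:-2, 1:] + (2 :: 'k poly)"
      by (simp add: pcompose_pCons numeral_poly)
    then show ?thesis by (metis pcompose_mult distrib_right)
  qed
  have 4: "[:- (2 * of_nat (Suc a)), 1:] * p = [:- (2 * of_nat a), 1:] * p - 2 * p" for p :: "'k poly"
    by (simp add: algebra_simps smult_add_left smult_diff_left numeral_poly)
  have 5: "smul 2 (single k q) = single k (2 * q)" for k and q :: "'k poly"
    by (simp add: numeral_poly)
  show "app (Hop * Eop z) (s a c p) = app (Eop z * Hop + 2 * Eop z) (s a c p)"
    by (simp only: s_def app_times app_plus app_numeral app_add_right smul_add E H 2 3 5 single_add mult.assoc add_ac)
  show "app (Hop * Fop z) (s a c p) = app (Fop z * Hop - 2 * Fop z) (s a c p)"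
    by (simp only: s_def app_times app_minus app_numeral F H 4 5 single_diff)
qed

lemma smul_2: "smul 2 m = m + m" and smul_4: "smul 4 m = m + m + (m + m)"
  using smul_add_left[of 1 1 m] smul_add_left[of 2 2 m] by simp_all

lemma app_X_comm:
  "app (Eop z) (app Xop m) = app Xop (app (Eop z) m)"
  "app (Fop z) (app Xop m) = app Xop (app (Fop z) m) + app (Yop z) m"
  "app (Yop z) (app Xop m) = app Xop (app (Yop z) m) - app (Zop z) m"
  "app Hop (app Xop m) = app Xop (app Hop m) + app Xop m"
  using EX[of z] FX[of z] YX[of z] HX by (metis app_times app_plus app_minus)+

text \<open>All six relations form one induction on the degree, since they feed each other: ef at x
  m uses ey at m, while ef at y m uses fy and hy at m. The relations of y with e, f, h at x m need
  z(\<Delta>) to commute with e, f, h in lower degree.\<close>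

lemma relations_below:
  assumes "m \<in> below n"
  shows "app (Eop z) (app (Fop z) m) = app (Fop z) (app (Eop z) m) + app Hop m
    \<and> app Hop (app (Eop z) m) = app (Eop z) (app Hop m) + smul 2 (app (Eop z) m)
    \<and> app Hop (app (Fop z) m) = app (Fop z) (app Hop m) - smul 2 (app (Fop z) m)
    \<and> app (Eop z) (app (Yop z) m) = app (Yop z) (app (Eop z) m) + app Xop m
    \<and> app (Fop z) (app (Yop z) m) = app (Yop z) (app (Fop z) m)
    \<and> app Hop (app (Yop z) m) = app (Yop z) (app Hop m) - app (Yop z) m"
  using assms
proof (induction n arbitrary: m)
  case 0
  then show ?case by (auto dest: below_zero_eq)
next
  case (Suc n)
  \<comment> \<open>Here \<open>D\<close> is the Casimir element \<Delta> itself, without the shift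
    by 1 used later.\<close>
  define D where "D = Hop * Hop + 4 * Eop z * Fop z - 2 * Hop"
  have ef: "app (Eop z) (app (Fop z) m) = app (Fop z) (app (Eop z) m) + app Hop m"
    and he: "app Hop (app (Eop z) m) = app (Eop z) (app Hop m) + smul 2 (app (Eop z) m)"
    and hf: "app Hop (app (Fop z) m) = app (Fop z) (app Hop m) - smul 2 (app (Fop z) m)"
    and ey: "app (Eop z) (app (Yop z) m) = app (Yop z) (app (Eop z) m) + app Xop m"
    and fy: "app (Fop z) (app (Yop z) m) = app (Yop z) (app (Fop z) m)"
    and hy: "app Hop (app (Yop z) m) = app (Yop z) (app Hop m) - app (Yop z) m" if "m \<in> below n" for m
    using Suc.IH[OF that] by auto
  note b = E_below F_below Hop_below
  note ra = app_add_right app_diff_right app_smul smul_add smul_diff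
  have Dm: "app D m = app Hop (app Hop m) + smul 4 (app (Eop z) (app (Fop z) m)) - smul 2 (app Hop m)" for m
    by (simp add: D_def app_minus app_plus app_numeral app_times mult.assoc)
  have D: "app (Eop z) (app D m) = app D (app (Eop z) m)" "app (Fop z) (app D m) = app D (app (Fop z) m)"
    "app Hop (app D m) = app D (app Hop m)" if "m \<in> below n" for m
    using that unfolding Dm by (simp_all add: ef he hf b ra smul_2 smul_4 algebra_simps)
  have Db: "app (sc.peval D q) m \<in> below n" if "m \<in> below n" for q m
    by (rule app_peval_cong[THEN conjunct1, OF that])
      (auto simp: D_def intro!: Casimir_below b below_add below_smul)
  have Z: "app (Eop z) (app (Zop z) m) = app (Zop z) (app (Eop z) m)" "app (Fop z) (app (Zop z) m) = app (Zop z) (app (Fop z) m)"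
    "app Hop (app (Zop z) m) = app (Zop z) (app Hop m)" if m: "m \<in> below n" for m
  proof -
    have "app (Eop z) (app (sc.peval D q) m) = app (sc.peval D q) (app (Eop z) m)
      \<and> app (Fop z) (app (sc.peval D q) m) = app (sc.peval D q) (app (Fop z) m)
      \<and> app Hop (app (sc.peval D q) m) = app (sc.peval D q) (app Hop m)" for q
      by (induction q) (simp_all add: sc.peval_pCons app_plus app_times ra D[OF Db[OF m]])
    then show "app (Eop z) (app (Zop z) m) = app (Zop z) (app (Eop z) m)" "app (Fop z) (app (Zop z) m) = app (Zop z) (app (Fop z) m)"
    "app Hop (app (Zop z) m) = app (Zop z) (app Hop m)"
      unfolding zop_def D_def[symmetric] by auto
  qed
  have 1: "app (Eop z * Fop z) m = app (Fop z * Eop z + Hop) m"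
  proof (rule app_eq_below_Suc[OF _ _ _ Suc.prems])
    show "app (Eop z * Fop z) (app Xop m) = app (Fop z * Eop z + Hop) (app Xop m)" if "m \<in> below n" for m
      using that by (simp add: app_times app_plus app_X_comm ra ey ef algebra_simps)
    show "app (Eop z * Fop z) (single (0,Suc j,a,c) p) = app (Fop z * Eop z + Hop) (single (0,Suc j,a,c) p)" 
      if "j < n" for j a c p
    proof -
      define m where "m = single (0::nat,j,a,c) p"
      have "m \<in> below n" using that by (simp add: m_def)
      then have "app (Eop z * Fop z) (app (Yop z) m) = app (Fop z * Eop z + Hop) (app (Yop z) m)"
        by (simp add: app_times app_plus app_X_comm ra ey fy hy ef b algebra_simps)
      then show ?thesis by (simp add: m_def EFY_single)
    qed
  qed (rule sl2_base)
  have 2: "app (Hop * Eop z) m = app (Eop z * Hop + 2 * Eop z) m"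
  proof (rule app_eq_below_Suc[OF _ _ _ Suc.prems])
    show "app (Hop * Eop z) (app Xop m) = app (Eop z * Hop + 2 * Eop z) (app Xop m)" if "m \<in> below n" for m
      using that by (simp add: app_times app_plus app_numeral app_X_comm ra he algebra_simps)
    show "app (Hop * Eop z) (single (0,Suc j,a,c) p) = app (Eop z * Hop + 2 * Eop z) (single (0,Suc j,a,c) p)"
      if "j < n" for j a c p
    proof -
      define m where "m = single (0::nat,j,a,c) p"
      have "m \<in> below n" using that by (simp add: m_def)
      then have "app (Hop * Eop z) (app (Yop z) m) = app (Eop z * Hop + 2 * Eop z) (app (Yop z) m)"
        by (simp add: app_times app_plus app_numeral app_X_comm ra ey hy he smul_2 b algebra_simps)
      then show ?thesis by (simp add: m_def EFY_single)
    qed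
  qed (rule sl2_base)
  have 3: "app (Hop * Fop z) m = app (Fop z * Hop - 2 * Fop z) m"
  proof (rule app_eq_below_Suc[OF _ _ _ Suc.prems])
    show "app (Hop * Fop z) (app Xop m) = app (Fop z * Hop - 2 * Fop z) (app Xop m)" if "m \<in> below n" for m
      using that by (simp add: app_times app_minus app_numeral app_X_comm ra hf hy smul_2 algebra_simps)
    show "app (Hop * Fop z) (single (0,Suc j,a,c) p) = app (Fop z * Hop - 2 * Fop z) (single (0,Suc j,a,c) p)"
      if "j < n" for j a c p
    proof -
      define m where "m = single (0::nat,j,a,c) p"
      have "m \<in> below n" using that by (simp add: m_def)
      then have "app (Hop * Fop z) (app (Yop z) m) = app (Fop z * Hop - 2 * Fop z) (app (Yop z) m)"
        by (simp add: app_times app_minus app_numeral app_X_comm ra fy hy hf smul_2 b algebra_simps)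
      then show ?thesis by (simp add: m_def EFY_single)
    qed
  qed (rule sl2_base)
  have 4: "app (Eop z * Yop z) m = app (Yop z * Eop z + Xop) m"
  proof (rule app_eq_below_Suc[OF _ _ _ Suc.prems])
    show "app (Eop z * Yop z) (app Xop m) = app (Yop z * Eop z + Xop) (app Xop m)" if "m \<in> below n" for m
      using that by (simp add: app_times app_plus app_X_comm ra ey Z algebra_simps)
  qed (simp_all add: app_times app_plus EFY_single)
  have 5: "app (Fop z * Yop z) m = app (Yop z * Fop z) m"
  proof (rule app_eq_below_Suc[OF _ _ _ Suc.prems])
    show "app (Fop z * Yop z) (app Xop m) = app (Yop z * Fop z) (app Xop m)" if "m \<in> below n" for m
      using that by (simp add: app_times app_plus app_X_comm ra fy Z algebra_simps)
  qed (simp_all add: app_times app_plus EFY_single)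
  have 6: "app (Hop * Yop z) m = app (Yop z * Hop - Yop z) m"
  proof (rule app_eq_below_Suc[OF _ _ _ Suc.prems])
    show "app (Hop * Yop z) (app Xop m) = app (Yop z * Hop - Yop z) (app Xop m)" if "m \<in> below n" for m
      using that by (simp add: app_times app_minus app_X_comm ra hy Z algebra_simps)
  qed (simp_all add: app_times app_minus EFY_single Hop_single single_diff[symmetric] smult_diff_left smult_add_left numeral_poly algebra_simps)
  from 1 2 3 4 5 6 show ?case by (simp add: app_times app_plus app_minus app_numeral)
qed

lemma in_below: "\<exists>n. m \<in> below n"
proof -
  have "\<forall>k\<in>keys m. vdeg k < Suc (Max (insert 0 (vdeg ` keys m)))"
    by (auto simp: less_Suc_eq_le intro!: Max_ge)
  then show ?thesis unfolding below_def by blast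
qed

text \<open>A realization of the defining relations in any k-algebra. It is applied to the PBW
  operators and also to their images under the exchange of x and y.\<close>

locale HZ = scalars \<iota> for \<iota> :: "'k::comm_ring_1 \<Rightarrow> 'a::ring_1" +
  fixes z :: "'k poly" and e f h x y :: 'a
  assumes ef: "e * f = f * e + h" and he: "h * e = e * h + 2 * e" and hf: "h * f = f * h - 2 * f"
    and ex: "e * x = x * e" and ey: "e * y = y * e + x" and fx: "f * x = x * f + y" and fy: "f * y = y * f"
    and hx: "h * x = x * h + x" and hy: "h * y = y * h - y"
    and yx: "y * x = x * y - peval (h * h + 4 * e * f - 2 * h) z"

lemma HZ_ops: "HZ scal z (Eop z) (Fop z) Hop Xop (Yop z)"
proof
  note r = relations_below[of _ _ z]
  show "Eop z * Fop z = Fop z * Eop z + Hop" "Hop * Eop z = Eop z * Hop + 2 * Eop z"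
    "Hop * Fop z = Fop z * Hop - 2 * Fop z" "Eop z * Yop z = Yop z * Eop z + Xop" "Fop z * Yop z = Yop z * Fop z"
    "Hop * Yop z = Yop z * Hop - Yop z"
    by (rule endo_eqI; use r in_below in \<open>simp add: app_times app_plus app_minus app_numeral, blast\<close>)+
qed (use EX FX HX YX in \<open>simp_all add: zop_def\<close>)

section \<open>Representations of the free algebra\<close>

lemma falg_sum: "(a :: ('g, 'k::comm_ring_1) free_alg) = (\<Sum>w\<in>keys a. single w (lookup a w))"
proof (rule poly_mapping_eqI)
  fix k
  show "lookup a k = lookup (\<Sum>k\<in>keys a. single k (lookup a k)) k"
    by (cases "k \<in> keys a")
      (auto simp: lookup_sum lookup_single when_def in_keys_iff if_distrib sum.delta cong: if_cong)
qed

lemma falg_induct [case_names single add zero]: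
  fixes a :: "('g, 'k::comm_ring_1) free_alg"
  assumes "\<And>w c. w \<in> keys a \<Longrightarrow> P (single w c)" and "\<And>u v. P u \<Longrightarrow> P v \<Longrightarrow> P (u + v)" and "P 0"
  shows "P a"
proof -
  have "P (\<Sum>k\<in>A. single k (lookup a k))" if "finite A" "A \<subseteq> keys a" for A
    using that by (induction A) (auto intro: assms)
  from this[of "keys a"] show ?thesis using falg_sum[of a] by simp
qed

lemma single_Cons: "single (Word (g # ws)) c = var g * single (Word ws) c"
  by (simp add: var_def mult_single plus_word_def)

lemma scalar_falg_comm: "scalar c * a = a * scalar c"
proof (induction a rule: falg_induct)
  case (single w d)
  have "w + 0 = w" "0 + w = w" by simp_all
  then show ?case by (simp add: scalar_def mult_single mult.commute)
qed (auto simp: distrib_left distrib_right)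

interpretation fa: scalars "scalar :: 'k::comm_ring_1 \<Rightarrow> ('g, 'k) free_alg"
proof unfold_locales
  show "scalar c * u = u * scalar c" for c and u :: "('g, 'k) free_alg" by (rule scalar_falg_comm)
qed (simp_all add: scalar_def single_add mult_single)

context scalars
begin

definition word_map :: "('g \<Rightarrow> 'a) \<Rightarrow> 'g word \<Rightarrow> 'a" where "word_map g w = prod_list (map g (letters w))"

definition free_hom :: "('g \<Rightarrow> 'a) \<Rightarrow> ('g, 'k) free_alg \<Rightarrow> 'a"
  where "free_hom g a = (\<Sum>w\<in>keys a. \<iota> (lookup a w) * word_map g w)"

lemma free_hom_superset:
  "finite A \<Longrightarrow> keys a \<subseteq> A \<Longrightarrow> free_hom g a = (\<Sum>w\<in>A. \<iota> (lookup a w) * word_map g w)"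
  unfolding free_hom_def by (intro sum.mono_neutral_left) (auto simp: in_keys_iff \<iota>_0)

lemma free_hom_add: "free_hom g (a + b) = free_hom g a + free_hom g b"
  using keys_add[of a b]
  by (simp add: free_hom_superset[where A = "keys a \<union> keys b"] lookup_add \<iota>_add distrib_right sum.distrib)

lemma free_hom_single: "free_hom g (single w c) = \<iota> c * word_map g w"
  by (simp add: free_hom_def \<iota>_0)

lemma free_hom_0 [simp]: "free_hom g 0 = 0"
  by (simp add: free_hom_def)

lemma free_hom_mult: "free_hom g (a * b) = free_hom g a * free_hom g b"
proof (induction a rule: falg_induct)
  case (single w c)
  show ?case
  proof (induction b rule: falg_induct)
    case (single v d)
    have "word_map g (w + v) = word_map g w * word_map g v"
      by (simp add: word_map_def plus_word_def)
    then show ?case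
      unfolding mult_single free_hom_single \<iota>_mult mult.assoc by (metis \<iota>_left_comm)
  qed (auto simp: distrib_left free_hom_add)
qed (auto simp: distrib_right free_hom_add)

lemma free_hom_scalar [simp]: "free_hom g (scalar c) = \<iota> c"
  by (simp add: scalar_def free_hom_single word_map_def zero_word_def)

lemma free_hom_1 [simp]: "free_hom g 1 = 1"
  using free_hom_scalar[of g 1] by (simp add: fa.\<iota>_1 \<iota>_1)

lemma free_hom_var [simp]: "free_hom g (var v) = g v"
  by (simp add: var_def free_hom_single word_map_def \<iota>_1)

lemma free_hom_minus: "free_hom g (- a) = - free_hom g a"
  using free_hom_add[of g a "- a"] by (simp add: eq_neg_iff_add_eq_0 add.commute)

lemma free_hom_diff: "free_hom g (a - b) = free_hom g a - free_hom g b"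
  using free_hom_add[of g a "- b"] by (simp add: free_hom_minus)

lemma free_hom_power: "free_hom g (a ^ n) = free_hom g a ^ n"
  by (induction n) (auto simp: free_hom_mult)

lemma free_hom_peval: "free_hom g (fa.peval a q) = peval (free_hom g a) q"
  by (induction q) (auto simp: fa.peval_pCons peval_pCons free_hom_add free_hom_mult)

lemma free_hom_comm:
  assumes "\<And>v. u * g v = g v * u" shows "u * free_hom g a = free_hom g a * u"
proof -
  have *: "u * prod_list (map g ws) = prod_list (map g ws) * u" for ws
    by (induction ws) (simp_all, metis assms mult.assoc)
  show ?thesis
    by (induction a rule: falg_induct)
      (simp_all add: free_hom_single free_hom_add distrib_left distrib_right word_map_def mult.assoc, simp only: \<iota>_left_comm[of u] *)
qed

end

lemma eval_Delta_peval: "eval_Delta (z :: 'k::comm_ring_1 poly) = fa.peval Delta z"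
proof -
  have 1: "fa.peval d (monom c n) = scalar c * d ^ n" for d :: "'k falg" and c n
    unfolding monom_altdef fa.peval_smult fa.peval_power fa.peval_X ..
  have 2: "fa.peval d (\<Sum>i\<in>A. g i) = (\<Sum>i\<in>A. fa.peval d (g i))" for d :: "'k falg" and g :: "nat \<Rightarrow> 'k poly" and A
    by (induction A rule: infinite_finite_induct) (auto simp: fa.peval_add)
  have "fa.peval Delta z = fa.peval Delta (\<Sum>i\<le>degree z. monom (coeff z i) i)"
    by (simp only: poly_as_sum_of_monoms)
  then show ?thesis
    unfolding eval_Delta_def 1 2 by simp
qed


section \<open>\<open>H\<^sub>z\<close> as an algebra of operators\<close>

fun generator :: "'k::field poly \<Rightarrow> gen \<Rightarrow> 'k endo" where
  "generator z (Inl E) = Eop z"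
| "generator z (Inl F) = Fop z"
| "generator z (Inl H) = Hop"
| "generator z (Inr Vx) = Xop"
| "generator z (Inr Vy) = Yop z"

definition rep :: "'k::field poly \<Rightarrow> 'k falg \<Rightarrow> 'k endo" where "rep z = sc.free_hom (generator z)"

lemma rep_simps [simp]:
  "rep z (a + b) = rep z a + rep z b" "rep z (a * b) = rep z a * rep z b" "rep z (a - b) = rep z a - rep z b"
  "rep z (- a) = - rep z a" "rep z 0 = 0" "rep z 1 = 1" "rep z (var v) = generator z v" "rep z (scalar c) = scal c"
  "rep z (a ^ n) = rep z a ^ n" "rep z (fa.peval a q) = sc.peval (rep z a) q"
  by (simp_all add: rep_def sc.free_hom_add sc.free_hom_mult sc.free_hom_diff sc.free_hom_minus sc.free_hom_power
      sc.free_hom_peval)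

lemma scal_numeral: "scal (numeral n) = numeral n"
  by (rule sc.\<iota>_numeral)

lemma rep_sum: "rep z (sum g A) = (\<Sum>a\<in>A. rep z (g a))"
  by (induction A rule: infinite_finite_induct) auto

lemma rep_Delta: "rep z Delta = Hop * Hop + 4 * Eop z * Fop z - 2 * Hop"
  by (simp add: Delta_def power2_eq_square scal_numeral)

lemma rep_eval_Delta: "rep z (eval_Delta z) = Zop z"
  by (simp add: eval_Delta_peval rep_Delta zop_def)

interpretation op: HZ scal z "Eop z" "Fop z" Hop Xop "Yop z" for z :: "'k::field poly"
  by (rule HZ_ops)

section \<open>From the two successive quotients to one congruence on the free algebra\<close>

lemma free_ring_simps [simp]:
  "carrier free_ring = UNIV" "x \<otimes>\<^bsub>free_ring\<^esub> y = x * y" "x \<oplus>\<^bsub>free_ring\<^esub> y = x + y"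
  "\<zero>\<^bsub>free_ring\<^esub> = 0" "\<one>\<^bsub>free_ring\<^esub> = 1"
  by (simp_all add: ring_of_type_algebra_def)

lemma free_ring_minus [simp]: "a \<ominus>\<^bsub>free_ring\<^esub> b = a - (b :: 'k::comm_ring_1 falg)"
proof -
  interpret ring "free_ring :: 'k falg ring" by (rule ring_free_ring)
  show ?thesis using minus_equality[of "- b" b] by (simp add: minus_eq)
qed

lemma quot_class:
  assumes "ring R" "ideal I R"
  shows "(+>\<^bsub>R\<^esub>) I \<in> ring_hom R (R Quot I)" "carrier (R Quot I) = ((+>\<^bsub>R\<^esub>) I) ` carrier R"
    "a \<in> carrier R \<Longrightarrow> b \<in> carrier R \<Longrightarrow> I +>\<^bsub>R\<^esub> a = I +>\<^bsub>R\<^esub> b \<longleftrightarrow> a \<ominus>\<^bsub>R\<^esub> b \<in> I"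
    "\<zero>\<^bsub>R Quot I\<^esub> = I"
  using ideal.rcos_ring_hom[OF assms(2)] ring.quotient_eq_iff_same_a_r_cos[OF assms]
  by (auto simp: FactRing_def A_RCOSETS_def RCOSETS_def a_r_coset_def)

lemma smash_class_hom: "smash_class \<in> ring_hom free_ring smash"
  using quot_class(1)[OF ring_free_ring ideal_smash_ideal]
  unfolding smash_class_def[abs_def] smash_def by simp

lemma carrier_smash: "carrier smash = range smash_class"
  using quot_class(2)[OF ring_free_ring ideal_smash_ideal]
  unfolding smash_class_def[abs_def] smash_def by simp

lemma smash_class_eq: "smash_class a = smash_class b \<longleftrightarrow> a - b \<in> smash_ideal"
  using quot_class(3)[OF ring_free_ring ideal_smash_ideal, of a b]
  unfolding smash_class_def by simp

lemma H_class_hom: "H_class z \<in> ring_hom free_ring (H_alg z)"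
  using ring_hom_trans[OF smash_class_hom quot_class(1)[OF ring_smash ideal_H_ideal[of z]]]
  unfolding H_class_def[abs_def] H_alg_def comp_def by simp

lemma carrier_H_alg: "carrier (H_alg z) = range (H_class z)"
  using quot_class(2)[OF ring_smash ideal_H_ideal[of z]]
  unfolding H_class_def[abs_def] H_alg_def carrier_smash by auto

text \<open>The kernel of the map from the free algebra to H_z; it replaces cosets of cosets by a
  single congruence.\<close>

definition J :: "'k::comm_ring_1 poly \<Rightarrow> 'k falg set" where "J z = {a. smash_class a \<in> H_ideal z}"

lemma smash_class_simps:
  "smash_class (a + b) = smash_class a \<oplus>\<^bsub>smash\<^esub> smash_class b"
  "smash_class (a * b) = smash_class a \<otimes>\<^bsub>smash\<^esub> smash_class b"
  "smash_class (a - b) = smash_class a \<ominus>\<^bsub>smash\<^esub> smash_class b"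
  "smash_class 0 = \<zero>\<^bsub>smash\<^esub>"
proof -
  interpret ring_hom_ring free_ring smash smash_class
    by (rule ring_hom_ringI2[OF ring_free_ring ring_smash smash_class_hom])
  show "smash_class (a + b) = smash_class a \<oplus>\<^bsub>smash\<^esub> smash_class b"
    "smash_class (a * b) = smash_class a \<otimes>\<^bsub>smash\<^esub> smash_class b"
    "smash_class 0 = \<zero>\<^bsub>smash\<^esub>"
    using hom_add[of a b] hom_mult[of a b] hom_zero by simp_all
  have "a \<ominus>\<^bsub>free_ring\<^esub> b = a \<oplus>\<^bsub>free_ring\<^esub> \<ominus>\<^bsub>free_ring\<^esub> b" by (simp only: a_minus_def)
  then show "smash_class (a - b) = smash_class a \<ominus>\<^bsub>smash\<^esub> smash_class b"
    by (metis S.minus_eq UNIV_I free_ring_minus free_ring_simps(1) hom_a_inv hom_add R.a_inv_closed)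
qed

lemma in_carrier_smash [simp]: "smash_class a \<in> carrier smash"
  by (simp add: carrier_smash)

lemma H_class_eq: "H_class z a = H_class z b \<longleftrightarrow> a - b \<in> J z"
  using quot_class(3)[OF ring_smash ideal_H_ideal[of z], of "smash_class a" "smash_class b"]
  unfolding H_class_def J_def by (simp add: smash_class_simps)

lemma J_closed:
  "0 \<in> J z" "a \<in> J z \<Longrightarrow> b \<in> J z \<Longrightarrow> a + b \<in> J z" "a \<in> J z \<Longrightarrow> c * a \<in> J z" "a \<in> J z \<Longrightarrow> a * c \<in> J z"
proof -
  interpret I: ideal "H_ideal z" smash by (rule ideal_H_ideal)
  show "0 \<in> J z" "a \<in> J z \<Longrightarrow> b \<in> J z \<Longrightarrow> a + b \<in> J z" "a \<in> J z \<Longrightarrow> c * a \<in> J z" "a \<in> J z \<Longrightarrow> a * c \<in> J z"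
    by (auto simp: J_def smash_class_simps I.I_l_closed I.I_r_closed)
qed

lemma J_minus: "a \<in> J z \<Longrightarrow> - a \<in> J z"
  using J_closed(3)[of a z "- 1"] by simp

lemma smash_ideal_J: "a \<in> smash_ideal \<Longrightarrow> a \<in> J z"
proof -
  interpret I: ideal "H_ideal z" smash by (rule ideal_H_ideal)
  assume "a \<in> smash_ideal"
  then have "smash_class a = smash_class 0" by (simp add: smash_class_eq)
  then show "a \<in> J z" by (simp add: J_def smash_class_simps)
qed

lemma relations_J:
  "commutator (sl2_var g) (sl2_var g') - sl2_bracket g g' \<in> J z"
  "commutator (sl2_var g) (V_var v) - sl2_act g v \<in> J z"
  "commutator (V_var Vx) (V_var Vy) - eval_Delta z \<in> J z"
proof -
  have "{commutator (sl2_var g) (sl2_var g') - sl2_bracket g g' | g g'. True}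
      \<union> {commutator (sl2_var g) (V_var v) - sl2_act g v | g v. True} \<subseteq> (smash_ideal :: 'a falg set)"
    unfolding smash_ideal_def by (rule ring.genideal_self[OF ring_free_ring]) simp
  then show "commutator (sl2_var g) (sl2_var g') - sl2_bracket g g' \<in> J z"
    "commutator (sl2_var g) (V_var v) - sl2_act g v \<in> J z"
    by (auto intro!: smash_ideal_J)
  show "commutator (V_var Vx) (V_var Vy) - eval_Delta z \<in> J z"
    unfolding J_def H_ideal_def using ring.genideal_self'[OF ring_smash in_carrier_smash] by blast
qed

text \<open>The kernel of the homomorphism is an ideal of the free algebra containing the smash
  relations, so its image in the smash product is an ideal. That image contains the generator of
  \<open>H_ideal z\<close>, hence all of \<open>H_ideal z\<close>.\<close>

lemma hom_J:
  assumes "HZ scal z (g (Inl E)) (g (Inl F)) (g (Inl H)) (g (Inr Vx)) (g (Inr Vy))" "a \<in> J z"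
  shows "sc.free_hom g a = 0"
proof -
  interpret g: HZ scal z "g (Inl E)" "g (Inl F)" "g (Inl H)" "g (Inr Vx)" "g (Inr Vy)" by fact
  let ?h = "sc.free_hom g" and ?K = "{a. sc.free_hom g a = 0}"
  note hom = sc.free_hom_mult sc.free_hom_diff sc.free_hom_minus sc.free_hom_add
  have r1: "?h (commutator (sl2_var u) (sl2_var v) - sl2_bracket u v) = 0" for u v
    by (cases u; cases v; simp add: commutator_def hom g.ef g.he g.hf scal_numeral)
  have r2: "?h (commutator (sl2_var u) (V_var v) - sl2_act u v) = 0" for u v
    by (cases u; cases v; simp add: commutator_def hom g.ex g.ey g.fx g.fy g.hx g.hy)
  have r3: "?h (commutator (V_var Vx) (V_var Vy) - eval_Delta z) = 0"
    by (simp add: commutator_def hom g.yx eval_Delta_peval sc.free_hom_peval Delta_def sc.free_hom_power power2_eq_square scal_numeral)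
  have I: "ideal ?K free_ring"
  proof (rule idealI[OF ring_free_ring])
    interpret ring "free_ring :: 'a falg ring" by (rule ring_free_ring)
    have "\<ominus>\<^bsub>free_ring\<^esub> a = - a" for a :: "'a falg"
      using minus_equality[of "- a" a] by simp
    then show "subgroup ?K (add_monoid free_ring)"
      by (intro add.subgroupI) (auto simp: hom a_inv_def[symmetric] intro: exI[of _ 0])
  qed (auto simp: hom)
  have s: "smash_ideal \<subseteq> ?K"
    unfolding smash_ideal_def by (rule ring.genideal_minimal[OF ring_free_ring I]) (auto simp: r1 r2)
  have "ideal (smash_class ` ?K) smash"
    using ring.ring_ideal_imp_quot_ideal[OF ring_free_ring ideal_smash_ideal I]
    unfolding smash_class_def[abs_def] smash_def .
  then have "H_ideal z \<subseteq> smash_class ` ?K"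
    unfolding H_ideal_def by (rule ring.genideal_minimal[OF ring_smash]) (auto simp: r3)
  then obtain b where "smash_class a = smash_class b" "?h b = 0" using assms(2) unfolding J_def by blast
  then have "a - b \<in> ?K" "?h b = 0" using s by (auto simp: smash_class_eq)
  then show ?thesis by (simp add: hom)
qed

lemma J_subset_ker: "a \<in> J z \<Longrightarrow> rep z a = 0"
  unfolding rep_def by (rule hom_J) (simp_all add: HZ_ops)

subsection \<open>The PBW theorem\<close>

abbreviation "ve \<equiv> sl2_var E"
abbreviation "vf \<equiv> sl2_var F"
abbreviation "vh \<equiv> sl2_var H"
abbreviation "vx \<equiv> V_var Vx"
abbreviation "vy \<equiv> V_var Vy"

definition pbw_word :: "key \<Rightarrow> 'k::comm_ring_1 poly \<Rightarrow> 'k falg"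
  where "pbw_word = (\<lambda>(i,j,a,c) p. vx ^ i * (vy ^ j * (vf ^ a * (fa.peval vh p * ve ^ c))))"

definition pbw_falg :: "'k::comm_ring_1 pbw \<Rightarrow> 'k falg"
  where "pbw_falg m = (\<Sum>k\<in>keys m. pbw_word k (lookup m k))"

lemma pbw_word_add: "pbw_word k ((p :: 'a::comm_ring_1 poly) + q) = pbw_word k p + pbw_word k q"
  and pbw_word_smult: "pbw_word k (smult c (p :: 'a poly)) = scalar c * pbw_word k p"
  and pbw_word_0 [simp]: "pbw_word k (0 :: 'a poly) = 0"
proof -
  show "pbw_word k (p + q) = pbw_word k p + pbw_word k q"
    by (auto simp: pbw_word_def fa.peval_add distrib_left distrib_right split: prod.split)
  have "u * (scalar c * v) = scalar c * (u * v)" for u v :: "'a falg" by (rule fa.\<iota>_left_comm)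
  then show "pbw_word k (smult c p) = scalar c * pbw_word k p"
    by (cases k) (simp add: pbw_word_def fa.peval_smult mult.assoc)
qed (auto simp: pbw_word_def split: prod.split)

lemma pbw_falg_superset:
  "finite A \<Longrightarrow> keys m \<subseteq> A \<Longrightarrow> pbw_falg m = (\<Sum>k\<in>A. pbw_word k (lookup m k))"
  unfolding pbw_falg_def by (intro sum.mono_neutral_left) (auto simp: in_keys_iff)

lemma pbw_falg_single [simp]: "pbw_falg (single k p) = pbw_word k p"
  by (simp add: pbw_falg_def)

lemma pbw_falg_0 [simp]: "pbw_falg 0 = 0"
  by (simp add: pbw_falg_def)

lemma pbw_falg_add: "pbw_falg (u + v) = pbw_falg u + pbw_falg v"
  using keys_add[of u v]
  by (simp add: pbw_falg_superset[where A = "keys u \<union> keys v"] lookup_add pbw_word_add sum.distrib)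

lemma pbw_falg_smul: "pbw_falg (smul c u) = scalar c * pbw_falg u"
  by (simp add: pbw_falg_superset[where A = "keys u"] keys_smul pbw_word_smult sum_distrib_left)

definition unit_vec :: "'k::field pbw" where "unit_vec = single (0,0,0,0) 1"

lemma Eop_power_unit: "app (Eop z ^ c) unit_vec = single (0,0,0,c) 1"
  by (induction c) (auto simp: app_times unit_vec_def EFY_single U_e_def pcompose_1)

lemma app_peval_Hop: "app (sc.peval Hop p) (single (0,0,0,c) q) = single (0,0,0,c) (p * q)"
  by (induction p) (auto simp: sc.peval_pCons app_plus app_times Hop_single single_add[symmetric])

lemma Fop_power: "app (Fop z ^ a) (single (0,0,0,c) q) = single (0,0,a,c) q"
  by (induction a) (auto simp: app_times EFY_single)

lemma Yop_power: "app (Yop z ^ j) (single (0,0,a,c) q) = single (0,j,a,c) q"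
  by (induction j) (auto simp: app_times EFY_single)

lemma Xop_power: "app (Xop ^ i) (single (i',j,a,c) q) = single (i + i',j,a,c) q"
  by (induction i) (auto simp: app_times)

lemma rep_pbw_word_unit: "app (rep z (pbw_word k p)) unit_vec = single k p"
  by (cases k) (simp add: pbw_word_def app_times Eop_power_unit app_peval_Hop Fop_power Yop_power Xop_power)

text \<open>Linear independence of the PBW monomials: applying a combination of them to the vector
  representing 1 gives back its coefficients.\<close>

lemma rep_pbw_unit: "app (rep z (pbw_falg m)) unit_vec = m"
  unfolding pbw_falg_def rep_sum app_sum_left rep_pbw_word_unit by (rule pbw_sum[symmetric])

section \<open>Spanning by PBW monomials\<close>

lemma eq_mod_J_trans: "a - b \<in> J z \<Longrightarrow> b - c \<in> J z \<Longrightarrow> a - c \<in> J z"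
  using J_closed(2)[of "a - b" z "b - c"] by simp

definition spanned :: "'k::field poly \<Rightarrow> nat \<Rightarrow> 'k falg set"
  where "spanned z n = {a. \<exists>m\<in>below n. a - pbw_falg m \<in> J z}"

lemma spanned_pbw: "m \<in> below n \<Longrightarrow> pbw_falg m \<in> spanned z n"
  unfolding spanned_def by (auto intro!: bexI[of _ m] J_closed)

lemma spanned_cong: "a - b \<in> J z \<Longrightarrow> b \<in> spanned z n \<Longrightarrow> a \<in> spanned z n"
  unfolding spanned_def using eq_mod_J_trans by blast

lemma spanned_J: "a \<in> J z \<Longrightarrow> a \<in> spanned z n"
  unfolding spanned_def by (auto intro!: bexI[of _ 0])

lemma spanned_add: "a \<in> spanned z n \<Longrightarrow> b \<in> spanned z n \<Longrightarrow> a + b \<in> spanned z n"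
proof -
  assume "a \<in> spanned z n" "b \<in> spanned z n"
  then obtain u v where u: "u \<in> below n" "a - pbw_falg u \<in> J z" and v: "v \<in> below n" "b - pbw_falg v \<in> J z"
    by (auto simp: spanned_def)
  have "(a + b) - pbw_falg (u + v) = (a - pbw_falg u) + (b - pbw_falg v)" by (simp add: pbw_falg_add)
  with J_closed(2)[OF u(2) v(2)] have "(a + b) - pbw_falg (u + v) \<in> J z" by (simp only:)
  then show ?thesis
    unfolding spanned_def using u v below_add by blast
qed

lemma spanned_scalar: "a \<in> spanned z n \<Longrightarrow> scalar c * a \<in> spanned z n"
proof -
  assume "a \<in> spanned z n"
  then obtain u where u: "u \<in> below n" "a - pbw_falg u \<in> J z" by (auto simp: spanned_def)
  have "scalar c * a - pbw_falg (smul c u) = scalar c * (a - pbw_falg u)"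
    by (simp add: pbw_falg_smul right_diff_distrib)
  with J_closed(3)[OF u(2)] have "scalar c * a - pbw_falg (smul c u) \<in> J z" by (simp only:)
  then show ?thesis
    unfolding spanned_def using u below_smul by blast
qed

lemma spanned_minus: "a \<in> spanned z n \<Longrightarrow> - a \<in> spanned z n"
  using spanned_scalar[of a z n "- 1"] by (simp add: fa.\<iota>_minus fa.\<iota>_1)

lemma spanned_diff: "a \<in> spanned z n \<Longrightarrow> b \<in> spanned z n \<Longrightarrow> a - b \<in> spanned z n"
  using spanned_add[OF _ spanned_minus, of a z n b] by simp

lemma spanned_mono: "a \<in> spanned z n \<Longrightarrow> n \<le> n' \<Longrightarrow> a \<in> spanned z n'"
  unfolding spanned_def using below_mono by blast

lemma spanned_numeral: "a \<in> spanned z n \<Longrightarrow> numeral k * a \<in> spanned z n"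
  using spanned_scalar[of a z n "numeral k"] by (simp add: fa.\<iota>_numeral)

lemma spanned_lmult:
  assumes "\<And>i j a c p. i + j < n \<Longrightarrow> g * pbw_word (i,j,a,c) p \<in> spanned z n'" and "s \<in> spanned z n"
  shows "g * s \<in> spanned z n'"
proof -
  obtain m where m: "m \<in> below n" "s - pbw_falg m \<in> J z" using assms(2) by (auto simp: spanned_def)
  from m(1) have "g * pbw_falg m \<in> spanned z n'"
    by (induction rule: below_induct)
      (auto simp: assms(1) pbw_falg_add distrib_left spanned_add spanned_J J_closed)
  moreover have "g * s - g * pbw_falg m \<in> J z"
    using J_closed(3)[OF m(2), of g] by (simp add: right_diff_distrib)
  ultimately show ?thesis using spanned_cong by blast
qed

lemma pbw_word_Suc:
  "vx * pbw_word (i,j,a,c) p = pbw_word (Suc i,j,a,c) p"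
  "vy * pbw_word (0,j,a,c) p = pbw_word (0,Suc j,a,c) p"
  "vf * pbw_word (0,0,a,c) p = pbw_word (0,0,Suc a,c) p"
  by (simp_all add: pbw_word_def mult.assoc)

lemma pbw_word_spanned: "i + j < n \<Longrightarrow> pbw_word (i,j,a,c) p \<in> spanned z n"
  using spanned_pbw[of "single (i,j,a,c) p" n z] by simp

lemma rel_J:
  "ve * vf - (vf * ve + vh) \<in> J z" "vh * ve - (ve * vh + 2 * ve) \<in> J z" "vh * vf - (vf * vh - 2 * vf) \<in> J z"
  "ve * vx - vx * ve \<in> J z" "ve * vy - (vy * ve + vx) \<in> J z" "vf * vx - (vx * vf + vy) \<in> J z" "vf * vy - vy * vf \<in> J z"
  "vh * vx - (vx * vh + vx) \<in> J z" "vh * vy - (vy * vh - vy) \<in> J z" "vy * vx - (vx * vy - eval_Delta z) \<in> J z"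
  using relations_J(1)[of E F z] relations_J(1)[of H E z] relations_J(1)[of H F z]
    relations_J(2)[of E Vx z] relations_J(2)[of E Vy z] relations_J(2)[of F Vx z] relations_J(2)[of F Vy z]
    relations_J(2)[of H Vx z] relations_J(2)[of H Vy z] J_minus[OF relations_J(3)[of z]]
  by (simp_all add: commutator_def fa.\<iota>_numeral algebra_simps)

lemma spanned_rel:
  assumes "g - g' \<in> J z" "g' * s \<in> spanned z n"
  shows "g * s \<in> spanned z n"
  using J_closed(4)[OF assms(1), of s] assms(2) by (auto intro: spanned_cong simp: left_diff_distrib)

text \<open>The case of U(sl2). The letters h and e are moved past f by induction on the exponent of
  f, and e past p(h) by induction on the polynomial p.\<close>

lemma U_spanned:
  "vh * pbw_word (0,0,a,c) p \<in> spanned z (Suc 0)" "ve * pbw_word (0,0,a,c) p \<in> spanned z (Suc 0)"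
proof -
  have f: "vf * s \<in> {b. \<exists>m\<in>U. b - pbw_falg m \<in> J z}"
    if "s \<in> {b. \<exists>m\<in>U. b - pbw_falg m \<in> J z}" "\<And>m. m \<in> U \<Longrightarrow> app (Fop z) m \<in> U \<and> vf * pbw_falg m = pbw_falg (app (Fop z) m)"
    for s U
    using that J_closed(3)[of "s - pbw_falg _" z vf] by (fastforce simp: right_diff_distrib)
  have F: "m \<in> below (Suc 0) \<Longrightarrow> vf * pbw_falg m = pbw_falg (app (Fop z) m)" for m
    by (induction rule: below_induct) (auto simp: pbw_word_Suc EFY_single pbw_falg_add app_add_right distrib_left)
  have f: "vf * s \<in> spanned z (Suc 0)" if "s \<in> spanned z (Suc 0)" for s
    using f[of s "below (Suc 0)"] that F F_below unfolding spanned_def by blast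
  have U0: "pbw_word (0,0,0,c) p = fa.peval vh p * ve ^ c" for p :: "'a poly" and c
    by (simp add: pbw_word_def)
  show H: "vh * pbw_word (0,0,a,c) p \<in> spanned z (Suc 0)" for a c p
  proof (induction a)
    case 0
    have "vh * pbw_word (0,0,0,c) p = pbw_word (0,0,0,c) (pCons 0 p)"
      by (simp add: U0 fa.peval_pCons fa.\<iota>_0 mult.assoc)
    then show ?case by (simp add: pbw_word_spanned)
  next
    case (Suc a)
    have "(vh * vf) * pbw_word (0,0,a,c) p \<in> spanned z (Suc 0)"
      by (rule spanned_rel[OF rel_J(3)])
        (simp add: left_diff_distrib mult.assoc spanned_diff spanned_numeral f Suc pbw_word_spanned)
    then show ?case by (simp add: mult.assoc pbw_word_Suc)
  qed
  have h: "vh * s \<in> spanned z (Suc 0)" if "s \<in> spanned z (Suc 0)" for s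
    by (rule spanned_lmult[OF _ that]) (use H in simp)
  show "ve * pbw_word (0,0,a,c) p \<in> spanned z (Suc 0)"
  proof (induction a)
    case 0
    show ?case
    proof (induction p)
      case (pCons b p)
      have "(ve * vh) * pbw_word (0,0,0,c) p \<in> spanned z (Suc 0)"
      proof (rule spanned_rel[where g' = "vh * ve - 2 * ve"])
        show "ve * vh - (vh * ve - 2 * ve) \<in> J z" using J_minus[OF rel_J(2)[of z]] by (simp add: algebra_simps)
      qed (simp add: left_diff_distrib mult.assoc spanned_diff spanned_numeral h pCons)
      moreover have "ve * (scalar b * ve ^ c) = scalar b * pbw_word (0,0,0,Suc c) 1"
        by (simp add: U0 fa.\<iota>_left_comm[of ve])
      then have "ve * (scalar b * ve ^ c) \<in> spanned z (Suc 0)"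
        by (simp add: spanned_scalar pbw_word_spanned)
      moreover have "ve * pbw_word (0,0,0,c) (pCons b p) = ve * (scalar b * ve ^ c) + (ve * vh) * pbw_word (0,0,0,c) p"
        by (simp add: U0 fa.peval_pCons distrib_left distrib_right mult.assoc)
      ultimately show ?case by (simp only: spanned_add)
    qed (simp add: spanned_J J_closed)
  next
    case (Suc a)
    have "(ve * vf) * pbw_word (0,0,a,c) p \<in> spanned z (Suc 0)"
      by (rule spanned_rel[OF rel_J(1)]) (simp add: distrib_right mult.assoc spanned_add f Suc H)
    then show ?case by (simp add: mult.assoc pbw_word_Suc)
  qed
qed

text \<open>The claim is about all spanned elements and not only monomials, because e (y s) leads to
  y (e s) with e s an arbitrary element of the same degree.\<close>

lemma spanned_ops:
  "s \<in> spanned z n \<Longrightarrow> ve * s \<in> spanned z n \<and> vf * s \<in> spanned z n \<and> vh * s \<in> spanned z n \<and> vy * s \<in> spanned z (Suc n)"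
proof (induction n arbitrary: s)
  case 0
  then have "s \<in> J z" by (auto simp: spanned_def dest: below_zero_eq)
  then show ?case by (simp add: spanned_J J_closed)
next
  case (Suc n)
  have x: "vx * s \<in> spanned z (Suc k)" if "s \<in> spanned z k" for s k
    by (rule spanned_lmult[OF _ that]) (simp add: pbw_word_Suc pbw_word_spanned)
  have D: "Delta * s \<in> spanned z n" if "s \<in> spanned z n" for s
    unfolding Delta_def power2_eq_square using Suc.IH that
    by (simp add: distrib_right left_diff_distrib mult.assoc spanned_add spanned_diff spanned_scalar)
  have Z: "eval_Delta z * s \<in> spanned z n" if "s \<in> spanned z n" for s
  proof -
    have "fa.peval Delta q * s \<in> spanned z n" for q
      by (induction q) (simp_all add: fa.peval_pCons distrib_right mult.assoc spanned_add spanned_scalar D that spanned_J J_closed)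
    then show ?thesis by (simp add: eval_Delta_peval)
  qed
  have *: "ve * pbw_word (i,j,a,c) p \<in> spanned z (Suc n) \<and> vf * pbw_word (i,j,a,c) p \<in> spanned z (Suc n)
    \<and> vh * pbw_word (i,j,a,c) p \<in> spanned z (Suc n) \<and> vy * pbw_word (i,j,a,c) p \<in> spanned z (Suc (Suc n))"
    if ij: "i + j < Suc n" for i j a c p
  proof -
    consider (x) i' where "i = Suc i'" | (y) j' where "i = 0" "j = Suc j'" | (u) "i = 0" "j = 0"
      by (cases i; cases j) auto
    then show ?thesis
    proof cases
      case (x i')
      define s where "s = pbw_word (i',j,a,c) p"
      have s: "s \<in> spanned z n" using ij x by (simp add: s_def pbw_word_spanned)
      note IH = Suc.IH[OF s]
      have "(ve * vx) * s \<in> spanned z (Suc n)"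
        by (rule spanned_rel[OF rel_J(4)]) (use IH in \<open>simp add: mult.assoc \<open>\<And>s k. s \<in> spanned z k \<Longrightarrow> vx * s \<in> spanned z (Suc k)\<close>\<close>)
      moreover have "(vf * vx) * s \<in> spanned z (Suc n)"
        by (rule spanned_rel[OF rel_J(6)]) (use IH in \<open>simp add: mult.assoc distrib_right spanned_add \<open>\<And>s k. s \<in> spanned z k \<Longrightarrow> vx * s \<in> spanned z (Suc k)\<close>\<close>)
      moreover have "(vh * vx) * s \<in> spanned z (Suc n)"
        by (rule spanned_rel[OF rel_J(8)]) (use IH s in \<open>simp add: mult.assoc distrib_right spanned_add \<open>\<And>s k. s \<in> spanned z k \<Longrightarrow> vx * s \<in> spanned z (Suc k)\<close>\<close>)
      moreover have "(vy * vx) * s \<in> spanned z (Suc (Suc n))"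
        by (rule spanned_rel[OF rel_J(10)]) (use IH Z[OF s] spanned_mono[of _ z n "Suc (Suc n)"] in
            \<open>simp add: mult.assoc left_diff_distrib spanned_diff \<open>\<And>s k. s \<in> spanned z k \<Longrightarrow> vx * s \<in> spanned z (Suc k)\<close>\<close>)
      ultimately show ?thesis by (simp add: x s_def mult.assoc pbw_word_Suc)
    next
      case (y j')
      define s where "s = pbw_word (0,j',a,c) p"
      have s: "s \<in> spanned z n" using ij y by (simp add: s_def pbw_word_spanned)
      note IH = Suc.IH[OF s]
      have "(ve * vy) * s \<in> spanned z (Suc n)"
        by (rule spanned_rel[OF rel_J(5)]) (use IH Suc.IH[of "ve * s"] s in \<open>simp add: mult.assoc distrib_right spanned_add x\<close>)
      moreover have "(vf * vy) * s \<in> spanned z (Suc n)"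
        by (rule spanned_rel[OF rel_J(7)]) (use IH Suc.IH[of "vf * s"] in \<open>simp add: mult.assoc\<close>)
      moreover have "(vh * vy) * s \<in> spanned z (Suc n)"
        by (rule spanned_rel[OF rel_J(9)]) (use IH Suc.IH[of "vh * s"] in \<open>simp add: mult.assoc left_diff_distrib spanned_diff\<close>)
      moreover have "vy * (vy * s) \<in> spanned z (Suc (Suc n))"
        using ij by (simp add: s_def pbw_word_Suc pbw_word_spanned y)
      ultimately show ?thesis by (simp add: y s_def mult.assoc pbw_word_Suc)
    next
      case u
      then show ?thesis
        using U_spanned[of a c p z] spanned_mono[of _ z "Suc 0" "Suc n"] by (simp add: pbw_word_Suc pbw_word_spanned)
    qed
  qed
  show ?case
    using spanned_lmult[OF _ Suc.prems] * by blast
qed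

lemma spanned_word: "single (Word ws) c \<in> spanned z (Suc (V_degree (Word ws)))"
proof (induction ws)
  case Nil
  have "single (Word []) c = scalar c * pbw_word (0,0,0,0) 1"
    by (simp add: pbw_word_def scalar_def zero_word_def)
  then show ?case by (simp add: spanned_scalar pbw_word_spanned)
next
  case (Cons g ws)
  have x: "vx * s \<in> spanned z (Suc k)" if "s \<in> spanned z k" for s k
    by (rule spanned_lmult[OF _ that]) (simp add: pbw_word_Suc pbw_word_spanned)
  show ?case
  proof (cases g)
    case (Inl b)
    then show ?thesis
      using spanned_ops[OF Cons] by (cases b) (auto simp: single_Cons V_degree_def)
  next
    case (Inr b)
    then show ?thesis
      using spanned_ops[OF Cons] x[OF Cons] by (cases b) (auto simp: single_Cons V_degree_def)
  qed
qed

lemma falg_spanned: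
  assumes "\<forall>w\<in>keys a. V_degree w < n" shows "a \<in> spanned z n"
proof -
  have "(\<Sum>w\<in>W. single w (lookup a w)) \<in> spanned z n" if "finite W" "W \<subseteq> keys a" for W
    using that
  proof (induction W)
    case (insert w W)
    have "single w (lookup a w) \<in> spanned z n"
      using spanned_mono[OF spanned_word[of "letters w" _ z]] assms insert by (cases w) auto
    with insert show ?case by (simp add: spanned_add)
  qed (simp add: spanned_J J_closed)
  from this[of "keys a"] show ?thesis using falg_sum[of a] by simp
qed

text \<open>The coordinates of an element of H_z in the PBW basis, read off by letting it act on the
  vector of 1.\<close>

definition nf :: "'k::field poly \<Rightarrow> 'k falg \<Rightarrow> 'k pbw" where "nf z a = app (rep z a) unit_vec"

lemma nf_add: "nf z (a + b) = nf z a + nf z b"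
  and nf_diff: "nf z (a - b) = nf z a - nf z b"
  and nf_scalar: "nf z (scalar c * a) = smul c (nf z a)"
  and nf_pbw [simp]: "nf z (pbw_falg m) = m"
  and nf_mult: "nf z (a * b) = app (rep z a) (nf z b)"
  and nf_0 [simp]: "nf z 0 = 0"
  by (simp_all add: nf_def app_plus app_minus app_times rep_pbw_unit)

lemma nf_J: "a \<in> J z \<Longrightarrow> nf z a = 0"
  using J_subset_ker[of a z] by (auto simp: nf_def)

lemma nf_below:
  assumes "\<forall>w\<in>keys a. V_degree w < n" shows "nf z a \<in> below n" "a - pbw_falg (nf z a) \<in> J z"
proof -
  obtain m where m: "m \<in> below n" "a - pbw_falg m \<in> J z"
    using falg_spanned[OF assms, of z] by (auto simp: spanned_def)
  with nf_J[OF m(2)] show "nf z a \<in> below n" "a - pbw_falg (nf z a) \<in> J z" by (simp_all add: nf_diff)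
qed

lemma falg_V_bound: "\<exists>n. \<forall>w\<in>keys a. V_degree w < n"
proof
  show "\<forall>w\<in>keys a. V_degree w < Suc (Max (insert 0 (V_degree ` keys a)))"
    by (auto simp: less_Suc_eq_le intro!: Max_ge)
qed

lemma nf_cong: "a - pbw_falg (nf z a) \<in> J z"
  using falg_V_bound[of a] nf_below by blast

lemma nf_eq_0_iff: "nf z a = 0 \<longleftrightarrow> a \<in> J z"
  using nf_J nf_cong[of a z] by auto

text \<open>Faithfulness: identities in H_z may be checked as identities of operators.\<close>

lemma rep_eq_0_iff: "rep z a = 0 \<longleftrightarrow> a \<in> J z"
  using J_subset_ker[of a z] nf_eq_0_iff[of z a] by (auto simp: nf_def)

lemma H_class_eq_nf: "H_class z a = H_class z b \<longleftrightarrow> nf z a = nf z b"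
  using nf_eq_0_iff[of z "a - b"] by (simp add: H_class_eq nf_diff)

lemma H_class_eq_rep: "H_class z a = H_class z b \<longleftrightarrow> rep z a = rep z b"
  using rep_eq_0_iff[of z "a - b"] by (simp add: H_class_eq)

section \<open>Homogeneous elements of the free algebra\<close>

definition homog :: "nat \<Rightarrow> 'k::comm_ring_1 falg set"
  where "homog n = {a. \<forall>w\<in>keys a. V_degree w = n}"

lemma homog_0 [simp]: "0 \<in> homog n"
  by (simp add: homog_def)

lemma homog_add: "a \<in> homog n \<Longrightarrow> b \<in> homog n \<Longrightarrow> a + b \<in> homog n"
  using keys_add[of a b] by (auto simp: homog_def)

lemma homog_minus: "a \<in> homog n \<Longrightarrow> - a \<in> homog n"
  by (auto simp: homog_def in_keys_iff)

lemma homog_diff: "a \<in> homog n \<Longrightarrow> b \<in> homog n \<Longrightarrow> a - b \<in> homog n"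
  using homog_add[OF _ homog_minus, of a n b] by simp

lemma V_degree_plus: "V_degree (u + v) = V_degree u + V_degree v"
  by (simp add: V_degree_def plus_word_def)

lemma homog_mult: "a \<in> homog m \<Longrightarrow> b \<in> homog n \<Longrightarrow> a * b \<in> homog (m + n)"
  using keys_mult[of a b] by (fastforce simp: homog_def V_degree_plus)

lemma homog_scalar: "scalar c \<in> homog 0"
  by (auto simp: homog_def scalar_def V_degree_def zero_word_def)

lemma homog_var: "sl2_var g \<in> homog 0" "V_var v \<in> homog 1"
  by (auto simp: homog_def var_def V_degree_def)

lemma homog_1: "1 \<in> homog 0"
  using homog_scalar[of 1] by (simp add: fa.\<iota>_1)

lemma homog_power: "a \<in> homog n \<Longrightarrow> a ^ k \<in> homog (k * n)"
  by (induction k) (auto intro: homog_mult homog_1)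

lemma homog_peval: "d \<in> homog 0 \<Longrightarrow> fa.peval d q \<in> homog 0"
  by (induction q) (auto simp: fa.peval_pCons intro!: homog_add homog_scalar homog_mult[of _ 0 _ 0, simplified])

lemma homog_pbw_word: "pbw_word (i,j,a,c) p \<in> homog (i + j)"
proof -
  have "vy ^ j * (vf ^ a * (fa.peval vh p * ve ^ c)) \<in> homog (j * 1 + (a * 0 + (0 + c * 0)))"
    by (intro homog_mult homog_power homog_peval homog_var)
  from homog_mult[OF homog_power[OF homog_var(2)[of Vx], of i] this] show ?thesis
    by (simp add: pbw_word_def)
qed

lemma keys_pbw_falg: "w \<in> keys (pbw_falg m) \<Longrightarrow> \<exists>k\<in>keys m. V_degree w = vdeg k"
proof -
  assume "w \<in> keys (pbw_falg m)"
  then obtain k where "k \<in> keys m" "w \<in> keys (pbw_word k (lookup m k))"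
    using keys_sum[of "\<lambda>k. pbw_word k (lookup m k)" "keys m"] by (auto simp: pbw_falg_def)
  with homog_pbw_word show ?thesis by (cases k) (force simp: homog_def)
qed

section \<open>A difference equation in characteristic \<open>p\<close>\<close>

text \<open>At X = c^2 this is the product of (c - i)(c + i), a run of linear factors with a gap at
  0. The shift by 1 in c therefore changes only the factors at the ends and around the gap. There is
  one monic polynomial in each degree, so any w can be reduced by them.\<close>

definition casimir_poly :: "nat \<Rightarrow> 'k::field poly" where "casimir_poly d = (\<Prod>i=1..d. [:- (of_nat i)\<^sup>2, 1:])"

lemma casimir_poly_Suc: "casimir_poly (Suc d) = casimir_poly d * [:- (of_nat (Suc d))\<^sup>2, 1:]"
  by (simp add: casimir_poly_def)

lemma casimir_poly_coeff:
  fixes d :: nat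
  defines "P \<equiv> (casimir_poly :: nat \<Rightarrow> 'a::field poly)"
  shows "coeff (P d) d = 1 \<and> (\<forall>i>d. coeff (P d) i = 0)"
proof (induction d)
  case (Suc d)
  note IH = this
  have "coeff (P (Suc d)) (Suc i) = - (of_nat (Suc d))\<^sup>2 * coeff (P d) (Suc i) + coeff (P d) i"
    for i unfolding P_def casimir_poly_Suc by (simp add: mult.commute[of "P d"])
  note eq = this
  have "coeff (P (Suc d)) i = 0" if "i > Suc d" for i
  proof (cases i)
    case (Suc i')
    then have "d < i'" "d < Suc i'" using that by auto
    with IH have "coeff (P d) i' = (0 :: 'a)" "coeff (P d) (Suc i') = (0 :: 'a)"
      by simp_all
    then show ?thesis unfolding Suc eq by simp
  qed (use that in simp)
  moreover have "coeff (P (Suc d)) (Suc d) = 1"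
    using Suc unfolding eq by simp
  ultimately show ?case by blast
qed (simp add: P_def casimir_poly_def)

definition "sqr = [:0, 0, 1:]"
definition "sqr1 = [:1, 2, 1:]"

lemma casimir_poly_shift:
  "[:1, 1:] * [:- of_nat d, 1:] * pcompose (casimir_poly d) sqr1
    = [:0, 1:] * [:of_nat d + 1, 1:] * pcompose (casimir_poly d) (sqr :: 'k::field poly)"
proof (induction d)
  case 0
  show ?case by (simp add: casimir_poly_def pcompose_1)
next
  case (Suc d)
  let ?A = "pcompose (casimir_poly d) (sqr :: 'k poly)" and ?B = "pcompose (casimir_poly d) (sqr1 :: 'k poly)"
  have A: "pcompose (casimir_poly (Suc d)) sqr = ?A * ([:- of_nat (Suc d), 1:] * [:of_nat (Suc d), 1:])"
  proof -
    have "pcompose [:- (of_nat (Suc d))\<^sup>2, 1:] sqr = [:- of_nat (Suc d), 1:] * [:of_nat (Suc d), 1 :: 'k:]"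
      by (simp add: pcompose_pCons sqr_def power2_eq_square del: of_nat_Suc)
    then show ?thesis by (simp only: casimir_poly_Suc pcompose_mult)
  qed
  have B: "pcompose (casimir_poly (Suc d)) sqr1 = ?B * ([:- of_nat d, 1:] * [:of_nat (Suc d) + 1, 1:])"
  proof -
    have "pcompose [:- (of_nat (Suc d))\<^sup>2, 1:] sqr1 = [:- of_nat d, 1:] * [:of_nat (Suc d) + 1, 1 :: 'k:]"
      by (simp add: pcompose_pCons sqr1_def power2_eq_square) (simp add: algebra_simps)
    then show ?thesis by (simp only: casimir_poly_Suc pcompose_mult)
  qed
  have "[:1, 1:] * [:- of_nat (Suc d), 1:] * pcompose (casimir_poly (Suc d)) sqr1
    = [:- of_nat (Suc d), 1:] * [:of_nat (Suc d) + 1, 1:] * ([:1, 1:] * [:- of_nat d, 1:] * ?B)"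
    unfolding B by (simp only: mult_ac)
  also have "\<dots> = [:- of_nat (Suc d), 1:] * [:of_nat (Suc d) + 1, 1:] * ([:0, 1:] * [:of_nat (Suc d), 1:] * ?A)"
    unfolding Suc by (simp add: add.commute)
  also have "\<dots> = [:0, 1:] * [:of_nat (Suc d) + 1, 1:] * pcompose (casimir_poly (Suc d)) sqr"
    unfolding A by (simp only: mult_ac)
  finally show ?case .
qed

text \<open>Equivalently, 2 r(c^2) + c w(c^2) is invariant under c \<mapsto> -1 - c. Both forms are
  used: this one makes the quadratic element commute with x, the symmetric one makes the continuant
  odd.\<close>

definition antidifference :: "'k::field poly \<Rightarrow> 'k poly \<Rightarrow> bool"
  where "antidifference w r \<longleftrightarrow>
    2 * (pcompose r sqr1 - pcompose r sqr) = [:0, 1:] * pcompose w sqr + [:1, 1:] * pcompose w sqr1"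

lemma antidifference_casimir_poly:
  assumes "(2 :: 'k::field) \<noteq> 0" "(of_nat (Suc d) :: 'k) \<noteq> 0"
  shows "antidifference (casimir_poly d) (smult (1 / (2 * of_nat (Suc d))) ([:0, 1:] * casimir_poly d :: 'k poly))"
proof -
  let ?A = "pcompose (casimir_poly d) (sqr :: 'k poly)" and ?B = "pcompose (casimir_poly d) (sqr1 :: 'k poly)"
  let ?c = "[:0, 1:] :: 'k poly" and ?n = "[:of_nat (Suc d):] :: 'k poly"
  have e: "[:1, 1:] = 1 + ?c" "[:- of_nat d, 1:] = ?c - ?n + 1" "[:of_nat d + 1, 1:] = ?c + ?n"
    "sqr1 = (1 + ?c) * (1 + ?c)" "sqr = ?c * ?c"
    by (simp_all add: one_pCons sqr1_def sqr_def)
  have *: "(1 + ?c) * (1 + ?c) * ?B - ?c * ?c * ?A = ?n * (?c * ?A + (1 + ?c) * ?B)"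
  proof -
    \<comment> \<open>With n = d + 1 the right side is the difference of the two sides of
      \<open>casimir_poly_shift\<close>, hence zero.\<close>
    have "(1 + c) * (1 + c) * B - c * c * A - n * (c * A + (1 + c) * B) = (1 + c) * (c - n + 1) * B - c * (c + n) * A"
      for A B c n :: "'k poly" by (simp add: algebra_simps)
    from this[of ?c ?B ?A ?n] show ?thesis
      using casimir_poly_shift[of d, where 'k='k] unfolding e(1-3) by simp
  qed
  have "pcompose (?c * casimir_poly d) sqr1 - pcompose (?c * casimir_poly d) sqr
    = (1 + ?c) * (1 + ?c) * ?B - ?c * ?c * ?A"
    by (simp add: pcompose_mult pcompose_pCons e(4,5))
  also note *
  also have "?n * q = smult (of_nat (Suc d)) q" for q by simp
  finally have eq: "pcompose (?c * casimir_poly d) sqr1 - pcompose (?c * casimir_poly d) sqr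
    = smult (of_nat (Suc d)) (?c * ?A + (1 + ?c) * ?B)" .
  have "2 * q = smult 2 q" for q :: "'k poly" by (simp add: numeral_poly)
  then have "2 * smult (1 / (2 * of_nat (Suc d))) (pcompose (?c * casimir_poly d) sqr1 - pcompose (?c * casimir_poly d) sqr)
     = smult (2 * (1 / (2 * of_nat (Suc d))) * of_nat (Suc d)) (?c * ?A + (1 + ?c) * ?B)"
    unfolding eq by (simp only: smult_smult mult.assoc)
  also have "2 * (1 / (2 * of_nat (Suc d))) * of_nat (Suc d) = (1 :: 'k)"
    using assms by (simp del: of_nat_Suc)
  finally show ?thesis
    unfolding antidifference_def e(1) by (simp only: pcompose_smult smult_diff_right smult_1_left)
qed

lemma antidifference_add: "antidifference w r \<Longrightarrow> antidifference w' r' \<Longrightarrow> antidifference (w + w') (r + r')"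
proof -
  have "2 * (a + a' - (b + b')) = 2 * (a - b) + 2 * (a' - b')" for a a' b b' :: "'a poly"
    by (simp add: algebra_simps)
  moreover assume "antidifference w r" "antidifference w' r'"
  ultimately show ?thesis
    unfolding antidifference_def pcompose_add by (simp only: distrib_left add_ac)
qed

lemma antidifference_smult:
  assumes "antidifference w r" shows "antidifference (smult a w) (smult a r)"
proof -
  have "smult a (2 * (pcompose r sqr1 - pcompose r sqr)) = smult a ([:0, 1:] * pcompose w sqr + [:1, 1:] * pcompose w sqr1)"
    using assms by (simp only: antidifference_def)
  then show ?thesis
    unfolding antidifference_def by (simp only: pcompose_smult smult_diff_right[symmetric] mult_smult_right smult_add_right)
qed

text \<open>The leading coefficient of w is removed by a multiple of \<open>casimir_poly\<close>.
  The solution for degree n has denominator 2 (n + 1), and n + 1 < p keeps it invertible; this is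
  the source of the bound on the degree.\<close>

lemma antidifference_exists:
  fixes w :: "'k::field poly"
  assumes "CHAR('k) = p" "p > 2" "degree w < p - 1"
  shows "\<exists>r. antidifference w r"
proof -
  have "\<exists>r. antidifference w r" if "\<forall>i\<ge>n. coeff w i = 0" "n \<le> p - 1" for n and w :: "'k poly"
    using that
  proof (induction n arbitrary: w)
    case 0
    then have "w = 0" by (simp add: poly_eqI)
    then show ?case by (auto simp: antidifference_def intro!: exI[of _ 0])
  next
    case (Suc n)
    define w' where "w' = w - smult (coeff w n) (casimir_poly n)"
    have "\<forall>i\<ge>n. coeff w' i = 0"
    proof safe
      fix i assume "n \<le> i"
      then consider "i = n" | "i > n" by linarith
      then show "coeff w' i = 0"
        using Suc.prems(1) casimir_poly_coeff[of n, where 'a='k] by cases (auto simp: w'_def)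
    qed
    then obtain r where r: "antidifference w' r" using Suc by fastforce
    have ne: "(of_nat m :: 'k) \<noteq> 0" if "0 < m" "m < p" for m
      using that assms(1) by (auto simp: of_nat_eq_0_iff_char_dvd dest: dvd_imp_le)
    have "(2 :: 'k) \<noteq> 0" "(of_nat (Suc n) :: 'k) \<noteq> 0"
      using ne[of 2] ne[of "Suc n"] assms(2) Suc.prems(2) by auto
    from antidifference_add[OF r antidifference_smult[OF antidifference_casimir_poly[OF this]], of "coeff w n"]
    have "\<exists>r. antidifference (w' + smult (coeff w n) (casimir_poly n)) r" by (rule exI)
    then show ?case by (simp only: w'_def diff_add_cancel)
  qed
  from this[of "Suc (degree w)" w] show ?thesis using assms by (simp add: coeff_eq_0)
qed


section \<open>The central element of degree two\<close>

lemma small_numerals: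
  fixes a :: "'a::ring_1"
  shows "2 * a = a + a" "3 * a = a + a + a" "4 * a = a + a + (a + a)" "8 * a = a + a + (a + a) + (a + a + (a + a))"
    "16 * a = 8 * a + 8 * a"
proof -
  have "2 * a = (1 + 1) * a" "3 * a = (1 + 1 + 1) * a" "4 * a = (1 + 1 + (1 + 1)) * a"
    "8 * a = (1 + 1 + (1 + 1) + (1 + 1 + (1 + 1))) * a" "16 * a = (8 + 8) * a" by simp_all
  then show "2 * a = a + a" "3 * a = a + a + a" "4 * a = a + a + (a + a)" "8 * a = a + a + (a + a) + (a + a + (a + a))"
    "16 * a = 8 * a + 8 * a"
    by (simp_all only: distrib_right mult_1_left)
qed

lemma numeral_comm: fixes a :: "'a::ring_1"
  shows "a * numeral n = numeral n * a" "a * (numeral n * b) = numeral n * (a * b)"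
proof -
  have "a * of_nat m = of_nat m * a" for m by (simp add: mult_of_nat_commute)
  from this[of "numeral n"] show *: "a * numeral n = numeral n * a" by simp
  then show "a * (numeral n * b) = numeral n * (a * b)" by (metis mult.assoc)
qed

context HZ
begin

definition "\<Delta> = h * h + 4 * e * f - 2 * h"
text \<open>Adding 1 completes the square: on a highest weight vector of weight \<mu> this acts as
  (\<mu> + 1)^2.\<close>

definition "D = \<Delta> + 1"
definition "Z = peval \<Delta> z"

lemma eh: "e * h = h * e - 2 * e" using he by simp
lemma yxZ: "y * x = x * y - Z" using yx by (simp add: Z_def \<Delta>_def)

lemma assoc_rule: "a * b = c \<Longrightarrow> a * (b * d) = c * d" for a b c d :: 'a
  by (simp add: mult.assoc[symmetric])

lemmas rels = ef hf eh ex ey fx fy hx hy yxZ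
  ef[THEN assoc_rule] hf[THEN assoc_rule] eh[THEN assoc_rule] ex[THEN assoc_rule] ey[THEN assoc_rule]
  fx[THEN assoc_rule] fy[THEN assoc_rule] hx[THEN assoc_rule] hy[THEN assoc_rule] yxZ[THEN assoc_rule]

lemmas ring_norm = distrib_left distrib_right left_diff_distrib right_diff_distrib mult.assoc

lemma \<Delta>_normal: "\<Delta> = h * h + 4 * (f * e) + 2 * h"
  by (simp add: \<Delta>_def rels ring_norm small_numerals)

lemma \<Delta>_comm: "e * \<Delta> = \<Delta> * e" "f * \<Delta> = \<Delta> * f" "h * \<Delta> = \<Delta> * h"
  unfolding \<Delta>_normal by (simp_all add: rels ring_norm small_numerals)

lemma D_comm: "e * D = D * e" "f * D = D * f" "h * D = D * h"
  by (simp_all add: D_def ring_norm \<Delta>_comm)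

lemma Z_comm: "Z * e = e * Z" "Z * f = f * Z" "Z * h = h * Z" "Z * D = D * Z"
  unfolding Z_def D_def by (simp_all add: peval_comm \<Delta>_comm ring_norm)

lemma Dx: "D * x - x * D = 2 * (x * h) + 4 * (y * e) + 3 * x"
  unfolding D_def \<Delta>_normal by (simp add: rels ring_norm small_numerals)

text \<open>In terms of left and right multiplication this reads (L - R)^2 = 2 (L + R) - 1, which
  holds for R = c^2 and L = (c + 1)^2.\<close>

lemma D_quadratic: "D * (D * x) - 2 * (D * (x * D)) + x * (D * D) = 2 * (D * x + x * D) - x"
proof -
  have "D * (D * x) - 2 * (D * (x * D)) + x * (D * D) = D * (D * x - x * D) - (D * x - x * D) * D"
    by (simp add: ring_norm small_numerals)
  also have "\<dots> = 2 * (D * x + x * D) - x"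
    unfolding Dx unfolding D_def \<Delta>_normal by (simp add: rels ring_norm small_numerals)
  finally show ?thesis .
qed

text \<open>The same double commutator with the roles of x and D exchanged. The term e Z is what y x
  = x y - Z contributes.\<close>

lemma x_quadratic: "x * (x * D) - 2 * (x * (D * x)) + D * (x * x) = 2 * (x * x) - 4 * (e * Z)"
proof -
  have "x * (x * D) - 2 * (x * (D * x)) + D * (x * x) = (D * x - x * D) * x - x * (D * x - x * D)"
    by (simp add: ring_norm small_numerals)
  also have "\<dots> = 2 * (x * x) - 4 * (e * Z)"
    unfolding Dx by (simp add: rels ring_norm small_numerals Z_comm)
  finally show ?thesis .
qed


lemma peval_D_comm: "e * peval D q = peval D q * e" "f * peval D q = peval D q * f" "h * peval D q = peval D q * h"
  "D * peval D q = peval D q * D"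
  by (simp_all add: peval_comm D_comm)

text \<open>Since \<Delta> = D - 1, the polynomial z has to be recentred before it is used as a
  polynomial in D; this explains the composition with X - 1 from here on.\<close>

lemma Z_D: "Z = peval D (pcompose z [:-1, 1:])"
  by (simp add: peval_pcompose Z_def D_def peval_pCons \<iota>_1 \<iota>_minus)


lemma D_eq: "D = h * h + 4 * e * f - 2 * h + 1"
  by (simp add: D_def \<Delta>_def)

end

section \<open>Left and right multiplication by D near x, and the lifted quadratic element\<close>

locale HZ_antidifference = HZ \<iota> z e f h x y
  for \<iota> :: "'k::field \<Rightarrow> 'a::ring_1" and z e f h x y +
  fixes r :: "'k poly"
  assumes two: "(2 :: 'k) \<noteq> 0" and r: "antidifference (pcompose z [:-1, 1:]) r"
begin

lemma two_cancel: "2 * a = 0 \<Longrightarrow> (a :: 'a) = 0"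
proof -
  assume "2 * a = 0"
  then have "\<iota> (1 / 2) * (\<iota> 2 * a) = 0" by (simp add: \<iota>_numeral)
  then show "a = 0" using two by (simp add: mult.assoc[symmetric] \<iota>_mult[symmetric] \<iota>_1)
qed

text \<open>
  Let \<open>c\<close> act on \<open>v\<close> as \<open>([D, v] - v) / 2\<close>. On the bimodule generated by \<open>x\<close>, right and left
  multiplication by \<open>D\<close> become \<open>c\<^sup>2\<close> and \<open>(c + 1)\<^sup>2\<close>.
\<close>

definition \<kappa> :: "'a \<Rightarrow> 'a" where "\<kappa> v = \<iota> (1 / 2) * (D * v - v * D - v)"

lemma \<kappa>2: "2 * \<kappa> v = D * v - v * D - v"
  using two by (simp add: \<kappa>_def \<iota>_numeral[symmetric] mult.assoc[symmetric] \<iota>_mult[symmetric] \<iota>_1)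

sublocale bim: module_operator "\<lambda>a u. \<iota> a * u" \<kappa>
proof unfold_locales
  show "\<kappa> (\<iota> a * u) = \<iota> a * \<kappa> u" for a u
  proof -
    have "\<kappa> (\<iota> a * u) = \<iota> (1 / 2) * (\<iota> a * (D * u - u * D - u))"
      by (simp add: \<kappa>_def right_diff_distrib mult.assoc \<iota>_left_comm[of D])
    also have "\<dots> = \<iota> a * \<kappa> u" unfolding \<kappa>_def by (rule \<iota>_left_comm)
    finally show ?thesis .
  qed
qed (auto simp: \<kappa>_def ring_norm)

text \<open>The elements satisfying the relation of \<open>D_quadratic\<close>. The set is closed
  under both multiplications by D, so \<kappa> can be iterated on it.\<close>

definition bimodule :: "'a set"
  where "bimodule = {v. D * (D * v) - 2 * (D * (v * D)) + v * (D * D) = 2 * (D * v + v * D) - v}"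

lemma x_bimodule: "x \<in> bimodule"
  using D_quadratic by (simp add: bimodule_def mult.assoc)

lemma bimodule_DD: "v \<in> bimodule \<Longrightarrow> D * (D * v) = 2 * (D * (v * D)) - v * (D * D) + 2 * (D * v) + 2 * (v * D) - v"
  unfolding bimodule_def by (auto simp: algebra_simps)

lemma bimodule_add: "u \<in> bimodule \<Longrightarrow> v \<in> bimodule \<Longrightarrow> u + v \<in> bimodule"
proof -
  assume "u \<in> bimodule" "v \<in> bimodule"
  then have "(D * (D * u) - 2 * (D * (u * D)) + u * (D * D)) + (D * (D * v) - 2 * (D * (v * D)) + v * (D * D))
     = (2 * (D * u + u * D) - u) + (2 * (D * v + v * D) - v)" by (simp only: bimodule_def mem_Collect_eq)
  then show ?thesis by (simp add: bimodule_def ring_norm small_numerals algebra_simps)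
qed

lemma bimodule_closed:
  assumes "v \<in> bimodule"
  shows "v * D \<in> bimodule" "D * v \<in> bimodule" "\<iota> a * v \<in> bimodule" "\<kappa> v \<in> bimodule"
proof -
  have eq: "D * (D * v) - 2 * (D * (v * D)) + v * (D * D) = 2 * (D * v + v * D) - v"
    using assms by (simp add: bimodule_def)
  from arg_cong[OF eq, of "\<lambda>u. u * D"] show r: "v * D \<in> bimodule"
    by (simp add: bimodule_def ring_norm)
  from arg_cong[OF eq, of "\<lambda>u. D * u"] show l: "D * v \<in> bimodule"
    by (simp add: bimodule_def ring_norm small_numerals)
  have s: "\<iota> a * v \<in> bimodule" if "v \<in> bimodule" for a v
  proof -
    have "D * (D * v) - 2 * (D * (v * D)) + v * (D * D) = 2 * (D * v + v * D) - v"
      using that by (simp add: bimodule_def)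
    from arg_cong[OF this, of "\<lambda>u. \<iota> a * u"] show ?thesis
      by (simp add: bimodule_def ring_norm small_numerals \<iota>_left_comm[of D])
  qed
  have "D * v - v * D - v \<in> bimodule"
    using bimodule_add[OF bimodule_add[OF l s[OF r, of "- 1"]] s[OF assms, of "- 1"]]
    by (simp add: \<iota>_minus \<iota>_1)
  then show "\<kappa> v \<in> bimodule" unfolding \<kappa>_def by (rule s)
  show "\<iota> a * v \<in> bimodule" using assms by (rule s)
qed


text \<open>With left and right multiplication L, R one has 4 \<kappa>^2 = (L - R - 1)^2 = (L - R)^2
  - 2 (L - R) + 1, and the quadratic relation turns this into 4 R.\<close>

lemma \<kappa>_\<kappa>: assumes "v \<in> bimodule" shows "\<kappa> (\<kappa> v) = v * D"
proof -
  have "4 * \<kappa> (\<kappa> v) = 2 * (D * \<kappa> v - \<kappa> v * D - \<kappa> v)"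
    by (simp only: \<kappa>2[symmetric]) (simp add: small_numerals)
  also have "\<dots> = D * (2 * \<kappa> v) - (2 * \<kappa> v) * D - 2 * \<kappa> v" by (simp add: small_numerals ring_norm)
  also have "\<dots> = 4 * (v * D)"
    unfolding \<kappa>2 using bimodule_DD[OF assms] by (simp add: small_numerals ring_norm)
  finally have "2 * (2 * (\<kappa> (\<kappa> v) - v * D)) = 0" by (simp add: small_numerals ring_norm)
  then show ?thesis by (metis two_cancel eq_iff_diff_eq_0)
qed

lemma \<kappa>_left: assumes "v \<in> bimodule" shows "D * v = bim.ps sqr1 v"
proof -
  have "bim.ps sqr1 v = v + 2 * \<kappa> v + \<kappa> (\<kappa> v)"
    by (simp add: sqr1_def bim.ps_pCons bim.\<phi>_add \<iota>_1 \<iota>_numeral bim.\<phi>_scale[of 2, unfolded \<iota>_numeral] algebra_simps)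
  also have "\<dots> = D * v" unfolding \<kappa>_\<kappa>[OF assms] \<kappa>2 by simp
  finally show ?thesis by simp
qed

lemma \<kappa>_right: assumes "v \<in> bimodule" shows "v * D = bim.ps sqr v"
  by (simp add: sqr_def bim.ps_pCons \<iota>_1 \<iota>_0 \<kappa>_\<kappa>[OF assms])

lemma ps_bimodule: "v \<in> bimodule \<Longrightarrow> bim.ps q v \<in> bimodule"
proof (induction q)
  case 0
  then show ?case using bimodule_closed(3)[of v 0] by (simp add: \<iota>_0)
qed (simp add: bim.ps_pCons bimodule_add bimodule_closed)

lemma bimodule_peval:
  "peval D q * x = bim.ps (pcompose q sqr1) x" "x * peval D q = bim.ps (pcompose q sqr) x"
proof -
  show "peval D q * x = bim.ps (pcompose q sqr1) x"
    by (induction q) (simp_all add: peval_pCons pcompose_pCons distrib_right mult.assoc bim.ps_add bim.ps_mult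
        \<kappa>_left ps_bimodule x_bimodule)
  show "x * peval D q = bim.ps (pcompose q sqr) x"
  proof (induction q)
    case (pCons a q)
    have "x * (D * peval D q) = (x * peval D q) * D"
      by (simp add: peval_D_comm mult.assoc)
    then show ?case
      using pCons by (simp add: peval_pCons pcompose_pCons distrib_left bim.ps_add bim.ps_mult
        \<kappa>_right ps_bimodule x_bimodule \<iota>_comm[of a x, symmetric])
  qed simp
qed

definition "R = peval D r"

text \<open>The antidifference equation, evaluated at c = \<kappa> and applied to x. Then 2
  \<kappa>(v) = [D, v] - v removes \<kappa>.\<close>

lemma R_commutator: "4 * (R * x - x * R) = (D * x - x * D) * Z + Z * (D * x - x * D) + (Z * x - x * Z)"
proof -
  let ?w = "pcompose z [:-1, 1:]"
  have "2 * (R * x - x * R) = bim.ps (2 * (pcompose r sqr1 - pcompose r sqr)) x"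
  proof -
    have ps2: "2 * bim.ps q x = bim.ps (2 * q) x" for q
      unfolding mult_2 bim.ps_add ..
    have "bim.ps (pcompose r sqr1 - pcompose r sqr) x = bim.ps (pcompose r sqr1) x - bim.ps (pcompose r sqr) x"
      using bim.ps_add[of "pcompose r sqr1 - pcompose r sqr" "pcompose r sqr" x] by simp
    then show ?thesis unfolding R_def bimodule_peval ps2[symmetric] by simp
  qed
  also have "\<dots> = bim.ps ([:0, 1:] * pcompose ?w sqr + [:1, 1:] * pcompose ?w sqr1) x"
    using r by (simp only: antidifference_def)
  also have "\<dots> = \<kappa> (x * Z) + (Z * x + \<kappa> (Z * x))"
    unfolding Z_D bimodule_peval by (simp add: bim.ps_add bim.ps_mult bim.ps_pCons \<iota>_1 \<iota>_0 del: mult_pCons_left)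
  finally have "4 * (R * x - x * R) = 2 * \<kappa> (x * Z) + 2 * (Z * x) + 2 * \<kappa> (Z * x)"
    by (simp add: small_numerals algebra_simps)
  also have "\<dots> = (D * x - x * D) * Z + Z * (D * x - x * D) + (Z * x - x * Z)"
    unfolding \<kappa>2 by (simp add: small_numerals ring_norm Z_comm(4) Z_comm(4)[THEN assoc_rule])
  finally show ?thesis .
qed

text \<open>The first summand is the quadratic central element for z = 0. The multiples of Z and the
  term 2 R compensate for y x = x y - Z.\<close>

definition "T = 2 * (e * (y * y) + h * (x * y) - f * (x * x)) - h * Z - Z + 2 * R"

lemma T_comm: "e * T = T * e" "h * T = T * h" "f * T = T * f" "x * T = T * x" "y * T = T * y" "D * T = T * D"
proof -
  have c: "R * e = e * R" "R * f = f * R" "R * h = h * R" by (simp_all add: R_def peval_D_comm)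
  note rl = c[THEN assoc_rule] c Z_comm Z_comm[THEN assoc_rule] rels
  show e: "e * T = T * e" and h: "h * T = T * h" and f: "f * T = T * f"
    by (simp_all add: T_def rl ring_norm small_numerals)
  have Dx': "D * x - x * D = 2 * (h * x) + 4 * (e * y) - 3 * x"
    unfolding Dx by (simp add: rels ring_norm small_numerals)
  have "2 * (T * x - x * T) = 4 * ((e * (y * y) + h * (x * y) - f * (x * x)) * x - x * (e * (y * y) + h * (x * y) - f * (x * x)))
     - 2 * ((h * Z + Z) * x - x * (h * Z + Z)) + 4 * (R * x - x * R)"
    by (simp add: T_def ring_norm small_numerals)
  also have "\<dots> = 0"
    unfolding R_commutator Dx'
    by (simp add: rels Z_comm(1-3)[symmetric] Z_comm(1-3)[symmetric, THEN assoc_rule] ring_norm small_numerals)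
  finally have "2 * (T * x - x * T) = 0" .
  then show x: "x * T = T * x" using two_cancel by fastforce
  \<comment> \<open>As y is the commutator of f and x, commuting with f and x is enough.\<close>
  have "y = f * x - x * f" by (simp add: fx)
  then show "y * T = T * y" using x f by (simp add: ring_norm) (metis mult.assoc)
  have "T * a * b = a * b * T" if "T * a = a * T" "T * b = b * T" for a b
    using that by (metis mult.assoc)
  then have 1: "T * (a * b) = a * b * T" if "T * a = a * T" "T * b = b * T" for a b
    using that by (metis mult.assoc)
  have 2: "T * (2 * h) = 2 * h * T" "T * (4 * e * f) = 4 * e * f * T"
    using h[symmetric] 1[OF e[symmetric] f[symmetric]] by (simp_all add: small_numerals ring_norm)
  show "D * T = T * D" unfolding D_eq
    using 2 1[OF h[symmetric] h[symmetric]] by (simp add: distrib_left distrib_right left_diff_distrib right_diff_distrib)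
qed

text \<open>This writes e T without h and y, so that the ladder can be treated with D, x, e, Z, R
  and T alone.\<close>

lemma T_formula:
  "8 * (e * T) = (D * x - x * D) * (D * x - x * D) + 4 * ((D * x - x * D) * x) + x * x - 4 * (D * (x * x))
     + 4 * (e * Z) + 16 * (e * R)"
proof -
  have Dx': "D * x = x * D + (2 * (x * h) + 4 * (y * e) + 3 * x)"
    using Dx by (simp add: algebra_simps)
  have "D * (x * x) = x * (x * D) + x * (2 * (x * h) + 4 * (y * e) + 3 * x) + (2 * (x * h) + 4 * (y * e) + 3 * x) * x"
    by (simp add: mult.assoc[symmetric] Dx') (simp add: ring_norm Dx')
  then show ?thesis
    unfolding Dx unfolding T_def D_def \<Delta>_normal
    by (simp add: rels ring_norm small_numerals Z_comm Z_comm[THEN assoc_rule])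
qed

end

section \<open>Continuants\<close>

text \<open>
  \<open>continuant a b i n\<close> is the determinant of the tridiagonal matrix with diagonal
  \<open>a\<^sub>i, \<dots>, a\<^sub>i\<^sub>+\<^sub>n\<^sub>-\<^sub>1\<close>, the product of the two off-diagonal entries between \<open>j - 1\<close> and \<open>j\<close> being \<open>b\<^sub>j\<close>.
\<close>

fun continuant :: "(int \<Rightarrow> 'r::comm_ring_1) \<Rightarrow> (int \<Rightarrow> 'r) \<Rightarrow> int \<Rightarrow> nat \<Rightarrow> 'r" where
  "continuant a b i 0 = 1"
| "continuant a b i (Suc 0) = a i"
| "continuant a b i (Suc (Suc n)) = a (i + 1 + int n) * continuant a b i (Suc n) - b (i + 1 + int n) * continuant a b i n"

text \<open>Expansion of the determinant along the first row, whereas the defining recursion expands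
  along the last one.\<close>

lemma continuant_left:
  "continuant a b i (Suc (Suc n)) = a i * continuant a b (i + 1) (Suc n) - b (i + 1) * continuant a b (i + 2) n"
proof (induction n rule: less_induct)
  case (less n)
  consider "n = 0" | "n = 1" | m where "n = Suc (Suc m)" by (metis One_nat_def not0_implies_Suc)
  then show ?case
  proof cases
    case 3
    have i: "i + 1 + int (Suc (Suc m)) = i + 3 + int m" "i + 1 + 1 + int (Suc m) = i + 3 + int m"
      "i + 2 + 1 + int m = i + 3 + int m" "i + 1 + 1 + int m = i + 2 + int m" by simp_all
    have "continuant a b i (Suc (Suc n)) = a (i + 3 + int m) * continuant a b i (Suc (Suc (Suc m))) - b (i + 3 + int m) * continuant a b i (Suc (Suc m))"
      unfolding 3 by (subst continuant.simps(3)) (simp only: i)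
    also have "continuant a b i (Suc (Suc (Suc m))) = a i * continuant a b (i + 1) (Suc (Suc m)) - b (i + 1) * continuant a b (i + 2) (Suc m)"
      by (rule less) (simp add: 3)
    also have "continuant a b i (Suc (Suc m)) = a i * continuant a b (i + 1) (Suc m) - b (i + 1) * continuant a b (i + 2) m"
      by (rule less) (simp add: 3)
    also have "a (i + 3 + int m) * (a i * continuant a b (i + 1) (Suc (Suc m)) - b (i + 1) * continuant a b (i + 2) (Suc m))
       - b (i + 3 + int m) * (a i * continuant a b (i + 1) (Suc m) - b (i + 1) * continuant a b (i + 2) m)
      = a i * (a (i + 3 + int m) * continuant a b (i + 1) (Suc (Suc m)) - b (i + 3 + int m) * continuant a b (i + 1) (Suc m))
       - b (i + 1) * (a (i + 3 + int m) * continuant a b (i + 2) (Suc m) - b (i + 3 + int m) * continuant a b (i + 2) m)"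
      by (simp add: algebra_simps)
    also have "a (i + 3 + int m) * continuant a b (i + 1) (Suc (Suc m)) - b (i + 3 + int m) * continuant a b (i + 1) (Suc m)
       = continuant a b (i + 1) (Suc n)"
      using continuant.simps(3)[of a b "i + 1" "Suc m"] by (simp only: 3 i)
    also have "a (i + 3 + int m) * continuant a b (i + 2) (Suc m) - b (i + 3 + int m) * continuant a b (i + 2) m
       = continuant a b (i + 2) n"
      using continuant.simps(3)[of a b "i + 2" m] by (simp only: 3 i)
    finally show ?thesis .
  qed (simp_all add: algebra_simps)
qed

lemma continuant_shift:
  "continuant (\<lambda>j. a (j + k)) (\<lambda>j. b (j + k)) i n = continuant a b (i + k) n"
  by (induction n rule: continuant.induct[of _ a b i]) (simp_all add: algebra_simps)

lemma continuant_periodic: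
  assumes "\<And>j. a (j + k) = a j" "\<And>j. b (j + k) = b j"
  shows "continuant a b (i + k) n = continuant a b i n"
  using continuant_shift[of a k b i n] assms by simp

text \<open>The tridiagonal matrix is negated and its rows and columns are reversed. A product of
  two off-diagonal entries does not see the sign, so only the determinant acquires (-1)^n.\<close>

lemma continuant_reverse:
  "continuant (\<lambda>j. - a (- j)) (\<lambda>j. b (1 - j)) i n = (- 1) ^ n * continuant a b (1 - i - int n) n"
proof (induction n rule: less_induct)
  case (less n)
  consider "n = 0" | "n = 1" | m where "n = Suc (Suc m)" by (metis One_nat_def not0_implies_Suc)
  then show ?case
  proof cases
    case 3
    have e: "1 - i - int (Suc m) = 1 - i - int n + 1" "1 - i - int m = 1 - i - int n + 2"
      "- (i + 1 + int m) = 1 - i - int n" "1 - (i + 1 + int m) = 1 - i - int n + 1" by (simp_all add: 3)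
    have "continuant (\<lambda>j. - a (- j)) (\<lambda>j. b (1 - j)) i n
      = - a (- (i + 1 + int m)) * ((- 1) ^ Suc m * continuant a b (1 - i - int (Suc m)) (Suc m))
       - b (1 - (i + 1 + int m)) * ((- 1) ^ m * continuant a b (1 - i - int m) m)"
      using less[of "Suc m"] less[of m] by (simp add: 3)
    also have "\<dots> = (- 1) ^ n * (a (1 - i - int n) * continuant a b (1 - i - int n + 1) (Suc m)
       - b (1 - i - int n + 1) * continuant a b (1 - i - int n + 2) m)"
      unfolding e by (simp add: 3 algebra_simps)
    also have "\<dots> = (- 1) ^ n * continuant a b (1 - i - int n) n"
      unfolding 3 continuant_left ..
    finally show ?thesis .
  qed simp_all
qed

text \<open>The trace of the product of the transfer matrices with rows (a_j, -b_j) and (1, 0) over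
  one period. Invariance of the trace under cyclic rotation is what
  \<open>cyclic_continuant_rotate\<close> expresses.\<close>

definition cyclic_continuant :: "(int \<Rightarrow> 'r::comm_ring_1) \<Rightarrow> (int \<Rightarrow> 'r) \<Rightarrow> int \<Rightarrow> nat \<Rightarrow> 'r"
  where "cyclic_continuant a b i p = continuant a b i p - b i * continuant a b (i + 1) (p - 2)"

lemma cyclic_continuant_rotate:
  assumes "\<And>j. a (j + int p) = a j" "\<And>j. b (j + int p) = b j" "p > 2"
  shows "cyclic_continuant a b (i + 1) p = cyclic_continuant a b i p"
proof -
  obtain m where p: "p = Suc (Suc m)" using that[of "p - 2"] assms(3) by simp
  have i: "i + 1 + 1 + int m = i + int p" "i + 1 + 1 = i + 2" by (simp_all add: p)
  have "continuant a b (i + 1) p = a i * continuant a b (i + 1) (Suc m) - b i * continuant a b (i + 1) m"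
    using continuant.simps(3)[of a b "i + 1" m] by (simp only: i(1) assms(1,2)) (simp only: p)
  moreover have "continuant a b i p = a i * continuant a b (i + 1) (Suc m) - b (i + 1) * continuant a b (i + 2) m"
    unfolding p by (rule continuant_left)
  ultimately show ?thesis by (simp add: cyclic_continuant_def i(2)) (simp add: p)
qed


section \<open>Polynomials invariant under the shift in characteristic \<open>p\<close>\<close>

lemma coeff_pcompose_shift:
  assumes "degree Q \<le> m"
  shows "coeff (pcompose Q [:1, 1:]) m = coeff Q m"
    "m > 0 \<Longrightarrow> coeff (pcompose Q [:1, 1:]) (m - 1) = coeff Q (m - 1) + of_nat m * coeff (Q :: 'r::idom poly) m"
proof -
  have "degree Q \<le> m \<Longrightarrow> coeff (pcompose Q [:1, 1:]) m = coeff Q m \<and>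
    (m > 0 \<longrightarrow> coeff (pcompose Q [:1, 1:]) (m - 1) = coeff Q (m - 1) + of_nat m * coeff Q m)"
  proof (induction Q arbitrary: m)
    case (pCons a Q)
    show ?case
    proof (cases "m = 0")
      case True
      with pCons show ?thesis by (simp split: if_splits)
    next
      case False
      then obtain n where m: "m = Suc n" by (metis not0_implies_Suc)
      have "degree Q \<le> n" using pCons.prems by (auto simp: m split: if_splits)
      with pCons.IH[of n] pCons.IH[of m] m show ?thesis
        by (cases n) (auto simp: pcompose_pCons coeff_eq_0 algebra_simps)
    qed
  qed simp
  then show "coeff (pcompose Q [:1, 1:]) m = coeff Q m"
    "m > 0 \<Longrightarrow> coeff (pcompose Q [:1, 1:]) (m - 1) = coeff Q (m - 1) + of_nat m * coeff Q m"
    using assms by auto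
qed

definition artin_schreier :: "nat \<Rightarrow> 'r::comm_ring_1 poly" where "artin_schreier p = [:0, 1:] ^ p - [:0, 1:]"

lemma pcompose_power: "pcompose (q ^ n) r = pcompose q r ^ n"
  by (induction n) (simp_all add: pcompose_mult pcompose_1)

lemma artin_schreier_shift:
  assumes "CHAR('r::idom) = p" "prime p"
  shows "pcompose (artin_schreier p) [:1, 1:] = (artin_schreier p :: 'r poly)"
proof -
  have e: "[:1, 1:] = [:0, 1:] + (1 :: 'r poly)" by (simp add: poly_eq_iff coeff_pCons split: nat.split)
  have "[:1, 1:] ^ p = [:0, 1:] ^ p + (1 :: 'r poly)"
  proof -
    have c: "prime CHAR('r poly)" "p = CHAR('r poly)" using assms by simp_all
    from freshmans_dream[OF c, of "[:0, 1:]" 1] show ?thesis by (simp only: power_one e)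
  qed
  moreover have "pcompose [:0, 1:] [:1, 1:] = [:1, 1 :: 'r:]" by (simp add: pcompose_pCons)
  ultimately show ?thesis
    unfolding artin_schreier_def pcompose_diff pcompose_power by (simp only:) (simp only: e add_diff_cancel_right)
qed

lemma degree_artin_schreier:
  assumes "p > 1"
  shows "degree (artin_schreier p :: 'r::idom poly) = p" "lead_coeff (artin_schreier p :: 'r::idom poly) = 1"
proof -
  have d: "degree ([:0, 1:] ^ p :: 'r poly) = p" "degree ([:0, 1 :: 'r:]) < p"
    using assms by (simp_all add: degree_power_eq)
  show d': "degree (artin_schreier p :: 'r poly) = p"
    unfolding artin_schreier_def diff_conv_add_uminus using d by (subst degree_add_eq_left) simp_all
  show "lead_coeff (artin_schreier p :: 'r poly) = 1"
    unfolding d' using d lead_coeff_power[of "[:0, 1 :: 'r:]" p] coeff_eq_0[OF d(2)] by (simp add: artin_schreier_def)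
qed

text \<open>Comparing the coefficients one below the top gives deg Q times the leading coefficient =
  0, so p divides deg Q. Subtracting a multiple of a power of X^p - X then lowers the
  degree.\<close>

lemma shift_invariant:
  fixes Q :: "'r::idom poly"
  assumes "CHAR('r) = p" "prime p" "pcompose Q [:1, 1:] = Q"
  shows "\<exists>P. Q = pcompose P (artin_schreier p)"
  using assms(3)
proof (induction "degree Q" arbitrary: Q rule: less_induct)
  case less
  show ?case
  proof (cases "degree Q = 0")
    case True
    then obtain a where "Q = [:a:]" by (metis degree_eq_zeroE)
    then show ?thesis by (auto intro!: exI[of _ "[:a:]"])
  next
    case False
    then have "of_nat (degree Q) * lead_coeff Q = 0"
      using coeff_pcompose_shift(2)[of Q "degree Q"] less.prems by simp
    then have "of_nat (degree Q) = (0 :: 'r)" using False by auto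
    then have "p dvd degree Q" using assms(1) by (simp add: of_nat_eq_0_iff_char_dvd)
    then obtain q where q: "degree Q = p * q" by auto
    define Q' where "Q' = Q - smult (lead_coeff Q) (artin_schreier p ^ q)"
    have p1: "p > 1" using assms(2) prime_gt_1_nat by blast
    have inv: "pcompose Q' [:1, 1:] = Q'"
      by (simp add: Q'_def pcompose_diff pcompose_smult pcompose_power artin_schreier_shift[OF assms(1,2)] less.prems)
    have d: "degree (artin_schreier p ^ q :: 'r poly) = degree Q" "lead_coeff (artin_schreier p ^ q :: 'r poly) = 1"
    proof -
      have "artin_schreier p \<noteq> (0 :: 'r poly)" using degree_artin_schreier(2)[OF p1, where 'r='r] by fastforce
      then show "degree (artin_schreier p ^ q :: 'r poly) = degree Q"
        by (simp add: degree_power_eq degree_artin_schreier(1)[OF p1] q)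
      show "lead_coeff (artin_schreier p ^ q :: 'r poly) = 1"
        unfolding lead_coeff_power degree_artin_schreier(2)[OF p1] by simp
    qed
    have "degree Q' < degree Q"
    proof (rule degree_lessI)
      show "Q' \<noteq> 0 \<or> 0 < degree Q" using False by simp
      show "\<forall>k\<ge>degree Q. coeff Q' k = 0"
        using d by (auto simp: Q'_def coeff_eq_0 le_less)
    qed
    from less.hyps[OF this inv] obtain P where P: "Q' = pcompose P (artin_schreier p)" by blast
    have "Q = pcompose (P + smult (lead_coeff Q) ([:0, 1:] ^ q)) (artin_schreier p)"
      using P by (simp add: pcompose_add pcompose_smult pcompose_power pcompose_pCons Q'_def) (metis diff_add_cancel)
    then show ?thesis by blast
  qed
qed

lemma odd_poly:
  fixes Q :: "'r::idom poly"
  assumes "(2 :: 'r) \<noteq> 0" "pcompose Q [:0, -1:] = - Q"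
  shows "\<exists>P. Q = [:0, 1:] * pcompose P [:0, 0, 1:]"
proof -
  have z: "coeff Q i = 0" if "even i" for i
  proof -
    have "coeff Q i = - coeff Q i"
      using arg_cong[OF assms(2), of "\<lambda>q. coeff q i"] that by (simp add: coeff_pcompose_linear)
    then have "2 * coeff Q i = 0" by simp
    then show ?thesis using assms(1) by simp
  qed
  have "\<exists>P. Q = [:0, 1:] * pcompose P [:0, 0, 1:]" if "\<forall>i. even i \<longrightarrow> coeff Q i = 0" for Q :: "'r poly"
    using that
  proof (induction "degree Q" arbitrary: Q rule: less_induct)
    case less
    show ?case
    proof (cases "Q = 0")
      case False
      obtain a q where q: "Q = pCons a q" by (cases Q)
      obtain b q' where q': "q = pCons b q'" by (cases q)
      have a: "a = 0" using less.prems by (auto simp: q dest: spec[of _ 0])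
      with False have "q \<noteq> 0" by (auto simp: q)
      have "\<forall>i. even i \<longrightarrow> coeff q' i = 0"
      proof safe
        fix i :: nat assume "even i"
        with less.prems have "coeff Q (Suc (Suc i)) = 0" by simp
        then show "coeff q' i = 0" by (simp add: q q')
      qed
      moreover have "degree q' < degree Q" using \<open>q \<noteq> 0\<close> by (auto simp: q q' split: if_splits)
      ultimately obtain P where "q' = [:0, 1:] * pcompose P [:0, 0, 1:]" using less.hyps by blast
      then have "Q = [:0, 1:] * pcompose (pCons b P) [:0, 0, 1:]"
        by (simp add: q q' a pcompose_pCons)
      then show ?thesis by blast
    qed (auto intro!: exI[of _ 0])
  qed
  with z show ?thesis by blast
qed

text \<open>For odd p the polynomial s = X^p - X is itself odd. Composition with s is injective
  because s has positive degree, so the outer polynomial P must be odd as well.\<close>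

lemma odd_shift_invariant:
  fixes Q :: "'r::idom poly"
  assumes "CHAR('r) = p" "prime p" "p > 2" "pcompose Q [:1, 1:] = Q" "pcompose Q [:0, -1:] = - Q"
  shows "\<exists>P. Q = artin_schreier p * pcompose P (artin_schreier p ^ 2)"
proof -
  obtain P where P: "Q = pcompose P (artin_schreier p)" using shift_invariant assms by blast
  have "odd p" using assms(2,3) prime_odd_nat by auto
  then have s: "pcompose (artin_schreier p) [:0, -1:] = - (artin_schreier p :: 'r poly)"
  proof -
    have "[:0, - 1:] = - [:0, 1 :: 'r:]" by simp
    then have "[:0, - 1:] ^ p = - ([:0, 1 :: 'r:] ^ p)" using \<open>odd p\<close> by (metis power_minus_odd)
    then show ?thesis by (simp add: artin_schreier_def pcompose_diff pcompose_power pcompose_pCons)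
  qed
  have "pcompose (pcompose P [:0, -1:] + P) (artin_schreier p) = 0"
  proof -
    have "pcompose (pcompose P [:0, -1:]) (artin_schreier p) = pcompose P (- artin_schreier p)"
      by (simp add: pcompose_assoc[symmetric] pcompose_pCons)
    also have "\<dots> = pcompose Q [:0, -1:]" by (simp add: P pcompose_assoc[symmetric] s)
    finally show ?thesis using assms(5) by (simp add: pcompose_add P)
  qed
  then have "pcompose P [:0, -1:] + P = 0"
    using degree_artin_schreier[of p, where 'r='r] assms(3) pcompose_eq_0 by force
  moreover have "(2 :: 'r) \<noteq> 0"
    using of_nat_eq_0_iff_char_dvd[of 2, where 'a='r] assms(1,3) by (auto dest: dvd_imp_le)
  ultimately obtain P' where "P = [:0, 1:] * pcompose P' [:0, 0, 1:]"
    using odd_poly[of P] by (metis eq_neg_iff_add_eq_0)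
  then have "Q = artin_schreier p * pcompose P' (pcompose [:0, 0, 1:] (artin_schreier p))"
    by (simp only: P pcompose_mult pcompose_assoc) (simp add: pcompose_pCons)
  then show ?thesis by (auto simp: pcompose_pCons power2_eq_square)
qed

text \<open>Division by X^p - X from the top: a coefficient of Q is a coefficient of the product
  plus a higher coefficient of Q. Only additions occur, so closure of W under addition
  suffices.\<close>

lemma coeffs_artin_schreier_mult:
  fixes Q :: "'r::idom poly"
  assumes W: "\<And>u v. u \<in> W \<Longrightarrow> v \<in> W \<Longrightarrow> u + v \<in> W" "0 \<in> W" and "p > 1"
    and "\<And>i. coeff (artin_schreier p * Q) i \<in> W"
  shows "coeff Q i \<in> W"
proof -
  have eq: "coeff Q i = coeff (artin_schreier p * Q) (i + p) + coeff Q (i + p - 1)" for i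
    using assms(3) by (cases p) (simp_all add: artin_schreier_def left_diff_distrib coeff_pCons mult_pCons_left
       monom_altdef[of 1, symmetric, simplified] coeff_monom_mult flip: monom_altdef)
  show ?thesis
  proof (induction "Suc (degree Q) - i" arbitrary: i rule: less_induct)
    case less
    show ?case
    proof (cases "i > degree Q")
      case False
      then have "coeff Q (i + p - 1) \<in> W" using less.hyps[of "i + p - 1"] assms(3) by simp
      then show ?thesis using eq[of i] W(1) assms(4) by simp
    qed (simp add: coeff_eq_0 W)
  qed
qed

section \<open>Two by two matrices\<close>

text \<open>Matrices over a noncommutative algebra provide a square root of D, namely its companion
  matrix, while scalar matrices keep the original algebra acting from the left.\<close>

datatype 'a mat2 = Mat2 'a 'a 'a 'a

instantiation mat2 :: (ring_1) ring_1
begin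
definition "0 = Mat2 0 0 0 0"
definition "1 = Mat2 1 0 0 1"
fun plus_mat2 :: "'a mat2 \<Rightarrow> 'a mat2 \<Rightarrow> 'a mat2" where
  "plus_mat2 (Mat2 a b c d) (Mat2 a' b' c' d') = Mat2 (a + a') (b + b') (c + c') (d + d')"
fun minus_mat2 :: "'a mat2 \<Rightarrow> 'a mat2 \<Rightarrow> 'a mat2" where
  "minus_mat2 (Mat2 a b c d) (Mat2 a' b' c' d') = Mat2 (a - a') (b - b') (c - c') (d - d')"
fun uminus_mat2 :: "'a mat2 \<Rightarrow> 'a mat2" where
  "uminus_mat2 (Mat2 a b c d) = Mat2 (- a) (- b) (- c) (- d)"
fun times_mat2 :: "'a mat2 \<Rightarrow> 'a mat2 \<Rightarrow> 'a mat2" where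
  "times_mat2 (Mat2 a b c d) (Mat2 a' b' c' d') = Mat2 (a * a' + b * c') (a * b' + b * d') (c * a' + d * c') (c * b' + d * d')"

instance
proof
  fix a b c :: "'a mat2"
  show "(0 :: 'a mat2) \<noteq> 1" by (simp add: zero_mat2_def one_mat2_def)
  show "a + b = b + a" by (cases a; cases b) (simp add: add.commute)
  show "a + b + c = a + (b + c)" by (cases a; cases b; cases c) (simp add: add.assoc)
  show "0 + a = a" "- a + a = 0" by (cases a; simp add: zero_mat2_def)+
  show "a - b = a + - b" by (cases a; cases b) simp
  show "1 * a = a" "a * 1 = a" by (cases a; simp add: one_mat2_def)+
  show "a * b * c = a * (b * c)" by (cases a; cases b; cases c) (simp add: distrib_left distrib_right mult.assoc add_ac)
  show "(a + b) * c = a * c + b * c" "a * (b + c) = a * b + a * c"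
    by (cases a; cases b; cases c; simp add: distrib_left distrib_right add_ac)+
qed
end

definition diag2 :: "'a \<Rightarrow> 'a::ring_1 mat2" where "diag2 a = Mat2 a 0 0 a"

lemma diag2_simps:
  "diag2 (a + b) = diag2 a + diag2 b" "diag2 (a - b) = diag2 a - diag2 b" "diag2 (a * b) = diag2 a * diag2 b"
  "diag2 1 = 1" "diag2 0 = 0" "diag2 (- a) = - diag2 a"
  by (simp_all add: diag2_def one_mat2_def zero_mat2_def)

lemma diag2_numeral: "diag2 (numeral n) = numeral n"
proof -
  have "diag2 (of_nat m) = of_nat m" for m by (induction m) (simp_all add: diag2_simps)
  from this[of "numeral n"] show ?thesis by simp
qed

lemma diag2_power: "diag2 (a ^ n) = diag2 a ^ n"
  by (induction n) (simp_all add: diag2_simps)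

text \<open>One ladder step up followed by one down. The hypotheses rewrite D D x w, D x x w and e T
  w, after which both sides are in the same normal form. The statement is for an abstract ring
  because it is used with matrices.\<close>

lemma ladder_product:
  fixes D x w m e T Z R zm rm :: "'b::ring_1"
  assumes AD: "x * (x * D) - 2 * (x * (D * x)) + D * (x * x) = 2 * (x * x) - 4 * (e * Z)"
    and Q: "D * (D * x) - 2 * (D * (x * D)) + x * (D * D) = 2 * (D * x + x * D) - x"
    and TF: "8 * (e * T) = (D * x - x * D) * (D * x - x * D) + 4 * ((D * x - x * D) * x) + x * x - 4 * (D * (x * x))
     + 4 * (e * Z) + 16 * (e * R)"
    and w: "D * w = w * (m * m)" "Z * w = w * zm" "R * w = w * rm" and comm: "zm * m = m * zm"
  defines "v \<equiv> D * (x * w) - x * (w * ((m - 1) * (m - 1)))"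
  shows "x * (v * ((m + 2) * (m + 2))) - D * (x * v) = 8 * (e * (2 * (w * rm) + w * (m * zm) - T * w))"
proof -
  have ar: "a * b = c \<Longrightarrow> a * (b * d) = c * d" for a b c d :: 'b
    by (simp add: mult.assoc[symmetric])
  note n = distrib_left distrib_right left_diff_distrib right_diff_distrib mult.assoc small_numerals w
  have 1: "D * (D * (x * w)) = 2 * (D * (x * (w * (m * m)))) - x * (w * (m * (m * (m * m)))) + 2 * (D * (x * w)) + 2 * (x * (w * (m * m))) - x * w"
    (is "_ = ?r")
  proof -
    have "D * (D * (x * w)) - ?r = (D * (D * x) - 2 * (D * (x * D)) + x * (D * D)) * w - (2 * (D * x + x * D) - x) * w"
      by (simp add: n w[THEN ar])
    then show ?thesis unfolding Q by simp
  qed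
  have 2: "D * (x * (x * w)) = 2 * (x * (x * w)) - 4 * (e * (w * zm)) - x * (x * (w * (m * m))) + 2 * (x * (D * (x * w)))"
    (is "_ = ?r")
  proof -
    have "D * (x * (x * w)) - ?r = (x * (x * D) - 2 * (x * (D * x)) + D * (x * x)) * w - (2 * (x * x) - 4 * (e * Z)) * w"
      by (simp add: n w[THEN ar])
    then show ?thesis unfolding AD by simp
  qed
  have 3: "8 * (e * (T * w)) = D * (x * (D * (x * w))) - D * (x * (x * (w * (m * m)))) - x * (D * (D * (x * w))) + x * (D * (x * (w * (m * m))))
     + 4 * (D * (x * (x * w))) - 4 * (x * (D * (x * w))) + x * (x * w) - 4 * (D * (x * (x * w))) + 4 * (e * (w * zm)) + 16 * (e * (w * rm))"
    (is "_ = ?r")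
  proof -
    have "8 * (e * (T * w)) - ?r = (8 * (e * T)) * w - ((D * x - x * D) * (D * x - x * D) + 4 * ((D * x - x * D) * x) + x * x - 4 * (D * (x * x))
       + 4 * (e * Z) + 16 * (e * R)) * w"
      by (simp add: n w[THEN ar])
    then show ?thesis unfolding TF by simp
  qed
  \<comment> \<open>Fact 2 multiplied on the right by u, since the expansion also contains w
    followed by powers of m.\<close>
  have 4: "D * (x * (x * (w * u))) = 2 * (x * (x * (w * u))) - 4 * (e * (w * (zm * u))) - x * (x * (w * (m * (m * u)))) + 2 * (x * (D * (x * (w * u))))" for u
    using arg_cong[OF 2, of "\<lambda>q. q * u"] by (simp add: n)
  have e1: "u * ((m - 1) * (m - 1)) = u * (m * m) - 2 * (u * m) + u" for u
    by (simp add: distrib_left right_diff_distrib left_diff_distrib small_numerals)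
  have "4 * u = u * 4" for u :: 'b by (rule numeral_comm[symmetric])
  then have e2: "u * ((m + 2) * (m + 2)) = u * (m * m) + 4 * (u * m) + 4 * u" for u
    by (simp add: distrib_left distrib_right numeral_comm(1)[of m] small_numerals)
  have "8 * (e * (2 * (w * rm) + w * (m * zm) - T * w)) = 16 * (e * (w * rm)) + 8 * (e * (w * (m * zm))) - 8 * (e * (T * w))"
    by (simp add: distrib_left right_diff_distrib small_numerals)
  also have "\<dots> = x * (v * ((m + 2) * (m + 2))) - D * (x * v)"
    unfolding 3 unfolding v_def e1 e2 by (simp add: n 1 2 4 comm)
  finally show ?thesis by simp
qed

section \<open>The central element lifting \<open>x\<^sup>p\<close>\<close>

text \<open>With this an action of a polynomial ring in several variables is built by adjoining one
  commuting operator at a time.\<close>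

lemma (in module_operator) module_operator_ps:
  assumes "\<And>u v. \<psi> (u + v) = \<psi> u + \<psi> v" "\<And>a u. \<psi> (s a u) = s a (\<psi> u)" "\<And>u. \<psi> (\<phi> u) = \<phi> (\<psi> u)"
  shows "module_operator ps \<psi>"
proof (rule module_operator.intro[OF module_ps], unfold_locales)
  show "\<psi> (u + v) = \<psi> u + \<psi> v" for u v by (rule assms)
  show "\<psi> (ps a u) = ps a (\<psi> u)" for a u by (rule ps_comm) (auto simp: assms)
qed

lemma pcompose_continuant:
  "pcompose (continuant a b i n) s = continuant (\<lambda>j. pcompose (a j) s) (\<lambda>j. pcompose (b j) s) i n"
  by (induction a b i n rule: continuant.induct) (simp_all add: pcompose_mult pcompose_diff pcompose_1)

lemma pcompose_of_int [simp]: "pcompose (of_int n) s = of_int n"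
  using pcompose_const[of "of_int n" s] by (simp add: of_int_poly)

text \<open>
  The cyclic continuant with diagonal \<open>a\<^sub>i = \<lambda> (c + i)\<close> and off-diagonal products
  \<open>b\<^sub>i = A \<zeta>(c + i - 1) + B\<close> in \<open>k[A, B, \<lambda>][c]\<close>.
\<close>

type_synonym 'k poly3 = "'k poly poly poly"

definition sA :: "'k::field poly3" where "sA = [:[:[:0, 1:]:]:]"
definition sB :: "'k::field poly3" where "sB = [:[:0, 1:]:]"
definition sL :: "'k::field poly3" where "sL = [:0, 1:]"
definition sc3 :: "'k::field \<Rightarrow> 'k poly3" where "sc3 a = [:[:[:a:]:]:]"
definition cv :: "'k::field poly3 poly" where "cv = [:0, 1:]"

interpretation pk: scalars "\<lambda>a. [:sc3 a:] :: 'k::field poly3 poly"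
  by unfold_locales (simp_all add: sc3_def one_pCons del: pCons_one)

definition av :: "int \<Rightarrow> 'k::field poly3 poly" where "av j = [:sL:] * (cv + of_int j)"
definition bv :: "'k poly \<Rightarrow> int \<Rightarrow> 'k::field poly3 poly"
  where "bv \<zeta> j = [:sA:] * pk.peval (cv + of_int (j - 1)) \<zeta> + [:sB:]"

lemma pcompose_peval: "pcompose (pk.peval d q) s = pk.peval (pcompose d s) q"
  by (induction q) (simp_all add: pk.peval_pCons pcompose_add pcompose_mult)

lemma pcompose_cv: "pcompose cv [:1, 1:] = cv + 1" "pcompose cv [:0, -1:] = - cv"
  by (simp_all add: cv_def pcompose_pCons one_pCons)

lemma char_poly3:
  assumes "CHAR('k::field) = p"
  shows "CHAR('k poly3) = p" "(of_int (j + int p) :: 'k poly3 poly) = of_int j" "(of_nat p :: 'k poly3 poly) = 0"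
proof -
  have c: "CHAR('k poly3) = p" "CHAR('k poly3 poly) = p" using assms by simp_all
  then show "CHAR('k poly3) = p" "(of_nat p :: 'k poly3 poly) = 0" using of_nat_eq_0_iff_char_dvd[of p, where 'a="'k poly3 poly"] by simp_all
  then show "(of_int (j + int p) :: 'k poly3 poly) = of_int j" by simp
qed

definition cyc :: "'k::field poly \<Rightarrow> nat \<Rightarrow> 'k poly3 poly" where "cyc \<zeta> p = cyclic_continuant av (bv \<zeta>) 0 p"

text \<open>The substitution c \<mapsto> c + 1 moves every index up by one. In characteristic p the
  entries have period p, so this is a rotation.\<close>

lemma cyc_shift:
  assumes "CHAR('k) = p" "p > 2"
  shows "pcompose (cyc \<zeta> p) [:1, 1:] = (cyc \<zeta> p :: 'k::field poly3 poly)"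
proof -
  have a: "pcompose (av j) [:1, 1:] = (av (j + 1) :: 'k poly3 poly)" for j
    by (simp only: av_def pcompose_mult pcompose_add pcompose_cv pcompose_const pcompose_of_int of_int_add of_int_1 add_ac)
  have "cv + 1 + of_int (j - 1) = (cv + of_int (j + 1 - 1) :: 'k poly3 poly)" for j :: int by simp
  then have b: "pcompose (bv \<zeta> j) [:1, 1:] = bv \<zeta> (j + 1)" for j
    by (simp only: bv_def pcompose_add pcompose_mult pcompose_peval pcompose_cv pcompose_of_int pcompose_const)
  have per: "av (j + int p) = (av j :: 'k poly3 poly)" "bv \<zeta> (j + int p) = bv \<zeta> j" for j
  proof -
    have "j + int p - 1 = (j - 1) + int p" by simp
    then show "av (j + int p) = (av j :: 'k poly3 poly)" "bv \<zeta> (j + int p) = bv \<zeta> j"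
      by (simp_all only: av_def bv_def char_poly3(2)[OF assms(1)])
  qed
  have "pcompose (cyc \<zeta> p) [:1, 1:] = cyclic_continuant av (bv \<zeta>) 1 p"
    unfolding cyc_def cyclic_continuant_def pcompose_diff pcompose_mult pcompose_continuant a b
    by (simp add: continuant_shift[of av 1 "bv \<zeta>"])
  also have "\<dots> = cyc \<zeta> p"
    using cyclic_continuant_rotate[of av p "bv \<zeta>" 0] per assms(2) by (simp add: cyc_def)
  finally show ?thesis .
qed

text \<open>The substitution c \<mapsto> -c sends a_j to -a_(-j) and, by the symmetry of \<zeta>,
  b_j to b_(1-j). This is the pattern of \<open>continuant_reverse\<close>, and the sign is (-1)^p =
  -1.\<close>

lemma cyc_reflect:
  assumes "CHAR('k) = p" "p > 2" "odd p" and \<zeta>: "pcompose \<zeta> [:-1, -1:] = \<zeta>"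
  shows "pcompose (cyc \<zeta> p) [:0, -1:] = - (cyc \<zeta> p :: 'k::field poly3 poly)"
proof -
  have per: "av (j + int p) = (av j :: 'k poly3 poly)" "bv \<zeta> (j + int p) = bv \<zeta> j" for j
  proof -
    have "j + int p - 1 = (j - 1) + int p" by simp
    then show "av (j + int p) = (av j :: 'k poly3 poly)" "bv \<zeta> (j + int p) = bv \<zeta> j"
      by (simp_all only: av_def bv_def char_poly3(2)[OF assms(1)])
  qed
  have a: "pcompose (av j) [:0, -1:] = (- av (- j) :: 'k poly3 poly)" for j
  proof -
    have "- cv + of_int j = - (cv + of_int (- j) :: 'k poly3 poly)" by simp
    then show ?thesis
      by (simp only: av_def pcompose_mult pcompose_add pcompose_cv pcompose_const pcompose_of_int mult_minus_right)
  qed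
  have b: "pcompose (bv \<zeta> j) [:0, -1:] = bv \<zeta> (1 - j)" for j
  proof -
    have "pk.peval (- cv + of_int (j - 1)) \<zeta> = pk.peval (- cv + of_int (j - 1)) (pcompose \<zeta> [:-1, -1:])"
      by (simp only: \<zeta>)
    also have "\<dots> = pk.peval (cv + of_int (1 - j - 1)) \<zeta>"
      by (simp add: pk.peval_pcompose pk.peval_pCons pk.\<iota>_minus pk.\<iota>_1 algebra_simps)
    finally show ?thesis
      by (simp only: bv_def pcompose_add pcompose_mult pcompose_peval pcompose_cv pcompose_of_int pcompose_const)
  qed
  obtain m where p: "p = Suc (Suc m)" using that[of "p - 2"] assms(2) by simp
  have "pcompose (cyc \<zeta> p) [:0, -1:]
    = (- 1) ^ p * continuant av (bv \<zeta>) (1 - 0 - int p) p - bv \<zeta> (1 - 0) * ((- 1) ^ (p - 2) * continuant av (bv \<zeta>) (1 - 1 - int (p - 2)) (p - 2))"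
    unfolding cyc_def cyclic_continuant_def pcompose_diff pcompose_mult pcompose_continuant a b
    by (simp only: continuant_reverse[of av "bv \<zeta>"] add_0_left)
  also have "\<dots> = - (continuant av (bv \<zeta>) (1 - int p) p - bv \<zeta> 1 * continuant av (bv \<zeta>) (2 - int p) (p - 2))"
    using assms(3) by (simp add: p)
  also have "continuant av (bv \<zeta>) (1 - int p) p = continuant av (bv \<zeta>) 1 p"
    using continuant_periodic[of av "int p" "bv \<zeta>" "1 - int p" p] per by simp
  also have "continuant av (bv \<zeta>) (2 - int p) (p - 2) = continuant av (bv \<zeta>) 2 (p - 2)"
    using continuant_periodic[of av "int p" "bv \<zeta>" "2 - int p" "p - 2"] per by simp
  also have "continuant av (bv \<zeta>) 1 p - bv \<zeta> 1 * continuant av (bv \<zeta>) 2 (p - 2) = cyc \<zeta> p"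
    using cyclic_continuant_rotate[of av p "bv \<zeta>" 0] per assms(2) by (simp add: cyc_def cyclic_continuant_def)
  finally show ?thesis .
qed

lemma cyc_factor:
  assumes "CHAR('k) = p" "p > 2" "pcompose \<zeta> [:-1, -1:] = \<zeta>"
  shows "\<exists>P. (cyc \<zeta> p :: 'k::field poly3 poly) = artin_schreier p * pcompose P (artin_schreier p ^ 2)"
proof (rule odd_shift_invariant[OF char_poly3(1)[OF assms(1)] _ assms(2) cyc_shift[OF assms(1,2)]])
  show p: "prime p" using assms prime_CHAR_semidom[where 'a='k] by simp
  show "pcompose (cyc \<zeta> p) [:0, -1:] = - (cyc \<zeta> p :: 'k poly3 poly)"
    using assms p prime_odd_nat by (intro cyc_reflect) auto
qed

text \<open>The reference case for the leading term. The degree in c is at most p, while (c^p - c)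
  P((c^p - c)^2) has degree p + 2p deg P; so P is constant and equals the coefficient \<lambda>^p of
  c^p.\<close>

lemma cyc_0:
  assumes "CHAR('k) = p" "p > 2"
  shows "(cyc 0 p :: 'k::field poly3 poly) = artin_schreier p * [:sL ^ p:]"
proof -
  have bv0: "bv 0 j = ([:sB:] :: 'k poly3 poly)" for j by (simp add: bv_def)
  have cvj: "cv + of_int j = ([:of_int j, 1:] :: 'k poly3 poly)" for j
    by (simp add: cv_def of_int_poly)
  have K: "degree (continuant av (bv 0) i n :: 'k poly3 poly) \<le> n \<and> coeff (continuant av (bv 0) i n :: 'k poly3 poly) n = sL ^ n" for i n
  proof (induction n rule: less_induct)
    case (less n)
    consider "n = 0" | "n = 1" | m where "n = Suc (Suc m)" by (metis One_nat_def not0_implies_Suc)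
    then show ?case
    proof cases
      case 2
      then show ?thesis by (simp add: av_def cvj)
    next
      case 3
      let ?K = "continuant av (bv 0) i (Suc m) :: 'k poly3 poly" and ?K' = "continuant av (bv 0) i m :: 'k poly3 poly"
      have eq: "continuant av (bv 0) i n = smult sL ([:of_int (i + 1 + int m), 1:] * ?K) - smult sB ?K'"
        by (simp only: 3 continuant.simps bv0 av_def cvj) (simp add: smult_add_right mult.commute)
      have K: "degree ?K \<le> Suc m" "coeff ?K (Suc m) = sL ^ Suc m" "degree ?K' \<le> m" using less[of "Suc m"] less[of m] 3 by auto
      have "degree (smult sL ([:of_int (i + 1 + int m), 1:] * ?K)) \<le> n"
        using K(1) 3 degree_smult_le[of sL "[:of_int (i + 1 + int m), 1:] * ?K"] degree_mult_le[of "[:of_int (i + 1 + int m), 1:]" ?K] by simp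
      moreover have "degree (smult sB ?K') \<le> n" using K(3) 3 degree_smult_le[of sB ?K'] by simp
      ultimately have "degree (continuant av (bv 0) i n :: 'k poly3 poly) \<le> n" unfolding eq by (rule degree_diff_le)
      moreover have "coeff (continuant av (bv 0) i n :: 'k poly3 poly) n = sL ^ n"
        unfolding eq using K by (simp add: 3 coeff_eq_0)
      ultimately show ?thesis by blast
    qed simp
  qed
  obtain P where P: "(cyc 0 p :: 'k poly3 poly) = artin_schreier p * pcompose P (artin_schreier p ^ 2)"
    using cyc_factor[OF assms, of 0] by auto
  have d: "degree (cyc 0 p :: 'k poly3 poly) \<le> p" "coeff (cyc 0 p :: 'k poly3 poly) p = sL ^ p"
  proof -
    have "degree (smult sB (continuant av (bv 0) 1 (p - 2) :: 'k poly3 poly)) \<le> p - 2"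
      using K[of 1 "p - 2"] degree_smult_le order_trans by blast
    then have *: "degree (smult sB (continuant av (bv 0) 1 (p - 2) :: 'k poly3 poly)) < p" using assms(2) by simp
    have eq: "cyc 0 p = continuant av (bv 0) 0 p - smult sB (continuant av (bv 0) 1 (p - 2) :: 'k poly3 poly)"
      by (simp add: cyc_def cyclic_continuant_def bv0)
    show "degree (cyc 0 p :: 'k poly3 poly) \<le> p"
      unfolding eq using * K[of 0 p] by (intro degree_diff_le) (simp_all del: degree_smult_eq)
    show "coeff (cyc 0 p :: 'k poly3 poly) p = sL ^ p"
      unfolding eq using K[of 0 p] coeff_eq_0[OF *] by simp
  qed
  have p1: "p > 1" using assms by simp
  note as = degree_artin_schreier[OF p1, where 'r="'k poly3"]
  have "sL ^ p \<noteq> (0 :: 'k poly3)" by (simp add: sL_def)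
  then have "cyc 0 p \<noteq> (0 :: 'k poly3 poly)" using d(2) by auto
  then have nz: "pcompose P (artin_schreier p ^ 2) \<noteq> 0" "artin_schreier p \<noteq> (0 :: 'k poly3 poly)" by (auto simp: P)
  have "degree (cyc 0 p :: 'k poly3 poly) = p + degree P * (2 * p)"
    unfolding P using nz as by (simp add: degree_mult_eq degree_pcompose degree_power_eq)
  then have "degree P = 0" using d(1) p1 by simp
  then obtain u where "P = [:u:]" by (metis degree_eq_zeroE)
  then have u: "cyc 0 p = artin_schreier p * [:u:]" using P by simp
  then have "coeff (cyc 0 p) p = u * coeff (artin_schreier p) p" by simp
  moreover have "coeff (artin_schreier p) p = (1 :: 'k poly3)" using as by metis
  ultimately have "u = sL ^ p" using d(2) by simp
  then show ?thesis using u by simp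
qed


text \<open>The two cancellation rules strip the right factors that the construction leaves on
  commutators of the lift.\<close>

locale HZ_filtered = HZ_antidifference \<iota> z e f h x y r
  for \<iota> :: "'k::field \<Rightarrow> 'a::ring_1" and z e f h x y r +
  fixes Fl :: "nat \<Rightarrow> 'a set" and p :: nat
  assumes char: "CHAR('k) = p" and p2: "p > 2"
    and Fl_add: "a \<in> Fl n \<Longrightarrow> b \<in> Fl n \<Longrightarrow> a + b \<in> Fl n" and Fl_mult: "a \<in> Fl m \<Longrightarrow> b \<in> Fl n \<Longrightarrow> a * b \<in> Fl (m + n)"
    and Fl_mono: "a \<in> Fl m \<Longrightarrow> m \<le> n \<Longrightarrow> a \<in> Fl n" and Fl_\<iota>: "\<iota> c \<in> Fl 0"
    and Fl_gen: "e \<in> Fl 0" "f \<in> Fl 0" "h \<in> Fl 0" "x \<in> Fl 1" "y \<in> Fl 1"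
    and cancel_e: "q \<in> Fl n \<Longrightarrow> q * e = 0 \<Longrightarrow> q = 0"
    and cancel_D: "q \<in> Fl n \<Longrightarrow> k > 0 \<Longrightarrow> q * ((h * h + 4 * e * f - 2 * h + 1) ^ k - 1) = 0 \<Longrightarrow> q = 0"
begin

lemma Fl_0: "0 \<in> Fl n" using Fl_mono[OF Fl_\<iota>[of 0]] by (simp add: \<iota>_0)
lemma Fl_1: "1 \<in> Fl n" using Fl_mono[OF Fl_\<iota>[of 1]] by (simp add: \<iota>_1)
lemma Fl_minus: "a \<in> Fl n \<Longrightarrow> - a \<in> Fl n" using Fl_mult[OF Fl_\<iota>[of "- 1"], of a n] by (simp add: \<iota>_minus \<iota>_1)
lemma Fl_diff: "a \<in> Fl n \<Longrightarrow> b \<in> Fl n \<Longrightarrow> a - b \<in> Fl n" using Fl_add[OF _ Fl_minus, of a n b] by simp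
lemma Fl_numeral: "a \<in> Fl n \<Longrightarrow> numeral k * a \<in> Fl n" using Fl_mult[OF Fl_\<iota>[of "numeral k"], of a n] by (simp add: \<iota>_numeral)
lemma Fl_mult0: "a \<in> Fl 0 \<Longrightarrow> b \<in> Fl n \<Longrightarrow> a * b \<in> Fl n" using Fl_mult[of a 0 b n] by simp
lemma Fl_mult0': "a \<in> Fl n \<Longrightarrow> b \<in> Fl 0 \<Longrightarrow> a * b \<in> Fl n" using Fl_mult[of a n b 0] by simp
lemma Fl_peval: "d \<in> Fl 0 \<Longrightarrow> peval d q \<in> Fl 0"
  by (induction q) (simp_all add: peval_pCons Fl_0 Fl_add Fl_\<iota> Fl_mult0)
lemma Fl_\<Delta>: "\<Delta> \<in> Fl 0" unfolding \<Delta>_def mult.assoc by (intro Fl_add Fl_diff Fl_mult0 Fl_gen Fl_numeral)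
lemma Fl_D: "D \<in> Fl 0" unfolding D_def by (intro Fl_add Fl_\<Delta> Fl_1)
lemma Fl_T: "T \<in> Fl 2"
proof -
  have 1: "x * x \<in> Fl 2" "x * y \<in> Fl 2" "y * y \<in> Fl 2"
    using Fl_mult[of _ 1 _ 1] Fl_gen by (simp_all add: numeral_2_eq_2)
  have 2: "a \<in> Fl 0 \<Longrightarrow> a \<in> Fl 2" for a by (erule Fl_mono) simp
  show ?thesis unfolding T_def R_def Z_def
    by (intro Fl_add Fl_diff Fl_numeral Fl_mult0 Fl_gen 1 2 Fl_peval Fl_\<Delta> Fl_D)
qed

section \<open>A commuting action of k[A, B, \<lambda>][c] on 2x2 matrices\<close>

sublocale mt: scalars "\<lambda>c. diag2 (\<iota> c)"
proof
  show "diag2 (\<iota> c) * u = u * diag2 (\<iota> c)" for c u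
    using \<iota>_comm by (cases u) (simp add: diag2_def)
qed (simp_all add: diag2_simps \<iota>_add \<iota>_mult \<iota>_1)

definition C :: "'a mat2" where "C = Mat2 0 1 D 0"
text \<open>This start vector commutes with scalar matrices. Right multiplication by C stays in the
  first row, even powers giving the left entry and odd powers the right one, so even and odd parts
  in c are separated.\<close>

definition w0 :: "'a mat2" where "w0 = Mat2 1 0 0 0"

lemma CC: "C * C = diag2 D" by (simp add: C_def diag2_def)

lemma C_diag: "D * g = g * D \<Longrightarrow> C * diag2 g = diag2 g * C" by (simp add: C_def diag2_def)

lemma w0_diag: "diag2 g * w0 = w0 * diag2 g" by (simp add: w0_def diag2_def)

text \<open>The variables A, B and \<lambda> act as the left factors found in
  \<open>lower_raise_zeta\<close> and \<open>raise_add_lower\<close>, and c acts as right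
  multiplication by C.\<close>

definition "act0 a v = diag2 (\<iota> a) * v"
definition "act1 = poly_scale act0 (\<lambda>v. diag2 (8 * e) * v)"
definition "act2 = poly_scale act1 (\<lambda>v. diag2 (- (8 * (e * T))) * v)"
definition "act3 = poly_scale act2 (\<lambda>v. diag2 (4 * x) * v)"
definition "act = poly_scale act3 (\<lambda>v. v * C)"

sublocale l1: module_operator act0 "\<lambda>v. diag2 (8 * e) * v"
  using mt.left.module_operator_axioms unfolding act0_def[abs_def] .

lemma numeral_4_8: "4 * (8 * u) = (8 * (4 * u) :: 'a)"
  by (simp add: mult.assoc[symmetric])

lemma act0_left: "diag2 g * act0 a v = act0 a (diag2 g * v)"
  unfolding act0_def by (rule mt.\<iota>_left_comm)

sublocale l2: module_operator act1 "\<lambda>v. diag2 (- (8 * (e * T))) * v"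
  unfolding act1_def
proof (rule l1.module_operator_ps)
  have "- (8 * (e * T)) * (8 * e) = 8 * e * - (8 * (e * T))"
    by (simp add: mult.assoc numeral_comm(2)[of e] numeral_comm(2)[of T] T_comm(1) T_comm(1)[THEN assoc_rule])
  then show "diag2 (- (8 * (e * T))) * (diag2 (8 * e) * u) = diag2 (8 * e) * (diag2 (- (8 * (e * T))) * u)" for u
    unfolding mult.assoc[symmetric] diag2_simps(3)[symmetric] by (simp only:)
qed (simp_all add: distrib_left act0_left)

lemma act1_left: "g * e = e * g \<Longrightarrow> diag2 g * act1 a v = act1 a (diag2 g * v)"
  unfolding act1_def
proof (rule l1.ps_comm)
  assume "g * e = e * g"
  then have "g * (8 * e) = 8 * e * g" by (simp add: mult.assoc numeral_comm(2)[of g])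
  then show "diag2 g * (diag2 (8 * e) * u) = diag2 (8 * e) * (diag2 g * u)" for u
    unfolding mult.assoc[symmetric] diag2_simps(3)[symmetric] by (simp only:)
qed (simp_all add: distrib_left act0_left)

sublocale l3: module_operator act2 "\<lambda>v. diag2 (4 * x) * v"
  unfolding act2_def
proof (rule l2.module_operator_ps)
  have "4 * x * - (8 * (e * T)) = - (8 * (e * T)) * (4 * x)"
    by (simp add: T_comm(1,4) T_comm(1,4)[THEN assoc_rule] ex ex[THEN assoc_rule] mult.assoc numeral_comm(2)[of x] numeral_comm(2)[of e] numeral_comm(2)[of T] numeral_4_8)
  then show "diag2 (4 * x) * (diag2 (- (8 * (e * T))) * u) = diag2 (- (8 * (e * T))) * (diag2 (4 * x) * u)" for u
    unfolding mult.assoc[symmetric] diag2_simps(3)[symmetric] by (simp only:)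
  show "diag2 (4 * x) * act1 a u = act1 a (diag2 (4 * x) * u)" for a u
    by (rule act1_left) (simp add: mult.assoc numeral_comm(2)[of e] ex)
qed (simp add: distrib_left)

lemma act0_right: "act0 a v * u = act0 a (v * u)" by (simp add: act0_def mult.assoc)
lemma act1_right: "act1 a v * u = act1 a (v * u)"
  unfolding act1_def by (rule l1.ps_comm) (simp_all add: distrib_right act0_right mult.assoc)
lemma act2_right: "act2 a v * u = act2 a (v * u)"
  unfolding act2_def by (rule l2.ps_comm) (simp_all add: distrib_right act1_right mult.assoc)
lemma act3_right: "act3 a v * u = act3 a (v * u)"
  unfolding act3_def by (rule l3.ps_comm) (simp_all add: distrib_right act2_right mult.assoc)

sublocale l4: module_operator act3 "\<lambda>v. v * C"
  unfolding act3_def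
  by (rule l3.module_operator_ps) (simp_all add: distrib_right act2_right mult.assoc)

sublocale ma: Modules.module act
  unfolding act_def by (rule l4.module_ps)

lemma act_mult: "act (q * q') v = act q (act q' v)" by simp

lemma act_left:
  assumes "g * e = e * g" "g * x = x * g" "g * T = T * g" shows "diag2 g * act q v = act q (diag2 g * v)"
proof -
  have "g * (- (8 * (e * T))) = - (8 * (e * T)) * g" "g * (4 * x) = 4 * x * g"
    using assms assms(1)[THEN assoc_rule] by (simp_all add: mult.assoc numeral_comm(2)[of g])
  then have c: "diag2 g * (diag2 (- (8 * (e * T))) * u) = diag2 (- (8 * (e * T))) * (diag2 g * u)"
    "diag2 g * (diag2 (4 * x) * u) = diag2 (4 * x) * (diag2 g * u)" for u
    unfolding mult.assoc[symmetric] diag2_simps(3)[symmetric] by (simp_all only:)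
  have 2: "diag2 g * act2 q v = act2 q (diag2 g * v)" for q v
    unfolding act2_def by (rule l2.ps_comm) (simp_all add: distrib_left act1_left assms c)
  have 3: "diag2 g * act3 q v = act3 q (diag2 g * v)" for q v
    unfolding act3_def by (rule l3.ps_comm) (simp_all add: distrib_left 2 c)
  show ?thesis
    unfolding act_def by (rule l4.ps_comm) (simp_all add: distrib_left 3 mult.assoc)
qed

lemma act_right: "u * C = C * u \<Longrightarrow> act q v * u = act q (v * u)"
  unfolding act_def by (rule l4.ps_comm) (simp_all add: distrib_right act3_right mult.assoc)

lemma act_gen:
  "act [:sA:] v = diag2 (8 * e) * v" "act [:sB:] v = diag2 (- (8 * (e * T))) * v" "act [:sL:] v = diag2 (4 * x) * v"
  "act cv v = v * C" "act [:sc3 a:] v = diag2 (\<iota> a) * v"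
proof -
  have c: "act [:u:] v = act3 u v" "act3 [:u':] v = act2 u' v" "act2 [:u'':] v = act1 u'' v" "act1 [:a:] v = act0 a v"
    for u u' u''
    unfolding act_def by (rule l4.ps_const, unfold act3_def, rule l3.ps_const, unfold act2_def, rule l2.ps_const,
       unfold act1_def, rule l1.ps_const)
  show "act [:sA:] v = diag2 (8 * e) * v" unfolding sA_def c unfolding act1_def by (rule l1.ps_X)
  show "act [:sB:] v = diag2 (- (8 * (e * T))) * v" unfolding sB_def c unfolding act2_def by (rule l2.ps_X)
  show "act [:sL:] v = diag2 (4 * x) * v" unfolding sL_def c unfolding act3_def by (rule l3.ps_X)
  show "act cv v = v * C" unfolding cv_def act_def by (rule l4.ps_X)
  show "act [:sc3 a:] v = diag2 (\<iota> a) * v" unfolding sc3_def c act0_def ..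
qed

lemma act_of_int: "act (of_int n) v = v * of_int n"
proof -
  have "act (of_nat n) v = v * of_nat n" for n
    by (induction n) (simp_all add: ma.scale_left_distrib distrib_left)
  then show ?thesis by (cases n) (simp_all add: ma.scale_left_diff_distrib ma.scale_minus_left right_diff_distrib)
qed

lemma act_cv: "act (cv + of_int n) v = v * (C + of_int n)"
  by (simp add: ma.scale_left_distrib act_gen act_of_int distrib_left)

lemma act_peval: "act (pk.peval (cv + of_int n) q) v = v * mt.peval (C + of_int n) q"
proof (induction q arbitrary: v)
  case (pCons a q)
  have "act (cv + of_int n) (act (pk.peval (cv + of_int n) q) v) = act (pk.peval (cv + of_int n) q) (act (cv + of_int n) v)"
    by (metis act_mult mult.commute)
  also have "\<dots> = v * (C + of_int n) * mt.peval (C + of_int n) q" unfolding pCons act_cv ..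
  finally have fin: "act (cv + of_int n) (act (pk.peval (cv + of_int n) q) v) = v * (C + of_int n) * mt.peval (C + of_int n) q" .
  have "act (pk.peval (cv + of_int n) (pCons a q)) v = diag2 (\<iota> a) * v + v * (C + of_int n) * mt.peval (C + of_int n) q"
    unfolding pk.peval_pCons by (simp only: ma.scale_left_distrib[of "[:sc3 a:]"] act_mult fin act_gen)
  then show ?case
    by (simp only: mt.peval_pCons distrib_left[of v "diag2 _"] mt.\<iota>_comm[of a v] mult.assoc)
qed simp

section \<open>The ladder operators\<close>

definition zeta :: "'k poly"
  where "zeta = 2 * pcompose r sqr + [:0, 1:] * pcompose (pcompose z [:-1, 1:]) sqr"

text \<open>This is the antidifference equation for r with one term moved to the other side.\<close>

lemma zeta_reflect: "pcompose zeta [:-1, -1:] = zeta"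
proof -
  have 1: "pcompose sqr [:-1, -1:] = (sqr1 :: 'k poly)" by (simp add: sqr_def sqr1_def pcompose_pCons)
  have 2: "pcompose 2 t = 2" "pcompose [:0, 1:] [:-1, -1:] = - [:1, 1 :: 'k:]" for t :: "'k poly"
    by (simp_all add: numeral_poly pcompose_pCons)
  have "pcompose zeta [:-1, -1:] = 2 * pcompose r sqr1 + - [:1, 1:] * pcompose (pcompose z [:-1, 1:]) sqr1"
    unfolding zeta_def pcompose_add pcompose_mult pcompose_assoc[symmetric, of _ sqr] 1 2 ..
  also have "2 * pcompose r sqr1 + - [:1, 1:] * pcompose (pcompose z [:-1, 1:]) sqr1 = zeta"
  proof -
    have "2 * a + - d * w = 2 * b + c * u" if "2 * (a - b) = c * u + d * w" for a b c d u w :: "'k poly"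
    proof -
      have "2 * a + - d * w = 2 * (a - b) - d * w + 2 * b" by (simp add: algebra_simps)
      then show ?thesis unfolding that by simp
    qed
    from this[OF r[unfolded antidifference_def]] show ?thesis by (simp only: zeta_def)
  qed
  finally show ?thesis .
qed

text \<open>If D v = v m^2, the quadratic relation says that D - (m + 1)^2 and D - (m - 1)^2, with m
  acting on the right, compose to zero on x v. Applying one factor thus leaves an eigenvector for
  the other; this is the projection, up to scaling, to the part for m + 1.\<close>

definition raise :: "'a mat2 \<Rightarrow> 'a mat2 \<Rightarrow> 'a mat2"
  where "raise m v = diag2 D * (diag2 x * v) - diag2 x * (v * ((m - 1) * (m - 1)))"

definition lower :: "'a mat2 \<Rightarrow> 'a mat2 \<Rightarrow> 'a mat2"
  where "lower m v = diag2 x * (v * ((m + 1) * (m + 1))) - diag2 D * (diag2 x * v)"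

lemma lower_raise: "lower m v = - raise (- m) v"
proof -
  have "(- m - 1) * (- m - 1) = (m + 1) * (m + 1)" for m :: "'a mat2"
    by (simp add: algebra_simps)
  then show ?thesis by (simp add: lower_def raise_def)
qed

lemma raise_minus: "raise m (- v) = - raise m v"
  by (simp add: raise_def)

lemma raise_eigen:
  assumes "diag2 D * v = v * (m * m)"
  shows "diag2 D * raise m v = raise m v * ((m + 1) * (m + 1))"
proof -
  let ?D = "diag2 D" and ?x = "diag2 x"
  have ar: "a * b = c \<Longrightarrow> a * (b * d) = c * d" for a b c d :: "'a mat2"
    by (simp add: mult.assoc[symmetric])
  have Q: "?D * (?D * ?x) - 2 * (?D * (?x * ?D)) + ?x * (?D * ?D) = 2 * (?D * ?x + ?x * ?D) - ?x"
    using arg_cong[OF D_quadratic, of diag2] by (simp add: diag2_simps diag2_numeral)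
  note n = distrib_left distrib_right left_diff_distrib right_diff_distrib mult.assoc small_numerals assms
  have "diag2 D * raise m v - raise m v * ((m + 1) * (m + 1))
     = (?D * (?D * ?x) - 2 * (?D * (?x * ?D)) + ?x * (?D * ?D)) * v - (2 * (?D * ?x + ?x * ?D) - ?x) * v"
    unfolding raise_def by (simp add: n assms[THEN ar])
  then show ?thesis unfolding Q by simp
qed

lemma lower_eigen:
  assumes "diag2 D * v = v * (m * m)"
  shows "diag2 D * lower m v = lower m v * ((m - 1) * (m - 1))"
proof -
  have "(- m + 1) * (- m + 1) = (m - 1) * (m - 1)" by (simp add: algebra_simps)
  then show ?thesis using raise_eigen[of v "- m"] assms by (simp add: lower_raise)
qed

lemma raise_add_lower: "raise m v + lower m v = diag2 (4 * x) * (v * m)"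
proof -
  have "diag2 (4 * x) = 4 * diag2 x" by (simp add: diag2_simps diag2_numeral)
  then show ?thesis
    by (simp add: raise_def lower_def distrib_left distrib_right left_diff_distrib right_diff_distrib small_numerals mult.assoc)
qed

lemma peval_eigen: "diag2 D * v = v * u \<Longrightarrow> diag2 (peval D q) * v = v * mt.peval u q"
proof (induction q)
  case (pCons a q)
  have "diag2 D * (diag2 (peval D q) * v) = diag2 (peval D q) * (diag2 D * v)"
    by (simp add: mult.assoc[symmetric] diag2_simps(3)[symmetric] peval_D_comm)
  also have "\<dots> = diag2 (peval D q) * v * u" using pCons.prems by (simp add: mult.assoc)
  also have "\<dots> = v * mt.peval u q * u" using pCons by simp
  also have "\<dots> = v * (u * mt.peval u q)" using mt.peval_comm[of u u q] by (simp add: mult.assoc)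
  finally show ?case
    by (simp add: peval_pCons mt.peval_pCons diag2_simps distrib_left distrib_right mult.assoc mt.\<iota>_comm[of a v])
qed (simp add: diag2_simps)

lemma lower_raise_zeta:
  assumes w: "diag2 D * v = v * (m * m)"
  shows "lower (m + 1) (raise m v) = diag2 (8 * e) * (v * mt.peval m zeta) + diag2 (- (8 * (e * T))) * v"
proof -
  let ?w = "pcompose z [:-1, 1:]"
  have d: "diag2 (x * y) = diag2 x * diag2 y" "diag2 (x + y) = diag2 x + diag2 y" "diag2 (x - y) = diag2 x - diag2 y"
    "diag2 (numeral n) = numeral n" for x y n
    by (simp_all add: diag2_simps diag2_numeral)
  have "(m + 1 + 1) * (m + 1 + 1) = (m + 2) * (m + 2)" by (simp add: add.assoc)
  then have "lower (m + 1) (raise m v) = diag2 x * (raise m v * ((m + 2) * (m + 2))) - diag2 D * (diag2 x * raise m v)"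
    unfolding lower_def by (simp only:)
  also have "\<dots> = 8 * (diag2 e * (2 * (v * mt.peval (m * m) r) + v * (m * mt.peval (m * m) ?w) - diag2 T * v))"
    unfolding raise_def
  proof (rule ladder_product[where Z = "diag2 Z" and R = "diag2 R"])
    show "diag2 Z * v = v * mt.peval (m * m) ?w" "diag2 R * v = v * mt.peval (m * m) r"
      unfolding Z_D R_def by (rule peval_eigen[OF w])+
    show "mt.peval (m * m) ?w * m = m * mt.peval (m * m) ?w"
      by (rule mt.peval_comm[symmetric]) (simp add: mult.assoc)
  qed (rule arg_cong[OF x_quadratic, of diag2, unfolded d] arg_cong[OF D_quadratic, of diag2, unfolded d]
      arg_cong[OF T_formula, of diag2, unfolded d] w)+
  also have "\<dots> = diag2 (8 * e) * (v * mt.peval m zeta) + diag2 (- (8 * (e * T))) * v"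
  proof -
    have sq: "mt.peval m (pcompose q sqr) = mt.peval (m * m) q" for q
      by (simp add: mt.peval_pcompose sqr_def mt.peval_pCons mt.\<iota>_0 mt.\<iota>_1)
    have "mt.peval m zeta = mt.peval (m * m) r + mt.peval (m * m) r + m * mt.peval (m * m) ?w"
      unfolding zeta_def mult_2 by (simp only: mt.peval_add mt.peval_mult mt.peval_X sq)
    then show ?thesis by (simp add: diag2_simps diag2_numeral distrib_left distrib_right right_diff_distrib left_diff_distrib
        mult.assoc small_numerals)
  qed
  finally show ?thesis .
qed


section \<open>Taking p steps of the ladder\<close>

lemma of_nat_p_mat: "(of_nat p :: 'a mat2) = 0"
  using mt.\<iota>_of_nat[of p] of_nat_eq_0_iff_char_dvd[of p, where 'a='k] char by (simp add: mt.\<iota>_0)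

primrec ups :: "nat \<Rightarrow> 'a mat2" where
  "ups 0 = w0" | "ups (Suc n) = raise (C + of_int (int n)) (ups n)"

primrec downs :: "nat \<Rightarrow> 'a mat2" where
  "downs 0 = w0" | "downs (Suc n) = lower (C + of_int (- int n)) (downs n)"

lemma w0_eigen: "diag2 D * w0 = w0 * (C * C)"
  by (simp add: CC w0_diag)

lemma ups_eigen: "diag2 D * ups n = ups n * ((C + of_int (int n)) * (C + of_int (int n)))"
proof (induction n)
  case (Suc n)
  have "C + of_int (int n) + 1 = C + of_int (int (Suc n))" by simp
  with raise_eigen[OF Suc] show ?case by (simp only: ups.simps)
qed (simp add: w0_eigen)

lemma downs_eigen: "diag2 D * downs n = downs n * ((C + of_int (- int n)) * (C + of_int (- int n)))"
proof (induction n)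
  case (Suc n)
  have "C + of_int (- int n) - 1 = C + of_int (- int (Suc n))" by simp
  with lower_eigen[OF Suc] show ?case by (simp only: downs.simps)
qed (simp add: w0_eigen)

lemma act_av: "act (av j) v = diag2 (4 * x) * (v * (C + of_int j))"
  unfolding av_def act_mult by (simp only: act_gen act_cv)

lemma act_bv: "act (bv zeta j) v = diag2 (8 * e) * (v * mt.peval (C + of_int (j - 1)) zeta) + diag2 (- (8 * (e * T))) * v"
  unfolding bv_def ma.scale_left_distrib act_mult by (simp only: act_gen act_peval)

text \<open>Replace raising by 4 x (v m) minus lowering; lowering undoes the previous raising up to
  the factor b. The result is the recursion of a continuant.\<close>

lemma ups_rec: "ups (Suc (Suc n)) = act (av (int (Suc n))) (ups (Suc n)) - act (bv zeta (int (Suc n))) (ups n)"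
proof -
  have e: "C + of_int (int n) + 1 = C + of_int (int (Suc n))" "int (Suc n) - 1 = int n" by simp_all
  have "lower (C + of_int (int (Suc n))) (ups (Suc n)) = act (bv zeta (int (Suc n))) (ups n)"
    using lower_raise_zeta[OF ups_eigen[of n]] unfolding act_bv e by (simp only: ups.simps)
  then show ?thesis
    using raise_add_lower[of "C + of_int (int (Suc n))" "ups (Suc n)"]
    unfolding act_av by (simp only: ups.simps(2)[of "Suc n"]) (metis add_diff_cancel_right')
qed

text \<open>Lowering at m is minus raising at -m, so the argument for going up applies; the symmetry
  of \<zeta> brings the argument -m back to m - 1.\<close>

lemma downs_rec: "downs (Suc (Suc n)) = act (av (- int (Suc n))) (downs (Suc n)) - act (bv zeta (- int n)) (downs n)"
proof -
  let ?m = "C + of_int (- int n)"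
  have e: "C + of_int (- int (Suc n)) = ?m - 1" by simp
  have "raise (?m - 1) (lower ?m (downs n)) = lower (- ?m + 1) (raise (- ?m) (downs n))"
    by (simp add: lower_raise raise_minus)
  also have "\<dots> = diag2 (8 * e) * (downs n * mt.peval (- ?m) zeta) + diag2 (- (8 * (e * T))) * downs n"
    by (rule lower_raise_zeta) (simp only: minus_mult_minus downs_eigen)
  also have "mt.peval (- ?m) zeta = mt.peval (- ?m) (pcompose zeta [:-1, -1:])" by (simp only: zeta_reflect)
  also have "\<dots> = mt.peval (C + of_int (- int n - 1)) zeta"
    by (simp add: mt.peval_pcompose mt.peval_pCons mt.\<iota>_minus mt.\<iota>_1 algebra_simps diag2_simps)
  finally have "raise (?m - 1) (downs (Suc n)) = act (bv zeta (- int n)) (downs n)"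
    by (simp only: act_bv downs.simps)
  then show ?thesis
    using raise_add_lower[of "?m - 1" "downs (Suc n)"]
    unfolding act_av e by (simp only: downs.simps(2)[of "Suc n"] e) (metis add_diff_cancel_left')
qed

lemma ups_1_downs_1: "ups 1 = act (av 0) w0 - downs 1"
  using raise_add_lower[of "C + of_int 0" w0] unfolding act_av by (simp add: eq_diff_eq)

abbreviation "K \<equiv> continuant av (bv zeta)"

text \<open>A two-term recursion needs two start vectors; \<open>downs 1\<close> takes the place of
  a vector one step before \<open>w0\<close>.\<close>

lemma ups_continuant: "ups (Suc n) = act (K 0 (Suc n)) w0 - act (K 1 n) (downs 1)"
proof (induction n rule: less_induct)
  case (less n)
  consider "n = 0" | "n = 1" | m where "n = Suc (Suc m)" by (metis One_nat_def not0_implies_Suc)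
  then show ?case
  proof cases
    case 1
    then show ?thesis using ups_1_downs_1 by simp
  next
    case 2
    have "ups 2 = act (av 1) (ups 1) - act (bv zeta 1) w0"
      using ups_rec[of 0] by (simp add: numeral_2_eq_2)
    with 2 show ?thesis
      unfolding ups_1_downs_1 by (simp add: ma.scale_right_diff_distrib ma.scale_left_diff_distrib numeral_2_eq_2)
  next
    case 3
    have i: "0 + 1 + int (Suc m) = int (Suc (Suc m))" "1 + 1 + int m = int (Suc (Suc m))" by simp_all
    have "ups (Suc n) = act (av (int (Suc (Suc m)))) (ups (Suc (Suc m))) - act (bv zeta (int (Suc (Suc m)))) (ups (Suc m))"
      unfolding 3 by (rule ups_rec)
    also have "ups (Suc (Suc m)) = act (K 0 (Suc (Suc m))) w0 - act (K 1 (Suc m)) (downs 1)" by (rule less) (simp add: 3)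
    also have "ups (Suc m) = act (K 0 (Suc m)) w0 - act (K 1 m) (downs 1)" by (rule less) (simp add: 3)
    finally show ?thesis
      unfolding 3 continuant.simps(3)[of _ _ 0 "Suc m"] continuant.simps(3)[of _ _ 1 m] i
      by (simp only: ma.scale_right_diff_distrib ma.scale_left_diff_distrib act_mult) simp
  qed
qed

lemma downs_continuant: "downs (Suc n) = act (K (- int n) (Suc n)) w0 - act (K (- int n) n) (ups 1)"
proof (induction n rule: less_induct)
  case (less n)
  consider "n = 0" | "n = 1" | m where "n = Suc (Suc m)" by (metis One_nat_def not0_implies_Suc)
  then show ?case
  proof cases
    case 1
    then show ?thesis using ups_1_downs_1 by simp
  next
    case 2
    have "downs 2 = act (av (- 1)) (downs 1) - act (bv zeta 0) w0"
      using downs_rec[of 0] by (simp add: numeral_2_eq_2)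
    moreover have "downs 1 = act (av 0) w0 - ups 1" using ups_1_downs_1 by simp
    moreover have "K (- 1) 2 = av (- 1) * av 0 - bv zeta 0" using continuant_left[of av "bv zeta" "- 1" 0] by (simp add: numeral_2_eq_2)
    ultimately show ?thesis using 2
      by (simp add: ma.scale_right_diff_distrib ma.scale_left_diff_distrib numeral_2_eq_2 mult.commute[of "av 0"])
  next
    case 3
    have i: "- int n + 1 = - int (Suc m)" "- int n + 2 = - int m" by (simp_all add: 3)
    have "downs (Suc n) = act (av (- int n)) (downs (Suc (Suc m))) - act (bv zeta (- int (Suc m))) (downs (Suc m))"
      unfolding 3 by (rule downs_rec)
    also have "downs (Suc (Suc m)) = act (K (- int (Suc m)) (Suc (Suc m))) w0 - act (K (- int (Suc m)) (Suc m)) (ups 1)"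
      by (rule less) (simp add: 3)
    also have "downs (Suc m) = act (K (- int m) (Suc m)) w0 - act (K (- int m) m) (ups 1)" by (rule less) (simp add: 3)
    finally have d: "downs (Suc n) = act (av (- int n)) (act (K (- int (Suc m)) (Suc (Suc m))) w0 - act (K (- int (Suc m)) (Suc m)) (ups 1))
       - act (bv zeta (- int (Suc m))) (act (K (- int m) (Suc m)) w0 - act (K (- int m) m) (ups 1))" .
    have "K (- int n) (Suc n) = av (- int n) * K (- int (Suc m)) (Suc (Suc m)) - bv zeta (- int (Suc m)) * K (- int m) (Suc m)"
      using continuant_left[of av "bv zeta" "- int n" "Suc m"] unfolding i by (simp only: 3)
    moreover have "K (- int n) n = av (- int n) * K (- int (Suc m)) (Suc m) - bv zeta (- int (Suc m)) * K (- int m) m"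
      using continuant_left[of av "bv zeta" "- int n" m] unfolding i by (simp only: 3)
    ultimately show ?thesis
      unfolding d by (simp only: ma.scale_right_diff_distrib ma.scale_left_diff_distrib act_mult) simp
  qed
qed

text \<open>Modulo p the indices of both ladders agree. After rewriting by
  \<open>ups_1_downs_1\<close> the contributions of \<open>downs 1\<close> cancel, and the
  coefficients of \<open>w0\<close> combine to the cyclic continuant.\<close>

lemma cyc_w0: "act (cyc zeta p) w0 = ups p + downs p"
proof -
  obtain m where p: "p = Suc (Suc m)" using that[of "p - 2"] p2 by simp
  have per: "av (j + int p) = (av j :: 'k poly3 poly)" "bv zeta (j + int p) = bv zeta j" for j
  proof -
    have "j + int p - 1 = (j - 1) + int p" by simp
    then show "av (j + int p) = (av j :: 'k poly3 poly)" "bv zeta (j + int p) = bv zeta j"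
      by (simp_all only: av_def bv_def char_poly3(2)[OF char])
  qed
  have i: "- int (Suc m) + int p = 1" by (simp add: p)
  have K: "K (- int (Suc m)) n = K 1 n" for n
    using continuant_periodic[of av "int p" "bv zeta" "- int (Suc m)" n, OF per] unfolding i ..
  have "downs p = act (K 1 p) w0 - act (K 1 (Suc m)) (act (av 0) w0 - downs 1)"
    using downs_continuant[of "Suc m"] unfolding K p ups_1_downs_1 .
  moreover have "ups p = act (K 0 p) w0 - act (K 1 (Suc m)) (downs 1)"
    using ups_continuant[of "Suc m"] unfolding p .
  moreover have "K 1 p = av 0 * K 1 (Suc m) - bv zeta 0 * K 1 m"
    using continuant.simps(3)[of av "bv zeta" 1 m] per[of 0] by (simp add: p)
  ultimately have "ups p + downs p = act (K 0 p + (av 0 * K 1 (Suc m) - bv zeta 0 * K 1 m) - K 1 (Suc m) * av 0) w0"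
    by (simp only: ma.scale_right_diff_distrib ma.scale_left_diff_distrib ma.scale_left_distrib act_mult) simp
  also have "K 0 p + (av 0 * K 1 (Suc m) - bv zeta 0 * K 1 m) - K 1 (Suc m) * av 0 = cyc zeta p"
    by (simp add: cyc_def cyclic_continuant_def p)
  finally show ?thesis ..
qed

text \<open>After p steps the eigenvalues (C + p)^2 and (C - p)^2 both return to C^2 = D.\<close>

lemma cyc_D: "diag2 D * act (cyc zeta p) w0 = act (cyc zeta p) w0 * diag2 D"
  unfolding cyc_w0 distrib_left distrib_right ups_eigen downs_eigen
  by (simp add: of_nat_p_mat CC)

end

lemma (in module_operator) ps_closed:
  assumes "0 \<in> V" "\<And>u v. u \<in> V \<Longrightarrow> v \<in> V \<Longrightarrow> u + v \<in> V" "\<And>a u. u \<in> V \<Longrightarrow> s a u \<in> V" "\<And>u. u \<in> V \<Longrightarrow> \<phi> u \<in> V" "m \<in> V"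
  shows "ps q m \<in> V"
  by (induction q) (simp_all add: ps_pCons assms)

context HZ_filtered
begin

section \<open>Dividing the continuant by c^p - c\<close>

lemma act_artin_schreier: "act (artin_schreier n) v = v * (C ^ n - C)"
proof -
  have "act (cv ^ n) v = v * C ^ n" for n
    by (induction n) (simp_all add: act_mult act_gen mult.assoc power_commutes)
  then show ?thesis
    by (simp add: artin_schreier_def cv_def[symmetric] ma.scale_left_diff_distrib act_gen right_diff_distrib)
qed

definition "k2 = p div 2"
text \<open>With p = 2 k2 + 1 this is the even cofactor in c^p - c = c (D^k2 - 1).\<close>

definition "s1 = D ^ k2 - 1"

lemma prime_p: "prime p"
  using char p2 prime_CHAR_semidom[where 'a='k] by simp

lemma p_k2: "p = Suc (2 * k2)" "k2 > 0"
  using prime_odd_nat[OF prime_p p2] p2 by (auto simp: k2_def)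

lemma power_p: "a ^ p = a * a ^ (2 * k2)" for a :: "'b::monoid_mult"
  by (metis p_k2(1) power_Suc)

lemma C_power: "C ^ p - C = C * diag2 s1"
proof -
  have "C ^ (2 * k2) = diag2 (D ^ k2)" by (simp add: power_mult power2_eq_square CC diag2_power)
  then show ?thesis by (simp add: power_p s1_def diag2_simps right_diff_distrib)
qed

lemma s1_comm: "e * s1 = s1 * e" "h * s1 = s1 * h" "D * s1 = s1 * D"
proof -
  have "g * D ^ n = D ^ n * g" if "g * D = D * g" for g n
    by (rule power_commuting_commutes[OF that[symmetric], symmetric])
  then show "e * s1 = s1 * e" "h * s1 = s1 * h" "D * s1 = s1 * D"
    by (simp_all add: s1_def D_comm right_diff_distrib left_diff_distrib)
qed

lemma act_artin_schreier2: "act (artin_schreier p ^ 2) v = v * diag2 (D * s1 * s1)"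
proof -
  have "(C * diag2 s1) * (C * diag2 s1) = C * (diag2 s1 * C) * diag2 s1" by (simp add: mult.assoc)
  also have "\<dots> = diag2 (D * s1 * s1)"
    by (simp add: C_diag[OF s1_comm(3), symmetric] diag2_simps) (simp add: mult.assoc[symmetric] CC)
  finally show ?thesis
    by (simp add: power2_eq_square act_mult act_artin_schreier C_power mult.assoc)
qed

text \<open>As a function of c the element D s1^2 is (c^p - c)^2, invariant under c \<mapsto> c + 1.
  Left and right multiplication by it therefore agree on x.\<close>

lemma x_comm_sigma: "(D * s1 * s1) * x = x * (D * s1 * s1)"
proof -
  define \<sigma> :: "'k poly" where "\<sigma> = [:0, 1:] * ([:0, 1:] ^ k2 - 1) * ([:0, 1:] ^ k2 - 1)"
  have "peval D \<sigma> = D * s1 * s1" by (simp add: \<sigma>_def s1_def peval_mult peval_diff peval_power del: mult_pCons_left)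
  moreover have "pcompose \<sigma> sqr1 = pcompose \<sigma> sqr"
  proof -
    have e: "sqr = [:0, 1:] * [:0, 1 :: 'k:]" "sqr1 = pcompose sqr [:1, 1 :: 'k:]"
      by (simp_all add: sqr_def sqr1_def pcompose_pCons)
    have "pcompose \<sigma> sqr = ([:0, 1:] * ([:0, 1:] ^ (2 * k2) - 1)) * ([:0, 1:] * ([:0, 1:] ^ (2 * k2) - 1))"
    proof -
      have "pcompose [:0, 1:] sqr = [:0, 1:] * [:0, 1 :: 'k:]" by (simp add: e(1) pcompose_pCons)
      then show ?thesis
        unfolding \<sigma>_def pcompose_mult pcompose_diff pcompose_power pcompose_1
        by (simp only: power_mult power2_eq_square mult_ac power_mult_distrib)
    qed
    also have "[:0, 1:] * ([:0, 1:] ^ (2 * k2) - 1) = (artin_schreier p :: 'k poly)"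
      by (simp only: artin_schreier_def power_p right_diff_distrib mult_1_right)
    finally have "pcompose \<sigma> sqr = artin_schreier p * artin_schreier p" .
    moreover from this have "pcompose \<sigma> sqr1 = artin_schreier p * artin_schreier p"
      unfolding e(2) pcompose_assoc by (simp only: pcompose_mult artin_schreier_shift[OF char prime_p])
    ultimately show ?thesis by simp
  qed
  ultimately show ?thesis using bimodule_peval[of \<sigma>] by simp
qed

definition P :: "'k poly3 poly" where "P = (SOME P. cyc zeta p = artin_schreier p * pcompose P (artin_schreier p ^ 2))"
definition Q :: "'k poly3 poly" where "Q = pcompose P (artin_schreier p ^ 2)"

lemma cyc_Q: "cyc zeta p = artin_schreier p * Q"
  using someI_ex[OF cyc_factor[OF char p2 zeta_reflect]] by (simp add: Q_def P_def)

lemma act3_closed: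
  assumes "0 \<in> V" "\<And>u v. u \<in> V \<Longrightarrow> v \<in> V \<Longrightarrow> u + v \<in> V" "\<And>g u. u \<in> V \<Longrightarrow> diag2 g * u \<in> V" "v \<in> V"
  shows "act3 q v \<in> V"
proof -
  have 0: "act0 a v \<in> V" if "v \<in> V" for a v using assms that by (simp add: act0_def)
  have 1: "act1 a v \<in> V" if "v \<in> V" for a v unfolding act1_def by (rule l1.ps_closed) (use assms that 0 in auto)
  have 2: "act2 a v \<in> V" if "v \<in> V" for a v unfolding act2_def by (rule l2.ps_closed) (use assms that 1 in auto)
  show ?thesis unfolding act3_def by (rule l3.ps_closed) (use assms 2 in auto)
qed

lemma act_const: "act [:u:] v = act3 u v" unfolding act_def by (rule l4.ps_const)

lemma act_pcompose_pCons: "act (pcompose (pCons u q) t) v = act3 u v + act t (act (pcompose q t) v)"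
  by (simp only: pcompose_pCons ma.scale_left_distrib act_mult act_const)

definition X' :: 'a where "X' = (THE a. act Q w0 = Mat2 a 0 0 0)"

text \<open>The inner argument (c^p - c)^2 acts as a scalar matrix from the right and the
  coefficients act from the left, so the action never leaves the upper left entry.\<close>

lemma act_Q: "act Q w0 = Mat2 X' 0 0 0"
proof -
  define V where "V = {Mat2 a 0 0 0 | a :: 'a. True}"
  have V: "0 \<in> V" "\<And>u v. u \<in> V \<Longrightarrow> v \<in> V \<Longrightarrow> u + v \<in> V" "\<And>g u. u \<in> V \<Longrightarrow> diag2 g * u \<in> V" "\<And>g u. u \<in> V \<Longrightarrow> u * diag2 g \<in> V"
    "w0 \<in> V"
    by (auto simp: V_def zero_mat2_def diag2_def w0_def)
  have "act (pcompose q (artin_schreier p ^ 2)) v \<in> V" if "v \<in> V" for q v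
  proof (induction q)
    case (pCons u q)
    then show ?case unfolding act_pcompose_pCons act_artin_schreier2 by (intro V act3_closed that)
  qed (simp add: V)
  then obtain a where "act Q w0 = Mat2 a 0 0 0" using V(5) unfolding Q_def V_def by blast
  then show ?thesis unfolding X'_def by simp
qed

section \<open>The leading term of the lift\<close>

definition Fm :: "nat \<Rightarrow> 'a mat2 set" where "Fm n = {Mat2 a b c d | a b c d. a \<in> Fl n \<and> b \<in> Fl n \<and> c \<in> Fl n \<and> d \<in> Fl n}"

lemma Fm_add: "u \<in> Fm n \<Longrightarrow> v \<in> Fm n \<Longrightarrow> u + v \<in> Fm n"
  by (fastforce simp: Fm_def intro: Fl_add)
lemma Fm_minus: "u \<in> Fm n \<Longrightarrow> - u \<in> Fm n"
  by (fastforce simp: Fm_def intro: Fl_minus)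
lemma Fm_0: "0 \<in> Fm n"
  by (simp add: Fm_def zero_mat2_def Fl_0)
lemma Fm_mono: "u \<in> Fm m \<Longrightarrow> m \<le> n \<Longrightarrow> u \<in> Fm n"
  using Fl_mono by (fastforce simp: Fm_def)
lemma Fm_diag: "g \<in> Fl k \<Longrightarrow> u \<in> Fm n \<Longrightarrow> diag2 g * u \<in> Fm (n + k)"
proof -
  assume "g \<in> Fl k" "u \<in> Fm n"
  then obtain a b c d where u: "u = Mat2 a b c d" "a \<in> Fl n" "b \<in> Fl n" "c \<in> Fl n" "d \<in> Fl n" by (auto simp: Fm_def)
  have "diag2 g * u = Mat2 (g * a) (g * b) (g * c) (g * d)" by (simp add: u diag2_def)
  then show ?thesis
    using Fl_mult[OF \<open>g \<in> Fl k\<close>, of _ n] u unfolding Fm_def add.commute[of n k] by auto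
qed
lemma Fm_C: "u \<in> Fm n \<Longrightarrow> u * C \<in> Fm n"
  by (auto simp: Fm_def C_def intro: Fl_mult0'[OF _ Fl_D])
lemma Fm_w0: "w0 \<in> Fm 0"
  by (simp add: Fm_def w0_def Fl_0 Fl_1)

text \<open>Coefficients are measured by how far they raise the filtration: A counts 0, \<lambda>
  counts 1 and B counts 2.\<close>

definition W :: "nat \<Rightarrow> 'k poly3 set" where "W n = {q. \<forall>d. \<forall>v\<in>Fm d. act3 q v \<in> Fm (d + n)}"

lemma W_0: "0 \<in> W n" by (simp add: W_def Fm_0)
lemma W_add: "q \<in> W n \<Longrightarrow> q' \<in> W n \<Longrightarrow> q + q' \<in> W n" by (simp add: W_def l4.scale_left_distrib Fm_add)
lemma W_minus: "q \<in> W n \<Longrightarrow> - q \<in> W n" by (simp add: W_def l4.scale_minus_left Fm_minus)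
lemma W_mult: "q \<in> W m \<Longrightarrow> q' \<in> W n \<Longrightarrow> q * q' \<in> W (m + n)"
  by (force simp: W_def l4.scale_scale[symmetric] add.assoc add.commute[of m] simp del: l4.scale_scale)
lemma W_mono: "q \<in> W m \<Longrightarrow> m \<le> n \<Longrightarrow> q \<in> W n"
  unfolding W_def using Fm_mono by fastforce

lemma act3_gen: "act3 sA v = diag2 (8 * e) * v" "act3 sB v = diag2 (- (8 * (e * T))) * v" "act3 sL v = diag2 (4 * x) * v"
   "act3 (sc3 a) v = diag2 (\<iota> a) * v"
  using act_gen unfolding act_const by auto

lemma W_gen: "sA \<in> W 0" "sB \<in> W 2" "sL \<in> W 1" "sc3 a \<in> W 0" "1 \<in> W 0"
  using Fm_diag[OF Fl_numeral[OF Fl_gen(1)], of _ _ "num.Bit0 (num.Bit0 (num.Bit0 num.One))"]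
    Fm_diag[OF Fl_minus[OF Fl_numeral[OF Fl_mult[OF Fl_gen(1) Fl_T], of "num.Bit0 (num.Bit0 (num.Bit0 num.One))"]]]
    Fm_diag[OF Fl_numeral[OF Fl_gen(4), of "num.Bit0 (num.Bit0 num.One)"]] Fm_diag[OF Fl_\<iota>[of a]]
  by (auto simp: W_def act3_gen)

definition CW :: "nat \<Rightarrow> 'k poly3 poly set" where "CW n = {q. \<forall>i. coeff q i \<in> W n}"

lemma CW_add: "q \<in> CW n \<Longrightarrow> q' \<in> CW n \<Longrightarrow> q + q' \<in> CW n" by (simp add: CW_def W_add)
lemma CW_minus: "q \<in> CW n \<Longrightarrow> - q \<in> CW n" by (simp add: CW_def W_minus)
lemma CW_diff: "q \<in> CW n \<Longrightarrow> q' \<in> CW n \<Longrightarrow> q - q' \<in> CW n" using CW_add[OF _ CW_minus, of q n q'] by simp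
lemma CW_mono: "q \<in> CW m \<Longrightarrow> m \<le> n \<Longrightarrow> q \<in> CW n" using W_mono by (auto simp: CW_def)
lemma CW_mult: "q \<in> CW m \<Longrightarrow> q' \<in> CW n \<Longrightarrow> q * q' \<in> CW (m + n)"
proof -
  assume a: "q \<in> CW m" "q' \<in> CW n"
  have "sum g A \<in> W l" if "\<And>i. g i \<in> W l" for g l and A :: "nat set"
    using that by (induction A rule: infinite_finite_induct) (auto simp: W_0 W_add)
  then show ?thesis using a by (auto simp: CW_def coeff_mult W_mult)
qed
lemma CW_const: "u \<in> W n \<Longrightarrow> [:u:] \<in> CW n" by (auto simp: CW_def W_0 coeff_pCons split: nat.split)
lemma CW_1: "1 \<in> CW 0" using CW_const[OF W_gen(5)] by (simp add: one_pCons)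
lemma CW_of_int: "of_int j \<in> CW 0"
proof -
  have "of_nat m \<in> CW 0" for m by (induction m) (auto intro: CW_add CW_1 CW_const[OF W_0, simplified])
  then show ?thesis by (cases j) (auto intro!: CW_diff CW_minus CW_1)
qed
lemma CW_cv: "cv \<in> CW 0" by (auto simp: CW_def cv_def coeff_pCons W_0 W_gen split: nat.split)
lemma CW_peval: "d \<in> CW 0 \<Longrightarrow> pk.peval d q \<in> CW 0"
  by (induction q) (auto simp: pk.peval_pCons intro!: CW_add CW_const W_gen W_0 CW_mult[of _ 0 _ 0, simplified] CW_const[OF W_0, simplified])
lemma CW_av: "av j \<in> CW 1"
  unfolding av_def using CW_mult[OF CW_const[OF W_gen(3)] CW_add[OF CW_cv CW_of_int[of j]]] by simp
lemma CW_bv_diff: "bv \<zeta> j - bv 0 j \<in> CW 0"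
  using CW_mult[OF CW_const[OF W_gen(1)] CW_peval[OF CW_add[OF CW_cv CW_of_int[of "j - 1"]]]] by (simp add: bv_def)
lemma CW_bv: "bv \<zeta> j \<in> CW 2"
proof -
  have "bv \<zeta> j = (bv \<zeta> j - bv 0 j) + [:sB:]" by (simp add: bv_def)
  then show ?thesis using CW_add[OF CW_mono[OF CW_bv_diff, of 2 \<zeta> j] CW_const[OF W_gen(2)]] by simp
qed

lemma CW_continuant: "continuant av (bv \<zeta>) i n \<in> CW n"
proof (induction n rule: less_induct)
  case (less n)
  consider "n = 0" | "n = 1" | m where "n = Suc (Suc m)" by (metis One_nat_def not0_implies_Suc)
  then show ?case
  proof cases
    case 3
    show ?thesis unfolding 3 continuant.simps
      using CW_mult[OF CW_av less[of "Suc m"]] CW_mult[OF CW_bv less[of m]] 3 by (auto intro: CW_diff)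
  qed (use CW_1 CW_av in auto)
qed

text \<open>Each b = A \<zeta> + B may have weight 2, but its difference from the value B at \<zeta>
  = 0 has weight 0. So changing \<zeta> costs two in weight.\<close>

lemma CW_continuant_diff: "continuant av (bv \<zeta>) i (Suc (Suc n)) - continuant av (bv 0) i (Suc (Suc n)) \<in> CW n"
proof (induction n rule: less_induct)
  case (less n)
  let ?K = "\<lambda>n. continuant av (bv \<zeta>) i n" and ?K' = "\<lambda>n. continuant av (bv 0) i n"
  define j where "j = i + 1 + int n"
  have eq: "?K (Suc (Suc n)) - ?K' (Suc (Suc n))
    = av j * (?K (Suc n) - ?K' (Suc n)) - ((bv \<zeta> j - bv 0 j) * ?K n + bv 0 j * (?K n - ?K' n))"
    by (simp add: j_def algebra_simps)
  have 1: "av j * (?K (Suc n) - ?K' (Suc n)) \<in> CW n"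
  proof (cases n)
    case (Suc m)
    with CW_mult[OF CW_av less[of m]] show ?thesis by simp
  qed (simp add: CW_const[OF W_0, simplified])
  have 2: "(bv \<zeta> j - bv 0 j) * ?K n \<in> CW n" using CW_mult[OF CW_bv_diff CW_continuant[of \<zeta> i n], of \<zeta> j] by simp
  have 3: "bv 0 j * (?K n - ?K' n) \<in> CW n"
  proof -
    consider "n = 0" | "n = 1" | m where "n = Suc (Suc m)" by (metis One_nat_def not0_implies_Suc)
    then show ?thesis
    proof cases
      case 3
      with CW_mult[OF CW_bv less[of m], of 0 j] show ?thesis by simp
    qed (simp_all add: CW_const[OF W_0, simplified])
  qed
  show ?case unfolding eq by (intro CW_diff CW_add 1 2 3)
qed

lemma CW_cyc_diff: "cyc zeta p - cyc 0 p \<in> CW (p - 2)"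
proof -
  obtain m where p: "p = Suc (Suc m)" using that[of "p - 2"] p2 by simp
  have eq: "cyc zeta p - cyc 0 p = (continuant av (bv zeta) 0 p - continuant av (bv 0) 0 p)
    - ((bv zeta 0 - bv 0 0) * continuant av (bv zeta) 1 m + bv 0 0 * (continuant av (bv zeta) 1 m - continuant av (bv 0) 1 m))"
    by (simp add: cyc_def cyclic_continuant_def p algebra_simps)
  have 3: "bv 0 0 * (continuant av (bv zeta) 1 m - continuant av (bv 0) 1 m) \<in> CW m"
  proof -
    consider "m = 0" | "m = 1" | m' where "m = Suc (Suc m')" by (metis One_nat_def not0_implies_Suc)
    then show ?thesis
    proof cases
      case 3
      with CW_mult[OF CW_bv CW_continuant_diff[of zeta 1 m'], of 0 0] show ?thesis by simp
    qed (simp_all add: CW_const[OF W_0, simplified])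
  qed
  have 2: "(bv zeta 0 - bv 0 0) * continuant av (bv zeta) 1 m \<in> CW m"
    using CW_mult[OF CW_bv_diff[of zeta 0] CW_continuant[of zeta 1 m]] by simp
  have "continuant av (bv zeta) 0 p - continuant av (bv 0) 0 p \<in> CW m"
    unfolding p by (rule CW_continuant_diff)
  then have "cyc zeta p - cyc 0 p \<in> CW m"
    unfolding eq by (intro CW_diff[OF _ CW_add[OF 2 3]])
  then show ?thesis by (simp add: p)
qed

text \<open>Both continuants are divisible by c^p - c, and the bound on their difference survives
  this division. For \<zeta> = 0 the quotient is \<lambda>^p, which acts as (4 x)^p.\<close>

lemma X'_leading: "X' - (4 * x) ^ p \<in> Fl (p - 2)"
proof -
  have "artin_schreier p * (Q - [:sL ^ p:]) = cyc zeta p - cyc 0 p"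
    by (simp only: right_diff_distrib cyc_Q cyc_0[OF char p2])
  with CW_cyc_diff have "coeff (artin_schreier p * (Q - [:sL ^ p:])) i \<in> W (p - 2)" for i by (simp add: CW_def)
  then have "coeff (Q - [:sL ^ p:]) i \<in> W (p - 2)" for i
    using coeffs_artin_schreier_mult[of "W (p - 2)" p "Q - [:sL ^ p:]"] p2 by (simp add: W_add W_0)
  then have "Q - [:sL ^ p:] \<in> CW (p - 2)" by (simp add: CW_def)
  moreover have "act q v \<in> Fm (d + n)" if "q \<in> CW n" "v \<in> Fm d" for q v d n
    using that(1)
  proof (induction q)
    case (pCons u q)
    have "u \<in> W n" using pCons.prems by (auto simp: CW_def dest: spec[of _ 0])
    moreover have "q \<in> CW n"
      unfolding CW_def
    proof safe
      fix i show "coeff q i \<in> W n" using pCons.prems by (auto simp: CW_def dest: spec[of _ "Suc i"])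
    qed
    ultimately show ?case
      using pCons.IH that(2) unfolding act_def l4.ps_pCons by (auto simp: W_def intro: Fm_add Fm_C)
  qed (simp add: Fm_0)
  ultimately have "act (Q - [:sL ^ p:]) w0 \<in> Fm (0 + (p - 2))" using Fm_w0 by blast
  moreover have "act3 (sL ^ n) v = diag2 ((4 * x) ^ n) * v" for n v
    by (induction n) (simp_all add: diag2_simps act3_gen mult.assoc flip: l4.scale_scale)
  then have "act (Q - [:sL ^ p:]) w0 = Mat2 (X' - (4 * x) ^ p) 0 0 0"
    by (simp add: ma.scale_left_diff_distrib act_Q act_const) (simp add: w0_def diag2_def)
  ultimately show ?thesis by (simp add: Fm_def)
qed

section \<open>Centrality of the lift\<close>

lemma Fl_power: "a \<in> Fl m \<Longrightarrow> a ^ n \<in> Fl (n * m)"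
  by (induction n) (auto intro: Fl_1 Fl_mult)

lemma X'_Fl: "X' \<in> Fl p"
proof -
  have "(4 * x) ^ p \<in> Fl p" using Fl_power[OF Fl_numeral[OF Fl_gen(4)], of _ p] by simp
  from Fl_add[OF Fl_mono[OF X'_leading] this] show ?thesis by simp
qed

text \<open>The continuant applied to \<open>w0\<close> has the single entry X' s1. A commutator
  with it is [g, X'] s1, and s1 can be cancelled.\<close>

lemma X'_comm_aux:
  assumes g: "diag2 g * act (cyc zeta p) w0 = act (cyc zeta p) w0 * diag2 g" "g * s1 = s1 * g" "g \<in> Fl 0"
  shows "g * X' = X' * g"
proof -
  have a: "act (cyc zeta p) w0 = Mat2 0 (X' * s1) 0 0"
    by (simp add: cyc_Q act_mult act_Q act_artin_schreier C_power) (simp add: C_def diag2_def)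
  have "g * (X' * s1) = X' * s1 * g" using g(1) unfolding a by (simp add: diag2_def)
  then have "(g * X' - X' * g) * s1 = 0" using g(2) by (simp add: left_diff_distrib mult.assoc)
  then have "g * X' - X' * g = 0"
    using cancel_D[of "g * X' - X' * g" p k2] p_k2(2) Fl_diff[OF Fl_mult0 Fl_mult0'] g(3) X'_Fl by (simp add: s1_def D_eq)
  then show ?thesis by simp
qed

text \<open>Weights for the adjoint action of h.\<close>

definition wt :: "nat \<Rightarrow> 'k poly3 poly set"
  where "wt n = {q. \<forall>v. diag2 h * act q v = act q (diag2 h * v) + of_nat n * act q v}"

lemma act_of_nat: "act q (of_nat n * v) = of_nat n * act q v"
proof -
  have "act q (diag2 (of_nat n) * v) = diag2 (of_nat n) * act q v"
    by (rule act_left[symmetric]) (simp_all add: mult_of_nat_commute)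
  moreover have "diag2 (of_nat n) = (of_nat n :: 'a mat2)" by (induction n) (simp_all add: diag2_simps)
  ultimately show ?thesis by simp
qed

lemma wt_mult: "q \<in> wt m \<Longrightarrow> q' \<in> wt n \<Longrightarrow> q * q' \<in> wt (m + n)"
  by (simp add: wt_def act_mult ma.scale_right_distrib act_of_nat distrib_right add_ac del: ma.scale_scale)
lemma wt_add: "q \<in> wt n \<Longrightarrow> q' \<in> wt n \<Longrightarrow> q + q' \<in> wt n"
  by (simp add: wt_def ma.scale_left_distrib distrib_left)
lemma wt_minus: "q \<in> wt n \<Longrightarrow> - q \<in> wt n"
  by (simp add: wt_def ma.scale_minus_left algebra_simps)
lemma wt_diff: "q \<in> wt n \<Longrightarrow> q' \<in> wt n \<Longrightarrow> q - q' \<in> wt n"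
  using wt_add[OF _ wt_minus, of q n q'] by simp

lemma wt_gen: "[:sA:] \<in> wt 2" "[:sB:] \<in> wt 2" "[:sL:] \<in> wt 1" "cv \<in> wt 0" "of_int j \<in> wt 0" "[:sc3 a:] \<in> wt 0"
proof -
  have aux: "diag2 h * (diag2 g * v) = diag2 g * (diag2 h * v) + of_nat n * (diag2 g * v)" if "h * g = g * h + of_nat n * g" for g v n
  proof -
    have "diag2 (of_nat n) = (of_nat n :: 'a mat2)" by (induction n) (simp_all add: diag2_simps)
    then have "diag2 h * diag2 g = diag2 g * diag2 h + of_nat n * diag2 g"
      using arg_cong[OF that, of diag2] by (simp add: diag2_simps)
    then show ?thesis by (simp add: mult.assoc[symmetric] distrib_right)
  qed
  have "h * (8 * e) = 8 * e * h + of_nat 2 * (8 * e)"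
    using he by (simp add: numeral_comm(2)[of h] mult.assoc distrib_left)
  then show "[:sA:] \<in> wt 2" unfolding wt_def mem_Collect_eq act_gen using aux by blast
  have "h * (- (8 * (e * T))) = - (8 * (e * T)) * h + of_nat 2 * (- (8 * (e * T)))"
    using he[THEN assoc_rule] T_comm(2) by (simp add: numeral_comm(2)[of h] mult.assoc distrib_left distrib_right)
  then show "[:sB:] \<in> wt 2" unfolding wt_def mem_Collect_eq act_gen using aux by blast
  have "h * (4 * x) = 4 * x * h + of_nat 1 * (4 * x)"
    using hx by (simp add: numeral_comm(2)[of h] mult.assoc distrib_left)
  then show "[:sL:] \<in> wt 1" unfolding wt_def mem_Collect_eq act_gen using aux by blast
  show "cv \<in> wt 0" "of_int j \<in> wt 0" by (simp_all add: wt_def act_gen act_of_int mult.assoc)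
  show "[:sc3 a:] \<in> wt 0" by (simp add: wt_def act_gen) (metis mt.\<iota>_left_comm)
qed

lemma wt_0: "0 \<in> wt n" by (simp add: wt_def)
lemma wt_av: "av j \<in> wt 1" unfolding av_def using wt_mult[OF wt_gen(3) wt_add[OF wt_gen(4,5)]] by simp
lemma wt_peval: "d \<in> wt 0 \<Longrightarrow> pk.peval d q \<in> wt 0"
  by (induction q) (auto simp: pk.peval_pCons wt_0 intro!: wt_add wt_gen wt_mult[of _ 0 _ 0, simplified])
lemma wt_bv: "bv \<zeta> j \<in> wt 2"
proof -
  have "[:sA:] * pk.peval (cv + of_int (j - 1)) \<zeta> \<in> wt (2 + 0)"
    by (intro wt_mult wt_gen wt_peval) (rule wt_add[OF wt_gen(4) wt_gen(5)])
  then show ?thesis unfolding bv_def using wt_gen(2) by (simp only: add_0_right wt_add)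
qed

lemma wt_continuant: "continuant av (bv \<zeta>) i n \<in> wt n"
proof (induction n rule: less_induct)
  case (less n)
  consider "n = 0" | "n = 1" | m where "n = Suc (Suc m)" by (metis One_nat_def not0_implies_Suc)
  then show ?case
  proof cases
    case 3
    show ?thesis unfolding 3 continuant.simps
      using wt_mult[OF wt_av less[of "Suc m"]] wt_mult[OF wt_bv less[of m]] 3 by (auto intro: wt_diff)
  qed (use wt_gen(5)[of 1] wt_av in auto)
qed

lemma wt_cyc: "cyc zeta p \<in> wt p"
proof -
  obtain m where p: "p = Suc (Suc m)" using that[of "p - 2"] p2 by simp
  show ?thesis unfolding cyc_def cyclic_continuant_def
    using wt_mult[OF wt_bv[of zeta 0] wt_continuant[of zeta 1 m]] wt_continuant[of zeta 0 p]
    by (auto simp: p intro: wt_diff)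
qed

lemma X'_central: "e * X' = X' * e" "h * X' = X' * h" "D * X' = X' * D" "f * X' = X' * f" "x * X' = X' * x" "y * X' = X' * y"
proof -
  show E: "e * X' = X' * e"
  proof (rule X'_comm_aux)
    have "diag2 e * act (cyc zeta p) w0 = act (cyc zeta p) (w0 * diag2 e)"
      using act_left[of e "cyc zeta p" w0] ex T_comm(1) by (simp add: w0_diag)
    also have "\<dots> = act (cyc zeta p) w0 * diag2 e"
      by (rule act_right[symmetric]) (simp add: C_diag D_comm)
    finally show "diag2 e * act (cyc zeta p) w0 = act (cyc zeta p) w0 * diag2 e" .
  qed (simp_all add: s1_comm Fl_gen)
  show Hh: "h * X' = X' * h"
  proof (rule X'_comm_aux)
    \<comment> \<open>The continuant has weight p for the adjoint action of h, which is zero in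
      characteristic p.\<close>
    have "diag2 h * act (cyc zeta p) w0 = act (cyc zeta p) (w0 * diag2 h)"
      using wt_cyc by (simp add: wt_def of_nat_p_mat w0_diag)
    also have "\<dots> = act (cyc zeta p) w0 * diag2 h"
      by (rule act_right[symmetric]) (simp add: C_diag D_comm)
    finally show "diag2 h * act (cyc zeta p) w0 = act (cyc zeta p) w0 * diag2 h" .
  qed (simp_all add: s1_comm Fl_gen)
  show DD: "D * X' = X' * D"
    by (rule X'_comm_aux[OF cyc_D]) (simp_all add: s1_comm Fl_D)
  show F: "f * X' = X' * f"
  proof -
    \<comment> \<open>The element f e is a combination of D, h and h^2, which commute with the lift.
      Hence [f, X'] e = 0, and e is cancelled on the right.\<close>
    have 4: "4 * (f * e) = D - 1 - h * h - 2 * h"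
      unfolding D_def \<Delta>_normal by simp
    have "4 * ((f * X' - X' * f) * e) = 4 * (f * e) * X' - X' * (4 * (f * e))"
      using E by (simp add: left_diff_distrib right_diff_distrib mult.assoc numeral_comm(2)[of X'])
    also have "\<dots> = 0"
      unfolding 4 using DD Hh by (simp add: left_diff_distrib right_diff_distrib mult.assoc Hh[THEN assoc_rule] numeral_comm(2)[of X'])
    finally have "2 * (2 * ((f * X' - X' * f) * e)) = 0" by (simp add: mult.assoc[symmetric])
    then have "(f * X' - X' * f) * e = 0" using two_cancel by blast
    then show ?thesis
      using cancel_e[of "f * X' - X' * f" p] Fl_diff[OF Fl_mult0 Fl_mult0'] Fl_gen(2) X'_Fl by simp
  qed
  show x: "x * X' = X' * x"
  proof -
    \<comment> \<open>Right multiplication by x passes through because (c^p - c)^2 acts as an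
      element commuting with x.\<close>
    have t: "act (pcompose q (artin_schreier p ^ 2)) v * diag2 x = act (pcompose q (artin_schreier p ^ 2)) (v * diag2 x)" for q v
    proof (induction q)
      case (pCons u q)
      have "diag2 (D * s1 * s1) * diag2 x = diag2 x * diag2 (D * s1 * s1)"
        using arg_cong[OF x_comm_sigma, of diag2] by (simp only: diag2_simps(3))
      then show ?case
        unfolding act_pcompose_pCons act_artin_schreier2 distrib_right act3_right pCons(2)[symmetric]
        by (simp only: mult.assoc)
    qed simp
    have "diag2 x * act Q w0 = act Q w0 * diag2 x"
      using act_left[of x Q w0] ex T_comm(4) t[of P w0] by (simp add: w0_diag Q_def)
    then show ?thesis unfolding act_Q by (simp add: diag2_def)
  qed
  have "y = f * x - x * f" by (simp add: fx)
  then show "y * X' = X' * y" using x F by (simp add: left_diff_distrib right_diff_distrib) (metis mult.assoc)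
qed

theorem central_lift:
  "\<exists>u. u \<in> Fl p \<and> u - x ^ p \<in> Fl (p - 1) \<and> e * u = u * e \<and> f * u = u * f \<and> h * u = u * h
     \<and> x * u = u * x \<and> y * u = u * y"
proof -
  \<comment> \<open>This scalar normalizes the leading term (4 x)^p to x^p.\<close>
  define c where "c = \<iota> ((1 / 4) ^ p)"
  have four: "(4 :: 'k) \<noteq> 0"
  proof -
    have "(4 :: 'k) = 2 * 2" by simp
    then show ?thesis using two by (metis mult_eq_0_iff)
  qed
  have "(4 * x) ^ p = \<iota> (4 ^ p) * x ^ p"
  proof -
    have "(4 * x) ^ n = \<iota> (4 ^ n) * x ^ n" for n
    proof (induction n)
      case (Suc n)
      then show ?case by (simp add: \<iota>_mult \<iota>_numeral mult.assoc \<iota>_left_comm[of x])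
    qed (simp add: \<iota>_1)
    then show ?thesis .
  qed
  then have "c * (4 * x) ^ p = x ^ p"
    using four by (simp add: c_def mult.assoc[symmetric] \<iota>_mult[symmetric] power_mult_distrib[symmetric] \<iota>_1 del: power_one_over)
  moreover have "c * (X' - (4 * x) ^ p) \<in> Fl (p - 1)"
    using Fl_mult0[OF Fl_\<iota> Fl_mono[OF X'_leading]] unfolding c_def by simp
  ultimately have "c * X' - x ^ p \<in> Fl (p - 1)" by (simp add: right_diff_distrib)
  moreover have "c * X' \<in> Fl p" using Fl_mult0[OF Fl_\<iota> X'_Fl] by (simp add: c_def)
  moreover have "g * (c * X') = c * X' * g" if "g * X' = X' * g" for g
    using that by (simp add: c_def \<iota>_left_comm mult.assoc)
  ultimately show ?thesis using X'_central by blast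
qed

end

section \<open>The filtration by degree in \<open>x, y\<close>\<close>

definition V_bounded :: "nat \<Rightarrow> 'k::comm_ring_1 falg set" where "V_bounded n = {a. \<forall>w\<in>keys a. V_degree w \<le> n}"

lemma V_bounded_add: "a \<in> V_bounded n \<Longrightarrow> b \<in> V_bounded n \<Longrightarrow> a + b \<in> V_bounded n"
  using keys_add[of a b] by (auto simp: V_bounded_def)

lemma V_bounded_0: "0 \<in> V_bounded n"
  by (simp add: V_bounded_def)

lemma V_bounded_mult: "a \<in> V_bounded m \<Longrightarrow> b \<in> V_bounded n \<Longrightarrow> a * b \<in> V_bounded (m + n)"
  using keys_mult[of a b] by (fastforce simp: V_bounded_def V_degree_plus intro: add_mono)

lemma V_bounded_mono: "a \<in> V_bounded m \<Longrightarrow> m \<le> n \<Longrightarrow> a \<in> V_bounded n"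
  by (auto simp: V_bounded_def)

lemma homog_V_bounded: "a \<in> homog n \<Longrightarrow> a \<in> V_bounded n"
  by (auto simp: homog_def V_bounded_def)

lemma nf_V_bounded: "a \<in> V_bounded n \<Longrightarrow> nf z a \<in> below (Suc n)"
  using nf_below[of a "Suc n" z] by (simp add: V_bounded_def less_Suc_eq_le)

lemma pbw_V_bounded: "m \<in> below (Suc n) \<Longrightarrow> pbw_falg m \<in> V_bounded n"
  using keys_pbw_falg[of _ m] by (fastforce simp: below_def V_bounded_def less_Suc_eq_le)

definition Fil :: "'k::field poly \<Rightarrow> nat \<Rightarrow> 'k endo set" where "Fil z n = rep z ` V_bounded n"

lemma Fil_add: "a \<in> Fil z n \<Longrightarrow> b \<in> Fil z n \<Longrightarrow> a + b \<in> Fil z n"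
proof -
  assume "a \<in> Fil z n" "b \<in> Fil z n"
  then obtain u v where "a = rep z u" "b = rep z v" "u \<in> V_bounded n" "v \<in> V_bounded n" by (auto simp: Fil_def)
  then have "a + b = rep z (u + v)" "u + v \<in> V_bounded n" by (simp_all add: V_bounded_add)
  then show ?thesis unfolding Fil_def by blast
qed

lemma Fil_mult: "a \<in> Fil z m \<Longrightarrow> b \<in> Fil z n \<Longrightarrow> a * b \<in> Fil z (m + n)"
proof -
  assume "a \<in> Fil z m" "b \<in> Fil z n"
  then obtain u v where "a = rep z u" "b = rep z v" "u \<in> V_bounded m" "v \<in> V_bounded n" by (auto simp: Fil_def)
  then have "a * b = rep z (u * v)" "u * v \<in> V_bounded (m + n)" by (simp_all add: V_bounded_mult)
  then show ?thesis unfolding Fil_def by blast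
qed

lemma Fil_rep: "rep z a = rep z (pbw_falg (nf z a))"
  using nf_cong[of a z] rep_eq_0_iff[of z "a - pbw_falg (nf z a)"] by simp

lemma rep_eqI: "nf z a = nf z b \<Longrightarrow> rep z a = rep z b"
  using Fil_rep[of z a] Fil_rep[of z b] by simp

text \<open>Right multiplication by \<open>e\<close> and by \<open>D = \<Delta> + 1\<close> on PBW monomials.\<close>

definition right_e :: "'k::field endo" where "right_e = lend (\<lambda>(i,j,a,c) p. single (i,j,a,Suc c) p)"

definition right_D :: "'k::field endo"
  where "right_D = lend (\<lambda>(i,j,a,c) p. single (i,j,a,c) (sqr1 * p) + single (i,j,Suc a,Suc c) (4 * pcompose p [:-2, 1:]))"

lemma right_e_single: "app right_e (single (i,j,a,c) p) = single (i,j,a,Suc c) p"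
proof -
  have "coeff_linear (\<lambda>(i,j,a,c) p. single (i,j,a,Suc c) p :: 'a pbw)"
    by (rule coeff_linearI; auto simp: single_add)
  then show ?thesis unfolding right_e_def by (subst app_lend_single) auto
qed

lemma right_D_single:
  "app right_D (single (i,j,a,c) p) = single (i,j,a,c) (sqr1 * p) + single (i,j,Suc a,Suc c) (4 * pcompose p [:-2, 1:])"
proof -
  have "coeff_linear (\<lambda>(i,j,a,c) p. single (i,j,a,c) (sqr1 * p) + single (i,j,Suc a,Suc c) (4 * pcompose p [:-2, 1:]) :: 'a pbw)"
    by (rule coeff_linearI; simp only: split_paired_all prod.case distrib_left single_add mult_smult_right
        pcompose_add pcompose_smult smul_add smul_single add_ac)
  then show ?thesis unfolding right_D_def by (subst app_lend_single) auto
qed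

lemma rep_right:
  assumes "\<And>k p. app (rep z (pbw_word k p)) u = app g (single k p)"
  shows "app (rep z a) u = app g (nf z a)"
proof -
  have "app (rep z (pbw_falg m)) u = app g m" for m
    by (induction m rule: pbw_induct) (simp_all add: pbw_falg_add app_plus app_add_right assms)
  then show ?thesis using Fil_rep[of z a] by simp
qed

lemma Fop_power': "app (Fop z ^ a) (single (0,0,b,c) q) = single (0,0,a + b,c) q"
  by (induction a) (auto simp: app_times EFY_single)

lemma nf_right_e: "nf z (a * ve) = app right_e (nf z a)"
proof -
  have "app (Eop z ^ c) (single (0,0,0,d) 1) = single (0,0,0,c + d) 1" for c d
    by (induction c) (auto simp: app_times EFY_single U_e_def pcompose_1)
  then have "app (rep z (pbw_word k p)) (app (Eop z) unit_vec) = app right_e (single k p)" for k p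
    by (cases k) (simp add: pbw_word_def app_times Eop_power_unit[of z 1, simplified] app_peval_Hop Fop_power Yop_power
        Xop_power right_e_single)
  from rep_right[of z "app (Eop z) unit_vec" right_e a, OF this] show ?thesis by (simp add: nf_def app_times)
qed

definition D_falg :: "'k::field falg" where "D_falg = Delta + 1"

lemma rep_D: "rep z D_falg = op.D z"
  by (simp add: D_falg_def rep_Delta op.D_def op.\<Delta>_def)

lemma app_D_single: "app (op.D z) (single (0,0,0,c) p) = single (0,0,0,c) (sqr1 * p) + single (0,0,1,Suc c) (4 * pcompose p [:-2, 1:])"
proof -
  have s: "smul (numeral n) (single k q) = single k (numeral n * q)" for n k and q :: "'a poly"
    by (simp add: numeral_poly)
  have q: "sqr1 * p = [:0, 1:] * ([:0, 1:] * p) + 2 * ([:0, 1:] * p) + p"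
    by (simp add: sqr1_def numeral_poly)
  have H: "app Hop (single (0,0,0,c) p) = single (0,0,0,c) ([:0, 1:] * p)" for p :: "'a poly" using Hop_single[of 0 0 0 c p] by simp
  show ?thesis
    unfolding op.D_def op.\<Delta>_normal app_plus app_times app_numeral H app_1 EFY_single U_e_def prod.case app_add_right
    by (simp only: EFY_single app_numeral s single_add q smul_add of_nat_0 mult_zero_left single_zero add_0_right app_zero_right One_nat_def
        smul_zero add_0_left add_ac)
qed

text \<open>As D = (h + 1)^2 + 4 f e commutes with e and h, it can be moved from the far right to
  just behind f^a, where it acts by \<open>app_D_single\<close>.\<close>

lemma nf_right_D: "nf z (a * D_falg) = app right_D (nf z a)"
proof -
  have "app (rep z (pbw_word k p)) (app (op.D z) unit_vec) = app right_D (single k p)" for k p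
  proof (cases k)
    case (fields i j a c)
    have "app (Eop z ^ c) (app (op.D z) v) = app (op.D z) (app (Eop z ^ c) v)" for v
      using power_commuting_commutes[of "Eop z" "op.D z" c] op.D_comm(1)[of z] by (metis app_times)
    moreover have "app (sc.peval Hop p) (app (op.D z) v) = app (op.D z) (app (sc.peval Hop p) v)" for v
      using sc.peval_comm[of "op.D z" Hop p] op.D_comm(3)[of z] by (metis app_times)
    ultimately have "app (sc.peval Hop p) (app (Eop z ^ c) (app (op.D z) unit_vec)) = app (op.D z) (single (0,0,0,c) p)"
      by (simp only: Eop_power_unit app_peval_Hop mult_1_right)
    then show ?thesis
      by (simp add: fields pbw_word_def app_times app_D_single Fop_power' Yop_power Xop_power
          right_D_single app_add_right)
  qed
  from rep_right[of z "app (op.D z) unit_vec" right_D a, OF this] show ?thesis by (simp add: nf_def app_times rep_D)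
qed

lemma right_e_inj: "app right_e m = 0 \<Longrightarrow> m = 0"
proof -
  have *: "lookup (app right_e m) (i,j,a,Suc c) = lookup m (i,j,a,c)" for i j a c
  proof (induction m rule: pbw_induct)
    case (single k p)
    show ?case by (cases k) (auto simp: right_e_single lookup_single when_def)
  qed (simp_all add: app_add_right lookup_add)
  assume "app right_e m = 0"
  then have "lookup m k = 0" for k using * by (cases k) (metis lookup_zero)
  then show "m = 0" by (simp add: poly_mapping_eqI)
qed

definition f_above :: "nat \<Rightarrow> 'k::field pbw set" where "f_above n = {m. \<forall>(i,j,a,c)\<in>keys m. n \<le> a}"

lemma right_D_above:
  assumes "m \<in> f_above n"
  shows "app right_D m \<in> f_above n \<and> lookup (app right_D m) (i,j,n,c) = sqr1 * lookup m (i,j,n,c)"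
proof -
  have above_add: "u + v \<in> f_above n" if "u \<in> f_above n" "v \<in> f_above n" for u v :: "'a pbw"
    using that keys_add[of u v] by (auto simp: f_above_def)
  show ?thesis
  proof (induction m rule: pbw_induct)
    case (single k p)
    obtain i' j' a' c' where k: "k = (i',j',a',c')" by (cases k)
    have a': "n \<le> a'" using single assms by (auto simp: k f_above_def)
    then have "single (i',j',a',c') q \<in> f_above n" "single (i',j',Suc a',c'') q \<in> f_above n" for q c''
      by (simp_all add: f_above_def)
    then show ?case
      using a' unfolding k right_D_single by (auto simp: lookup_single lookup_add when_def intro!: above_add)
  next
    case (add u v)
    then show ?case by (simp add: app_add_right lookup_add distrib_left above_add)
  qed (simp add: f_above_def)
qed

text \<open>On the terms with the smallest exponent of f, right multiplication by D only multiplies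
  the coefficient by (X + 1)^2. A fixed vector would give (X + 1)^(2k) = 1.\<close>

lemma right_D_inj:
  assumes "k > 0" "app (right_D ^ k) m = m" shows "m = 0"
proof (rule ccontr)
  assume "m \<noteq> 0"
  then obtain i0 j0 a0 c0 where k0: "(i0,j0,a0,c0) \<in> keys m" by (metis keys_eq_empty all_not_in_conv prod_cases4)
  define n where "n = (LEAST a. \<exists>i j c. (i,j,a,c) \<in> keys m)"
  have "\<exists>i j c. (i,j,n,c) \<in> keys m" unfolding n_def by (rule LeastI) (use k0 in blast)
  then obtain i j c where key: "(i,j,n,c) \<in> keys m" by blast
  have above: "m \<in> f_above n" unfolding f_above_def n_def by (auto intro: Least_le)
  have "app (right_D ^ l) m \<in> f_above n \<and> lookup (app (right_D ^ l) m) (i,j,n,c) = sqr1 ^ l * lookup m (i,j,n,c)" for l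
    by (induction l) (simp_all add: above app_times right_D_above mult.assoc)
  from this[of k] have "sqr1 ^ k * lookup m (i,j,n,c) = 1 * lookup m (i,j,n,c)" using assms(2) by simp
  then have "sqr1 ^ k = (1 :: 'a poly)" using key by (simp add: in_keys_iff)
  moreover have "degree (sqr1 ^ k :: 'a poly) = k * 2" by (simp add: degree_power_eq sqr1_def)
  ultimately show False using assms(1) by simp
qed

lemma HZ_filtered_ops:
  fixes z :: "'k::field poly"
  assumes "CHAR('k) = p" "p > 2" "degree z < p - 1"
  shows "\<exists>r. HZ_filtered scal z (Eop z) (Fop z) Hop Xop (Yop z) r (Fil z) p"
proof -
  have "degree (pcompose z [:-1, 1:]) < p - 1" using assms(3) by (simp add: degree_pcompose)
  then obtain r where r: "antidifference (pcompose z [:-1, 1:]) r" using antidifference_exists[OF assms(1,2)] by blast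
  have two: "(2 :: 'k) \<noteq> 0"
    using of_nat_eq_0_iff_char_dvd[of 2, where 'a='k] assms(1,2) by (auto dest: dvd_imp_le)
  have "HZ_filtered scal z (Eop z) (Fop z) Hop Xop (Yop z) r (Fil z) p"
  proof (intro HZ_filtered.intro HZ_antidifference.intro HZ_ops HZ_antidifference_axioms.intro HZ_filtered_axioms.intro)
    show "(2 :: 'k) \<noteq> 0" "antidifference (pcompose z [:-1, 1:]) r" "CHAR('k) = p" "p > 2" by (fact two r assms)+
    show "a \<in> Fil z m \<Longrightarrow> m \<le> n \<Longrightarrow> a \<in> Fil z n" for a m n using V_bounded_mono by (fastforce simp: Fil_def)
    have scalar: "scalar c \<in> V_bounded 0" for c :: 'k by (rule homog_V_bounded[OF homog_scalar])
    show "scal c \<in> Fil z 0" for c using scalar[of c] unfolding Fil_def by (metis imageI rep_simps(8))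
    have g: "Eop z = rep z ve" "Fop z = rep z vf" "Hop = rep z vh" "Xop = rep z vx" "Yop z = rep z vy" by simp_all
    show "Eop z \<in> Fil z 0" "Fop z \<in> Fil z 0" "Hop \<in> Fil z 0" "Xop \<in> Fil z 1" "Yop z \<in> Fil z 1"
      unfolding g Fil_def by (intro imageI homog_V_bounded homog_var)+
    show "q = 0" if "q \<in> Fil z n" and "q * Eop z = 0" for q n
    proof -
      obtain a where a: "q = rep z a" using \<open>q \<in> Fil z n\<close> by (auto simp: Fil_def)
      have "nf z (a * ve) = 0" using that(2) by (simp add: nf_def a app_times[symmetric])
      then have "nf z a = 0" unfolding nf_right_e by (rule right_e_inj)
      then show ?thesis using a rep_eqI[of z a 0] by simp
    qed
    show "q = 0" if "q \<in> Fil z n" "k > 0" "q * ((Hop * Hop + 4 * Eop z * Fop z - 2 * Hop + 1) ^ k - 1) = 0" for q n k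
    proof -
      obtain a where a: "q = rep z a" using \<open>q \<in> Fil z n\<close> by (auto simp: Fil_def)
      have D: "nf z (a * D_falg ^ l) = app (right_D ^ l) (nf z a)" for l
      proof (induction l)
        case (Suc l)
        have "a * D_falg ^ Suc l = (a * D_falg ^ l) * D_falg" by (simp only: power_Suc2 mult.assoc)
        then show ?case by (simp only: nf_right_D Suc power_Suc app_times)
      qed simp
      have "rep z (a * D_falg ^ k - a) = 0"
        using that(3) by (simp add: a rep_D op.D_eq right_diff_distrib)
      then have "nf z (a * D_falg ^ k) - nf z a = 0" by (simp add: nf_diff[symmetric]) (simp add: nf_def)
      then have "nf z a = 0" using right_D_inj[OF that(2)] by (simp add: D)
      then show ?thesis using a rep_eqI[of z a 0] by simp
    qed
  qed (fact Fil_add Fil_mult)+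
  then show ?thesis by blast
qed

section \<open>Comparison with \<open>H\<^sub>0\<close>\<close>

definition exact :: "nat \<Rightarrow> 'k::field pbw set" where "exact n = {m. \<forall>k\<in>keys m. vdeg k = n}"

lemma exact_0 [simp]: "0 \<in> exact n"
  by (simp add: exact_def)

lemma exact_add: "u \<in> exact n \<Longrightarrow> v \<in> exact n \<Longrightarrow> u + v \<in> exact n"
  using keys_add[of u v] by (auto simp: exact_def)

lemma exact_minus: "u \<in> exact n \<Longrightarrow> - u \<in> exact n"
  by (auto simp: exact_def in_keys_iff)

lemma exact_diff: "u \<in> exact n \<Longrightarrow> v \<in> exact n \<Longrightarrow> u - v \<in> exact n"
  using exact_add[OF _ exact_minus, of u n v] by simp

lemma exact_single [simp]: "vdeg k = n \<Longrightarrow> single k p \<in> exact n"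
  by (simp add: exact_def)

lemma exact_below: "m \<in> exact n \<Longrightarrow> m \<in> below (Suc n)"
  by (simp add: exact_def below_def)

lemma exact_below_0: "m \<in> exact n \<Longrightarrow> m \<in> below n \<Longrightarrow> m = 0"
proof -
  assume "m \<in> exact n" "m \<in> below n"
  then have "vdeg k = n \<and> vdeg k < n" if "k \<in> keys m" for k using that unfolding exact_def below_def by blast
  then have "keys m = {}" by blast
  then show ?thesis by (simp add: keys_eq_empty)
qed

lemma exact_induct [consumes 1, case_names single add zero]:
  fixes m :: "'k::field pbw"
  assumes "m \<in> exact n" "\<And>i j a c p. i + j = n \<Longrightarrow> P (single (i,j,a,c) p)"
    "\<And>u v. P u \<Longrightarrow> P v \<Longrightarrow> P (u + v)" "P 0"
  shows "P m"
  by (rule pbw_induct[of m P]) (use assms in \<open>auto simp: exact_def\<close>)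

lemma app_exact:
  assumes "m \<in> exact n" "\<And>i j a c p. i + j = n \<Longrightarrow> app g (single (i,j,a,c) p) \<in> exact n'"
  shows "app g m \<in> exact n'"
  using assms(1) by (induction rule: exact_induct) (auto simp: assms(2) app_add_right exact_add)

lemma Xop_exact: "m \<in> exact n \<Longrightarrow> app Xop m \<in> exact (Suc n)"
  by (erule app_exact) simp

lemma Hop_exact: "m \<in> exact n \<Longrightarrow> app Hop m \<in> exact n"
  by (erule app_exact) (simp add: Hop_single)

lemma Zop_0: "Zop 0 = 0"
  by (simp add: zop_def)

text \<open>The operators of H_z and H_0 differ only through z(\<Delta>) in y x = x y - z(\<Delta>),
  which lowers the degree.\<close>

lemma ops_exact:
  assumes "m \<in> exact n"
  shows "app (Eop 0) m \<in> exact n \<and> app (Eop z) m - app (Eop 0) m \<in> below n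
    \<and> app (Fop 0) m \<in> exact n \<and> app (Fop z) m - app (Fop 0) m \<in> below n
    \<and> app (Yop 0) m \<in> exact (Suc n) \<and> app (Yop z) m - app (Yop 0) m \<in> below (Suc n)"
  using assms
proof (induction n arbitrary: m)
  case 0
  then show ?case
  proof (induction rule: exact_induct)
    case (single i j a c p)
    then show ?case by (simp add: EFY_single U_e_def exact_add)
  next
    case (add u v)
    then show ?case
      using below_add[of "app _ u - _" _ "app _ v - _"] by (simp add: app_add_right exact_add add_diff_add)
  qed simp
next
  case (Suc n)
  from Suc.prems show ?case
  proof (induction rule: exact_induct)
    case (single i j a c p)
    consider (x) i' where "i = Suc i'" | (y) j' where "i = 0" "j = Suc j'" using single by (cases i; cases j) auto
    then show ?case
    proof cases
      case x
      define m where "m = single (i',j,a,c) p"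
      have m: "m \<in> exact n" using single by (simp add: m_def x)
      note IH = Suc.IH[OF m]
      have X: "app Xop (app (Eop z) m) - app Xop (app (Eop 0) m) \<in> below (Suc n)"
        "app Xop (app (Fop z) m) - app Xop (app (Fop 0) m) \<in> below (Suc n)"
        "app Xop (app (Yop z) m) - app Xop (app (Yop 0) m) \<in> below (Suc (Suc n))"
        using IH by (simp_all add: app_diff_right[symmetric] Xop_below)
      have Z: "app (Zop z) m \<in> below (Suc (Suc n))"
        by (rule below_mono[OF Zop_below[OF exact_below[OF m]]]) simp
      have F: "app Xop (app (Fop z) m) + app (Yop z) m - (app Xop (app (Fop 0) m) + app (Yop 0) m) \<in> below (Suc n)"
        unfolding add_diff_add using X(2) IH by (simp add: below_add)
      have Y: "app Xop (app (Yop z) m) - app (Zop z) m - app Xop (app (Yop 0) m) \<in> below (Suc (Suc n))"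
        using below_diff[OF X(3) Z] by (simp add: algebra_simps)
      show ?thesis
        using IH X(1) F Y by (simp add: x m_def[symmetric] EFY_single Zop_0 Xop_exact exact_add)
    next
      case (y j')
      define m where "m = single (0::nat,j',a,c) p"
      have m: "m \<in> exact n" using single by (simp add: m_def y)
      note IH = Suc.IH[OF m]
      have "app (Yop z) (app g m) - app (Yop 0) (app g' m) \<in> below (Suc n) \<and> app (Yop 0) (app g' m) \<in> exact (Suc n)"
        if "app g' m \<in> exact n" "app g m - app g' m \<in> below n" for g g'
      proof -
        have eq: "app (Yop z) (app g m) - app (Yop 0) (app g' m)
           = app (Yop z) (app g m - app g' m) + (app (Yop z) (app g' m) - app (Yop 0) (app g' m))"
          by (simp add: app_diff_right)
        show ?thesis unfolding eq using Suc.IH[OF that(1)] Y_below[OF that(2), of z] by (blast intro: below_add)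
      qed
      note YEF = this[of "Eop 0" "Eop z"] this[of "Fop 0" "Fop z"]
      have "single (Suc 0, j', a, c) p \<in> exact (Suc n)" "single (0, Suc (Suc j'), a, c) p \<in> exact (Suc (Suc n))"
        using single y by simp_all
      with YEF show ?thesis
        using IH by (simp add: y m_def[symmetric] EFY_single exact_add)
    qed
  next
    case (add u v)
    then show ?case
      using below_add[of "app _ u - _" _ "app _ v - _"] by (simp add: app_add_right exact_add add_diff_add)
  qed simp
qed

lemma nf_word_exact:
  "nf 0 (single (Word ws) c) \<in> exact (V_degree (Word ws)) \<and> nf z (single (Word ws) c) - nf 0 (single (Word ws) c) \<in> below (V_degree (Word ws))"
proof (induction ws)
  case Nil
  have "single (Word []) c = scalar c * pbw_falg (single (0,0,0,0) 1)"
    by (simp add: pbw_word_def scalar_def zero_word_def)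
  then show ?case by (simp add: nf_scalar V_degree_def del: pbw_falg_single)
next
  case (Cons g ws)
  let ?m = "nf z (single (Word ws) c)" and ?u = "nf 0 (single (Word ws) c)" and ?n = "V_degree (Word ws)"
  have *: "app a ?m - app b ?u \<in> below k" if "app a (?m - ?u) \<in> below k" "app a ?u - app b ?u \<in> below k" for a b k
    using below_add[OF that] by (simp add: app_diff_right)
  have IH: "?u \<in> exact ?n" "?m - ?u \<in> below ?n" using Cons by auto
  note o = ops_exact[OF IH(1), of z]
  have b: "app (Eop z) (?m - ?u) \<in> below ?n" "app (Fop z) (?m - ?u) \<in> below ?n" "app Hop (?m - ?u) \<in> below ?n"
    "app Xop (?m - ?u) \<in> below (Suc ?n)" "app (Yop z) (?m - ?u) \<in> below (Suc ?n)"
    using IH(2) by (simp_all add: E_below F_below Hop_below Xop_below Y_below)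
  have gops: "app (Eop z) ?m - app (Eop 0) ?u \<in> below ?n" "app (Fop z) ?m - app (Fop 0) ?u \<in> below ?n"
    "app Hop ?m - app Hop ?u \<in> below ?n" "app Xop ?m - app Xop ?u \<in> below (Suc ?n)"
    "app (Yop z) ?m - app (Yop 0) ?u \<in> below (Suc ?n)"
    using o by (auto intro!: * b)
  show ?case
  proof (cases g)
    case (Inl s)
    have "V_degree (Word (g # ws)) = ?n" by (simp add: Inl V_degree_def)
    then show ?thesis
      unfolding single_Cons[of g] nf_mult using o gops Hop_exact[OF IH(1)] by (cases s) (simp_all only: Inl rep_simps generator.simps)
  next
    case (Inr s)
    have "V_degree (Word (g # ws)) = Suc ?n" by (simp add: Inr V_degree_def)
    then show ?thesis
      unfolding single_Cons[of g] nf_mult using o gops Xop_exact[OF IH(1)] by (cases s) (simp_all only: Inr rep_simps generator.simps)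
  qed
qed

lemma nf_homog:
  assumes "a \<in> homog n"
  shows "nf 0 a \<in> exact n" "nf z a - nf 0 a \<in> below n"
proof -
  have "nf 0 (\<Sum>w\<in>W. single w (lookup a w)) \<in> exact n \<and> nf z (\<Sum>w\<in>W. single w (lookup a w)) - nf 0 (\<Sum>w\<in>W. single w (lookup a w)) \<in> below n"
    if "finite W" "W \<subseteq> keys a" for W
    using that
  proof (induction W)
    case (insert w W)
    have "V_degree w = n" using assms insert by (auto simp: homog_def)
    then have "nf 0 (single w (lookup a w)) \<in> exact n" "nf z (single w (lookup a w)) - nf 0 (single w (lookup a w)) \<in> below n"
      using nf_word_exact[of "letters w" "lookup a w" z] by auto
    with insert show ?case by (simp add: nf_add exact_add add_diff_add below_add)
  qed simp
  from this[of "keys a"] show "nf 0 a \<in> exact n" "nf z a - nf 0 a \<in> below n" using falg_sum[of a] by simp_all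
qed

definition part :: "nat \<Rightarrow> 'k::field pbw \<Rightarrow> 'k pbw" where "part n m = (\<Sum>k\<in>{k\<in>keys m. vdeg k = n}. single k (lookup m k))"

lemma lookup_part: "lookup (part n m) k = (if vdeg k = n then lookup m k else 0)"
  by (auto simp: part_def lookup_sum lookup_single when_def in_keys_iff if_distrib sum.delta cong: if_cong)

lemma part_exact: "part n m \<in> exact n"
  by (auto simp: exact_def in_keys_iff lookup_part split: if_splits)

lemma part_of_exact: "m \<in> exact n \<Longrightarrow> part n m = m"
  by (rule poly_mapping_eqI) (auto simp: lookup_part exact_def in_keys_iff)

lemma part_of_exact_other: "m \<in> exact n' \<Longrightarrow> n \<noteq> n' \<Longrightarrow> part n m = 0"
  by (rule poly_mapping_eqI) (auto simp: lookup_part exact_def in_keys_iff)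

lemma part_add: "part n (u + v) = part n u + part n v"
  by (rule poly_mapping_eqI) (auto simp: lookup_part lookup_add)

lemma part_below: "m \<in> below (Suc n) \<Longrightarrow> m - part n m \<in> below n"
  by (auto simp: below_def in_keys_iff lookup_part lookup_minus less_Suc_eq split: if_splits)

lemma lookup_V_component: "lookup (V_component n a) w = (if V_degree w = n then lookup a w else 0)"
  by (auto simp: V_component_def lookup_sum lookup_single when_def in_keys_iff if_distrib sum.delta cong: if_cong)

lemma V_component_homog: "V_component n a \<in> homog n"
  by (auto simp: homog_def in_keys_iff lookup_V_component split: if_splits)

lemma V_component_of_homog: "a \<in> homog n \<Longrightarrow> V_component n a = a"
  by (rule poly_mapping_eqI) (auto simp: lookup_V_component homog_def in_keys_iff)

lemma V_component_of_homog_other: "a \<in> homog n' \<Longrightarrow> n \<noteq> n' \<Longrightarrow> V_component n a = 0"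
  by (rule poly_mapping_eqI) (auto simp: lookup_V_component homog_def in_keys_iff)

lemma V_component_add: "V_component n (a + b) = V_component n a + V_component n b"
  by (rule poly_mapping_eqI) (auto simp: lookup_V_component lookup_add)

lemma V_component_0 [simp]: "V_component n 0 = 0"
  by (rule poly_mapping_eqI) (auto simp: lookup_V_component)

lemma V_component_mult: "V_component n (a * b) = (\<Sum>i\<le>n. V_component i a * V_component (n - i) b)"
proof (induction a rule: falg_induct)
  case (single v c)
  show ?case
  proof (induction b rule: falg_induct)
    case (single w d)
    have V: "V_component i (single u e) = (if V_degree u = i then single u e else 0)" for i u and e :: 'a
      by (rule poly_mapping_eqI) (auto simp: lookup_V_component lookup_single when_def)
    have "(\<Sum>i\<le>n. V_component i (single v c) * V_component (n - i) (single w d))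
       = (\<Sum>i\<le>n. if i = V_degree v then (if V_degree w = n - i then single (v + w) (c * d) else 0) else 0)"
      by (rule sum.cong) (auto simp: V mult_single)
    also have "\<dots> = V_component n (single v c * single w d)"
      by (auto simp: mult_single V V_degree_plus sum.delta)
    finally show ?case ..
  qed (simp_all add: distrib_left V_component_add sum.distrib)
qed (simp_all add: distrib_right V_component_add sum.distrib)

lemma nf_V_component: "nf 0 (V_component n a) = part n (nf 0 a)"
proof (induction a rule: falg_induct)
  case (single w c)
  have h: "single w c \<in> homog (V_degree w)" by (auto simp: homog_def)
  show ?case
    using V_component_of_homog[OF h] V_component_of_homog_other[OF h] part_of_exact[OF nf_homog(1)[OF h]]
      part_of_exact_other[OF nf_homog(1)[OF h]]
    by (cases "n = V_degree w") simp_all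
next
  case zero
  show ?case by (simp add: part_def)
qed (simp add: V_component_add nf_add part_add)

lemma nf_V_component_below: "nf z (V_component n a) - part n (nf 0 a) \<in> below n"
  using nf_homog(2)[OF V_component_homog[of n a], of z] unfolding nf_V_component .

section \<open>The associated graded ring\<close>

lemma H_class_simps:
  "H_class z (a + b) = H_class z a \<oplus>\<^bsub>H_alg z\<^esub> H_class z b"
  "H_class z (a * b) = H_class z a \<otimes>\<^bsub>H_alg z\<^esub> H_class z b"
  "H_class z 1 = \<one>\<^bsub>H_alg z\<^esub>" "H_class z 0 = \<zero>\<^bsub>H_alg z\<^esub>"
  "H_class z (- a) = \<ominus>\<^bsub>H_alg z\<^esub> H_class z a"
proof -
  interpret ring_hom_ring free_ring "H_alg z" "H_class z"
    by (rule ring_hom_ringI2[OF ring_free_ring ring_H_alg H_class_hom])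
  show "H_class z (a + b) = H_class z a \<oplus>\<^bsub>H_alg z\<^esub> H_class z b" "H_class z (a * b) = H_class z a \<otimes>\<^bsub>H_alg z\<^esub> H_class z b"
    "H_class z 1 = \<one>\<^bsub>H_alg z\<^esub>" and 0: "H_class z 0 = \<zero>\<^bsub>H_alg z\<^esub>"
    using hom_add[of a b] hom_mult[of a b] hom_one hom_zero by simp_all
  have "H_class z (- a) \<oplus>\<^bsub>H_alg z\<^esub> H_class z a = \<zero>\<^bsub>H_alg z\<^esub>"
    using hom_add[of "- a" a] 0 by simp
  then show "H_class z (- a) = \<ominus>\<^bsub>H_alg z\<^esub> H_class z a" using S.minus_equality by simp
qed

lemma H_class_carrier [simp]: "H_class z a \<in> carrier (H_alg z)"
  by (simp add: carrier_H_alg)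

abbreviation "Prev z \<equiv> prev (H_alg z) (H_fil z)"

lemma below_nf_iff: "nf z a \<in> below n \<longleftrightarrow> (\<exists>b. (\<forall>w\<in>keys b. V_degree w < n) \<and> H_class z a = H_class z b)"
proof
  assume b: "nf z a \<in> below n"
  have "H_class z a = H_class z (pbw_falg (nf z a))" by (simp add: H_class_eq_nf)
  moreover have "\<forall>w\<in>keys (pbw_falg (nf z a)). V_degree w < n"
    using keys_pbw_falg[of _ "nf z a"] b by (fastforce simp: below_def)
  ultimately show "\<exists>b. (\<forall>w\<in>keys b. V_degree w < n) \<and> H_class z a = H_class z b" by blast
qed (auto simp: H_class_eq_nf nf_below)

lemma Prev_eq: "Prev z n = {H_class z a | a. nf z a \<in> below n}"
proof -
  have "Prev z n = H_class z ` {b. \<forall>w\<in>keys b. V_degree w < n}"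
    by (cases n) (auto simp: prev_def H_fil_def less_Suc_eq_le H_class_simps)
  then show ?thesis unfolding below_nf_iff by blast
qed

lemma H_class_Prev: "H_class z a \<in> Prev z n \<longleftrightarrow> nf z a \<in> below n"
  unfolding Prev_eq by (auto simp: H_class_eq_nf)

lemma H_fil_eq: "H_fil z n = {H_class z a | a. a \<in> V_bounded n}"
  by (auto simp: H_fil_def V_bounded_def)

lemma Prev_subgroup: "abelian_subgroup (Prev z n) (H_alg (z :: 'k::field poly))"
proof -
  interpret ring "H_alg z" by (rule ring_H_alg)
  have "subgroup (Prev z n) (add_monoid (H_alg z))"
  proof (rule add.subgroupI)
    show "Prev z n \<subseteq> carrier (H_alg z)" by (auto simp: Prev_eq)
    show "Prev z n \<noteq> {}" using H_class_Prev[of z 0 n] by auto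
    show "\<ominus>\<^bsub>H_alg z\<^esub> a \<in> Prev z n" if "a \<in> Prev z n" for a
      using that nf_diff[of z 0 _] by (fastforce simp: Prev_eq H_class_simps(5)[symmetric] H_class_eq_nf intro: below_minus)
    show "a \<oplus>\<^bsub>H_alg z\<^esub> b \<in> Prev z n" if "a \<in> Prev z n" "b \<in> Prev z n" for a b
      using that by (auto simp: Prev_eq H_class_simps(1)[symmetric] nf_add below_add)
  qed
  then show ?thesis by (intro abelian_subgroupI3 additive_subgroup.intro abelian_group_axioms)
qed

definition coset :: "'k::field poly \<Rightarrow> nat \<Rightarrow> 'k falg \<Rightarrow> 'k falg set set set"
  where "coset z n a = Prev z n +>\<^bsub>H_alg z\<^esub> H_class z a"

lemma in_coset: "H_class z b \<in> coset z n a \<longleftrightarrow> nf z b - nf z a \<in> below n"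
proof -
  interpret abelian_subgroup "Prev z n" "H_alg z" by (rule Prev_subgroup)
  interpret ring "H_alg z" by (rule ring_H_alg)
  have "H_class z b \<in> coset z n a \<longleftrightarrow> H_class z b \<ominus>\<^bsub>H_alg z\<^esub> H_class z a \<in> Prev z n"
    unfolding coset_def by (rule a_rcos_module_minus[OF ring_axioms]) simp_all
  also have "H_class z b \<ominus>\<^bsub>H_alg z\<^esub> H_class z a = H_class z (b - a)"
    using H_class_simps(1)[of z b "- a"] by (simp add: a_minus_def H_class_simps(5))
  finally show ?thesis by (simp add: H_class_Prev nf_diff)
qed

lemma coset_subset: "coset z n a \<subseteq> range (H_class z)"
proof -
  interpret abelian_subgroup "Prev z n" "H_alg z" by (rule Prev_subgroup)
  show ?thesis unfolding coset_def carrier_H_alg[symmetric] by (rule a_r_coset_subset_G[OF a_subset H_class_carrier])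
qed

lemma coset_eq_set: "coset z n a = {H_class z b | b. nf z b - nf z a \<in> below n}"
  using coset_subset[of z n a] in_coset[of z _ n a] by blast

lemma coset_eq_iff: "coset z n a = coset z n b \<longleftrightarrow> nf z a - nf z b \<in> below n"
proof
  assume "coset z n a = coset z n b"
  then show "nf z a - nf z b \<in> below n" using in_coset[of z a n a] by (simp add: in_coset)
next
  assume a: "nf z a - nf z b \<in> below n"
  have "nf z c - nf z a \<in> below n \<longleftrightarrow> nf z c - nf z b \<in> below n" for c
    using below_add[OF _ a, of "nf z c - nf z a"] below_diff[OF _ a, of "nf z c - nf z b"] by auto
  then show "coset z n a = coset z n b" by (simp add: coset_eq_set)
qed

lemma coset_0: "coset z n 0 = Prev z n"
  by (simp add: coset_eq_set Prev_eq)

lemma coset_add: "coset z n a <+>\<^bsub>H_alg z\<^esub> coset z n b = coset z n (a + b)"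
proof -
  interpret abelian_subgroup "Prev z n" "H_alg z" by (rule Prev_subgroup)
  show ?thesis unfolding coset_def H_class_simps by (rule a_rcos_sum) simp_all
qed

text \<open>The product of cosets is a union over all representatives, so independence of the
  representatives modulo lower degree has to be shown.\<close>

lemma coset_mult:
  assumes "a \<in> V_bounded i" "b \<in> V_bounded j" "i + j = n"
  shows "rcoset_mult (H_alg z) (Prev z n) (coset z i a) (coset z j b) = coset z n (a * b)"
proof -
  have *: "Prev z n +>\<^bsub>H_alg z\<^esub> (H_class z a' \<otimes>\<^bsub>H_alg z\<^esub> H_class z b') = coset z n (a * b)"
    if a': "nf z a' - nf z a \<in> below i" and b': "nf z b' - nf z b \<in> below j" for a' b'
  proof -
    obtain r where r: "\<forall>w\<in>keys r. V_degree w < i" "H_class z (a' - a) = H_class z r"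
      using a' below_nf_iff[of z "a' - a" i] by (auto simp: nf_diff)
    obtain s where s: "\<forall>w\<in>keys s. V_degree w < j" "H_class z (b' - b) = H_class z s"
      using b' below_nf_iff[of z "b' - b" j] by (auto simp: nf_diff)
    have ab: "rep z a' = rep z (a + r)" "rep z b' = rep z (b + s)"
      using r(2) s(2) by (simp_all add: H_class_eq_rep algebra_simps)
    have "\<forall>w\<in>keys (r * (b + s) + a * s). V_degree w < n"
    proof
      fix w assume "w \<in> keys (r * (b + s) + a * s)"
      then consider "w \<in> keys (r * (b + s))" | "w \<in> keys (a * s)" using keys_add[of "r * (b + s)" "a * s"] by blast
      then show "V_degree w < n"
      proof cases
        case 1
        then obtain u v where w: "w = u + v" "u \<in> keys r" "v \<in> keys (b + s)" using keys_mult[of r "b + s"] by blast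
        have "b + s \<in> V_bounded j" using assms(2) s(1) by (intro V_bounded_add) (auto simp: V_bounded_def less_imp_le)
        then show ?thesis using w r(1) assms(3) by (force simp: V_bounded_def V_degree_plus)
      next
        case 2
        then obtain u v where w: "w = u + v" "u \<in> keys a" "v \<in> keys s" using keys_mult[of a s] by blast
        then show ?thesis using assms s(1) by (force simp: V_bounded_def V_degree_plus)
      qed
    qed
    then have "nf z (r * (b + s) + a * s) \<in> below n" by (rule nf_below)
    moreover have "nf z (a' * b') = nf z ((a + r) * (b + s))" using ab by (simp add: nf_def)
    moreover have "(a + r) * (b + s) = a * b + (r * (b + s) + a * s)" by (simp add: algebra_simps)
    ultimately have "nf z (a' * b') - nf z (a * b) \<in> below n" by (simp only: nf_add add_diff_cancel_left')
    then have "coset z n (a' * b') = coset z n (a * b)" by (simp add: coset_eq_iff)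
    then show ?thesis by (simp add: coset_def H_class_simps)
  qed
  have "nf z a - nf z a \<in> below i" "nf z b - nf z b \<in> below j" by simp_all
  then show ?thesis
    unfolding rcoset_mult_def coset_eq_set[of z i a] coset_eq_set[of z j b] using * by fast
qed

text \<open>The group operation of the additive quotient is written as a product here, so
  \<open>finprod\<close> is a sum of cosets.\<close>

lemma finprod_coset:
  "(\<Otimes>\<^bsub>H_alg z A_Mod Prev z N\<^esub>i\<in>{..n}. coset z N (g i)) = coset z N (\<Sum>i\<le>n. g (i::nat))"
proof -
  interpret abelian_subgroup "Prev z N" "H_alg z" by (rule Prev_subgroup)
  interpret Q: comm_group "H_alg z A_Mod Prev z N" by (rule a_factorgroup_is_comm_group)
  have c: "coset z N a \<in> carrier (H_alg z A_Mod Prev z N)" for a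
    by (simp add: A_FactGroup_def' coset_def a_rcosetsI[OF a_subset])
  show ?thesis
  proof (induction n)
    case (Suc n)
    have "(\<Otimes>\<^bsub>H_alg z A_Mod Prev z N\<^esub>i\<in>{..Suc n}. coset z N (g i))
      = coset z N (g (Suc n)) \<otimes>\<^bsub>H_alg z A_Mod Prev z N\<^esub> (\<Otimes>\<^bsub>H_alg z A_Mod Prev z N\<^esub>i\<in>{..n}. coset z N (g i))"
      unfolding atMost_Suc by (rule Q.finprod_insert) (simp_all add: c)
    then show ?case by (simp add: Suc coset_add add.commute)
  qed (simp add: c del: add_A_FactGroup)
qed

lemma gr_mult:
  assumes "\<And>n. u n = coset z n (a n)" "\<And>n. v n = coset z n (b n)" "\<And>n. a n \<in> V_bounded n" "\<And>n. b n \<in> V_bounded n"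
  shows "(u \<otimes>\<^bsub>gr_H z\<^esub> v) n = coset z n (\<Sum>i\<le>n. a i * b (n - i))"
proof -
  have "(u \<otimes>\<^bsub>gr_H z\<^esub> v) n = (\<Otimes>\<^bsub>H_alg z A_Mod Prev z n\<^esub>i\<in>{..n}. rcoset_mult (H_alg z) (Prev z n) (u i) (v (n - i)))"
    by (simp add: gr_H_def gr_def)
  also have "\<dots> = (\<Otimes>\<^bsub>H_alg z A_Mod Prev z n\<^esub>i\<in>{..n}. coset z n (a i * b (n - i)))"
  proof -
    interpret abelian_subgroup "Prev z n" "H_alg z" by (rule Prev_subgroup)
    interpret Q: comm_group "H_alg z A_Mod Prev z n" by (rule a_factorgroup_is_comm_group)
    have c: "coset z n a \<in> carrier (H_alg z A_Mod Prev z n)" for a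
      by (simp add: A_FactGroup_def' coset_def a_rcosetsI[OF a_subset])
    show ?thesis
      by (rule Q.finprod_cong') (auto simp: c assms coset_mult)
  qed
  finally show ?thesis unfolding finprod_coset .
qed

lemma carrier_gr_H:
  "carrier (gr_H z) = {u. (\<forall>n. \<exists>a\<in>V_bounded n. u n = coset z n a) \<and> finite {n. u n \<noteq> Prev z n}}"
proof -
  have "(\<exists>a\<in>H_fil z n. u n = Prev z n +>\<^bsub>H_alg z\<^esub> a) \<longleftrightarrow> (\<exists>a\<in>V_bounded n. u n = coset z n a)" for u n
    unfolding H_fil_eq coset_def by blast
  then show ?thesis unfolding gr_H_def gr_def by simp
qed

section \<open>The natural map\<close>

lemma V_component_nonzero: "V_component n a \<noteq> 0 \<Longrightarrow> n \<in> V_degree ` keys a"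
proof (rule ccontr)
  assume *: "V_component n a \<noteq> 0" "n \<notin> V_degree ` keys a"
  have "lookup (V_component n a) w = 0" for w
  proof -
    have "V_degree w = n \<Longrightarrow> w \<notin> keys a" using *(2) by blast
    then show ?thesis by (simp add: lookup_V_component in_keys_iff)
  qed
  then have "V_component n a = 0" by (intro poly_mapping_eqI) simp
  with * show False by simp
qed

lemma part_nonzero: "part n m \<noteq> 0 \<Longrightarrow> n \<in> vdeg ` keys m"
proof (rule ccontr)
  assume *: "part n m \<noteq> 0" "n \<notin> vdeg ` keys m"
  have "lookup (part n m) k = 0" for k
  proof -
    have "vdeg k = n \<Longrightarrow> k \<notin> keys m" using *(2) by blast
    then show ?thesis by (simp add: lookup_part in_keys_iff)
  qed
  then have "part n m = 0" by (intro poly_mapping_eqI) simp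
  with * show False by simp
qed

lemma graded_class_coset: "graded_class z a = (\<lambda>n. coset z n (V_component n a))"
  by (simp add: graded_class_def coset_def)

text \<open>Modulo lower degree the component in degree n depends only on the degree n part of the
  H_0 normal form. This shows that \<open>natural_map\<close> is well defined and also
  injective.\<close>

lemma graded_class_eq_iff: "graded_class z a = graded_class z b \<longleftrightarrow> nf 0 a = nf 0 b"
proof -
  have c: "nf z (V_component n a) - nf z (V_component n b) \<in> below n \<longleftrightarrow> part n (nf 0 a) = part n (nf 0 b)" for n
  proof -
    let ?d = "part n (nf 0 a) - part n (nf 0 b)"
    have e: "nf z (V_component n a) - nf z (V_component n b) - ?d \<in> below n"
      using below_diff[OF nf_V_component_below[of z n a] nf_V_component_below[of z n b]] by (simp add: algebra_simps)
    have "nf z (V_component n a) - nf z (V_component n b) \<in> below n \<longleftrightarrow> ?d \<in> below n"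
    proof
      show "?d \<in> below n" if "nf z (V_component n a) - nf z (V_component n b) \<in> below n"
        using below_diff[OF that e] by simp
      show "nf z (V_component n a) - nf z (V_component n b) \<in> below n" if "?d \<in> below n"
        using below_add[OF e that] by simp
    qed
    also have "\<dots> \<longleftrightarrow> ?d = 0"
      using exact_below_0[OF exact_diff[OF part_exact part_exact], of n "nf 0 a" "nf 0 b"] by auto
    finally show ?thesis by simp
  qed
  have "(\<forall>n. part n u = part n v) \<longleftrightarrow> u = v" for u v :: "'a pbw"
  proof
    assume *: "\<forall>n. part n u = part n v"
    show "u = v"
    proof (rule poly_mapping_eqI)
      fix k
      have "lookup (part (vdeg k) u) k = lookup (part (vdeg k) v) k" using * by simp
      then show "lookup u k = lookup v k" by (simp add: lookup_part)
    qed
  qed simp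
  then show ?thesis unfolding graded_class_coset fun_eq_iff coset_eq_iff c .
qed

lemma natural_map_H_class: "natural_map (z :: 'k::field poly) (H_class 0 a) = graded_class z a"
proof -
  have "graded_class z ` {b. H_class 0 b = H_class 0 a} = {graded_class z a}"
    unfolding H_class_eq_nf graded_class_eq_iff[symmetric, of _ _ z] by auto
  then show ?thesis by (simp add: natural_map_def)
qed

lemma V_component_bounded: "V_component n a \<in> V_bounded n"
  by (rule homog_V_bounded[OF V_component_homog])

lemma graded_class_carrier: "graded_class z a \<in> carrier (gr_H (z :: 'k::field poly))"
proof -
  have "{n. coset z n (V_component n a) \<noteq> Prev z n} \<subseteq> V_degree ` keys a"
  proof
    fix n assume "n \<in> {n. coset z n (V_component n a) \<noteq> Prev z n}"
    then have "V_component n a \<noteq> 0" using coset_0 by fastforce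
    then show "n \<in> V_degree ` keys a" by (rule V_component_nonzero)
  qed
  then have "finite {n. coset z n (V_component n a) \<noteq> Prev z n}" by (rule finite_subset) simp
  then show ?thesis unfolding carrier_gr_H graded_class_coset using V_component_bounded by blast
qed

lemma natural_map_surj:
  fixes z :: "'k::field poly"
  assumes "u \<in> carrier (gr_H z)"
  shows "\<exists>c. graded_class z c = u"
proof -
  define S where "S = {n. u n \<noteq> Prev z n}"
  obtain a0 where a0: "\<And>n. a0 n \<in> V_bounded n" "\<And>n. u n = coset z n (a0 n)"
    using assms unfolding carrier_gr_H by (simp add: Bex_def) metis
  define a where "a n = (if n \<in> S then a0 n else 0)" for n
  have a: "a n \<in> V_bounded n" "u n = coset z n (a n)" for n
    using a0[of n] by (auto simp: a_def S_def coset_0 V_bounded_def)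
  have S: "finite S" using assms by (simp add: carrier_gr_H S_def)
  \<comment> \<open>The leading parts of all components of u are assembled into one PBW vector.
    Components equal to \<open>Prev z n\<close> are represented by 0, so the sum is finite.\<close>
  define m where "m = (\<Sum>n\<in>S. part n (nf z (a n)))"
  have "lookup (part n m) k = lookup (part n (nf z (a n))) k" for n k
  proof -
    have "lookup m k = (\<Sum>i\<in>S. if i = vdeg k then lookup (nf z (a i)) k else 0)"
      unfolding m_def lookup_sum by (rule sum.cong) (auto simp: lookup_part)
    also have "\<dots> = (if vdeg k \<in> S then lookup (nf z (a (vdeg k))) k else 0)"
      using S by (simp add: sum.delta)
    finally show ?thesis by (auto simp: lookup_part a_def)
  qed
  then have pm: "part n m = part n (nf z (a n))" for n by (intro poly_mapping_eqI) auto
  have "coset z n (V_component n (pbw_falg m)) = u n" for n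
  proof -
    have "nf z (V_component n (pbw_falg m)) - part n m \<in> below n"
      using nf_V_component_below[of z n "pbw_falg m"] by (simp add: nf_pbw)
    moreover have "nf z (a n) - part n m \<in> below n"
      unfolding pm by (rule part_below[OF nf_V_bounded[OF a(1)]])
    ultimately have "nf z (V_component n (pbw_falg m)) - nf z (a n) \<in> below n"
      using below_diff by fastforce
    then show ?thesis by (simp add: a(2) coset_eq_iff)
  qed
  then have "graded_class z (pbw_falg m) = u" by (simp add: graded_class_coset)
  then show ?thesis by blast
qed

lemma natural_map_iso: "natural_map (z :: 'k::field poly) \<in> ring_iso (H_alg 0) (gr_H z)"
proof -
  have "natural_map z \<in> ring_hom (H_alg 0) (gr_H z)"
  proof (rule ring_hom_memI)
    fix A B :: "'k falg set set" assume "A \<in> carrier (H_alg 0)" "B \<in> carrier (H_alg 0)"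
    then obtain a b where AB: "A = H_class 0 a" "B = H_class 0 b" by (auto simp: carrier_H_alg)
    show "natural_map z (A \<otimes>\<^bsub>H_alg 0\<^esub> B) = natural_map z A \<otimes>\<^bsub>gr_H z\<^esub> natural_map z B"
    proof
      fix n
      show "natural_map z (A \<otimes>\<^bsub>H_alg 0\<^esub> B) n = (natural_map z A \<otimes>\<^bsub>gr_H z\<^esub> natural_map z B) n"
        unfolding AB H_class_simps(2)[symmetric] natural_map_H_class
        by (subst gr_mult[where a = "\<lambda>n. V_component n a" and b = "\<lambda>n. V_component n b"])
          (simp_all add: graded_class_coset V_component_bounded V_component_mult)
    qed
    show "natural_map z (A \<oplus>\<^bsub>H_alg 0\<^esub> B) = natural_map z A \<oplus>\<^bsub>gr_H z\<^esub> natural_map z B"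
      unfolding AB H_class_simps(1)[symmetric] natural_map_H_class
      by (simp add: graded_class_coset V_component_add coset_add gr_H_def gr_def)
  next
    fix A :: "'k falg set set" assume "A \<in> carrier (H_alg 0)"
    then show "natural_map z A \<in> carrier (gr_H z)"
      by (auto simp: carrier_H_alg natural_map_H_class graded_class_carrier)
  next
    have "V_component n 1 = (if n = 0 then 1 else 0 :: 'k falg)" for n
      using V_component_of_homog[OF homog_1] V_component_of_homog_other[OF homog_1, of n] by auto
    then have "graded_class z 1 = \<one>\<^bsub>gr_H z\<^esub>"
      unfolding graded_class_coset gr_H_def gr_def coset_def by (auto simp: H_class_simps fun_eq_iff)
    then show "natural_map z \<one>\<^bsub>H_alg 0\<^esub> = \<one>\<^bsub>gr_H z\<^esub>"
      by (simp add: H_class_simps(3)[symmetric] natural_map_H_class)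
  qed
  moreover have "bij_betw (natural_map z) (carrier (H_alg 0)) (carrier (gr_H z))"
  proof (rule bij_betw_imageI)
    show "inj_on (natural_map z) (carrier (H_alg 0))"
      by (auto simp: inj_on_def carrier_H_alg natural_map_H_class graded_class_eq_iff H_class_eq_nf)
    show "natural_map z ` carrier (H_alg 0) = carrier (gr_H z)"
      using natural_map_surj[of _ z] by (force simp: carrier_H_alg natural_map_H_class graded_class_carrier)
  qed
  ultimately show ?thesis by (simp add: ring_iso_def)
qed

lemma ring_iso_center:
  assumes "g \<in> ring_iso R S" "ring R"
  shows "g ` center R = center S"
proof -
  interpret ring R by fact
  have hom: "g \<in> ring_hom R S" and bij: "bij_betw g (carrier R) (carrier S)" using assms by (auto simp: ring_iso_def)
  have inj: "inj_on g (carrier R)" and im: "g ` carrier R = carrier S" using bij by (auto simp: bij_betw_def)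
  have m: "g (a \<otimes>\<^bsub>R\<^esub> b) = g a \<otimes>\<^bsub>S\<^esub> g b" if "a \<in> carrier R" "b \<in> carrier R" for a b
    using ring_hom_mult[OF hom] that by simp
  have iff: "g a \<in> center S \<longleftrightarrow> a \<in> center R" if a: "a \<in> carrier R" for a
  proof -
    have "g a \<in> center S \<longleftrightarrow> (\<forall>b\<in>carrier R. g (a \<otimes>\<^bsub>R\<^esub> b) = g (b \<otimes>\<^bsub>R\<^esub> a))"
      unfolding center_def im[symmetric] using a by (auto simp: m)
    also have "\<dots> \<longleftrightarrow> a \<in> center R" using a by (auto simp: center_def inj_on_eq_iff[OF inj])
    finally show ?thesis .
  qed
  show ?thesis
  proof (intro equalityI subsetI)
    fix s assume "s \<in> g ` center R"
    then obtain a where "a \<in> center R" "s = g a" by blast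
    then show "s \<in> center S" using iff[of a] by (simp add: center_def)
  next
    fix s assume s: "s \<in> center S"
    then have "s \<in> g ` carrier R" by (simp add: center_def im)
    then obtain a where "a \<in> carrier R" "s = g a" by blast
    then show "s \<in> g ` center R" using iff[of a] s by simp
  qed
qed

section \<open>The associated graded of the center\<close>

lemma H_class_center: "H_class z a \<in> center (H_alg z) \<longleftrightarrow> (\<forall>b. rep z a * rep z b = rep z b * rep z a)"
proof -
  have "H_class z a \<in> center (H_alg z) \<longleftrightarrow> (\<forall>b. H_class z (a * b) = H_class z (b * a))"
    by (auto simp: center_def carrier_H_alg H_class_simps)
  then show ?thesis unfolding H_class_eq_rep by (simp add: rep_simps)
qed

lemma zero_center: "\<zero>\<^bsub>H_alg z\<^esub> \<in> center (H_alg z)"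
proof -
  interpret ring "H_alg z" by (rule ring_H_alg)
  show ?thesis by (auto simp: center_def)
qed

lemma prev_center: "prev (center_ring (H_alg z)) (\<lambda>n. H_fil z n \<inter> center (H_alg z)) n = Prev z n \<inter> center (H_alg z)"
  using zero_center by (auto simp: prev_def center_ring_def split: nat.splits)

lemma center_coset:
  "Prev z n <+>\<^bsub>H_alg z\<^esub> ((Prev z n \<inter> center (H_alg z)) +>\<^bsub>center_ring (H_alg z)\<^esub> H_class z a) = coset z n a"
proof -
  interpret abelian_subgroup "Prev z n" "H_alg z" by (rule Prev_subgroup)
  interpret ring "H_alg z" by (rule ring_H_alg)
  have c: "c \<in> carrier (H_alg z)" if "c \<in> Prev z n" for c using that a_subset by auto
  have "Prev z n <+>\<^bsub>H_alg z\<^esub> ((Prev z n \<inter> center (H_alg z)) +>\<^bsub>center_ring (H_alg z)\<^esub> H_class z a)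
     = {b \<oplus>\<^bsub>H_alg z\<^esub> (c \<oplus>\<^bsub>H_alg z\<^esub> H_class z a) | b c. b \<in> Prev z n \<and> c \<in> Prev z n \<and> c \<in> center (H_alg z)}"
    by (auto simp: set_add_def' a_r_coset_def' center_ring_def)
  also have "\<dots> = {b \<oplus>\<^bsub>H_alg z\<^esub> H_class z a | b. b \<in> Prev z n}"
  proof (intro equalityI subsetI)
    fix w assume "w \<in> {b \<oplus>\<^bsub>H_alg z\<^esub> (c \<oplus>\<^bsub>H_alg z\<^esub> H_class z a) | b c. b \<in> Prev z n \<and> c \<in> Prev z n \<and> c \<in> center (H_alg z)}"
    then obtain b d where "b \<in> Prev z n" "d \<in> Prev z n" "w = b \<oplus>\<^bsub>H_alg z\<^esub> (d \<oplus>\<^bsub>H_alg z\<^esub> H_class z a)" by blast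
    then have "w = (b \<oplus>\<^bsub>H_alg z\<^esub> d) \<oplus>\<^bsub>H_alg z\<^esub> H_class z a" "b \<oplus>\<^bsub>H_alg z\<^esub> d \<in> Prev z n" using c by (auto simp: a_assoc)
    then show "w \<in> {b \<oplus>\<^bsub>H_alg z\<^esub> H_class z a | b. b \<in> Prev z n}" by blast
  next
    fix w assume "w \<in> {b \<oplus>\<^bsub>H_alg z\<^esub> H_class z a | b. b \<in> Prev z n}"
    then obtain b where "b \<in> Prev z n" "w = b \<oplus>\<^bsub>H_alg z\<^esub> (\<zero>\<^bsub>H_alg z\<^esub> \<oplus>\<^bsub>H_alg z\<^esub> H_class z a)" using c by auto
    then show "w \<in> {b \<oplus>\<^bsub>H_alg z\<^esub> (c \<oplus>\<^bsub>H_alg z\<^esub> H_class z a) | b c. b \<in> Prev z n \<and> c \<in> Prev z n \<and> c \<in> center (H_alg z)}"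
      using zero_center additive_subgroup.zero_closed[OF is_additive_subgroup] by blast
  qed
  also have "\<dots> = coset z n a" by (auto simp: coset_def a_r_coset_def')
  finally show ?thesis .
qed

lemma carrier_gr_center:
  "carrier (gr (center_ring (H_alg z)) (\<lambda>n. H_fil z n \<inter> center (H_alg z)))
    = {u. (\<forall>n. \<exists>a. a \<in> V_bounded n \<and> H_class z a \<in> center (H_alg z)
          \<and> u n = (Prev z n \<inter> center (H_alg z)) +>\<^bsub>center_ring (H_alg z)\<^esub> H_class z a)
        \<and> finite {n. u n \<noteq> Prev z n \<inter> center (H_alg z)}}"
proof -
  have *: "(\<exists>A\<in>H_fil z n \<inter> center (H_alg z). g A) \<longleftrightarrow> (\<exists>a. a \<in> V_bounded n \<and> H_class z a \<in> center (H_alg z) \<and> g (H_class z a))" for n g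
    by (auto simp: H_fil_eq)
  show ?thesis by (simp add: gr_def prev_center *)
qed

text \<open>Each component has a representative that is central in H_z, so the two convolution sums
  differ only in the order of their factors.\<close>

lemma gr_center_sub: "gr_center (H_alg (z :: 'k::field poly)) (H_fil z) \<subseteq> center (gr_H z)"
proof
  fix v assume "v \<in> gr_center (H_alg z) (H_fil z)"
  then obtain u where v: "v = gr_embed (H_alg z) (H_fil z) u"
    and u: "u \<in> carrier (gr (center_ring (H_alg z)) (\<lambda>n. H_fil z n \<inter> center (H_alg z)))" by (auto simp: gr_center_def)
  let ?P = "\<lambda>n. Prev z n \<inter> center (H_alg z)"
  have "\<exists>a. a \<in> V_bounded n \<and> H_class z a \<in> center (H_alg z) \<and> u n = ?P n +>\<^bsub>center_ring (H_alg z)\<^esub> H_class z a" for n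
    using u by (simp add: carrier_gr_center)
  then obtain a where a: "\<And>n. a n \<in> V_bounded n" "\<And>n. H_class z (a n) \<in> center (H_alg z)"
    "\<And>n. u n = ?P n +>\<^bsub>center_ring (H_alg z)\<^esub> H_class z (a n)" by metis
  have vn: "v n = coset z n (a n)" for n by (simp add: v gr_embed_def a(3) center_coset)
  have fin: "finite {n. u n \<noteq> ?P n}" using u by (simp add: carrier_gr_center)
  have P0: "?P n = ?P n +>\<^bsub>center_ring (H_alg z)\<^esub> H_class z 0" for n
  proof -
    interpret ring "H_alg z" by (rule ring_H_alg)
    have "c \<oplus>\<^bsub>H_alg z\<^esub> \<zero>\<^bsub>H_alg z\<^esub> = c" if "c \<in> center (H_alg z)" for c using that by (simp add: center_def)
    then show ?thesis by (auto simp: a_r_coset_def' center_ring_def H_class_simps)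
  qed
  have "v n = Prev z n" if "u n = ?P n" for n
  proof -
    have "Prev z n <+>\<^bsub>H_alg z\<^esub> ?P n = coset z n 0" using center_coset[of z n 0] unfolding P0[symmetric] .
    then show ?thesis using that by (simp add: v gr_embed_def coset_0)
  qed
  then have "{n. v n \<noteq> Prev z n} \<subseteq> {n. u n \<noteq> ?P n}" by (intro Collect_mono) blast
  then have "finite {n. v n \<noteq> Prev z n}" by (rule finite_subset[OF _ fin])
  then have "v \<in> carrier (gr_H z)" unfolding carrier_gr_H mem_Collect_eq using vn a(1) by (intro conjI allI) (rule bexI[of _ "a _"])
  moreover have "v \<otimes>\<^bsub>gr_H z\<^esub> w = w \<otimes>\<^bsub>gr_H z\<^esub> v" if w: "w \<in> carrier (gr_H z)" for w
  proof
    fix n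
    obtain b where b: "\<And>n. b n \<in> V_bounded n" "\<And>n. w n = coset z n (b n)"
      using w unfolding carrier_gr_H by (simp add: Bex_def) metis
    have s: "(\<Sum>i\<le>n. b i * a (n - i)) = (\<Sum>i\<le>n. b (n - i) * a i)"
      using sum.nat_diff_reindex[of "\<lambda>i. b i * a (n - i)" "Suc n"] by (simp add: lessThan_Suc_atMost)
    have "rep z (\<Sum>i\<le>n. a i * b (n - i)) = rep z (\<Sum>i\<le>n. b (n - i) * a i)"
      using a(2) by (simp add: H_class_center rep_sum rep_simps)
    then show "(v \<otimes>\<^bsub>gr_H z\<^esub> w) n = (w \<otimes>\<^bsub>gr_H z\<^esub> v) n"
      by (simp add: gr_mult[of v z a w b, OF vn b(2) a(1) b(1)] gr_mult[of w z b v a, OF b(2) vn b(1) a(1)] s coset_eq_iff nf_def)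
  qed
  ultimately show "v \<in> center (gr_H z)" by (simp add: center_def)
qed

lemma coset_in_gr_center:
  assumes "\<And>n. a n \<in> V_bounded n" "\<And>n. H_class z (a n) \<in> center (H_alg z)" "finite {n. a n \<noteq> 0}"
  shows "(\<lambda>n. coset z n (a n)) \<in> gr_center (H_alg z) (H_fil z)"
proof -
  let ?P = "\<lambda>n. Prev z n \<inter> center (H_alg z)"
  let ?u = "\<lambda>n. ?P n +>\<^bsub>center_ring (H_alg z)\<^esub> H_class z (a n)"
  interpret ring "H_alg z" by (rule ring_H_alg)
  have "c \<oplus>\<^bsub>H_alg z\<^esub> \<zero>\<^bsub>H_alg z\<^esub> = c" if "c \<in> center (H_alg z)" for c using that by (simp add: center_def)
  then have P0: "?P n = ?P n +>\<^bsub>center_ring (H_alg z)\<^esub> H_class z 0" for n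
    by (auto simp: a_r_coset_def' center_ring_def H_class_simps)
  have "{n. ?u n \<noteq> ?P n} \<subseteq> {n. a n \<noteq> 0}" using P0 by force
  then have fin: "finite {n. ?u n \<noteq> ?P n}" by (rule finite_subset) fact
  have 1: "?u \<in> carrier (gr (center_ring (H_alg z)) (\<lambda>n. H_fil z n \<inter> center (H_alg z)))"
    unfolding carrier_gr_center using fin assms(1,2) by blast
  have 2: "gr_embed (H_alg z) (H_fil z) ?u = (\<lambda>n. coset z n (a n))"
    by (simp add: gr_embed_def center_coset)
  show ?thesis unfolding gr_center_def using imageI[OF 1, of "gr_embed (H_alg z) (H_fil z)"] unfolding 2 .
qed

text \<open>Only the lifting of homogeneous parts is left to prove: each part of a central element
  of H_0 must be the leading term of a central element of H_z.\<close>

lemma gr_center_eq: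
  fixes z :: "'k::field poly"
  assumes lift: "\<And>c n. H_class 0 c \<in> center (H_alg 0) \<Longrightarrow>
    \<exists>b \<in> V_bounded n. H_class z b \<in> center (H_alg z) \<and> nf z b - part n (nf 0 c) \<in> below n"
  shows "gr_center (H_alg z) (H_fil z) = center (gr_H z)"
proof (rule antisym[OF gr_center_sub], rule subsetI)
  fix v assume "v \<in> center (gr_H z)"
  then have "v \<in> natural_map z ` center (H_alg 0)" by (simp add: ring_iso_center[OF natural_map_iso ring_H_alg])
  then obtain c where c: "H_class 0 c \<in> center (H_alg 0)" "v = graded_class z c"
    by (auto simp: center_def carrier_H_alg natural_map_H_class)
  obtain b where b: "\<And>n. b n \<in> V_bounded n" "\<And>n. H_class z (b n) \<in> center (H_alg z)" "\<And>n. nf z (b n) - part n (nf 0 c) \<in> below n"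
    using lift[OF c(1)] by metis
  \<comment> \<open>Lifts of vanishing parts are reset to 0 to keep the family finitely
    supported.\<close>
  define a where "a n = (if part n (nf 0 c) = 0 then 0 else b n)" for n
  have "{n. a n \<noteq> 0} \<subseteq> vdeg ` keys (nf 0 c)"
  proof
    fix n assume "n \<in> {n. a n \<noteq> 0}"
    then have "part n (nf 0 c) \<noteq> 0" by (auto simp: a_def)
    then show "n \<in> vdeg ` keys (nf 0 c)" by (rule part_nonzero)
  qed
  then have "finite {n. a n \<noteq> 0}" by (rule finite_subset) simp
  moreover have "a n \<in> V_bounded n" "H_class z (a n) \<in> center (H_alg z)" for n
    using b(1,2)[of n] zero_center by (auto simp: a_def H_class_simps V_bounded_def)
  moreover have "coset z n (a n) = v n" for n
  proof -
    have "nf z (a n) - part n (nf 0 c) \<in> below n" using b(3)[of n] by (auto simp: a_def)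
    then have "nf z (a n) - nf z (V_component n c) \<in> below n"
      using below_diff[OF _ nf_V_component_below[of z n c]] by fastforce
    then show ?thesis by (simp add: c(2) graded_class_coset coset_eq_iff)
  qed
  ultimately show "v \<in> gr_center (H_alg z) (H_fil z)" using coset_in_gr_center[of a z] by simp
qed

section \<open>The center of \<open>H\<^sub>0\<close>\<close>

definition wshift :: "(key \<Rightarrow> key) \<Rightarrow> (key \<Rightarrow> 'k) \<Rightarrow> 'k::field endo"
  where "wshift \<sigma> g = lend (\<lambda>k p. single (\<sigma> k) (smult (g k) p))"

lemma wshift_linear: "coeff_linear (\<lambda>k p. single (\<sigma> k) (smult (g k) p) :: 'k::field pbw)"
  by (rule coeff_linearI) (simp_all add: smult_add_right single_add mult.commute)

lemma wshift_single: "app (wshift \<sigma> g) (single k p) = single (\<sigma> k) (smult (g k) p)"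
  by (simp add: wshift_def app_lend_single[OF wshift_linear])

lemma keys_wshift: "keys (app (wshift \<sigma> g) m) \<subseteq> \<sigma> ` keys m"
proof -
  have "app (wshift \<sigma> g) m = (\<Sum>k\<in>keys m. single (\<sigma> k) (smult (g k) (lookup m k)))"
    by (simp add: wshift_def app_lend[OF wshift_linear] lin_def)
  also have "keys \<dots> \<subseteq> (\<Union>k\<in>keys m. keys (single (\<sigma> k) (smult (g k) (lookup m k))))" by (rule keys_sum)
  finally show ?thesis by (auto split: if_splits)
qed

lemma lookup_wshift:
  assumes "inj_on \<sigma> {k. g k \<noteq> 0}" "g k \<noteq> 0"
  shows "lookup (app (wshift \<sigma> g) m) (\<sigma> k) = smult (g k) (lookup m k)"
proof (induction m rule: pbw_induct)
  case (single k' p)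
  show ?case
  proof (cases "\<sigma> k' = \<sigma> k \<and> g k' \<noteq> 0")
    case True
    then have "k' = k" using assms by (auto dest: inj_onD)
    then show ?thesis by (simp add: wshift_single)
  next
    case False
    then have "k' \<noteq> k" using assms by auto
    with False show ?thesis by (auto simp: wshift_single lookup_single when_def)
  qed
qed (simp_all add: app_add_right lookup_add smult_add_right)

lemma wshift_kernel:
  assumes "inj_on \<sigma> {k. g k \<noteq> 0}" "app (wshift \<sigma> g) m = 0" "k \<in> keys m"
  shows "g k = 0"
  using lookup_wshift[OF assms(1), of k m] assms(2,3) by (auto simp: in_keys_iff)

section \<open>Left and right multiplication in H_0\<close>

abbreviation "Y0 \<equiv> Yop 0"
abbreviation "E0 \<equiv> Eop 0"
abbreviation "F0 \<equiv> Fop 0"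

lemma Y0_single: "app Y0 (single (i,j,a,c) p) = single (i,Suc j,a,c) p"
  by (induction i) (simp_all add: EFY_single Zop_0)

lemma E0_single: "app E0 (single (i,j,a,c) p) = single (i,j,a,Suc c) (pcompose p [:-2, 1:])
    + single (i,j,a-1,c) (of_nat a * [:1 - of_nat a, 1:] * p) + single (Suc i,j-1,a,c) (of_nat j * p)"
proof (induction i)
  case 0
  show ?case
  proof (induction j)
    case (Suc j)
    have "single (Suc 0,j,a,c) (of_nat (Suc j) * p) = single (Suc 0,j,a,c) p + single (Suc 0,j,a,c) (of_nat j * p)"
      by (simp add: single_add[symmetric] distrib_right)
    with Suc show ?case by (cases j) (simp_all add: EFY_single app_add_right Y0_single add_ac Zop_0)
  qed (simp add: EFY_single U_e_def)
qed (simp add: EFY_single app_add_right)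

lemma F0_single: "app F0 (single (i,j,a,c) p) = single (i,j,Suc a,c) p + single (i-1,Suc j,a,c) (of_nat i * p)"
proof (induction i)
  case 0
  show ?case by (induction j) (simp_all add: EFY_single Y0_single)
next
  case (Suc i)
  have "single (i,Suc j,a,c) (of_nat (Suc i) * p) = single (i,Suc j,a,c) p + single (i,Suc j,a,c) (of_nat i * p)"
    by (simp add: single_add[symmetric] distrib_right)
  with Suc show ?case by (cases i) (simp_all add: EFY_single app_add_right Y0_single add_ac Zop_0)
qed

definition shift :: "'k \<Rightarrow> 'k::field endo" where "shift s = lend (\<lambda>k p. single k (pcompose p [:s, 1:]))"

lemma shift_single: "app (shift s) (single k p) = single k (pcompose p [:s, 1:])"
proof -
  have "coeff_linear (\<lambda>k p. single k (pcompose p [:s, 1:]) :: 'a pbw)"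
    by (rule coeff_linearI) (simp_all add: pcompose_add pcompose_smult single_add)
  then show ?thesis by (simp add: shift_def app_lend_single)
qed

abbreviation "S \<equiv> shift 1"
text \<open>\<open>Gf\<close> and \<open>Ge\<close> are the partial derivatives in f and e. They
  enter right multiplication through f^a x = x f^a + a y f^(a-1) and e^c y = y e^c + c x e^(c-1),
  while S comes from p(h) x = x p(h + 1).\<close>

definition Gf :: "'k::field endo" where "Gf = wshift (\<lambda>(i,j,a,c). (i,j,a-1,c)) (\<lambda>(i,j,a,c). of_nat a)"
definition Ge :: "'k::field endo" where "Ge = wshift (\<lambda>(i,j,a,c). (i,j,a,c-1)) (\<lambda>(i,j,a,c). of_nat c)"
definition RX :: "'k::field endo" where "RX = S * (Xop + Y0 * Gf)"
definition RY :: "'k::field endo" where "RY = Y0 * shift (-1) + RX * Ge"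
definition RH :: "'k::field endo" where "RH = Hop + wshift id (\<lambda>(i,j,a,c). 2 * of_nat a + of_nat j - of_nat i - 2 * of_nat c)"

lemma G_single:
  "app Gf (single (i,j,a,c) p) = single (i,j,a-1,c) (smult (of_nat a) p)"
  "app Ge (single (i,j,a,c) p) = single (i,j,a,c-1) (smult (of_nat c) p)"
  by (simp_all add: Gf_def Ge_def wshift_single)

lemma pcompose_linear: "pcompose (pcompose p [:s, 1:]) [:t, 1:] = pcompose p [:s + t, 1 :: 'k::field:]"
  by (simp add: pcompose_assoc[symmetric] pcompose_pCons)

lemma pcompose_pCons_1: "pcompose [:u, 1:] [:t, 1:] = [:u + t, 1 :: 'k::field:]"
  by (simp add: pcompose_pCons)

lemma pcompose_id: "pcompose p [:0, 1:] = (p :: 'k::field poly)"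
  by (induction p) (auto simp: pcompose_pCons)

lemma pcompose_of_nat: "pcompose (of_nat n) q = of_nat n"
  by (induction n) (simp_all add: pcompose_add pcompose_1)

lemma RX_single: "app RX (single (i,j,a,c) p) = single (Suc i,j,a,c) (pcompose p [:1, 1:])
    + single (i,Suc j,a-1,c) (smult (of_nat a) (pcompose p [:1, 1:]))"
  by (simp add: RX_def app_times app_plus app_add_right G_single Y0_single shift_single pcompose_smult)

lemma RH_single: "app RH (single (i,j,a,c) p) = single (i,j,a,c) ([:- (2 * of_nat c), 1:] * p)"
proof -
  have "[:of_nat i - of_nat j - 2 * of_nat a, 1:] * p + smult (2 * of_nat a + of_nat j - of_nat i - 2 * of_nat c) p
    = [:- (2 * of_nat c), 1:] * p" for p :: "'a poly"
  proof -
    have "smult u p = [:u:] * p" for u by simp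
    then show ?thesis by (simp only: distrib_right[symmetric]) simp
  qed
  then show ?thesis by (simp only: RH_def app_plus Hop_single wshift_single single_add[symmetric] id_apply prod.case)
qed

lemma endo_eqI4: "(\<And>i j a c p. app f (single (i,j,a,c) p) = app g (single (i,j,a,c) p)) \<Longrightarrow> f = g"
  by (rule endo_eq_single) auto

lemmas single_rules = app_times app_plus app_minus app_uminus app_add_right app_diff_right Y0_single G_single shift_single
  pcompose_smult pcompose_linear right_e_single

lemma shift_comm:
  "Xop * shift s = shift s * Xop" "Y0 * shift s = shift s * Y0" "Gf * shift s = shift s * Gf" "Ge * shift s = shift s * Ge"
  "right_e * shift s = shift s * right_e" "F0 * shift s = shift s * F0"
  by (rule endo_eqI4, simp add: single_rules F0_single pcompose_mult pcompose_of_nat)+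

lemma shift_shift: "shift s * shift t = shift (s + t)" and shift_0: "shift 0 = 1"
  by (rule endo_eqI4, simp add: single_rules pcompose_id add.commute)+

lemma XY_comm: "Y0 * Xop = Xop * Y0" "Gf * Xop = Xop * Gf" "Gf * Y0 = Y0 * Gf" "Ge * Xop = Xop * Ge" "Ge * Y0 = Y0 * Ge"
  "right_e * Xop = Xop * right_e" "right_e * Y0 = Y0 * right_e" "Ge * Gf = Gf * Ge"
  by (rule endo_eqI4, simp add: single_rules mult.commute)+

lemma shift_H: "S * Hop = (Hop + 1) * S"
proof (rule endo_eqI4)
  fix i j a c and p :: "'a poly"
  have "[:of_nat i - of_nat j - 2 * of_nat a + 1, 1:] = [:of_nat i - of_nat j - 2 * of_nat a, 1 :: 'a:] + 1"
    by (simp add: one_pCons)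
  then show "app (S * Hop) (single (i,j,a,c) p) = app ((Hop + 1) * S) (single (i,j,a,c) p)"
    by (simp only: single_rules Hop_single pcompose_mult pcompose_pCons_1 distrib_right mult_1_left single_add app_1)
qed

lemma shift_E: "S * E0 = (E0 + Gf) * S"
proof (rule endo_eqI4)
  fix i j a c and p :: "'a poly"
  have "[:1 - of_nat a + 1, 1:] = [:1 - of_nat a, 1 :: 'a:] + 1"
    by (simp add: one_pCons)
  moreover have "smult (of_nat a) q = of_nat a * q" for q :: "'a poly" by (simp add: of_nat_poly)
  ultimately show "app (S * E0) (single (i,j,a,c) p) = app ((E0 + Gf) * S) (single (i,j,a,c) p)"
    by (simp only: single_rules E0_single pcompose_mult pcompose_pCons_1 distrib_right distrib_left mult_1_right mult_1_left single_add app_1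
        pcompose_of_nat) (simp add: add_ac)
qed

text \<open>The commutators with x, y, e, h as operators on normal forms.\<close>

definition KX :: "'k::field endo" where "KX = Xop - RX"
definition KY :: "'k::field endo" where "KY = Y0 - RY"
definition KE :: "'k::field endo" where "KE = E0 - right_e"
definition KH :: "'k::field endo" where "KH = Hop - RH"

lemma KH_wshift: "KH = wshift id (\<lambda>(i,j,a,c). of_nat i - of_nat j - 2 * of_nat a + 2 * of_nat c)"
  by (rule endo_eqI4, simp add: KH_def RH_def single_rules wshift_single single_uminus[symmetric] smult_minus_left[symmetric] del: smult_minus_left,
      simp add: algebra_simps)

lemma comm_mult: "a * b = b * a \<Longrightarrow> a * c = c * a \<Longrightarrow> a * (b * c) = (b * c) * a" for a b c :: "'a::ring_1"
  by (metis mult.assoc)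

lemma comm_add: "a * b = b * a \<Longrightarrow> a * c = c * a \<Longrightarrow> a * (b + c) = (b + c) * a" for a b c :: "'a::ring_1"
  by (simp add: distrib_left distrib_right)

lemma comm_diff: "a * b = b * a \<Longrightarrow> a * c = c * a \<Longrightarrow> a * (b - c) = (b - c) * a" for a b c :: "'a::ring_1"
  by (simp add: left_diff_distrib right_diff_distrib)

lemma shift_shift_comm: "shift s * shift t = shift t * shift s"
  by (simp add: shift_shift add.commute)

lemma K_comm:
  "S * KX = (KX :: 'k::field endo) * S" "Xop * KX = (KX :: 'k endo) * Xop" "Y0 * KX = (KX :: 'k endo) * Y0"
  "S * KY = (KY :: 'k endo) * S" "Xop * KY = (KY :: 'k endo) * Xop" "Y0 * KY = (KY :: 'k endo) * Y0"
  "S * KH = (KH :: 'k endo) * S" "Xop * Y0 * KH = (KH :: 'k endo) * (Xop * Y0)"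
proof -
  have *: "b * RX = RX * b" if "b \<in> {S, Xop, Y0}" for b :: "'k endo"
    using that unfolding RX_def
    by (auto intro!: comm_mult comm_add simp: shift_comm XY_comm shift_shift_comm)
  from this[of S] this[of Xop] this[of Y0] show "S * KX = (KX :: 'k endo) * S" "Xop * KX = (KX :: 'k endo) * Xop" "Y0 * KX = (KX :: 'k endo) * Y0"
    by (auto simp: KX_def right_diff_distrib left_diff_distrib shift_comm XY_comm)
  have "b * RY = RY * b" if "b \<in> {S, Xop, Y0}" for b :: "'k endo"
    using that *[OF that] unfolding RY_def
    by (auto intro!: comm_mult comm_add simp: shift_comm XY_comm shift_shift_comm)
  from this[of S] this[of Xop] this[of Y0] show "S * KY = (KY :: 'k endo) * S" "Xop * KY = (KY :: 'k endo) * Xop" "Y0 * KY = (KY :: 'k endo) * Y0"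
    by (auto simp: KY_def right_diff_distrib left_diff_distrib shift_comm XY_comm)
  show "S * KH = (KH :: 'k endo) * S" "Xop * Y0 * KH = (KH :: 'k endo) * (Xop * Y0)"
    by (rule endo_eqI4, simp add: KH_wshift single_rules wshift_single)+
qed

text \<open>Unlike the other commutators, the one with e commutes neither with S nor with x y. The
  two corrections cancel in \<open>center0_derivation\<close>.\<close>

lemma KE_comm: "S * KE = (KE :: 'k::field endo) * S + Gf * S" "(KE :: 'k endo) * (Xop * Y0) = Xop * Y0 * KE + Xop * Xop"
proof -
  show "S * KE = (KE :: 'k endo) * S + Gf * S" by (simp add: KE_def left_diff_distrib right_diff_distrib distrib_right shift_E shift_comm(5))
  have "(E0 :: 'k endo) * (Xop * Y0) = Xop * Y0 * E0 + Xop * Xop"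
    by (simp only: mult.assoc[symmetric] op.ex) (simp only: mult.assoc op.ey distrib_left)
  moreover have "(right_e :: 'k endo) * (Xop * Y0) = Xop * Y0 * right_e" by (rule comm_mult[OF XY_comm(6,7)])
  ultimately show "(KE :: 'k endo) * (Xop * Y0) = Xop * Y0 * KE + Xop * Xop" by (simp add: KE_def left_diff_distrib right_diff_distrib diff_add_eq)
qed

lemma X_inj: "app Xop m = 0 \<Longrightarrow> m = 0" and Y_inj: "app Y0 m = 0 \<Longrightarrow> m = 0"
  and keys_X: "keys (app Xop m) = (\<lambda>(i,j,a,c). (Suc i,j,a,c)) ` keys m"
  and keys_Y: "keys (app Y0 m) = (\<lambda>(i,j,a,c). (i,Suc j,a,c)) ` keys m"
proof -
  let ?x = "\<lambda>(i,j,a,c). (Suc i,j,a,c) :: key" and ?y = "\<lambda>(i,j,a,c). (i,Suc j,a,c) :: key"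
  have XY: "Xop = wshift ?x (\<lambda>_. 1 :: 'a)" "Y0 = wshift ?y (\<lambda>_. 1 :: 'a)"
    by (rule endo_eqI4, simp add: wshift_single Y0_single)+
  have k: "keys (app (wshift \<sigma> (\<lambda>_. 1 :: 'a)) m) = \<sigma> ` keys m" if "inj \<sigma>" for \<sigma>
    using keys_wshift[of \<sigma> "\<lambda>_. 1" m] lookup_wshift[of \<sigma> "\<lambda>_. 1 :: 'a" _ m] that by (auto simp: in_keys_iff)
  have "inj ?x" "inj ?y" by (auto simp: inj_on_def)
  from k[OF this(1)] k[OF this(2)]
  show x: "keys (app Xop m) = ?x ` keys m" and y: "keys (app Y0 m) = ?y ` keys m" unfolding XY .
  have "keys m = {} \<Longrightarrow> m = 0" by (simp add: keys_eq_empty)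
  then show "app Xop m = 0 \<Longrightarrow> m = 0" "app Y0 m = 0 \<Longrightarrow> m = 0" using x y by auto
qed

lemma XY_inj: "app (Xop * Y0) m = 0 \<Longrightarrow> m = 0"
  using X_inj Y_inj by (auto simp: app_times)

lemma shift_inj: "app (shift s) m = 0 \<Longrightarrow> m = 0"
  using shift_shift[of "- s" s] by (metis app_1 app_times app_zero_right left_minus shift_0 add.left_inverse)

lemma XY_divide:
  assumes "\<And>i j a c. (i,j,a,c) \<in> keys m \<Longrightarrow> i > 0 \<and> j > 0"
  shows "\<exists>b. m = app (Xop * Y0) b"
proof -
  let ?d = "wshift (\<lambda>(i,j,a,c). (i-1,j-1,a,c)) (\<lambda>_. 1 :: 'a)"
  have "app (Xop * Y0) (app ?d m) = m"
  proof (induction m rule: pbw_induct)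
    case (single k p)
    then show ?case using assms by (cases k) (simp add: wshift_single app_times Y0_single)
  qed (simp_all add: app_add_right)
  then show ?thesis by metis
qed

text \<open>Contains the normal forms of all central elements of H_0, see
  \<open>center_center0\<close>.\<close>

definition center0 :: "'k::field pbw set"
  where "center0 = {m. app KX m = 0 \<and> app KY m = 0 \<and> app KE m = 0 \<and> app KH m = 0}"

lemma center0_add: "u \<in> center0 \<Longrightarrow> v \<in> center0 \<Longrightarrow> u + v \<in> center0"
  and center0_smul: "u \<in> center0 \<Longrightarrow> smul r u \<in> center0"
  and center0_0: "0 \<in> center0"
  by (simp_all add: center0_def app_add_right app_smul)

text \<open>These are x n = n x and y n = n y, with right multiplication written out and solved for
  n - S n.\<close>

lemma center0_XY:
  assumes "n \<in> center0"
  shows "app Xop (n - app S n) = app Y0 (app S (app Gf n))" "app Y0 (n - app S n) = - app Xop (app S (app Ge n))"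
proof -
  have x: "app Xop n = app RX n" and y: "app Y0 n = app RY n"
    using assms by (simp_all add: center0_def KX_def KY_def app_minus)
  have c: "app a (app b m) = app b (app a m)" if "a * b = b * a" for a b :: "'a endo" and m
    using that by (metis app_times)
  have "app Xop n = app S (app Xop n) + app Y0 (app S (app Gf n))"
    unfolding x by (subst (1) RX_def) (simp add: app_times app_plus app_add_right c[OF shift_comm(2)] x[symmetric])
  then have "app Xop n - app S (app Xop n) = app Y0 (app S (app Gf n))" by (metis add_diff_cancel_left')
  then show "app Xop (n - app S n) = app Y0 (app S (app Gf n))" by (simp add: app_diff_right c[OF shift_comm(1)])
  have RG: "RX * Ge = Ge * (RX :: 'a endo)"
    unfolding RX_def by (intro comm_mult comm_add shift_comm XY_comm shift_comm[symmetric] XY_comm[symmetric] sym[OF comm_mult] sym[OF comm_add])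
  then have e: "app Y0 n = app Y0 (app (shift (-1)) n) + app Xop (app Ge n)"
    unfolding y using x by (subst RY_def) (simp add: app_plus app_times c[OF RG] c[OF XY_comm(4)] flip: x)
  have "app S (app Y0 n) = app Y0 (app S (app (shift (-1)) n)) + app Xop (app S (app Ge n))"
    using arg_cong[OF e, of "app S"] by (simp only: app_add_right c[OF shift_comm(1)] c[OF shift_comm(2)])
  moreover have "app S (app (shift (-1)) n) = n" using shift_shift[of 1 "-1 :: 'a"] by (metis add.right_inverse app_1 app_times shift_0)
  ultimately show "app Y0 (n - app S n) = - app Xop (app S (app Ge n))"
    by (simp add: app_diff_right c[OF shift_comm(2)])
qed

lemma center0_Gf:
  assumes "n \<in> center0" "n - app S n = app (Xop * Y0) b"
  shows "app Gf (app S n) = app Xop (app Xop b)"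
proof -
  have c: "app a (app b m) = app b (app a m)" if "a * b = b * a" for a b :: "'a endo" and m
    using that by (metis app_times)
  have "app Y0 (app Gf (app S n) - app Xop (app Xop b)) = 0"
    using center0_XY(1)[OF assms(1)] unfolding assms(2) by (simp add: app_diff_right app_times c[OF shift_comm(3)] c[OF XY_comm(1)])
  from Y_inj[OF this] show ?thesis by simp
qed

text \<open>The derivation \<open>n \<mapsto> (n - S n) / x y\<close> of the center plays the role of \<open>- d / d t\<close> for the quadratic central element.\<close>

lemma center0_derivation:
  assumes n: "n \<in> center0"
  shows "\<exists>b\<in>center0. n - app S n = app (Xop * Y0) b"
proof -
  let ?d = "n - app S n"
  \<comment> \<open>By \<open>center0_XY\<close>, x (n - S n) is a multiple of y and y (n - S n) is
    a multiple of x, so both letters occur in every monomial.\<close>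
  have "i > 0 \<and> j > 0" if k: "(i,j,a,c) \<in> keys ?d" for i j a c
  proof -
    have "(Suc i,j,a,c) \<in> keys (app Xop ?d)" unfolding keys_X by (rule image_eqI[OF _ k]) simp
    moreover have "(i,Suc j,a,c) \<in> keys (app Y0 ?d)" unfolding keys_Y by (rule image_eqI[OF _ k]) simp
    ultimately show ?thesis unfolding center0_XY[OF n] keys_minus keys_X keys_Y by auto
  qed
  with XY_divide[of ?d] obtain b where b: "?d = app (Xop * Y0) b" by blast
  have c: "app a (app b m) = app b (app a m)" if "a * b = b * a" for a b :: "'a endo" and m
    using that by (metis app_times)
  have zero: "app k b = 0" if "S * k = k * S" "Xop * Y0 * k = k * (Xop * Y0)" "app k n = 0" for k
  proof (rule XY_inj)
    have "app k ?d = 0" using that(3) c[OF that(1), of n] by (simp add: app_diff_right)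
    then show "app (Xop * Y0) (app k b) = 0" unfolding b c[OF that(2)] .
  qed
  have "Xop * Y0 * KX = KX * (Xop * Y0)" "Xop * Y0 * KY = KY * (Xop * Y0)"
    by (rule comm_mult[OF K_comm(2)[symmetric] K_comm(3)[symmetric], symmetric],
        rule comm_mult[OF K_comm(5)[symmetric] K_comm(6)[symmetric], symmetric])
  then have "app KX b = 0" "app KY b = 0" "app KH b = 0"
    using n by (auto intro!: zero simp: K_comm center0_def)
  \<comment> \<open>The correction from S is Gf S n = x^2 b by \<open>center0_Gf\<close>; it equals
    the term x^2 in [e, x y].\<close>
  moreover have "app KE b = 0"
  proof (rule XY_inj)
    have "app KE ?d = app KE n - app (KE * S) n" by (simp add: app_diff_right app_times)
    also have "KE * S = S * KE - Gf * S" by (simp add: KE_comm)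
    also have "app KE n - app (S * KE - Gf * S) n = app Xop (app Xop b)"
      using n center0_Gf[OF n b] by (simp add: center0_def app_minus app_times)
    finally have "app (KE * (Xop * Y0)) b = app (Xop * Xop) b" unfolding b by (simp add: app_times)
    then show "app (Xop * Y0) (app KE b) = 0" unfolding KE_comm by (simp add: app_plus app_times)
  qed
  ultimately show ?thesis using b by (auto simp: center0_def)
qed

lemma power_app_Suc: "app (g ^ Suc n) m = app g (app (g ^ n) m)"
  by (simp add: app_times)

section \<open>Identifying the right multiplication operators\<close>

lemma right_mult_power:
  "app (E0 ^ c) (single (1,0,0,0) 1) = single (1,0,0,c) 1"
  "app (E0 ^ c) (single (0,1,0,0) 1) = single (0,1,0,c) 1 + single (1,0,0,c-1) (of_nat c)"
  "app (E0 ^ c) (single (0,0,0,0) [:0, 1:]) = single (0,0,0,c) [:- (2 * of_nat c), 1:]"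
  "app (F0 ^ n) (single (1,0,0,c) q) = single (1,0,n,c) q + single (0,1,n-1,c) (of_nat n * q)"
  "app (F0 ^ n) (single (0,1,0,c) q) = single (0,1,n,c) q"
  "app (F0 ^ n) (single (0,0,0,c) q) = single (0,0,n,c) q"
  "app (Y0 ^ n) (single (i,j,a,c) q) = single (i,n + j,a,c) q"
proof -
  show "app (E0 ^ c) (single (1,0,0,0) 1) = single (1,0,0,c) 1"
    by (induction c) (simp_all add: power_app_Suc E0_single pcompose_1 del: power_Suc)
  show "app (E0 ^ c) (single (0,1,0,0) 1) = single (0,1,0,c) 1 + single (1,0,0,c-1) (of_nat c)"
  proof (induction c)
    case (Suc c)
    then show ?case
      by (cases c) (simp_all add: power_app_Suc app_add_right E0_single pcompose_1 pcompose_add pcompose_of_nat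
          single_add[symmetric] add_ac del: power_Suc)
  qed simp
  show "app (E0 ^ c) (single (0,0,0,0) [:0, 1:]) = single (0,0,0,c) [:- (2 * of_nat c), 1:]"
    by (induction c) (simp_all add: power_app_Suc E0_single pcompose_pCons algebra_simps del: power_Suc)
  show "app (F0 ^ n) (single (1,0,0,c) q) = single (1,0,n,c) q + single (0,1,n-1,c) (of_nat n * q)"
  proof (induction n)
    case (Suc n)
    have "single k (2 * q) = single k q + single k q" for k :: key by (simp only: mult_2 single_add)
    with Suc show ?case
      by (cases n) (simp_all add: power_app_Suc app_add_right F0_single single_add distrib_right add_ac del: power_Suc)
  qed simp
  show "app (F0 ^ n) (single (0,1,0,c) q) = single (0,1,n,c) q"
    by (induction n) (simp_all add: power_app_Suc F0_single del: power_Suc)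
  show "app (F0 ^ n) (single (0,0,0,c) q) = single (0,0,n,c) q"
    by (induction n) (simp_all add: power_app_Suc F0_single del: power_Suc)
  show "app (Y0 ^ n) (single (i,j,a,c) q) = single (i,n + j,a,c) q"
    by (induction n) (simp_all add: power_app_Suc Y0_single del: power_Suc)
qed

lemma app_peval_Hop':
  "app (sc.peval Hop p) (single (i,j,a,c) q) = single (i,j,a,c) (pcompose p [:of_nat i - of_nat j - 2 * of_nat a, 1:] * q)"
proof (induction p)
  case (pCons b p)
  have "smul b (single k q) = single k ([:b:] * q)" for k by simp
  with pCons show ?case
    by (simp only: sc.peval_pCons app_plus app_times app_scal Hop_single pcompose_pCons distrib_right mult.assoc single_add)
qed simp

lemma rep0_pbw_word: "rep 0 (pbw_word (i,j,a,c) p) = Xop ^ i * (Y0 ^ j * (F0 ^ a * (sc.peval Hop p * E0 ^ c)))"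
  by (simp add: pbw_word_def)

lemma nf0_right:
  "nf 0 (a * vx) = app RX (nf 0 a)" "nf 0 (a * vy) = app RY (nf 0 a)" "nf 0 (a * vh) = app RH (nf 0 a)"
proof -
  have u: "app Xop unit_vec = single (1,0,0,0) (1 :: 'a poly)" "app Y0 unit_vec = single (0,1,0,0) (1 :: 'a poly)"
    "app Hop unit_vec = single (0,0,0,0) ([:0, 1:] :: 'a poly)"
    by (simp_all add: unit_vec_def Y0_single Hop_single)
  have "app (rep 0 (pbw_word k p)) (app Xop unit_vec) = app RX (single k p)" for k and p :: "'a poly"
    unfolding u
    by (cases k; simp only: rep0_pbw_word app_times right_mult_power app_peval_Hop' app_add_right Xop_power RX_single)
      (simp add: of_nat_poly)
  from rep_right[OF this] show "nf 0 (a * vx) = app RX (nf 0 a)" by (simp add: nf_def app_times)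
  have "app (rep 0 (pbw_word k p)) (app Y0 unit_vec) = app RY (single k p)" for k and p :: "'a poly"
    unfolding u
    by (cases k; simp only: rep0_pbw_word app_times right_mult_power app_peval_Hop' app_add_right Xop_power RY_def app_plus G_single
          RX_single shift_single Y0_single)
      (simp add: of_nat_poly pcompose_smult mult.commute)
  from rep_right[OF this] show "nf 0 (a * vy) = app RY (nf 0 a)" by (simp add: nf_def app_times)
  have "app (rep 0 (pbw_word k p)) (app Hop unit_vec) = app RH (single k p)" for k and p :: "'a poly"
    unfolding u
    by (cases k; simp only: rep0_pbw_word app_times right_mult_power app_peval_Hop' app_add_right Xop_power RH_single)
      (simp add: pcompose_id mult.commute)
  from rep_right[OF this] show "nf 0 (a * vh) = app RH (nf 0 a)" by (simp add: nf_def app_times)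
qed

lemma center_center0:
  assumes "H_class 0 a \<in> center (H_alg 0)"
  shows "nf 0 a \<in> center0"
proof -
  have c: "nf 0 (b * a) = nf 0 (a * b)" for b using assms by (simp add: H_class_center nf_def)
  have "app Xop (nf 0 a) = app RX (nf 0 a)" "app Y0 (nf 0 a) = app RY (nf 0 a)" "app Hop (nf 0 a) = app RH (nf 0 a)"
    "app E0 (nf 0 a) = app right_e (nf 0 a)"
    using c[of vx] c[of vy] c[of vh] c[of ve] by (simp_all add: nf0_right nf_right_e) (simp_all add: nf_mult)
  then show ?thesis by (simp add: center0_def KX_def KY_def KE_def KH_def app_minus)
qed

lemma left_right_comm:
  assumes "\<And>a. nf z (a * v) = app R (nf z a)" shows "rep z b * R = R * rep z b"
proof (rule endo_eqI)
  fix m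
  have "app R m = nf z (pbw_falg m * v)" by (simp add: assms)
  then have "app (rep z b * R) m = nf z (b * (pbw_falg m * v))" by (simp add: app_times nf_mult)
  also have "\<dots> = app (R * rep z b) m" by (simp only: mult.assoc[symmetric] assms) (simp add: app_times nf_mult)
  finally show "app (rep z b * R) m = app (R * rep z b) m" .
qed

section \<open>The quadratic central element of H_0 and powers of it\<close>

definition half_tau :: "'k::comm_ring_1 falg" where "half_tau = ve * (vy * vy) + vh * (vx * vy) - vf * (vx * vx)"
definition tau :: "'k::comm_ring_1 falg" where "tau = half_tau + half_tau"

abbreviation "T0 \<equiv> rep 0 tau"

lemma T0_comm:
  assumes "(2 :: 'k::field) \<noteq> 0"
  shows "T0 * Xop = Xop * (T0 :: 'k endo)" "T0 * Y0 = Y0 * (T0 :: 'k endo)" "T0 * E0 = E0 * (T0 :: 'k endo)" "T0 * Hop = Hop * (T0 :: 'k endo)"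
proof -
  interpret A: HZ_antidifference scal "0 :: 'k poly" E0 F0 Hop Xop Y0 0
    by (intro HZ_antidifference.intro HZ_ops HZ_antidifference_axioms.intro assms) (simp add: antidifference_def)
  have "A.T = T0" by (simp add: A.T_def op.Z_def A.R_def tau_def half_tau_def mult_2)
  then show "T0 * Xop = Xop * (T0 :: 'k endo)" "T0 * Y0 = Y0 * (T0 :: 'k endo)" "T0 * E0 = E0 * (T0 :: 'k endo)" "T0 * Hop = Hop * (T0 :: 'k endo)"
    using A.T_comm by simp_all
qed

lemma center0_T0:
  assumes "(2 :: 'k::field) \<noteq> 0" "(w :: 'k pbw) \<in> center0"
  shows "app T0 w \<in> center0"
proof -
  have "T0 * K = K * T0" if "K \<in> {KX, KY, KE, KH}" for K :: "'k endo"
    using that T0_comm[OF assms(1)] left_right_comm[OF nf0_right(1), of tau] left_right_comm[OF nf0_right(2), of tau]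
      left_right_comm[OF nf0_right(3), of tau] left_right_comm[OF nf_right_e, of 0 tau]
    by (auto simp: KX_def KY_def KE_def KH_def left_diff_distrib right_diff_distrib)
  then have "app K (app T0 w) = app T0 (app K w)" if "K \<in> {KX, KY, KE, KH}" for K
    using that by (metis app_times)
  then show ?thesis using assms(2) by (simp add: center0_def)
qed

lemma shift_T0: "S * T0 = T0 * S + (Gf * (Y0 * Y0) + Xop * Y0 + (Gf * (Y0 * Y0) + Xop * Y0)) * (S :: 'k::field endo)"
proof -
  have yy: "S * (Y0 * Y0) = Y0 * Y0 * (S :: 'k endo)" and xy: "S * (Xop * Y0) = Xop * Y0 * (S :: 'k endo)" and xx: "S * (Xop * Xop) = Xop * Xop * (S :: 'k endo)"
    by (intro comm_mult shift_comm[symmetric])+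
  have E: "S * (E0 * (Y0 * Y0)) = E0 * (Y0 * Y0) * S + Gf * (Y0 * Y0) * (S :: 'k endo)"
    by (simp only: mult.assoc[symmetric] shift_E) (simp only: mult.assoc yy distrib_right)
  have H: "S * (Hop * (Xop * Y0)) = Hop * (Xop * Y0) * S + Xop * Y0 * (S :: 'k endo)"
    by (simp only: mult.assoc[symmetric] shift_H) (simp only: mult.assoc xy distrib_right mult_1_left)
  have F: "S * (F0 * (Xop * Xop)) = F0 * (Xop * Xop) * (S :: 'k endo)"
    by (simp only: mult.assoc[symmetric] shift_comm(6)[symmetric]) (simp only: mult.assoc xx)
  have "S * rep 0 half_tau = rep 0 half_tau * S + (Gf * (Y0 * Y0) + Xop * Y0) * (S :: 'k endo)"
    by (simp add: half_tau_def distrib_left right_diff_distrib distrib_right left_diff_distrib E H F)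
  then show ?thesis by (simp add: tau_def distrib_left distrib_right)
qed

text \<open>The product rule, with -2 as the image of the quadratic element. In the correction of
  \<open>shift_T0\<close> the multiples of x^2 y^2 b cancel and 2 x y w remains.\<close>

lemma T0_derivation:
  assumes two: "(2 :: 'k::field) \<noteq> 0" and w: "(w :: 'k pbw) \<in> center0" and b: "w - app S w = app (Xop * Y0) b"
  shows "app T0 w - app S (app T0 w) = app (Xop * Y0) (app T0 b - smul 2 w)"
proof -
  have c: "app a (app b m) = app b (app a m)" if "a * b = b * a" for a b :: "'k endo" and m
    using that by (metis app_times)
  have G: "app Gf (app Y0 (app Y0 (app S w))) = app Xop (app Xop (app Y0 (app Y0 b)))"
    by (simp add: c[OF XY_comm(3)] center0_Gf[OF w b] c[OF XY_comm(1)])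
  have Sw: "app S w = w - app Xop (app Y0 b)" using b by (simp add: app_times algebra_simps)
  have "app S (app T0 w) = app (S * T0) w" by (simp add: app_times)
  also have "\<dots> = app T0 (app S w) + smul 2 (app Xop (app Xop (app Y0 (app Y0 b))) + app Xop (app Y0 (app S w)))"
    unfolding shift_T0 by (simp add: app_plus app_times G smul_2)
  also have "\<dots> = app T0 w - app Xop (app Y0 (app T0 b)) + smul 2 (app Xop (app Y0 w))"
    by (simp add: Sw app_diff_right c[OF T0_comm(1)[OF two]] c[OF T0_comm(2)[OF two]] c[OF XY_comm(1)])
  finally show ?thesis by (simp add: app_times app_diff_right app_smul)
qed

lemma T0_power_derivation:
  assumes two: "(2 :: 'k::field) \<noteq> 0" and k: "(k :: 'k pbw) \<in> center0" "app S k = k"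
  shows "app (T0 ^ s) k \<in> center0 \<and>
    app (T0 ^ Suc s) k - app S (app (T0 ^ Suc s) k) = app (Xop * Y0) (smul (- (2 * of_nat (Suc s))) (app (T0 ^ s) k))"
proof (induction s)
  case 0
  have "app T0 k - app S (app T0 k) = app (Xop * Y0) (app T0 0 - smul 2 k)"
    by (rule T0_derivation[OF two k(1)]) (simp add: k(2))
  moreover have "smul (- 2) k = - smul 2 k" by (rule poly_mapping_eqI) simp
  ultimately show ?case using k(1) by (simp add: app_times)
next
  case (Suc s)
  let ?w = "app (T0 ^ Suc s) k"
  have w: "?w \<in> center0" using Suc center0_T0[OF two] by (simp add: app_times)
  have "app T0 ?w - app S (app T0 ?w) = app (Xop * Y0) (app T0 (smul (- (2 * of_nat (Suc s))) (app (T0 ^ s) k)) - smul 2 ?w)"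
    by (rule T0_derivation[OF two w]) (use Suc in blast)
  also have "app T0 (smul (- (2 * of_nat (Suc s))) (app (T0 ^ s) k)) = smul (- (2 * of_nat (Suc s))) ?w"
    by (simp add: app_smul app_times)
  also have "smul (- (2 * of_nat (Suc s))) ?w - smul 2 ?w = smul (- (2 * of_nat (Suc (Suc s)))) ?w"
  proof -
    have e: "(- (2 * of_nat (Suc s)) :: 'k) = - (2 * of_nat (Suc (Suc s))) + 2" by simp
    show ?thesis unfolding e smul_add_left by simp
  qed
  finally show ?case using w by (simp only: power_app_Suc)
qed

lemma center0_sum: "(\<And>i. i \<in> A \<Longrightarrow> g i \<in> center0) \<Longrightarrow> sum g A \<in> center0"
  by (induction A rule: infinite_finite_induct) (simp_all add: center0_0 center0_add)

text \<open>Integration: expand the derivative of w in powers of t by induction, subtract an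
  antiderivative, and what remains is a constant. The denominators 2 (s + 1) with s + 1 < p are
  invertible.\<close>

lemma center0_nilpotent:
  assumes p: "CHAR('k::field) = p" "p > 2"
  shows "j \<le> p \<Longrightarrow> (w :: 'k pbw) \<in> center0 \<Longrightarrow> app ((1 - S) ^ j) w = 0 \<Longrightarrow>
    \<exists>k. (\<forall>s<j. k s \<in> center0 \<and> app S (k s) = k s) \<and> w = (\<Sum>s<j. app (T0 ^ s) (k s))"
proof (induction j arbitrary: w)
  case (Suc j)
  have nz: "of_nat s \<noteq> (0 :: 'k)" if "0 < s" "s < p" for s
    using that p(1) by (auto simp: of_nat_eq_0_iff_char_dvd dest: dvd_imp_le)
  have two: "(2 :: 'k) \<noteq> 0" using nz[of 2] p(2) by simp
  obtain b where b: "b \<in> center0" "w - app S w = app (Xop * Y0) b" using center0_derivation[OF Suc.prems(2)] by blast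
  have comm: "(1 - S) ^ j * (Xop * Y0) = Xop * Y0 * (1 - S :: 'k endo) ^ j"
  proof (induction j)
    case (Suc j)
    have "(1 - S) * (Xop * Y0) = Xop * Y0 * (1 - S :: 'k endo)"
      using comm_mult[of S Xop Y0] by (simp add: left_diff_distrib right_diff_distrib shift_comm[symmetric])
    then show ?case using Suc by (simp only: power_Suc mult.assoc) (simp only: mult.assoc[symmetric])
  qed simp
  have "app (Xop * Y0) (app ((1 - S) ^ j) b) = app ((1 - S) ^ j) (app (1 - S) w)"
    using arg_cong[OF comm, of "\<lambda>g. app g b"] b(2) by (simp only: app_times app_minus app_1)
  also have "\<dots> = 0" using Suc.prems(3) by (simp add: power_Suc2 app_times del: power_Suc)
  finally have "app ((1 - S) ^ j) b = 0" by (rule XY_inj)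
  from Suc.IH[OF _ b(1) this] Suc.prems(1) obtain k where k: "\<And>s. s < j \<Longrightarrow> k s \<in> center0 \<and> app S (k s) = k s"
    and bk: "b = (\<Sum>s<j. app (T0 ^ s) (k s))" by auto
  \<comment> \<open>The derivation sends t^(s+1) to -2 (s + 1) t^s; these are the coefficients of
    the antiderivative up to sign.\<close>
  define l where "l s = smul (1 / (2 * of_nat (Suc s))) (k s)" for s
  have l: "l s \<in> center0 \<and> app S (l s) = l s" if "s < j" for s
    using k[OF that] by (simp add: l_def center0_smul app_smul)
  have d: "app (T0 ^ Suc s) (l s) - app S (app (T0 ^ Suc s) (l s)) = - app (Xop * Y0) (app (T0 ^ s) (k s))" if "s < j" for s
  proof -
    have "(2 * of_nat (Suc s) :: 'k) \<noteq> 0" using nz[of "Suc s"] two that Suc.prems(1) by (auto simp del: of_nat_Suc)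
    moreover have "- v * (1 / v) = - 1" if "v \<noteq> 0" for v :: 'k using that by simp
    ultimately have "(- (2 * of_nat (Suc s))) * (1 / (2 * of_nat (Suc s))) = (- 1 :: 'k)" by blast
    then have "smul (- (2 * of_nat (Suc s))) (app (T0 ^ s) (l s)) = smul (- 1) (app (T0 ^ s) (k s))"
      by (simp only: l_def app_smul smul_smul)
    also have "\<dots> = - app (T0 ^ s) (k s)" by (rule poly_mapping_eqI) simp
    finally show ?thesis using T0_power_derivation[OF two, of "l s" s] l[OF that] by (simp only: app_minus_right)
  qed
  define w' where "w' = w + (\<Sum>s<j. app (T0 ^ Suc s) (l s))"
  have "w' - app S w' = (w - app S w) + (\<Sum>s<j. app (T0 ^ Suc s) (l s) - app S (app (T0 ^ Suc s) (l s)))"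
    by (simp add: w'_def app_add_right app_sum sum_subtractf)
  also have "(\<Sum>s<j. app (T0 ^ Suc s) (l s) - app S (app (T0 ^ Suc s) (l s))) = (\<Sum>s<j. - app (Xop * Y0) (app (T0 ^ s) (k s)))"
    by (rule sum.cong[OF refl], rule d) simp
  also have "\<dots> = - app (Xop * Y0) b" by (simp add: bk app_sum sum_negf)
  finally have w'0: "app S w' = w'" by (simp add: b(2))
  have w'c: "w' \<in> center0"
  proof -
    have "app (T0 ^ Suc s) (l s) \<in> center0" if "s \<in> {..<j}" for s
      using T0_power_derivation[OF two, of "l s" "Suc s"] l[of s] that by blast
    then show ?thesis unfolding w'_def using Suc.prems(2) by (intro center0_add center0_sum)
  qed
  define k' where "k' s = (case s of 0 \<Rightarrow> w' | Suc s \<Rightarrow> - l s)" for s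
  have "- l s \<in> center0 \<and> app S (- l s) = - l s" if "s < j" for s
    using l[OF that] by (simp add: center0_def app_minus_right)
  then have "\<forall>s<Suc j. k' s \<in> center0 \<and> app S (k' s) = k' s" using w'c w'0 by (auto simp: k'_def split: nat.split)
  moreover have "(\<Sum>s<Suc j. app (T0 ^ s) (k' s)) = w"
    unfolding sum.lessThan_Suc_shift by (simp add: k'_def app_minus_right sum_negf w'_def del: power_Suc)
  ultimately show ?case by (intro exI[of _ k'] conjI) simp_all
qed simp

lemma shift_power: "S ^ n = shift (of_nat n)"
  by (induction n) (simp_all add: shift_0 shift_shift)

section \<open>Constants of the derivation\<close>

definition p_monomials :: "nat \<Rightarrow> 'k::field pbw set"
  where "p_monomials p = {m. \<forall>(i,j,a,c)\<in>keys m. p dvd i \<and> p dvd j \<and> p dvd a \<and> p dvd c \<and> (\<exists>P. lookup m (i,j,a,c) = pcompose P (artin_schreier p))}"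

text \<open>If S k = k, then \<open>center0_XY\<close> makes the derivatives in f and e vanish, so p
  divides a and c, and the coefficients are polynomials in h^p - h. After that the commutator with e
  forces p to divide j, and the one with h forces p to divide i.\<close>

lemma center0_invariant:
  assumes p: "CHAR('k::field) = p" "p > 2" and k: "(k :: 'k pbw) \<in> center0" "app S k = k"
  shows "k \<in> p_monomials p"
proof -
  have prime: "prime p" using p prime_CHAR_semidom[where 'a='k] by simp
  have G: "app Gf k = 0" "app Ge k = 0"
    using center0_XY[OF k(1)] k(2) X_inj[of "app S (app Ge k)"] Y_inj[of "app S (app Gf k)"] shift_inj by auto
  have ac: "of_nat a = (0 :: 'k)" "of_nat c = (0 :: 'k)" if "(i,j,a,c) \<in> keys k" for i j a c
  proof -
    have "inj_on (\<lambda>(i,j,a,c). (i,j,a-1,c) :: key) {k. (\<lambda>(i,j,a,c). of_nat a :: 'k) k \<noteq> 0}"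
      "inj_on (\<lambda>(i,j,a,c). (i,j,a,c-1) :: key) {k. (\<lambda>(i,j,a,c). of_nat c :: 'k) k \<noteq> 0}"
      by (auto simp: inj_on_def) (metis One_nat_def of_nat_0 diff_Suc_1 not0_implies_Suc)+
    from wshift_kernel[OF this(1) _ that] wshift_kernel[OF this(2) _ that] G
    show "of_nat a = (0 :: 'k)" "of_nat c = (0 :: 'k)" by (simp_all add: Gf_def Ge_def)
  qed
  have "k = (\<Sum>u\<in>keys k. single u (lookup k u))" by (rule pbw_sum)
  have inv: "pcompose (lookup k u) [:1, 1:] = lookup k u" for u
  proof -
    have "lookup (app S m) u = pcompose (lookup m u) [:1, 1:]" for m :: "'k pbw"
      by (induction m rule: pbw_induct) (auto simp: shift_single app_add_right lookup_add pcompose_add lookup_single when_def)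
    from this[of k] k(2) show ?thesis by simp
  qed
  have inv2: "pcompose (lookup k u) [:-2, 1:] = lookup k u" for u
  proof -
    have "pcompose (pcompose (lookup k u) [:-1, 1:]) [:1, 1:] = pcompose (pcompose (lookup k u) [:1, 1:]) [:-1, 1:]"
      by (simp only: pcompose_linear add.commute)
    then have 1: "pcompose (lookup k u) [:-1, 1:] = lookup k u" by (simp add: inv pcompose_linear pcompose_id)
    have "pcompose (pcompose (lookup k u) [:-1, 1:]) [:-1, 1:] = lookup k u" by (simp only: 1)
    then show ?thesis by (simp add: pcompose_linear)
  qed
  \<comment> \<open>Once a = 0 in k and the coefficients are shift invariant, only the term j x
    y^(j-1) of the commutator with e survives.\<close>
  let ?gy = "wshift (\<lambda>(i,j,a,c). (Suc i,j-1,a,c)) (\<lambda>(i,j,a,c). of_nat j :: 'k)"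
  have KEk: "app KE m = app ?gy m" if "\<And>u. u \<in> keys m \<Longrightarrow> u \<in> keys k \<and> lookup m u = lookup k u" for m
  proof -
    have "app KE (\<Sum>u\<in>keys m. single u (lookup m u)) = app ?gy (\<Sum>u\<in>keys m. single u (lookup m u))"
      unfolding app_sum
    proof (rule sum.cong[OF refl])
      fix u assume u: "u \<in> keys m"
      obtain i j a c where ui: "u = (i,j,a,c)" by (cases u) auto
      have q: "pcompose (lookup m u) [:-2, 1:] = lookup m u" using inv2[of u] that[OF u] by simp
      have "(of_nat a :: 'k poly) = 0" using ac(1)[of i j a c] that[OF u] by (simp add: ui of_nat_poly)
      then show "app KE (single u (lookup m u)) = app ?gy (single u (lookup m u))"
        using q by (simp add: ui KE_def app_minus E0_single right_e_single wshift_single of_nat_poly)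
    qed
    then show ?thesis by (simp add: pbw_sum[symmetric])
  qed
  have j: "of_nat j = (0 :: 'k)" if u: "(i,j,a,c) \<in> keys k" for i j a c
  proof -
    have "inj_on (\<lambda>(i,j,a,c). (Suc i,j-1,a,c) :: key) {k. (\<lambda>(i,j,a,c). of_nat j :: 'k) k \<noteq> 0}"
      by (auto simp: inj_on_def) (metis One_nat_def of_nat_0 diff_Suc_1 not0_implies_Suc)+
    moreover have "app ?gy k = 0" using KEk[of k] k(1) by (simp add: center0_def)
    ultimately show ?thesis using wshift_kernel[OF _ _ u] by fastforce
  qed
  have i: "of_nat i = (0 :: 'k)" if u: "(i,j,a,c) \<in> keys k" for i j a c
  proof -
    have "app KH k = 0" using k(1) by (simp add: center0_def)
    from wshift_kernel[OF _ this[unfolded KH_wshift] u] show ?thesis using ac[OF u] j[OF u] by simp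
  qed
  have "p dvd n" if "of_nat n = (0 :: 'k)" for n using that p(1) by (simp add: of_nat_eq_0_iff_char_dvd)
  moreover have "\<exists>P. lookup k u = pcompose P (artin_schreier p)" for u
    by (rule shift_invariant[OF p(1) prime inv])
  ultimately show ?thesis using ac i j by (auto simp: p_monomials_def)
qed

theorem center0_structure:
  assumes p: "CHAR('k::field) = p" "p > 2" and w: "(w :: 'k pbw) \<in> center0"
  shows "\<exists>k. (\<forall>s<p. k s \<in> p_monomials p) \<and> w = (\<Sum>s<p. app (T0 ^ s) (k s))"
proof -
  have prime: "prime p" using p prime_CHAR_semidom[where 'a='k] by simp
  \<comment> \<open>Freshman's dream is applied in the commutative ring k[X] and evaluated at S;
    moreover S^p shifts h by p = 0.\<close>
  have "(1 - S) ^ p = (0 :: 'k endo)"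
  proof -
    have c: "prime CHAR('k poly)" "p = CHAR('k poly)" using prime p by simp_all
    have e: "([:0, 1:] + [:- 1:] :: 'k poly) ^ p = [:0, 1:] ^ p + [:- 1:] ^ p" by (rule freshmans_dream[OF c])
    have "odd p" using prime p(2) prime_odd_nat by blast
    have "sc.peval S (([:0, 1:] + [:- 1:]) ^ p) = (S - 1 :: 'k endo) ^ p"
      by (simp only: sc.peval_power sc.peval_add sc.peval_X sc.peval_const) (simp add: sc.\<iota>_minus sc.\<iota>_1)
    moreover have "sc.peval S ([:0, 1:] ^ p + [:- 1:] ^ p) = (S ^ p + (- 1) ^ p :: 'k endo)"
      by (simp only: sc.peval_power sc.peval_add sc.peval_X sc.peval_const) (simp add: sc.\<iota>_minus sc.\<iota>_1)
    moreover have "S ^ p = (1 :: 'k endo)" using p(1) by (simp add: shift_power shift_0 flip: p(1))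
    ultimately have "(S - 1 :: 'k endo) ^ p = 0" using e \<open>odd p\<close> by simp
    moreover have "(- (S - 1 :: 'k endo)) ^ p = - ((S - 1) ^ p)" using \<open>odd p\<close> by (rule power_minus_odd)
    ultimately show ?thesis by (simp only: minus_diff_eq minus_zero)
  qed
  then obtain k where k: "\<forall>s<p. k s \<in> center0 \<and> app S (k s) = k s" "w = (\<Sum>s<p. app (T0 ^ s) (k s))"
    using center0_nilpotent[OF p order.refl w] by auto
  then show ?thesis using center0_invariant[OF p] by blast
qed

section \<open>Lifting central elements\<close>

context HZ
begin

lemma e_power:
  "e ^ n * h = (h - of_nat (2 * n)) * e ^ n" "e ^ n * x = x * e ^ n"
  "e ^ Suc n * y = y * e ^ Suc n + of_nat (Suc n) * (x * e ^ n)"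
  "e ^ Suc n * f = f * e ^ Suc n + of_nat (Suc n) * ((h - of_nat n) * e ^ n)"
proof -
  have c: "e * of_nat m = of_nat m * e" for m by (rule mult_of_nat_commute[symmetric])
  have eh': "e * (h - of_nat m) = (h - of_nat m - 2) * e" for m
    by (simp add: eh c right_diff_distrib left_diff_distrib)
  show "e ^ n * h = (h - of_nat (2 * n)) * e ^ n" for n
  proof (induction n)
    case (Suc n)
    have "e ^ Suc n * h = e * (h - of_nat (2 * n)) * e ^ n" by (simp add: mult.assoc Suc)
    also have "\<dots> = (h - of_nat (2 * Suc n)) * e ^ Suc n" unfolding eh' by (simp add: mult.assoc algebra_simps mult_2)
    finally show ?case .
  qed simp
  show X: "e ^ n * x = x * e ^ n" for n
    by (rule power_commuting_commutes) (simp add: ex)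
  show "e ^ Suc n * y = y * e ^ Suc n + of_nat (Suc n) * (x * e ^ n)"
  proof (induction n)
    case (Suc n)
    have "e ^ Suc (Suc n) * y = e * (e ^ Suc n * y)" by (simp add: mult.assoc)
    also have "\<dots> = e * y * e ^ Suc n + of_nat (Suc n) * (e * x * e ^ n)"
      unfolding Suc by (simp only: distrib_left mult.assoc[symmetric] c)
    also have "\<dots> = y * e ^ Suc (Suc n) + (x * e ^ Suc n + of_nat (Suc n) * (x * e ^ Suc n))"
      unfolding ey ex by (simp only: distrib_right mult.assoc power_Suc add.assoc)
    also have "x * e ^ Suc n + of_nat (Suc n) * (x * e ^ Suc n) = of_nat (Suc (Suc n)) * (x * e ^ Suc n)"
      by (simp only: of_nat_Suc[of "Suc n"] distrib_right mult_1_left)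
    finally show ?case .
  qed (simp add: ey)
  show "e ^ Suc n * f = f * e ^ Suc n + of_nat (Suc n) * ((h - of_nat n) * e ^ n)"
  proof (induction n)
    case (Suc n)
    have "e ^ Suc (Suc n) * f = e * (e ^ Suc n * f)" by (simp add: mult.assoc)
    also have "\<dots> = e * f * e ^ Suc n + of_nat (Suc n) * (e * (h - of_nat n) * e ^ n)"
      unfolding Suc by (simp only: distrib_left mult.assoc[symmetric] c)
    also have "\<dots> = f * e ^ Suc (Suc n) + (h + of_nat (Suc n) * (h - of_nat n - 2)) * e ^ Suc n"
      unfolding ef eh' by (simp only: distrib_right mult.assoc power_Suc add.assoc)
    also have "h + of_nat (Suc n) * (h - of_nat n - 2) = of_nat (Suc (Suc n)) * (h - of_nat (Suc n))"
    proof -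
      have "(of_nat (Suc n) :: 'a) * (of_nat n + 2) = of_nat (Suc n * (n + 2))" by (simp only: of_nat_mult of_nat_add of_nat_numeral)
      moreover have "(of_nat (Suc (Suc n)) :: 'a) * of_nat (Suc n) = of_nat (Suc (Suc n) * Suc n)" by (simp only: of_nat_mult)
      moreover have "Suc n * (n + 2) = Suc (Suc n) * Suc n" by simp
      ultimately have "(of_nat (Suc n) :: 'a) * (of_nat n + 2) = of_nat (Suc (Suc n)) * of_nat (Suc n)" by (simp only:)
      moreover have "h + of_nat (Suc n) * h = of_nat (Suc (Suc n)) * h"
        by (simp only: of_nat_Suc[of "Suc n"] distrib_right mult_1_left)
      moreover have "of_nat (Suc n) * (h - of_nat n - 2) = of_nat (Suc n) * h - of_nat (Suc n) * (of_nat n + 2)"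
        by (simp only: right_diff_distrib[symmetric] diff_diff_eq)
      ultimately show ?thesis by (simp only: right_diff_distrib add_diff_eq)
    qed
    finally show ?case by (simp only: mult.assoc)
  qed (simp add: ef)
qed

lemma e_power_central:
  assumes "CHAR('k) = p" "p > 0"
  shows "e ^ p * e = e * e ^ p" "e ^ p * h = h * e ^ p" "e ^ p * x = x * e ^ p" "e ^ p * y = y * e ^ p" "e ^ p * f = f * e ^ p"
proof -
  have "(of_nat p :: 'k) = 0" using assms(1) by auto
  then have p0: "(of_nat p :: 'a) = 0" using \<iota>_of_nat[of p] by (simp add: \<iota>_0)
  obtain n where n: "p = Suc n" using assms(2) by (cases p) auto
  show "e ^ p * e = e * e ^ p" by (simp add: power_commutes)
  show "e ^ p * h = h * e ^ p" using e_power(1)[of p] p0 by simp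
  show "e ^ p * x = x * e ^ p" by (rule e_power)
  show "e ^ p * y = y * e ^ p" "e ^ p * f = f * e ^ p"
    using e_power(3,4)[of n] p0 unfolding n[symmetric] by simp_all
qed

text \<open>The Weyl element of SL2 acting on all generators. It transfers results from e to f and
  from x to y.\<close>

lemma swap: "HZ \<iota> z (- f) (- e) (- h) y (- x)"
proof
  have e: "- h * - h + 4 * - f * - e - 2 * - h = h * h + 4 * e * f - 2 * h"
    using \<Delta>_normal unfolding \<Delta>_def by (simp add: mult.assoc)
  show "- x * y = y * - x - peval (- h * - h + 4 * - f * - e - 2 * - h) z" unfolding e using yx by simp
qed (simp_all add: ef he hf ex ey fx fy hx hy)

lemma f_power_central:
  assumes "CHAR('k) = p" "p > 0"
  shows "f ^ p * e = e * f ^ p" "f ^ p * h = h * f ^ p" "f ^ p * x = x * f ^ p" "f ^ p * y = y * f ^ p" "f ^ p * f = f * f ^ p"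
proof -
  interpret s: HZ \<iota> z "- f" "- e" "- h" y "- x" by (rule swap)
  have m: "(- f) ^ p = f ^ p \<or> (- f) ^ p = - (f ^ p)" by (cases "even p") (simp_all add: power_minus_even power_minus_odd)
  show "f ^ p * e = e * f ^ p" "f ^ p * h = h * f ^ p" "f ^ p * x = x * f ^ p" "f ^ p * y = y * f ^ p" "f ^ p * f = f * f ^ p"
    using s.e_power_central[OF assms] m by auto
qed

lemma h_shift:
  "peval h q * x = x * peval h (pcompose q [:1, 1:])" "peval h q * y = y * peval h (pcompose q [:-1, 1:])"
  "peval h q * e = e * peval h (pcompose q [:2, 1:])" "peval h q * f = f * peval h (pcompose q [:-2, 1:])"
proof -
  have *: "peval h q * v = v * peval h (pcompose q [:s, 1:])" if "h * v = v * (h + \<iota> s)" for v s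
  proof -
    have "peval h [:s, 1:] = h + \<iota> s" by (simp add: peval_pCons \<iota>_1 add.commute)
    moreover have "peval h q * v = v * peval (h + \<iota> s) q"
    proof (induction q)
      case (pCons a q)
      have "peval h (pCons a q) * v = \<iota> a * v + h * (peval h q * v)" by (simp only: peval_pCons distrib_right mult.assoc)
      also have "\<dots> = v * \<iota> a + h * v * peval (h + \<iota> s) q" by (simp only: pCons mult.assoc \<iota>_comm)
      finally show ?case unfolding that by (simp only: peval_pCons distrib_left[of v "\<iota> a"] mult.assoc)
    qed simp
    ultimately show ?thesis by (simp add: peval_pcompose)
  qed
  show "peval h q * x = x * peval h (pcompose q [:1, 1:])" by (rule *) (simp add: hx \<iota>_1 distrib_left)
  show "peval h q * y = y * peval h (pcompose q [:-1, 1:])" by (rule *) (simp add: hy \<iota>_1 \<iota>_minus right_diff_distrib distrib_left)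
  have two: "v * (h + \<iota> 2) = v * h + 2 * v" "v * (h + \<iota> (- 2)) = v * h - 2 * v" for v
    using numeral_comm(1)[of v "num.Bit0 num.One"] by (simp_all add: \<iota>_minus \<iota>_numeral distrib_left right_diff_distrib)
  show "peval h q * e = e * peval h (pcompose q [:2, 1:])" by (rule *) (simp only: two he)
  show "peval h q * f = f * peval h (pcompose q [:-2, 1:])" by (rule *) (simp only: two hf)
qed

end

definition central :: "'k::field poly \<Rightarrow> 'k falg \<Rightarrow> bool"
  where "central z a \<longleftrightarrow> (\<forall>b. rep z a * rep z b = rep z b * rep z a)"

lemma centralI:
  assumes "rep z a * Eop z = Eop z * rep z a" "rep z a * Fop z = Fop z * rep z a" "rep z a * Hop = Hop * rep z a"
    "rep z a * Xop = Xop * rep z a" "rep z a * Yop z = Yop z * rep z a"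
  shows "central z a"
  unfolding central_def
proof
  fix b
  have "rep z a * generator z v = generator z v * rep z a" for v
  proof (cases v)
    case (Inl s)
    then show ?thesis using assms by (cases s) simp_all
  next
    case (Inr s)
    then show ?thesis using assms by (cases s) simp_all
  qed
  then show "rep z a * rep z b = rep z b * rep z a"
    using sc.free_hom_comm[of "rep z a" "generator z" b] by (simp add: rep_def)
qed

lemma central_mult: "central z a \<Longrightarrow> central z b \<Longrightarrow> central z (a * b)"
  unfolding central_def
proof
  fix c
  assume a: "\<forall>c. rep z a * rep z c = rep z c * rep z a" and b: "\<forall>c. rep z b * rep z c = rep z c * rep z b"
  have "rep z (a * b) * rep z c = rep z a * (rep z b * rep z c)" by (simp add: mult.assoc)
  also have "\<dots> = rep z a * rep z c * rep z b" by (simp only: b[rule_format, of c] mult.assoc)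
  also have "\<dots> = rep z c * rep z (a * b)" by (simp only: a[rule_format, of c] mult.assoc rep_simps)
  finally show "rep z (a * b) * rep z c = rep z c * rep z (a * b)" .
qed

lemma central_add: "central z a \<Longrightarrow> central z b \<Longrightarrow> central z (a + b)"
  by (simp add: central_def distrib_left distrib_right)

lemma central_scalar: "central z (scalar c)"
  by (simp add: central_def scal_commute)

lemma central_power: "central z a \<Longrightarrow> central z (a ^ n)"
  by (induction n) (simp_all add: central_mult, simp add: central_def)

lemma central_pth:
  fixes z :: "'k::field poly"
  assumes "CHAR('k) = p" "p > 2"
  shows "central z (ve ^ p)" "central z (vf ^ p)" "central z (fa.peval vh (artin_schreier p))"
proof -
  have p: "p > 0" "prime p" using assms prime_CHAR_semidom[where 'a='k] by simp_all
  show "central z (ve ^ p)" "central z (vf ^ p)"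
    using op.e_power_central[OF assms(1) p(1), of z] op.f_power_central[OF assms(1) p(1), of z] by (auto intro!: centralI)
  let ?A = "artin_schreier p :: 'k poly"
  have A1: "pcompose ?A [:1, 1:] = ?A" by (rule artin_schreier_shift[OF assms(1) p(2)])
  have "pcompose ?A [:-1, 1:] = pcompose (pcompose ?A [:1, 1:]) [:-1, 1:]" by (simp only: A1)
  then have A2: "pcompose ?A [:-1, 1:] = ?A" by (simp add: pcompose_linear pcompose_id)
  have A3: "pcompose ?A [:2, 1:] = ?A" using pcompose_linear[of ?A 1 1] by (simp add: A1)
  have A4: "pcompose ?A [:-2, 1:] = ?A" using pcompose_linear[of ?A "-1" "-1"] by (simp add: A2)
  show "central z (fa.peval vh ?A)"
    using op.h_shift[where q = ?A] sc.peval_comm[of Hop Hop ?A] by (intro centralI) (simp_all add: A1 A2 A3 A4)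
qed

subsection \<open>The automorphism exchanging \<open>x\<close> and \<open>y\<close>\<close>

fun swap_var :: "gen \<Rightarrow> 'k::comm_ring_1 falg" where
  "swap_var (Inl E) = - vf"
| "swap_var (Inl F) = - ve"
| "swap_var (Inl H) = - vh"
| "swap_var (Inr Vx) = vy"
| "swap_var (Inr Vy) = - vx"

definition swap_hom :: "'k::comm_ring_1 falg \<Rightarrow> 'k falg" where "swap_hom = fa.free_hom swap_var"

lemma rep_swap_hom: "rep z (swap_hom a) = sc.free_hom (\<lambda>v. rep z (swap_var v)) a"
proof -
  have "rep z (prod_list us) = prod_list (map (rep z) us)" for us by (induction us) simp_all
  then show ?thesis
    by (simp add: swap_hom_def fa.free_hom_def sc.free_hom_def rep_sum fa.word_map_def sc.word_map_def comp_def)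
qed

text \<open>The exchange of x and y therefore descends from the free algebra to H_z.\<close>

lemma swap_hom_J: "a \<in> J z \<Longrightarrow> rep z (swap_hom a) = 0"
  unfolding rep_swap_hom by (rule hom_J) (simp_all add: op.swap)

lemma V_bounded_sum: "(\<And>i. i \<in> A \<Longrightarrow> g i \<in> V_bounded n) \<Longrightarrow> sum g A \<in> V_bounded n"
  by (induction A rule: infinite_finite_induct) (simp_all add: V_bounded_0 V_bounded_add)

lemma swap_var_homog: "swap_var v \<in> homog (V_degree (Word [v]))"
proof -
  have "V_degree (Word [Inl s]) = 0" "V_degree (Word [Inr t]) = 1" for s t by (simp_all add: V_degree_def)
  then show ?thesis
    by (cases v rule: swap_var.cases) (simp_all only: swap_var.simps homog_minus homog_var)
qed

lemma V_degree_Cons: "V_degree (Word (v # vs)) = V_degree (Word [v]) + V_degree (Word vs)"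
  by (simp add: V_degree_def)

lemma swap_hom_V_bounded:
  assumes "a \<in> V_bounded n" shows "swap_hom a \<in> V_bounded n"
  unfolding swap_hom_def fa.free_hom_def
proof (rule V_bounded_sum)
  fix w assume w: "w \<in> keys a"
  have "(fa.word_map swap_var (Word vs) :: 'a falg) \<in> homog (V_degree (Word vs))" for vs
  proof (induction vs)
    case Nil
    show ?case using homog_1 by (simp add: fa.word_map_def V_degree_def)
  next
    case (Cons v vs)
    have "(fa.word_map swap_var (Word (v # vs)) :: 'a falg) = swap_var v * fa.word_map swap_var (Word vs)"
      by (simp add: fa.word_map_def)
    with homog_mult[OF swap_var_homog Cons, of v] show ?case by (simp only: V_degree_Cons[of v vs])
  qed
  from this[of "letters w"] have "(fa.word_map swap_var w :: 'a falg) \<in> homog (V_degree w)" by simp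
  from homog_mult[OF homog_scalar this] have "scalar (lookup a w) * fa.word_map swap_var w \<in> homog (V_degree w)" by simp
  moreover have "V_degree w \<le> n" using w assms by (simp add: V_bounded_def)
  ultimately show "scalar (lookup a w) * fa.word_map swap_var w \<in> V_bounded n" using V_bounded_mono[OF homog_V_bounded] by blast
qed

lemma x_y_lifts:
  fixes z :: "'k::field poly"
  assumes "CHAR('k) = p" "p > 2" "degree z < p - 1"
  shows "\<exists>u r. central z u \<and> u \<in> V_bounded p \<and> r \<in> V_bounded (p - 1) \<and> rep z u = Xop ^ p + rep z r"
    "\<exists>u r. central z u \<and> u \<in> V_bounded p \<and> r \<in> V_bounded (p - 1) \<and> rep z u = Yop z ^ p + rep z r"
proof -
  obtain q where "HZ_filtered scal z (Eop z) (Fop z) Hop Xop (Yop z) q (Fil z) p" using HZ_filtered_ops[OF assms] by blast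
  from HZ_filtered.central_lift[OF this] obtain u0 where u0: "u0 \<in> Fil z p" "u0 - Xop ^ p \<in> Fil z (p - 1)"
    "Eop z * u0 = u0 * Eop z" "Fop z * u0 = u0 * Fop z" "Hop * u0 = u0 * Hop" "Xop * u0 = u0 * Xop" "Yop z * u0 = u0 * Yop z"
    by blast
  obtain u where u: "u0 = rep z u" "u \<in> V_bounded p" using u0(1) by (auto simp: Fil_def)
  obtain r where r: "u0 - Xop ^ p = rep z r" "r \<in> V_bounded (p - 1)" using u0(2) by (auto simp: Fil_def)
  have eq: "rep z u = Xop ^ p + rep z r" using u(1) r(1) by (metis add.commute diff_add_cancel)
  have c: "central z u" using u0(3-7) by (intro centralI) (simp_all add: u(1))
  show "\<exists>u r. central z u \<and> u \<in> V_bounded p \<and> r \<in> V_bounded (p - 1) \<and> rep z u = Xop ^ p + rep z r"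
    using c eq u r by blast
  \<comment> \<open>Congruences modulo J are transported by the exchange map, which turns x^p into
    y^p and keeps the degree bounds.\<close>
  have "u - (vx ^ p + r) \<in> J z" by (simp add: rep_eq_0_iff[symmetric] eq)
  then have "rep z (swap_hom (u - (vx ^ p + r))) = 0" by (rule swap_hom_J)
  then have eq': "rep z (swap_hom u) = Yop z ^ p + rep z (swap_hom r)"
    by (simp add: swap_hom_def fa.free_hom_diff fa.free_hom_add fa.free_hom_power)
  have "rep z (swap_hom u) * rep z (swap_var v) = rep z (swap_var v) * rep z (swap_hom u)" for v
  proof -
    have "u * var v - var v * u \<in> J z" using c by (simp add: rep_eq_0_iff[symmetric] central_def) (metis rep_simps(7))
    then have "rep z (swap_hom (u * var v - var v * u)) = 0" by (rule swap_hom_J)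
    then show ?thesis by (simp add: swap_hom_def fa.free_hom_diff fa.free_hom_mult)
  qed
  from this[of "Inl E"] this[of "Inl F"] this[of "Inl H"] this[of "Inr Vx"] this[of "Inr Vy"]
  have "central z (swap_hom u)" by (intro centralI) simp_all
  then show "\<exists>u r. central z u \<and> u \<in> V_bounded p \<and> r \<in> V_bounded (p - 1) \<and> rep z u = Yop z ^ p + rep z r"
    using eq' swap_hom_V_bounded[OF u(2)] swap_hom_V_bounded[OF r(2)] by blast
qed

section \<open>Lifting homogeneous leading terms\<close>

definition liftable :: "'k::field poly \<Rightarrow> nat \<Rightarrow> 'k pbw \<Rightarrow> bool"
  where "liftable z n w \<longleftrightarrow> (\<exists>b\<in>V_bounded n. central z b \<and> nf z b - w \<in> below n)"

lemma rep_below: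
  assumes "a \<in> V_bounded m" "u \<in> below n"
  shows "app (rep z a) u \<in> below (n + m)"
proof (cases n)
  case 0
  then have "u = 0" using assms(2) below_zero_eq by blast
  then show ?thesis by simp
next
  case (Suc k)
  then have "a * pbw_falg u \<in> V_bounded (m + k)" using assms by (intro V_bounded_mult pbw_V_bounded) simp_all
  from nf_V_bounded[OF this, of z] show ?thesis by (simp add: nf_mult Suc add.commute)
qed

text \<open>If b lifts w and l is central, then l b lifts the leading term of l w, since l applied
  to the error of b stays in lower degree.\<close>

lemma liftable_mult:
  assumes "liftable z n w" "l \<in> V_bounded m" "central z l" "app (rep z l) w - w' \<in> below (n + m)"
  shows "liftable z (n + m) w'"
proof -
  obtain b where b: "b \<in> V_bounded n" "central z b" "nf z b - w \<in> below n" using assms(1) by (auto simp: liftable_def)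
  have "nf z (l * b) - w' = app (rep z l) (nf z b - w) + (app (rep z l) w - w')"
    by (simp add: nf_mult app_diff_right)
  also have "\<dots> \<in> below (n + m)" by (intro below_add rep_below assms b)
  finally have "nf z (l * b) - w' \<in> below (n + m)" .
  moreover have "l * b \<in> V_bounded (n + m)" using V_bounded_mult[OF assms(2) b(1)] by (simp add: add.commute)
  ultimately show ?thesis unfolding liftable_def using central_mult[OF assms(3) b(2)] by blast
qed

lemma liftable_add:
  assumes "liftable z n u" "liftable z n v" shows "liftable z n (u + v)"
proof -
  obtain a b where ab: "a \<in> V_bounded n" "central z a" "nf z a - u \<in> below n" "b \<in> V_bounded n" "central z b" "nf z b - v \<in> below n"
    using assms by (auto simp: liftable_def)
  have eq: "nf z (a + b) - (u + v) = (nf z a - u) + (nf z b - v)" by (simp add: nf_add)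
  have "nf z (a + b) - (u + v) \<in> below n" unfolding eq by (rule below_add[OF ab(3,6)])
  then show ?thesis unfolding liftable_def using V_bounded_add[OF ab(1,4)] central_add[OF ab(2,5)] by blast
qed

lemma liftable_0: "liftable z n 0"
  unfolding liftable_def by (rule bexI[of _ 0]) (simp_all add: V_bounded_0 central_def)

definition lifting :: "'k::field poly \<Rightarrow> 'k pbw set" where "lifting z = {w. \<forall>n. liftable z n (part n w)}"

lemma part_0: "part n 0 = 0"
  by (simp add: part_def)

lemma lifting_add: "u \<in> lifting z \<Longrightarrow> v \<in> lifting z \<Longrightarrow> u + v \<in> lifting z"
  by (simp add: lifting_def part_add liftable_add)

lemma lifting_0: "0 \<in> lifting z"
  by (simp add: lifting_def part_0 liftable_0)

lemma lifting_sum: "(\<And>i. i \<in> A \<Longrightarrow> g i \<in> lifting z) \<Longrightarrow> sum g A \<in> lifting z"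
  by (induction A rule: infinite_finite_induct) (simp_all add: lifting_0 lifting_add)

lemma lifting_exact:
  assumes "w \<in> exact n" "liftable z n w" shows "w \<in> lifting z"
  unfolding lifting_def
proof (intro CollectI allI)
  fix m
  show "liftable z m (part m w)"
    using assms part_of_exact[OF assms(1)] part_of_exact_other[OF assms(1), of m] liftable_0[of z m] by (cases "m = n") simp_all
qed

lemma exact_pbw_homog:
  assumes "w \<in> exact n" shows "pbw_falg w \<in> homog n"
  unfolding homog_def
proof (intro CollectI ballI)
  fix v assume "v \<in> keys (pbw_falg w)"
  from keys_pbw_falg[OF this] obtain k where k: "k \<in> keys w" "V_degree v = vdeg k" by blast
  have "vdeg k = n" using assms k(1) unfolding exact_def by blast
  with k(2) show "V_degree v = n" by simp
qed

lemma tau_homog: "tau \<in> homog 2"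
proof -
  have "a * (b * c) \<in> homog 2" if "a \<in> homog 0" "b \<in> homog 1" "c \<in> homog 1" for a b c :: "'a falg"
    using homog_mult[OF that(1) homog_mult[OF that(2,3)]] by (simp add: numeral_2_eq_2)
  then show ?thesis unfolding tau_def half_tau_def by (intro homog_add homog_diff) (simp_all only: homog_var)
qed

lemma tau_exact:
  assumes "w \<in> exact n"
  shows "app T0 w \<in> exact (2 + n)" "app (rep z tau) w - app T0 w \<in> below (2 + n)"
  using nf_homog(1)[OF homog_mult[OF tau_homog exact_pbw_homog[OF assms]]]
    nf_homog(2)[OF homog_mult[OF tau_homog exact_pbw_homog[OF assms]], of z] by (simp_all only: nf_mult nf_pbw)

lemma part_T0: "part n (app T0 w) = (if 2 \<le> n then app T0 (part (n - 2) w) else 0)"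
proof (induction w rule: pbw_induct)
  case (single k p)
  have e: "single k p \<in> exact (vdeg k)" by simp
  note t = tau_exact(1)[OF e]
  show ?case
    using part_of_exact[OF t] part_of_exact_other[OF t, of n] part_of_exact[OF e] part_of_exact_other[OF e, of "n - 2"]
    by (cases "n = 2 + vdeg k") auto
qed (simp_all add: app_add_right part_add part_0)

lemma lifting_T0:
  fixes z :: "'k::field poly"
  assumes p: "CHAR('k) = p" "p > 2" "degree z < p - 1" and w: "w \<in> lifting z"
  shows "app T0 w \<in> lifting z"
proof -
  obtain q where q: "HZ_filtered scal z (Eop z) (Fop z) Hop Xop (Yop z) q (Fil z) p" using HZ_filtered_ops[OF p] by blast
  interpret A: HZ_antidifference scal z "Eop z" "Fop z" Hop Xop "Yop z" q
    using q by (simp add: HZ_filtered_def)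
  \<comment> \<open>The terms of the lifted element of V-degree 0, so that the leading part of the
    lift is \<open>tau\<close>.\<close>
  define s where "s = fa.peval D_falg q + fa.peval D_falg q - vh * eval_Delta z - eval_Delta z"
  have Z: "rep z (eval_Delta z) = op.Z z" by (simp add: rep_eval_Delta op.Z_def op.\<Delta>_def zop_def)
  have T: "rep z (tau + s) = A.T"
    by (simp add: A.T_def A.R_def tau_def half_tau_def s_def Z rep_D mult_2)
  have mult0: "a * b \<in> homog 0" if "a \<in> homog 0" "b \<in> homog 0" for a b :: "'k falg"
    using homog_mult[OF that] by simp
  have Delta: "Delta \<in> (homog 0 :: 'k falg set)"
    unfolding Delta_def power2_eq_square mult.assoc
    by (intro homog_add homog_diff mult0 homog_var homog_scalar)
  have "D_falg \<in> (homog 0 :: 'k falg set)" unfolding D_falg_def by (intro homog_add Delta homog_1)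
  then have s: "s \<in> homog 0"
    unfolding s_def eval_Delta_peval by (intro homog_add homog_diff mult0 homog_peval Delta homog_var)
  have c: "central z (tau + s)" by (rule centralI; unfold T; simp add: A.T_comm)
  have b: "tau + s \<in> V_bounded 2"
    using V_bounded_add[OF homog_V_bounded[OF tau_homog] V_bounded_mono[OF homog_V_bounded[OF s]]] by simp
  show ?thesis
    unfolding lifting_def
  proof (intro CollectI allI)
    fix n
    show "liftable z n (part n (app T0 w))"
    proof (cases "2 \<le> n")
      case True
      define m where "m = n - 2"
      have n: "n = m + 2" using True by (simp add: m_def)
      have e: "part m w \<in> exact m" by (rule part_exact)
      have "app (rep z s) (part m w) \<in> below (m + 2)"
        using rep_below[OF homog_V_bounded[OF s] exact_below[OF e], of z] by (rule below_mono) simp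
      then have "app (rep z (tau + s)) (part m w) - app T0 (part m w) \<in> below (m + 2)"
        using below_add[OF tau_exact(2)[OF e, of z], of "app (rep z s) (part m w)"]
        by (simp add: app_plus diff_add_eq)
      moreover have "liftable z m (part m w)" using w by (simp add: lifting_def)
      ultimately have "liftable z (m + 2) (app T0 (part m w))" by (intro liftable_mult[OF _ b c])
      then show ?thesis by (simp add: part_T0 n)
    qed (simp add: part_T0 liftable_0)
  qed
qed

lemma Yop_power': "app (Yop z ^ n) (single (0,j,a,c) q) = single (0,n + j,a,c) q"
  by (induction n) (simp_all add: power_app_Suc EFY_single del: power_Suc)

text \<open>In degree 0 the monomials f^p, h^p - h and e^p are already central in H_z. The powers of
  y^p and then of x^p are attached by repeated multiplication with their lifts.\<close>

lemma lifting_p_monomials: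
  fixes z :: "'k::field poly"
  assumes p: "CHAR('k) = p" "p > 2" "degree z < p - 1" and m: "m \<in> p_monomials p"
  shows "m \<in> lifting z"
proof -
  have base: "liftable z 0 (single (0,0,p * a,p * c) (pcompose P (artin_schreier p)))" for a c P
  proof -
    let ?b = "pbw_word (0,0,p * a,p * c) (pcompose P (artin_schreier p)) :: 'k falg"
    have "?b = vf ^ (p * a) * (fa.peval (fa.peval vh (artin_schreier p)) P * ve ^ (p * c))"
      by (simp add: pbw_word_def fa.peval_pcompose)
    moreover have "central z (fa.peval u P)" if "central z u" for u
    proof -
      have "rep z b * sc.peval (rep z u) P = sc.peval (rep z u) P * rep z b" for b
        by (rule sc.peval_comm) (use that in \<open>simp add: central_def\<close>)
      then show ?thesis by (simp add: central_def)
    qed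
    ultimately have "central z ?b"
      unfolding power_mult by (simp add: central_mult central_power central_pth[OF p(1,2)])
    moreover have "?b \<in> V_bounded 0" using homog_V_bounded[OF homog_pbw_word[of 0 0 "p * a" "p * c"]] by simp
    moreover have "nf z ?b - single (0,0,p * a,p * c) (pcompose P (artin_schreier p)) \<in> below 0"
      using nf_pbw[of z "single (0,0,p * a,p * c) (pcompose P (artin_schreier p))"] by simp
    ultimately show ?thesis unfolding liftable_def by blast
  qed
  have rest: "app (rep z r) w \<in> below (n + p)" if "r \<in> V_bounded (p - 1)" "w \<in> exact n" for r w n
    using rep_below[OF that(1) exact_below[OF that(2)], of z] p(2) by simp
  obtain yl yr where y: "central z yl" "yl \<in> V_bounded p" "yr \<in> V_bounded (p - 1)" "rep z yl = Yop z ^ p + rep z yr"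
    using x_y_lifts(2)[OF p] by blast
  obtain xl xr where x: "central z xl" "xl \<in> V_bounded p" "xr \<in> V_bounded (p - 1)" "rep z xl = Xop ^ p + rep z xr"
    using x_y_lifts(1)[OF p] by blast
  have Y: "liftable z (p * j) (single (0,p * j,p * a,p * c) (pcompose P (artin_schreier p)))" for j a c P
  proof (induction j)
    case (Suc j)
    let ?q = "pcompose P (artin_schreier p)"
    have "app (rep z yr) (single (0,p * j,p * a,p * c) ?q) \<in> below (p * j + p)"
      by (rule rest[OF y(3)]) simp
    then have "liftable z (p * j + p) (single (0,p + p * j,p * a,p * c) ?q)"
      by (intro liftable_mult[OF Suc y(2,1)]) (simp add: y(4) app_plus Yop_power')
    then show ?case by (simp add: add.commute)
  qed (simp add: base)
  have X: "liftable z (p * j + p * i) (single (p * i,p * j,p * a,p * c) (pcompose P (artin_schreier p)))" for i j a c P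
  proof (induction i)
    case (Suc i)
    let ?q = "pcompose P (artin_schreier p)"
    have "app (rep z xr) (single (p * i,p * j,p * a,p * c) ?q) \<in> below (p * j + p * i + p)"
      by (rule rest[OF x(3)]) simp
    then have "liftable z (p * j + p * i + p) (single (p + p * i,p * j,p * a,p * c) ?q)"
      by (intro liftable_mult[OF Suc x(2,1)]) (simp add: x(4) app_plus Xop_power)
    then show ?case by (simp add: add_ac)
  qed (simp add: Y)
  have "single k (lookup m k) \<in> lifting z" if k: "k \<in> keys m" for k
  proof -
    obtain i j a c where kk: "k = (i,j,a,c)" by (cases k) auto
    have "p dvd i \<and> p dvd j \<and> p dvd a \<and> p dvd c \<and> (\<exists>P. lookup m k = pcompose P (artin_schreier p))"
      using bspec[OF m[unfolded p_monomials_def mem_Collect_eq] k] by (simp add: kk)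
    then obtain i' j' a' c' P where k': "i = p * i'" "j = p * j'" "a = p * a'" "c = p * c'" "lookup m k = pcompose P (artin_schreier p)"
      unfolding dvd_def by blast
    show ?thesis unfolding k'(5) unfolding kk k'(1-4) by (rule lifting_exact[OF exact_single X]) simp
  qed
  then have "(\<Sum>k\<in>keys m. single k (lookup m k)) \<in> lifting z" by (rule lifting_sum)
  then show ?thesis by (simp add: pbw_sum[symmetric])
qed

theorem gr_center_H:
  fixes z :: "'k::field poly"
  assumes p: "CHAR('k) = p" "p > 2" "degree z < p - 1"
  shows "gr_center (H_alg z) (H_fil z) = center (gr_H z)"
proof (rule gr_center_eq)
  fix c :: "'k falg" and n assume "H_class 0 c \<in> center (H_alg 0)"
  then have "nf 0 c \<in> center0" by (rule center_center0)
  from center0_structure[OF p(1,2) this] obtain k where k: "\<forall>s<p. k s \<in> p_monomials p" "nf 0 c = (\<Sum>s<p. app (T0 ^ s) (k s))" by blast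
  have "app (T0 ^ t) (k s) \<in> lifting z" if "s < p" for s t
    using that k(1) by (induction t) (simp_all add: lifting_p_monomials[OF p] power_app_Suc lifting_T0[OF p] del: power_Suc)
  then have "nf 0 c \<in> lifting z" unfolding k(2) by (intro lifting_sum) auto
  then obtain b where "b \<in> V_bounded n" "central z b" "nf z b - part n (nf 0 c) \<in> below n"
    by (auto simp: lifting_def liftable_def)
  then show "\<exists>b\<in>V_bounded n. H_class z b \<in> center (H_alg z) \<and> nf z b - part n (nf 0 c) \<in> below n"
    unfolding H_class_center central_def by blast
qed

section \<open>Finite generation\<close>

text \<open>K will be the center, which is a ring and not a field, so the closure properties of
  \<open>Span\<close> are derived from closure of K under addition and multiplication.\<close>

lemma (in ring) span_closed:
  assumes K: "K \<subseteq> carrier R" "\<zero> \<in> K" "\<one> \<in> K" "\<And>a b. a \<in> K \<Longrightarrow> b \<in> K \<Longrightarrow> a \<oplus> b \<in> K" "\<And>a b. a \<in> K \<Longrightarrow> b \<in> K \<Longrightarrow> a \<otimes> b \<in> K"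
    and Us: "set Us \<subseteq> carrier R"
  shows "Span K Us \<subseteq> carrier R \<and> \<zero> \<in> Span K Us \<and> set Us \<subseteq> Span K Us
    \<and> (\<forall>u\<in>Span K Us. \<forall>v\<in>Span K Us. u \<oplus> v \<in> Span K Us) \<and> (\<forall>a\<in>K. \<forall>u\<in>Span K Us. a \<otimes> u \<in> Span K Us)"
  using Us
proof (induction Us)
  case Nil
  show ?case using K(1) by auto
next
  case (Cons g Us)
  let ?V = "Span K Us"
  have IH: "?V \<subseteq> carrier R" "\<zero> \<in> ?V" "set Us \<subseteq> ?V" "\<And>u v. u \<in> ?V \<Longrightarrow> v \<in> ?V \<Longrightarrow> u \<oplus> v \<in> ?V" "\<And>a u. a \<in> K \<Longrightarrow> u \<in> ?V \<Longrightarrow> a \<otimes> u \<in> ?V"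
    and g: "g \<in> carrier R" using Cons by auto
  have mem: "w \<in> Span K (g # Us) \<longleftrightarrow> (\<exists>k\<in>K. \<exists>v\<in>?V. w = k \<otimes> g \<oplus> v)" for w
    by (simp add: line_extension_mem_iff)
  have old: "v \<in> Span K (g # Us)" if "v \<in> ?V" for v
    unfolding mem using that K(2) IH(1) g by (intro bexI[of _ \<zero>] bexI[of _ v]) auto
  have "g \<in> Span K (g # Us)"
    unfolding mem using K(3) IH(2) g by (intro bexI[of _ \<one>] bexI[of _ \<zero>]) auto
  moreover have "u \<oplus> v \<in> Span K (g # Us)" if uv: "u \<in> Span K (g # Us)" "v \<in> Span K (g # Us)" for u v
  proof -
    obtain k u' l v' where "k \<in> K" "u' \<in> ?V" "u = k \<otimes> g \<oplus> u'" "l \<in> K" "v' \<in> ?V" "v = l \<otimes> g \<oplus> v'"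
      using uv unfolding mem by blast
    then show ?thesis unfolding mem using IH(1,4) K(1,4) g
      by (intro bexI[of _ "k \<oplus> l"] bexI[of _ "u' \<oplus> v'"]) (auto simp: subset_iff l_distr a_ac)
  qed
  moreover have "a \<otimes> u \<in> Span K (g # Us)" if au: "a \<in> K" "u \<in> Span K (g # Us)" for a u
  proof -
    obtain k u' where "k \<in> K" "u' \<in> ?V" "u = k \<otimes> g \<oplus> u'"
      using au(2) unfolding mem by blast
    then show ?thesis unfolding mem using au(1) IH(1,5) K(1,5) g
      by (intro bexI[of _ "a \<otimes> k"] bexI[of _ "a \<otimes> u'"]) (auto simp: subset_iff r_distr m_assoc)
  qed
  moreover have "Span K (g # Us) \<subseteq> carrier R"
  proof
    fix w assume "w \<in> Span K (g # Us)"
    then obtain k u' where "k \<in> K" "u' \<in> ?V" "w = k \<otimes> g \<oplus> u'" unfolding mem by blast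
    then show "w \<in> carrier R" using IH(1) K(1) g by auto
  qed
  ultimately show ?case using old IH(2,3) by auto
qed

lemma V_bounded_less: "a \<in> V_bounded m \<Longrightarrow> m < n \<Longrightarrow> \<forall>w\<in>keys a. V_degree w < n"
  by (auto simp: V_bounded_def dest!: bspec)

theorem fin_gen_H:
  fixes z :: "'k::field poly"
  assumes p: "CHAR('k) = p" "p > 2" "degree z < p - 1"
  shows "fin_gen_over (H_alg z) (center (H_alg z))"
proof -
  let ?K = "center (H_alg z)"
  \<comment> \<open>The p^5 PBW monomials with all exponents below p.\<close>
  define Us where "Us = map (\<lambda>((i,j),(a,c),b). H_class z (pbw_word (i,j,a,c) (monom 1 b)))
    (List.product (List.product [0..<p] [0..<p]) (List.product (List.product [0..<p] [0..<p]) [0..<p]))"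
  have cen: "A \<in> ?K \<longleftrightarrow> (\<exists>a. A = H_class z a \<and> central z a)" for A
    using H_class_center[of z] by (auto simp: central_def center_def carrier_H_alg)
  have K: "?K \<subseteq> carrier (H_alg z)" "\<zero>\<^bsub>H_alg z\<^esub> \<in> ?K" "\<one>\<^bsub>H_alg z\<^esub> \<in> ?K"
    "\<And>a b. a \<in> ?K \<Longrightarrow> b \<in> ?K \<Longrightarrow> a \<oplus>\<^bsub>H_alg z\<^esub> b \<in> ?K" "\<And>a b. a \<in> ?K \<Longrightarrow> b \<in> ?K \<Longrightarrow> a \<otimes>\<^bsub>H_alg z\<^esub> b \<in> ?K"
  proof -
    interpret ring "H_alg z" by (rule ring_H_alg)
    show "?K \<subseteq> carrier (H_alg z)" "\<zero>\<^bsub>H_alg z\<^esub> \<in> ?K" "\<one>\<^bsub>H_alg z\<^esub> \<in> ?K" by (auto simp: center_def)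
    fix a b assume "a \<in> ?K" "b \<in> ?K"
    then obtain a' b' where ab: "a = H_class z a'" "central z a'" "b = H_class z b'" "central z b'" unfolding cen by blast
    show "a \<oplus>\<^bsub>H_alg z\<^esub> b \<in> ?K"
      unfolding ab(1,3) H_class_simps(1)[symmetric] cen using central_add[OF ab(2,4)] by blast
    show "a \<otimes>\<^bsub>H_alg z\<^esub> b \<in> ?K"
      unfolding ab(1,3) H_class_simps(2)[symmetric] cen using central_mult[OF ab(2,4)] by blast
  qed
  have U: "set Us \<subseteq> carrier (H_alg z)" by (auto simp: Us_def)
  note sp = ring.span_closed[OF ring_H_alg K U]
  \<comment> \<open>The preimage of the span in the free algebra, so that membership can be tested
    on words.\<close>
  define M where "M = {a. H_class z a \<in> ring.Span (H_alg z) ?K Us}"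
  have M_add: "a + b \<in> M" if "a \<in> M" "b \<in> M" for a b using sp that by (auto simp: M_def H_class_simps)
  have M_cong: "b \<in> M" if "a \<in> M" "rep z a = rep z b" for a b using that by (auto simp: M_def H_class_eq_rep[symmetric])
  have M_central: "c * a \<in> M" if "central z c" "a \<in> M" for a c using sp that cen by (auto simp: M_def H_class_simps)
  have M_0: "0 \<in> M" using sp by (simp add: M_def H_class_simps)
  have M_base: "pbw_word (i,j,a,c) (monom 1 b) \<in> M" if "i < p" "j < p" "a < p" "c < p" "b < p" for i j a b c
  proof -
    have "H_class z (pbw_word (i,j,a,c) (monom 1 b)) \<in> set Us"
      unfolding Us_def set_map using that by (intro rev_image_eqI[of "((i,j),(a,c),b)"]) auto
    then show ?thesis using sp by (auto simp: M_def)
  qed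
  have low: "pbw_word (i,j,a,c) q \<in> M" if ij: "i < p" "j < p" "a < p" "c < p" "degree q < p" for i j a c q
  proof -
    have "pbw_word (i,j,a,c) (\<Sum>b\<in>B. monom (coeff q b) b) \<in> M" if "finite B" "B \<subseteq> {..<p}" for B
      using that
    proof (induction B)
      case (insert b B)
      have "pbw_word (i,j,a,c) (monom (coeff q b) b) = scalar (coeff q b) * pbw_word (i,j,a,c) (monom 1 b)"
        using pbw_word_smult[of "(i,j,a,c)" "coeff q b" "monom 1 b"] by (simp add: smult_monom)
      then have "pbw_word (i,j,a,c) (monom (coeff q b) b) \<in> M"
        using M_central[OF central_scalar M_base[OF ij(1-4), of b]] insert by auto
      with insert show ?case by (simp add: pbw_word_add M_add)
    qed (simp add: M_0)
    moreover have "{..degree q} \<subseteq> {..<p}" using ij(5) by auto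
    ultimately have "pbw_word (i,j,a,c) (\<Sum>b\<le>degree q. monom (coeff q b) b) \<in> M" by blast
    then show ?thesis by (simp only: poly_as_sum_of_monoms)
  qed
  let ?A = "artin_schreier p :: 'k poly"
  have word: "rep z (pbw_word (i,j,a,c) q) = Xop ^ i * (Yop z ^ j * (Fop z ^ a * (sc.peval Hop q * Eop z ^ c)))" for i j a c q
    by (simp add: pbw_word_def)
  have mid: "s * (g * t) = g * (s * t)" if "s * g = g * s" for s g t :: "'k endo" by (simp only: mult.assoc[symmetric] that)
  note cp = central_pth[OF p(1,2), of z, unfolded central_def]
  have hpoly: "pbw_word (i,j,a,c) q \<in> M" if ij: "i < p" "j < p" "a < p" "c < p" for i j a c q
  proof (induction "degree q" arbitrary: q rule: less_induct)
    case less
    show ?case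
    proof (cases "degree q < p")
      case True
      then show ?thesis using low ij by blast
    next
      case False
      have A: "?A \<noteq> 0" "degree ?A = p" using degree_artin_schreier[of p, where 'r='k] p(2) by auto
      \<comment> \<open>Division with remainder by X^p - X; the multiple is absorbed by the central
        element h^p - h.\<close>
      have q: "q = ?A * (q div ?A) + q mod ?A" by simp
      have d: "degree (q div ?A) < degree q" using degree_div_less[of q ?A] A p(2) False by (cases "q = 0") auto
      have "degree (q mod ?A) < p" using degree_mod_less[OF A(1), of q] A(2) p(2) by auto
      then have m: "pbw_word (i,j,a,c) (q mod ?A) \<in> M" using low ij by blast
      have "rep z (fa.peval vh ?A * pbw_word (i,j,a,c) (q div ?A)) = rep z (pbw_word (i,j,a,c) (?A * (q div ?A)))"
        using cp(3)[rule_format, of "vx ^ i"] cp(3)[rule_format, of "vy ^ j"] cp(3)[rule_format, of "vf ^ a"]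
        by (simp add: word sc.peval_mult mult.assoc mid)
      from M_cong[OF M_central[OF central_pth(3)[OF p(1,2)] less[OF d]] this] m
      have "pbw_word (i,j,a,c) (?A * (q div ?A) + q mod ?A) \<in> M" unfolding pbw_word_add by (rule M_add)
      then show ?thesis by simp
    qed
  qed
  have fpow: "pbw_word (i,j,a,c) q \<in> M" if ij: "i < p" "j < p" "c < p" for i j a c q
  proof (induction a rule: less_induct)
    case (less a)
    show ?case
    proof (cases "a < p")
      case True
      then show ?thesis using hpoly ij by blast
    next
      case False
      then have a: "p + (a - p) = a" by simp
      have "rep z (vf ^ p * pbw_word (i,j,a - p,c) q) = rep z (pbw_word (i,j,p + (a - p),c) q)"
        using cp(2)[rule_format, of "vx ^ i"] cp(2)[rule_format, of "vy ^ j"]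
        by (simp only: rep_simps word power_add mult.assoc generator.simps) (simp add: mid)
      from M_cong[OF M_central[OF central_pth(2)[OF p(1,2)] less[of "a - p"]] this] show ?thesis
        using False p(2) unfolding a by simp
    qed
  qed
  have epow: "pbw_word (i,j,a,c) q \<in> M" if ij: "i < p" "j < p" for i j a c q
  proof (induction c rule: less_induct)
    case (less c)
    show ?case
    proof (cases "c < p")
      case True
      then show ?thesis using fpow ij by blast
    next
      case False
      then have c: "p + (c - p) = c" by simp
      have comm: "Eop z ^ p * Xop ^ i = Xop ^ i * Eop z ^ p" "Eop z ^ p * Yop z ^ j = Yop z ^ j * Eop z ^ p"
        "Eop z ^ p * Fop z ^ a = Fop z ^ a * Eop z ^ p" "Eop z ^ p * sc.peval Hop q = sc.peval Hop q * Eop z ^ p"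
        using cp(1)[rule_format, of "vx ^ i"] cp(1)[rule_format, of "vy ^ j"] cp(1)[rule_format, of "vf ^ a"] cp(1)[rule_format, of "fa.peval vh q"]
        by simp_all
      have "rep z (ve ^ p * pbw_word (i,j,a,c - p) q) = rep z (pbw_word (i,j,a,p + (c - p)) q)"
        by (simp only: rep_simps word power_add mult.assoc generator.simps comm[THEN mid])
      from M_cong[OF M_central[OF central_pth(1)[OF p(1,2)] less[of "c - p"]] this] show ?thesis
        using False p(2) unfolding c by simp
    qed
  qed
  obtain yl yr where y: "central z yl" "yl \<in> V_bounded p" "yr \<in> V_bounded (p - 1)" "rep z yl = Yop z ^ p + rep z yr"
    using x_y_lifts(2)[OF p] by blast
  obtain xl xr where x: "central z xl" "xl \<in> V_bounded p" "xr \<in> V_bounded (p - 1)" "rep z xl = Xop ^ p + rep z xr"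
    using x_y_lifts(1)[OF p] by blast
  \<comment> \<open>The exponents of x and y need an induction on the degree: the central lifts
    agree with x^p and y^p only up to terms of lower degree.\<close>
  have all: "m \<in> below n \<Longrightarrow> pbw_falg m \<in> M" for m n
  proof (induction n arbitrary: m)
    case 0
    then have "m = 0" by (rule below_zero_eq)
    then show ?case using M_0 by simp
  next
    case (Suc n)
    have VM: "r \<in> M" if "\<forall>w\<in>keys r. V_degree w < n" for r
      by (rule M_cong[OF Suc.IH[OF nf_below(1)[OF that, of z]] Fil_rep[symmetric]])
    have minus: "- r \<in> M" if "r \<in> M" for r
      by (rule M_cong[OF M_central[OF central_scalar[of z "-1"] that]]) (simp add: sc.\<iota>_minus sc.\<iota>_1)
    have reduce: "pbw_word k q \<in> M" if "central z l" "b \<in> M" "rep z (l * b) = rep z (pbw_word k q) + rep z r" "\<forall>w\<in>keys r. V_degree w < n"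
      for k q l b r
      by (rule M_cong[OF M_add[OF M_central[OF that(1,2)] minus[OF VM[OF that(4)]]]]) (simp add: that(3)[simplified])
    have single: "pbw_word (i,j,a,c) q \<in> M" if ij: "i + j < Suc n" for i j a c q
    proof -
      consider "i < p" "j < p" | "i < p" "j \<ge> p" | "i \<ge> p" by linarith
      then show ?thesis
      proof cases
        case 1
        then show ?thesis using epow by blast
      next
        case 2
        define j' where "j' = j - p"
        have j: "j = p + j'" using 2 by (simp add: j'_def)
        let ?b = "pbw_word (i,j',a,c) q :: 'k falg"
        have "?b \<in> M" using Suc.IH[of "single (i,j',a,c) q"] ij j p(2) by simp
        let ?u = "vy ^ j' * (vf ^ a * (fa.peval vh q * ve ^ c)) :: 'k falg"
        have u: "?u \<in> homog j'" using homog_pbw_word[of 0 j' a c q] by (simp add: pbw_word_def)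
        \<comment> \<open>The lift is central, so it can be moved behind x^i and made to act where
          y^p is wanted.\<close>
        have e: "rep z (yl * ?b) = rep z (pbw_word (i,j,a,c) q) + rep z (vx ^ i * (yr * ?u))"
        proof -
          have "rep z yl * Xop ^ i = Xop ^ i * rep z yl" using y(1)[unfolded central_def, rule_format, of "vx ^ i"] by simp
          from mid[OF this] have "rep z (yl * ?b) = Xop ^ i * (rep z yl * rep z ?u)"
            by (simp add: pbw_word_def)
          also have "\<dots> = rep z (pbw_word (i,j,a,c) q) + rep z (vx ^ i * (yr * ?u))"
            unfolding y(4) by (simp only: rep_simps word j power_add distrib_left distrib_right mult.assoc generator.simps)
          finally show ?thesis .
        qed
        have "vx ^ i * (yr * ?u) \<in> V_bounded (i + (p - 1 + j'))"
          using homog_power[OF homog_var(2)[of Vx], of i] by (intro V_bounded_mult y(3) homog_V_bounded u) simp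
        then have "\<forall>w\<in>keys (vx ^ i * (yr * ?u)). V_degree w < n" by (rule V_bounded_less) (use ij j p(2) in arith)
        from reduce[OF y(1) \<open>?b \<in> M\<close> e this] show ?thesis .
      next
        case 3
        define i' where "i' = i - p"
        have i: "i = p + i'" using 3 by (simp add: i'_def)
        let ?b = "pbw_word (i',j,a,c) q :: 'k falg"
        have "?b \<in> M" using Suc.IH[of "single (i',j,a,c) q"] ij i p(2) by simp
        have e: "rep z (xl * ?b) = rep z (pbw_word (i,j,a,c) q) + rep z (xr * ?b)"
          by (simp only: rep_simps x(4) word i power_add distrib_right mult.assoc)
        have "xr * ?b \<in> V_bounded (p - 1 + (i' + j))" by (intro V_bounded_mult x(3) homog_V_bounded homog_pbw_word)
        then have "\<forall>w\<in>keys (xr * ?b). V_degree w < n" by (rule V_bounded_less) (use ij i p(2) in arith)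
        from reduce[OF x(1) \<open>?b \<in> M\<close> e this] show ?thesis .
      qed
    qed
    from Suc.prems show ?case
      by (induction rule: below_induct) (simp_all add: single pbw_falg_add M_add M_0)
  qed
  have "a \<in> M" for a
  proof -
    obtain n where "nf z a \<in> below n" using in_below by blast
    from M_cong[OF all[OF this] Fil_rep[symmetric]] show ?thesis .
  qed
  then have "carrier (H_alg z) \<subseteq> ring.Span (H_alg z) ?K Us" by (auto simp: carrier_H_alg M_def)
  then have "ring.Span (H_alg z) ?K Us = carrier (H_alg z)" using sp by blast
  then show ?thesis unfolding fin_gen_over_def using U by blast
qed

text \<open>The identification of gr(H_z) with H is made by \<open>natural_map\<close>, so the
  center of H enters through its image under this isomorphism.\<close>

theorem mainTheorem3:
  fixes z :: "'k::alg_closed_field poly" and p :: nat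
  assumes "CHAR('k) = p" and "p > 2"
    and "degree z < p - 1"
  shows "fin_gen_over (H_alg z) (center (H_alg z))
    \<and> gr_center (H_alg z) (H_fil z) = center (gr_H z)
    \<and> natural_map z \<in> ring_iso (H_alg 0) (gr_H z)
    \<and> natural_map z ` center (H_alg 0) = center (gr_H z)"
  using fin_gen_H[OF assms] gr_center_H[OF assms] natural_map_iso ring_iso_center[OF natural_map_iso ring_H_alg]
  by blast

end
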